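(* Let $m_n\to\infty$ be real numbers with $m_n=o(n)$. Then, as $n\to\infty$, conditionally on $BINGO(n,n)$ (i.e. $\Delta_{2n}=0$), \[ m_n^{-1/2}\Delta_{\lfloor m_nt\rfloor}\ \xrightarrow{d}\ H_\alpha(t):=(2\alpha-1)^{-1/2}t^{1-\alpha}B\bigl(t^{2\alpha-1}\bigr),\qquad t\in[0,\infty), \] in $D[0,\infty)$ with the Skorohod topology, where $B$ is a standard Brownian motion (and $H_\alpha(0)=0$).
   Context: Fix $\alpha>1$. Let $(X_k,Y_k)_{k\ge2}$ be the Markov chain on $\mathbb N\times\mathbb N$ with $(X_2,Y_2)=(1,1)$ and, from state $(i,j)$, moving to $(i+1,j)$ with probability $i^\alpha/(i^\alpha+j^\alpha)$ and to $(i,j+1)$ with probability $j^\alpha/(i^\alpha+j^\alpha)$ (so $X_k+Y_k=k$). $BINGO(i,j)$ is the event that the chain visits $(i,j)$, i.e. $(X_{i+j},Y_{i+j})=(i,j)$. Set $\Delta_k=X_k-Y_k$ for $k\ge2$ and $\Delta_0=\Delta_1=0$. *)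

theory Defs
  imports "HOL-Probability.Probability" "HOL-Library.Landau_Symbols"
begin

definition trans_prob :: "real \<Rightarrow> nat \<times> nat \<Rightarrow> nat \<times> nat \<Rightarrow> real" where
  "trans_prob \<alpha> s s' = (case s of (i, j) \<Rightarrow>
     if s' = (i + 1, j) then real i powr \<alpha> / (real i powr \<alpha> + real j powr \<alpha>)
     else if s' = (i, j + 1) then real j powr \<alpha> / (real i powr \<alpha> + real j powr \<alpha>)
     else 0)"

text \<open>(X k, Y k), k \<ge> 2, realize the Markov chain started at (X 2, Y 2) = (1,1) on
  the probability space N: the law of every initial segment is given by the product of
  transition probabilities (this determines the law of the chain).\<close>
definition urn_chain :: "real \<Rightarrow> 'a measure \<Rightarrow> (nat \<Rightarrow> 'a \<Rightarrow> nat) \<Rightarrow> (nat \<Rightarrow> 'a \<Rightarrow> nat) \<Rightarrow> bool" where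
  "urn_chain \<alpha> N X Y \<longleftrightarrow> prob_space N \<and>
     (\<forall>k. X k \<in> measurable N (count_space UNIV) \<and> Y k \<in> measurable N (count_space UNIV)) \<and>
     (\<forall>k\<ge>2. \<forall>p :: nat \<Rightarrow> nat \<times> nat.
        measure N {\<omega> \<in> space N. \<forall>j\<in>{2..k}. (X j \<omega>, Y j \<omega>) = p j} =
        (if p 2 = (1, 1) then (\<Prod>j\<in>{2..<k}. trans_prob \<alpha> (p j) (p (Suc j))) else 0))"

definition BINGO :: "'a measure \<Rightarrow> (nat \<Rightarrow> 'a \<Rightarrow> nat) \<Rightarrow> (nat \<Rightarrow> 'a \<Rightarrow> nat) \<Rightarrow> nat \<Rightarrow> nat \<Rightarrow> 'a set" where
  "BINGO N X Y i j = {\<omega> \<in> space N. X (i + j) \<omega> = i \<and> Y (i + j) \<omega> = j}"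

definition Delta :: "(nat \<Rightarrow> 'a \<Rightarrow> nat) \<Rightarrow> (nat \<Rightarrow> 'a \<Rightarrow> nat) \<Rightarrow> nat \<Rightarrow> 'a \<Rightarrow> int" where
  "Delta X Y k \<omega> = (if k < 2 then 0 else int (X k \<omega>) - int (Y k \<omega>))"

definition scaled_path :: "real \<Rightarrow> (nat \<Rightarrow> 'a \<Rightarrow> nat) \<Rightarrow> (nat \<Rightarrow> 'a \<Rightarrow> nat) \<Rightarrow> 'a \<Rightarrow> real \<Rightarrow> real" where
  "scaled_path m X Y \<omega> t = real_of_int (Delta X Y (nat \<lfloor>m * t\<rfloor>) \<omega>) / sqrt m"

text \<open>Paths are functions real \<Rightarrow> real, of which only the restriction to [0,\<infinity>) matters.\<close>
definition cadlag :: "(real \<Rightarrow> real) \<Rightarrow> bool" where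
  "cadlag x \<longleftrightarrow> (\<forall>t\<ge>0. continuous (at_right t) x) \<and> (\<forall>t>0. \<exists>l. (x \<longlongrightarrow> l) (at_left t))"

definition time_changes :: "(real \<Rightarrow> real) set" where
  "time_changes = {l. continuous_on {0..} l \<and> strict_mono_on {0..} l \<and> l ` {0..} = {0..}}"

text \<open>Convergence in the Skorohod J1 topology of D[0,\<infinity>)
  (Ethier--Kurtz, Markov Processes, Ch. 3, Prop. 5.3).\<close>
definition skorohod_conv :: "(nat \<Rightarrow> real \<Rightarrow> real) \<Rightarrow> (real \<Rightarrow> real) \<Rightarrow> bool" where
  "skorohod_conv xs x \<longleftrightarrow> (\<exists>l :: nat \<Rightarrow> real \<Rightarrow> real. (\<forall>n. l n \<in> time_changes) \<and>
     (\<forall>\<epsilon>>0. \<forall>\<^sub>F n in sequentially. \<forall>t\<ge>0. \<bar>l n t - t\<bar> \<le> \<epsilon>) \<and>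
     (\<forall>T\<ge>0. \<forall>\<epsilon>>0. \<forall>\<^sub>F n in sequentially. \<forall>t\<in>{0..T}. \<bar>xs n (l n t) - x t\<bar> \<le> \<epsilon>))"

text \<open>Bounded continuous functionals on D[0,\<infinity>) (the Skorohod topology is metrizable,
  so continuity = sequential continuity), extended by 0 outside D[0,\<infinity>).\<close>
definition skorohod_test_fun :: "((real \<Rightarrow> real) \<Rightarrow> real) \<Rightarrow> bool" where
  "skorohod_test_fun f \<longleftrightarrow> (\<exists>C. \<forall>x. \<bar>f x\<bar> \<le> C) \<and> (\<forall>x. \<not> cadlag x \<longrightarrow> f x = 0) \<and>
     (\<forall>xs x. cadlag x \<longrightarrow> (\<forall>n. cadlag (xs n)) \<longrightarrow> skorohod_conv xs x \<longrightarrow>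
        (\<lambda>n. f (xs n)) \<longlonglongrightarrow> f x)"

definition std_brownian_motion :: "'b measure \<Rightarrow> (real \<Rightarrow> 'b \<Rightarrow> real) \<Rightarrow> bool" where
  "std_brownian_motion M B \<longleftrightarrow> prob_space M \<and>
     (\<forall>t. B t \<in> borel_measurable M) \<and>
     (\<forall>\<omega>\<in>space M. B 0 \<omega> = 0 \<and> continuous_on {0..} (\<lambda>t. B t \<omega>)) \<and>
     (\<forall>s t. 0 \<le> s \<and> s < t \<longrightarrow>
        distributed M lborel (\<lambda>\<omega>. B t \<omega> - B s \<omega>) (\<lambda>x. ennreal (normal_density 0 (sqrt (t - s)) x))) \<and>
     (\<forall>(k :: nat) (ts :: nat \<Rightarrow> real). 0 \<le> ts 0 \<and> (\<forall>i<k. ts i < ts (Suc i)) \<longrightarrow>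
        prob_space.indep_vars M (\<lambda>_. borel) (\<lambda>i \<omega>. B (ts (Suc i)) \<omega> - B (ts i) \<omega>) {..<k})"

definition H_alpha :: "real \<Rightarrow> (real \<Rightarrow> 'b \<Rightarrow> real) \<Rightarrow> 'b \<Rightarrow> real \<Rightarrow> real" where
  "H_alpha \<alpha> B \<omega> t = (if t \<le> 0 then 0
     else (2 * \<alpha> - 1) powr (-1/2) * t powr (1 - \<alpha>) * B (t powr (2 * \<alpha> - 1)) \<omega>)"

end

theory Submission
  imports Defs
begin

text \<open>Along every path of the urn from \<open>(1, 1)\<close> to \<open>(n, n)\<close> the numerators of the transition
  probabilities multiply to the same number. Hence, given \<open>BINGO n n\<close>, a path is weighted by the product of
  the factors \<open>1 / (i powr \<alpha> + j powr \<alpha>)\<close>, which decrease away from the diagonal, and the conditioned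
  chain drifts towards the diagonal. A quartic supermartingale then controls how far
  \<open>\<bar>\<Delta>\<bar>\<close> can rise above its running minimum, and together with convergence of the finite-dimensional
  distributions to those of a continuous process this gives tightness.

  For the finite-dimensional distributions, Rubin's embedding of the urn into two independent pure birth
  processes expresses the probability of visiting \<open>s'\<close> from \<open>s\<close> as the density at 0 of a
  difference of sums of independent exponential variables, that is, as an explicit Fourier integral. Its
  asymptotics follow by dominated convergence, and Scheffe's lemma turns convergence of transition densities
  into convergence in law.

  A bounded continuous functional is the increasing limit of Lipschitz functionals, so it suffices to treat
  the latter, and no compactness argument on path space is needed. As the limit is continuous, locally
  uniform convergence may replace the Skorohod topology.\<close>

section \<open>The urn chain as a sum over paths\<close>

text \<open>With \<open>h s = visit \<alpha> s (n, n)\<close>, the conditioned chain moves from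
  \<open>s\<close> to \<open>s'\<close> with probability
  \<open>visit \<alpha> s s' * h s' / h s\<close>; each factor is a Fourier integral. From a state
  at time about \<open>\<tau> * m\<close> the clocks left to run have variance of order
  \<open>m powr (1 - 2 * \<alpha>)\<close>, while a displacement of order \<open>sqrt m\<close>
  shifts their mean by order \<open>sqrt m * m powr - \<alpha>\<close>, the order of the standard
  deviation. This is the origin of the diffusive scaling, and since \<open>m = o(n)\<close> the
  endpoint \<open>(n, n)\<close> lies at infinity on this scale. The fixed start
  \<open>(1, 1)\<close> admits no Gaussian limit; there the integrals towards the target and towards
  \<open>(n, n)\<close> tend to the same positive constant and their ratio to 1.

  The obstacle in tightness is that the drift is controlled from one side only:
  \<open>\<bar>\<Delta>\<bar>\<close> can be kept from rising, but nothing bounds how fast it falls.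
  A fall across a short time block is visible at the grid times, and there finite-dimensional
  convergence to a continuous limit excludes it. The limit itself is singular at time 0, where
  \<open>t powr (1 - \<alpha>)\<close> explodes, so its continuity there has to be proved.\<close>

definition pR :: "real \<Rightarrow> nat \<times> nat \<Rightarrow> real" where
  "pR \<alpha> s = real (fst s) powr \<alpha> / (real (fst s) powr \<alpha> + real (snd s) powr \<alpha>)"

definition pU :: "real \<Rightarrow> nat \<times> nat \<Rightarrow> real" where
  "pU \<alpha> s = real (snd s) powr \<alpha> / (real (fst s) powr \<alpha> + real (snd s) powr \<alpha>)"

definition right :: "nat \<times> nat \<Rightarrow> nat \<times> nat" where "right s = (fst s + 1, snd s)"
definition up :: "nat \<times> nat \<Rightarrow> nat \<times> nat" where "up s = (fst s, snd s + 1)"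

lemma right_Pair [simp]: "right (i, j) = (Suc i, j)" and up_Pair [simp]: "up (i, j) = (i, Suc j)"
  by (auto simp: right_def up_def)

lemma pR_nonneg [simp]: "pR \<alpha> s \<ge> 0" and pU_nonneg [simp]: "pU \<alpha> s \<ge> 0"
  by (auto simp: pR_def pU_def)

lemma pR_plus_pU: "fst s > 0 \<Longrightarrow> pR \<alpha> s + pU \<alpha> s = 1"
proof -
  assume "fst s > 0"
  then have "real (fst s) powr \<alpha> + real (snd s) powr \<alpha> > 0"
    by (intro add_pos_nonneg) auto
  then show ?thesis by (auto simp: pR_def pU_def add_divide_distrib[symmetric])
qed

text \<open>Paths are lists of states with the most recent state first.\<close>

fun paths :: "nat \<Rightarrow> (nat \<times> nat) list set" where
  "paths 0 = {[(1, 1)]}"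
| "paths (Suc l) = (\<lambda>p. right (hd p) # p) ` paths l \<union> (\<lambda>p. up (hd p) # p) ` paths l"

text \<open>The last step is integrated out first, so inductions on \<open>l\<close> run over all
  functionals \<open>F\<close> at once and one-step identities are applied at the head of the
  list.\<close>

fun path_expect :: "real \<Rightarrow> nat \<Rightarrow> ((nat \<times> nat) list \<Rightarrow> real) \<Rightarrow> real" where
  "path_expect \<alpha> 0 F = F [(1, 1)]"
| "path_expect \<alpha> (Suc l) F = path_expect \<alpha> l
     (\<lambda>p. pR \<alpha> (hd p) * F (right (hd p) # p) + pU \<alpha> (hd p) * F (up (hd p) # p))"

fun wt :: "real \<Rightarrow> (nat \<times> nat) list \<Rightarrow> real" where
  "wt \<alpha> [] = 0"
| "wt \<alpha> [s] = (if s = (1, 1) then 1 else 0)"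
| "wt \<alpha> (s' # s # p) = trans_prob \<alpha> s s' * wt \<alpha> (s # p)"

lemma paths_hd:
  "p \<in> paths l \<Longrightarrow> length p = Suc l \<and> fst (hd p) > 0 \<and> snd (hd p) > 0 \<and> fst (hd p) + snd (hd p) = l + 2"
  by (induction l arbitrary: p) (auto simp: right_def up_def)

lemma finite_paths [simp]: "finite (paths l)"
  by (induction l) auto

lemma path_expect_mono:
  "(\<And>p. p \<in> paths l \<Longrightarrow> F p \<le> G p) \<Longrightarrow> path_expect \<alpha> l F \<le> path_expect \<alpha> l G"
proof (induction l arbitrary: F G)
  case (Suc l)
  show ?case
    by (simp, intro Suc.IH add_mono mult_left_mono) (auto intro!: Suc.prems)
qed auto

lemma path_expect_cong:
  "(\<And>p. p \<in> paths l \<Longrightarrow> F p = G p) \<Longrightarrow> path_expect \<alpha> l F = path_expect \<alpha> l G"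
  by (intro antisym path_expect_mono) auto

lemma path_expect_cmult: "path_expect \<alpha> l (\<lambda>p. c * F p) = c * path_expect \<alpha> l F"
proof (induction l arbitrary: F)
  case (Suc l)
  have "path_expect \<alpha> (Suc l) (\<lambda>p. c * F p) = path_expect \<alpha> l
     (\<lambda>p. c * (pR \<alpha> (hd p) * F (right (hd p) # p) + pU \<alpha> (hd p) * F (up (hd p) # p)))"
    by (simp add: algebra_simps)
  then show ?case by (simp add: Suc.IH)
qed auto

lemma path_expect_const: "path_expect \<alpha> l (\<lambda>_. c) = c"
proof (induction l)
  case (Suc l)
  have "path_expect \<alpha> (Suc l) (\<lambda>_. c) = path_expect \<alpha> l (\<lambda>_. c)"
    unfolding path_expect.simps
    by (intro path_expect_cong) (auto simp: distrib_right[symmetric] pR_plus_pU paths_hd)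
  then show ?case using Suc.IH by simp
qed auto

lemma path_expect_eq_sum: "path_expect \<alpha> l F = (\<Sum>p\<in>paths l. wt \<alpha> p * F p)"
proof (induction l arbitrary: F)
  case (Suc l)
  let ?R = "(\<lambda>p. right (hd p) # p) ` paths l" and ?U = "(\<lambda>p. up (hd p) # p) ` paths l"
  have disj: "?R \<inter> ?U = {}" by (auto simp: right_def up_def)
  have wR: "wt \<alpha> (right (hd p) # p) = pR \<alpha> (hd p) * wt \<alpha> p"
    and wU: "wt \<alpha> (up (hd p) # p) = pU \<alpha> (hd p) * wt \<alpha> p" if "p \<in> paths l" for p
  proof -
    from that have "p \<in> paths l" .
    obtain s q where "p = s # q" using paths_hd[of p l] \<open>p \<in> paths l\<close> by (cases p) auto
    then show "wt \<alpha> (right (hd p) # p) = pR \<alpha> (hd p) * wt \<alpha> p" "wt \<alpha> (up (hd p) # p) = pU \<alpha> (hd p) * wt \<alpha> p"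
      by (auto simp: trans_prob_def right_def up_def pR_def pU_def split: prod.splits)
  qed
  have "(\<Sum>p\<in>paths (Suc l). wt \<alpha> p * F p) = (\<Sum>p\<in>?R. wt \<alpha> p * F p) + (\<Sum>p\<in>?U. wt \<alpha> p * F p)"
    using disj by (simp add: sum.union_disjoint)
  also have "\<dots> = (\<Sum>p\<in>paths l. wt \<alpha> (right (hd p) # p) * F (right (hd p) # p))
      + (\<Sum>p\<in>paths l. wt \<alpha> (up (hd p) # p) * F (up (hd p) # p))"
    by (subst (1 2) sum.reindex) (auto intro!: inj_onI)
  also have "\<dots> = (\<Sum>p\<in>paths l. wt \<alpha> p * (pR \<alpha> (hd p) * F (right (hd p) # p) + pU \<alpha> (hd p) * F (up (hd p) # p)))"
    by (simp add: sum.distrib[symmetric] wR wU algebra_simps)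
  also have "\<dots> = path_expect \<alpha> (Suc l) F" by (simp add: Suc.IH)
  finally show ?case by simp
qed auto

text \<open>The chain starts at time 2, so \<open>l\<close> steps end at time \<open>l + 2\<close>;
  this shift recurs in all translations between times and path lengths.\<close>

definition prefix :: "(nat \<Rightarrow> 'a \<Rightarrow> nat) \<Rightarrow> (nat \<Rightarrow> 'a \<Rightarrow> nat) \<Rightarrow> nat \<Rightarrow> 'a \<Rightarrow> (nat \<times> nat) list" where
  "prefix X Y l \<omega> = rev (map (\<lambda>k. (X k \<omega>, Y k \<omega>)) [2..<l + 3])"

lemma prefix_0 [simp]: "prefix X Y 0 \<omega> = [(X 2 \<omega>, Y 2 \<omega>)]"
  and prefix_Suc [simp]: "prefix X Y (Suc l) \<omega> = (X (l + 3) \<omega>, Y (l + 3) \<omega>) # prefix X Y l \<omega>"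
  and length_prefix [simp]: "length (prefix X Y l \<omega>) = Suc l"
proof -
  have "[2..<Suc l + 3] = [2..<l + 3] @ [l + 3]"
    using upt_Suc_append[of 2 "l + 3"] by simp
  then show "prefix X Y (Suc l) \<omega> = (X (l + 3) \<omega>, Y (l + 3) \<omega>) # prefix X Y l \<omega>"
    by (simp add: prefix_def)
qed (auto simp: prefix_def upt_rec[of 2 3])

lemma hd_prefix [simp]: "hd (prefix X Y l \<omega>) = (X (l + 2) \<omega>, Y (l + 2) \<omega>)"
  by (cases l) (auto simp: numeral_3_eq_3 numeral_2_eq_2)

lemma prefix_nth: "i \<le> l \<Longrightarrow> prefix X Y l \<omega> ! i = (X (l + 2 - i) \<omega>, Y (l + 2 - i) \<omega>)"
proof -
  assume "i \<le> l"
  then have *: "[2..<l + 3] ! (l - i) = l + 2 - i" by (subst nth_upt) auto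
  have "prefix X Y l \<omega> ! i = (\<lambda>k. (X k \<omega>, Y k \<omega>)) ([2..<l + 3] ! (l - i))"
    using \<open>i \<le> l\<close> by (simp add: prefix_def rev_nth del: nth_upt)
  then show ?thesis by (simp only: *)
qed

lemma drop_prefix: "drop d (prefix X Y (l + d) \<omega>) = prefix X Y l \<omega>"
  by (induction d) auto

lemma prefix_eq_iff:
  assumes "length p = Suc l"
  shows "prefix X Y l \<omega> = p \<longleftrightarrow> (\<forall>j\<in>{2..l + 2}. (X j \<omega>, Y j \<omega>) = p ! (l + 2 - j))"
proof -
  have "prefix X Y l \<omega> = p \<longleftrightarrow> (\<forall>i\<le>l. (X (l + 2 - i) \<omega>, Y (l + 2 - i) \<omega>) = p ! i)"
    using assms by (auto simp: list_eq_iff_nth_eq prefix_nth less_Suc_eq_le)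
  also have "\<dots> \<longleftrightarrow> (\<forall>j\<in>{2..l + 2}. (X j \<omega>, Y j \<omega>) = p ! (l + 2 - j))"
  proof safe
    fix j assume *: "\<forall>i\<le>l. (X (l + 2 - i) \<omega>, Y (l + 2 - i) \<omega>) = p ! i" and j: "j \<in> {2..l + 2}"
    have "l + 2 - (l + 2 - j) = j" "l + 2 - j \<le> l" using j by auto
    then show "(X j \<omega>, Y j \<omega>) = p ! (l + 2 - j)" using * by metis
  next
    fix i assume *: "\<forall>j\<in>{2..l + 2}. (X j \<omega>, Y j \<omega>) = p ! (l + 2 - j)" and i: "i \<le> l"
    have "l + 2 - i \<in> {2..l + 2}" "l + 2 - (l + 2 - i) = i" using i by auto
    then show "(X (l + 2 - i) \<omega>, Y (l + 2 - i) \<omega>) = p ! i" using * by metis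
  qed
  finally show ?thesis .
qed

text \<open>Position \<open>l + 2 - j\<close> of the reversed list holds the state at time
  \<open>j\<close>, so time 2 sits at position \<open>l\<close>. This matches \<open>wt\<close> with
  the product in \<open>urn_chain\<close>.\<close>

lemma wt_eq_prod:
  "length p = Suc l \<Longrightarrow> wt \<alpha> p = (if p ! l = (1, 1) then
     (\<Prod>j\<in>{2..<l + 2}. trans_prob \<alpha> (p ! (l + 2 - j)) (p ! (l + 2 - Suc j))) else 0)"
proof (induction l arbitrary: p)
  case 0
  then obtain s where "p = [s]" by (auto simp: length_Suc_conv)
  then show ?case by simp
next
  case (Suc l)
  from Suc.prems obtain s' s q where p: "p = s' # s # q" and q: "length (s # q) = Suc l"
    by (auto simp: length_Suc_conv)
  have "{2..<Suc l + 2} = insert (l + 2) {2..<l + 2}" by auto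
  moreover have "(p ! (Suc l + 2 - j)) = (s # q) ! (l + 2 - j)" "p ! (Suc l + 2 - Suc j) = (s # q) ! (l + 2 - Suc j)"
    if "j \<in> {2..<l + 2}" for j
  proof -
    have "Suc l + 2 - j = Suc (l + 2 - j)" "Suc l + 2 - Suc j = Suc (l + 2 - Suc j)" using that by auto
    then show "(p ! (Suc l + 2 - j)) = (s # q) ! (l + 2 - j)" "p ! (Suc l + 2 - Suc j) = (s # q) ! (l + 2 - Suc j)"
      using p by (metis nth_Cons_Suc)+
  qed
  ultimately show ?case using Suc.IH[OF q] p by simp
qed

lemma measure_prefix:
  assumes "urn_chain \<alpha> N X Y" "length p = Suc l"
  shows "measure N {\<omega> \<in> space N. prefix X Y l \<omega> = p} = wt \<alpha> p"
proof -
  have "measure N {\<omega> \<in> space N. \<forall>j\<in>{2..l + 2}. (X j \<omega>, Y j \<omega>) = p ! (l + 2 - j)} = 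
      (if p ! (l + 2 - 2) = (1, 1) then (\<Prod>j\<in>{2..<l + 2}. trans_prob \<alpha> (p ! (l + 2 - j)) (p ! (l + 2 - Suc j))) else 0)"
    using assms(1)[unfolded urn_chain_def, THEN conjunct2, THEN conjunct2,
       rule_format, of "l + 2" "\<lambda>j. p ! (l + 2 - j)"] by simp
  then show ?thesis using assms(2) by (simp add: wt_eq_prod prefix_eq_iff)
qed

lemma measurable_prefix [measurable]:
  assumes "urn_chain \<alpha> N X Y"
  shows "prefix X Y l \<in> measurable N (count_space UNIV)"
proof -
  have [measurable]: "X k \<in> measurable N (count_space UNIV)" "Y k \<in> measurable N (count_space UNIV)" for k
    using assms by (auto simp: urn_chain_def)
  show ?thesis
    by (induction l) (simp_all)
qed

text \<open>The weights of the finitely many \<open>paths l\<close> add up to 1 by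
  \<open>path_expect_const\<close>, so they exhaust the probability.\<close>

lemma AE_prefix_paths:
  assumes "urn_chain \<alpha> N X Y"
  shows "AE \<omega> in N. prefix X Y l \<omega> \<in> paths l"
proof -
  interpret prob_space N using assms by (auto simp: urn_chain_def)
  note [measurable] = measurable_prefix[OF assms, of l]
  have "1 = (\<Sum>p\<in>paths l. wt \<alpha> p)"
    using path_expect_const[of \<alpha> l 1] by (simp add: path_expect_eq_sum)
  also have "\<dots> = (\<Sum>p\<in>paths l. measure N {\<omega> \<in> space N. prefix X Y l \<omega> = p})"
    by (intro sum.cong refl measure_prefix[OF assms, symmetric]) (auto simp: paths_hd)
  also have "\<dots> = measure N (\<Union>p\<in>paths l. {\<omega> \<in> space N. prefix X Y l \<omega> = p})"
    by (intro finite_measure_finite_Union[symmetric]) (auto simp: disjoint_family_on_def)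
  also have "(\<Union>p\<in>paths l. {\<omega> \<in> space N. prefix X Y l \<omega> = p}) = {\<omega> \<in> space N. prefix X Y l \<omega> \<in> paths l}"
    by auto
  finally show ?thesis by (subst (asm) eq_commute, subst (asm) prob_Collect_eq_1) auto
qed

lemma integral_prefix:
  assumes "urn_chain \<alpha> N X Y"
  shows "integrable N (\<lambda>\<omega>. F (prefix X Y l \<omega>))"
    and "(\<integral>\<omega>. F (prefix X Y l \<omega>) \<partial>N) = path_expect \<alpha> l F"
proof -
  interpret prob_space N using assms by (auto simp: urn_chain_def)
  note [measurable] = measurable_prefix[OF assms, of l]
  let ?A = "\<lambda>p. {\<omega> \<in> space N. prefix X Y l \<omega> = p}"
  \<comment> \<open>Off a null set the prefix takes finitely many values, so \<open>F\<close> of it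
    is a simple function and integrable for arbitrary \<open>F\<close>.\<close>
  have ae: "AE \<omega> in N. F (prefix X Y l \<omega>) = (\<Sum>p\<in>paths l. F p * indicator (?A p) \<omega>)"
    using AE_prefix_paths[OF assms, of l] AE_space
  proof eventually_elim
    case (elim \<omega>)
    have "(\<Sum>p\<in>paths l. F p * indicator (?A p) \<omega>) = (\<Sum>p\<in>paths l. if p = prefix X Y l \<omega> then F p else 0)"
      using elim by (intro sum.cong) (auto simp: indicator_def)
    then show ?case using elim by simp
  qed
  have int: "integrable N (\<lambda>\<omega>. \<Sum>p\<in>paths l. F p * indicator (?A p) \<omega>)"
    by (intro Bochner_Integration.integrable_sum integrable_mult_right integrable_real_indicator)
       (auto simp: emeasure_eq_measure)
  show "integrable N (\<lambda>\<omega>. F (prefix X Y l \<omega>))"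
    by (subst integrable_cong_AE[OF _ _ ae]) (use int in \<open>simp_all\<close>)
  have "(\<integral>\<omega>. F (prefix X Y l \<omega>) \<partial>N) = (\<integral>\<omega>. (\<Sum>p\<in>paths l. F p * indicator (?A p) \<omega>) \<partial>N)"
    by (intro integral_cong_AE ae) auto
  also have "\<dots> = (\<Sum>p\<in>paths l. F p * measure N (?A p))"
    by (subst Bochner_Integration.integral_sum) (auto intro!: sum.cong integrable_mult_right integrable_real_indicator
        simp: emeasure_eq_measure)
  also have "\<dots> = path_expect \<alpha> l F"
    by (simp add: path_expect_eq_sum measure_prefix[OF assms] paths_hd mult.commute)
  finally show "(\<integral>\<omega>. F (prefix X Y l \<omega>) \<partial>N) = path_expect \<alpha> l F" .
qed

text \<open>The \<open>d\<close>-step transition operator of the urn, obtained by conditioning on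
  the first step, whereas \<open>path_expect\<close> conditions on the last.\<close>

fun hop :: "real \<Rightarrow> nat \<Rightarrow> (nat \<times> nat \<Rightarrow> real) \<Rightarrow> nat \<times> nat \<Rightarrow> real" where
  "hop \<alpha> 0 g s = g s"
| "hop \<alpha> (Suc d) g s = pR \<alpha> s * hop \<alpha> d g (right s) + pU \<alpha> s * hop \<alpha> d g (up s)"

text \<open>The Markov property: given the path \<open>drop d p\<close>, the last \<open>d\<close>
  steps depend on its head only.\<close>

lemma path_expect_hop:
  "path_expect \<alpha> (l + d) (\<lambda>p. \<Gamma> (drop d p) (hd p)) = path_expect \<alpha> l (\<lambda>p. hop \<alpha> d (\<Gamma> p) (hd p))"
proof -
  \<comment> \<open>\<open>e\<close> counts the steps already moved from the list into
    \<open>hop\<close>; the induction on \<open>d\<close> moves one more each time, and in the end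
    \<open>e = 0\<close> is used.\<close>
  have "path_expect \<alpha> (l + d) (\<lambda>p. hop \<alpha> e (\<Gamma> (drop d p)) (hd p)) = path_expect \<alpha> l (\<lambda>p. hop \<alpha> (d + e) (\<Gamma> p) (hd p))" for e
  proof (induction d arbitrary: e)
    case (Suc d)
    have "path_expect \<alpha> (l + Suc d) (\<lambda>p. hop \<alpha> e (\<Gamma> (drop (Suc d) p)) (hd p))
        = path_expect \<alpha> (l + d) (\<lambda>p. hop \<alpha> (Suc e) (\<Gamma> (drop d p)) (hd p))" by simp
    then show ?case using Suc.IH[of "Suc e"] by simp
  qed auto
  from this[of 0] show ?thesis by simp
qed

lemma hop_nonneg: "(\<And>s. g s \<ge> 0) \<Longrightarrow> hop \<alpha> d g s \<ge> 0"
  by (induction d arbitrary: s) auto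

lemma hop_cong:
  "(\<And>a. a \<le> d \<Longrightarrow> g (i + a, j + (d - a)) = g' (i + a, j + (d - a))) \<Longrightarrow> hop \<alpha> d g (i, j) = hop \<alpha> d g' (i, j)"
proof (induction d arbitrary: i j)
  case (Suc d)
  have "hop \<alpha> d g (Suc i, j) = hop \<alpha> d g' (Suc i, j)"
    by (rule Suc.IH) (use Suc.prems[of "Suc _"] in auto)
  moreover have "hop \<alpha> d g (i, Suc j) = hop \<alpha> d g' (i, Suc j)"
  proof (rule Suc.IH)
    fix a assume "a \<le> d"
    then show "g (i + a, Suc j + (d - a)) = g' (i + a, Suc j + (d - a))"
      using Suc.prems[of a] by (auto simp: Suc_diff_le)
  qed
  ultimately show ?case by simp
qed auto

lemma hop_sum: "hop \<alpha> d (\<lambda>s. \<Sum>x\<in>A. c x * g x s) s = (\<Sum>x\<in>A. c x * hop \<alpha> d (g x) s)"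
  by (induction d arbitrary: s) (auto simp: sum_distrib_left sum.distrib algebra_simps)

text \<open>Every step raises the coordinate sum by one, so the number of steps from
  \<open>s\<close> to \<open>s'\<close> is forced. If \<open>s'\<close> lies earlier, truncated
  subtraction gives 0 steps and the indicator still returns the correct value 0.\<close>

abbreviation visit :: "real \<Rightarrow> nat \<times> nat \<Rightarrow> nat \<times> nat \<Rightarrow> real" where
  "visit \<alpha> s s' \<equiv> hop \<alpha> (fst s' + snd s' - (fst s + snd s)) (indicator {s'}) s"

lemma hop_eq_sum:
  "hop \<alpha> d g (i, j) = (\<Sum>a\<le>d. g (i + a, j + (d - a)) * visit \<alpha> (i, j) (i + a, j + (d - a)))"
proof -
  have "hop \<alpha> d g (i, j) = hop \<alpha> d (\<lambda>s. \<Sum>a\<le>d. g (i + a, j + (d - a)) * indicator {(i + a, j + (d - a))} s) (i, j)"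
  proof (rule hop_cong)
    fix a assume a: "a \<le> d"
    have "(\<Sum>b\<le>d. g (i + b, j + (d - b)) * indicator {(i + b, j + (d - b))} (i + a, j + (d - a)))
      = (\<Sum>b\<le>d. if b = a then g (i + a, j + (d - a)) else 0)"
      by (intro sum.cong) (auto simp: indicator_def)
    then show "g (i + a, j + (d - a)) = (\<Sum>b\<le>d. g (i + b, j + (d - b)) * indicator {(i + b, j + (d - b))} (i + a, j + (d - a)))"
      using a by simp
  qed
  also have "\<dots> = (\<Sum>a\<le>d. g (i + a, j + (d - a)) * hop \<alpha> d (indicator {(i + a, j + (d - a))}) (i, j))"
    by (rule hop_sum)
  also have "\<dots> = (\<Sum>a\<le>d. g (i + a, j + (d - a)) * visit \<alpha> (i, j) (i + a, j + (d - a)))"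
    by (intro sum.cong) auto
  finally show ?thesis .
qed

lemma hop_add: "hop \<alpha> (d + e) g s = hop \<alpha> d (hop \<alpha> e g) s"
  by (induction d arbitrary: s) auto

lemma BINGO_eq_prefix:
  assumes "n \<ge> 1"
  shows "BINGO N X Y n n = {\<omega> \<in> space N. hd (prefix X Y (2 * n - 2) \<omega>) = (n, n)}"
proof -
  have "2 * n - 2 + 2 = n + n" using assms by simp
  then show ?thesis unfolding hd_prefix BINGO_def by auto
qed

text \<open>The steps after time \<open>l + 2\<close> are integrated out by the Markov property.
  What remains is the weight \<open>visit \<alpha> s (n, n)\<close> of a Doob transform, the form in
  which conditioning is handled throughout.\<close>

lemma integral_BINGO_prefix:
  assumes "urn_chain \<alpha> N X Y" "n \<ge> 1" "l \<le> 2 * n - 2"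
  shows "(\<integral>\<omega>. indicator (BINGO N X Y n n) \<omega> * F (prefix X Y l \<omega>) \<partial>N)
     = path_expect \<alpha> l (\<lambda>p. visit \<alpha> (hd p) (n, n) * F p)"
proof -
  define d where "d = 2 * n - 2 - l"
  have ld: "l + d = 2 * n - 2" using assms by (simp add: d_def)
  have "(\<integral>\<omega>. indicator (BINGO N X Y n n) \<omega> * F (prefix X Y l \<omega>) \<partial>N)
     = (\<integral>\<omega>. (\<lambda>p. F (drop d p) * indicator {(n, n)} (hd p)) (prefix X Y (l + d) \<omega>) \<partial>N)"
    by (rule Bochner_Integration.integral_cong) 
       (auto simp: BINGO_eq_prefix[OF assms(2)] drop_prefix ld[symmetric] indicator_def)
  also have "\<dots> = path_expect \<alpha> (l + d) (\<lambda>p. F (drop d p) * indicator {(n, n)} (hd p))"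
    by (rule integral_prefix(2)[OF assms(1)])
  also have "\<dots> = path_expect \<alpha> l (\<lambda>p. hop \<alpha> d (\<lambda>s. F p * indicator {(n, n)} s) (hd p))"
    by (rule path_expect_hop)
  also have "\<dots> = path_expect \<alpha> l (\<lambda>p. visit \<alpha> (hd p) (n, n) * F p)"
  proof (rule path_expect_cong)
    fix p assume "p \<in> paths l"
    then have "n + n - (fst (hd p) + snd (hd p)) = d" using assms by (simp add: paths_hd d_def)
    then show "hop \<alpha> d (\<lambda>s. F p * indicator {(n, n)} s) (hd p) = visit \<alpha> (hd p) (n, n) * F p"
      using hop_sum[of \<alpha> d "\<lambda>_. F p" "\<lambda>_. indicator {(n, n)}" "{()}" "hd p"] by simp
  qed
  finally show ?thesis .
qed

section \<open>Inward drift of the conditioned chain\<close>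

text \<open>The numerators of the transition probabilities contribute the same factor for every path
  from \<open>s\<close> to \<open>(n, n)\<close>; only the denominators are kept.\<close>

fun denom_weight :: "real \<Rightarrow> nat \<Rightarrow> nat \<Rightarrow> nat \<times> nat \<Rightarrow> real" where
  "denom_weight \<alpha> n 0 s = indicator {(n, n)} s"
| "denom_weight \<alpha> n (Suc d) s = (denom_weight \<alpha> n d (right s) + denom_weight \<alpha> n d (up s))
     / (real (fst s) powr \<alpha> + real (snd s) powr \<alpha>)"

text \<open>On every path to \<open>(n, n)\<close> the steps to the right start once from each of
  the columns \<open>Suc i, ..., n - 1\<close>, and likewise for the steps up. The numerators
  therefore multiply to quotients of factorials, whatever the order of the steps.\<close>

lemma hop_eq_denom_weight:
  assumes "n \<ge> 1"
  shows "hop \<alpha> d (indicator {(n, n)}) (Suc i, Suc j) =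
    (fact (n - 1) powr \<alpha>)\<^sup>2 / (fact i powr \<alpha> * fact j powr \<alpha>) * denom_weight \<alpha> n d (Suc i, Suc j)"
proof (induction d arbitrary: i j)
  case 0
  then show ?case by (auto simp: indicator_def power2_eq_square)
next
  case (Suc d)
  have f: "fact (Suc k) powr \<alpha> = real (Suc k) powr \<alpha> * fact k powr \<alpha>" for k
    by (simp add: powr_mult)
  have p: "real (Suc k) powr \<alpha> \<noteq> 0" "fact k powr \<alpha> \<noteq> (0::real)" for k by auto
  define K where "K = (fact (n - 1) powr \<alpha> :: real)"
  define a where "a = real (Suc i) powr \<alpha>"
  define b where "b = real (Suc j) powr \<alpha>"
  define u where "u = (fact i powr \<alpha> :: real)"
  define v where "v = (fact j powr \<alpha> :: real)"
  have nz: "a \<noteq> 0" "b \<noteq> 0" "u \<noteq> 0" "v \<noteq> 0" using p by (auto simp: a_def b_def u_def v_def)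
  have eq: "a / s * (K\<^sup>2 / (a * u * v) * w) + b / s * (K\<^sup>2 / (u * (b * v)) * w')
      = K\<^sup>2 / (u * v) * ((w + w') / s)" for w w' s
    using nz by (simp add: field_simps add_divide_distrib)
  show ?case
    unfolding hop.simps denom_weight.simps right_Pair up_Pair Suc.IH f pR_def pU_def fst_conv snd_conv
    unfolding a_def[symmetric] b_def[symmetric] u_def[symmetric] v_def[symmetric] K_def[symmetric]
    by (rule eq)
qed

lemma denom_weight_nonneg: "denom_weight \<alpha> n d s \<ge> 0"
  by (induction d arbitrary: s) auto

lemma denom_weight_sym: "denom_weight \<alpha> n d (i, j) = denom_weight \<alpha> n d (j, i)"
proof (induction d arbitrary: i j)
  case 0
  then show ?case by (auto simp: indicator_def)
next
  case (Suc d)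
  then show ?case using Suc.IH[of "Suc i" j] Suc.IH[of i "Suc j"] by (simp add: add.commute)
qed

text \<open>Convexity in discrete form: the unit increments of \<open>x powr \<alpha>\<close> grow
  with \<open>x\<close>.\<close>

lemma powr_convex_exchange:
  assumes "\<alpha> \<ge> 1" "(0::real) \<le> b" "b \<le> a"
  shows "a powr \<alpha> + (b + 1) powr \<alpha> \<le> (a + 1) powr \<alpha> + b powr \<alpha>"
proof -
  have "mono_on {0..} (\<lambda>x::real. (x + 1) powr \<alpha> - x powr \<alpha>)"
  proof (rule mono_onI)
    fix x y :: real assume xy: "x \<in> {0..}" "y \<in> {0..}" "x \<le> y"
    show "(x + 1) powr \<alpha> - x powr \<alpha> \<le> (y + 1) powr \<alpha> - y powr \<alpha>"
    proof (rule DERIV_nonneg_imp_increasing_open[OF xy(3)])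
      fix t assume t: "x < t" "t < y"
      then have "0 < t" using xy by auto
      then have "((\<lambda>x. (x + 1) powr \<alpha> - x powr \<alpha>) has_real_derivative
          \<alpha> * (t + 1) powr (\<alpha> - 1) - \<alpha> * t powr (\<alpha> - 1)) (at t)"
        by (auto intro!: derivative_eq_intros)
      moreover have "\<alpha> * (t + 1) powr (\<alpha> - 1) - \<alpha> * t powr (\<alpha> - 1) \<ge> 0"
        using assms \<open>0 < t\<close> by (auto intro!: mult_left_mono powr_mono2)
      ultimately show "\<exists>D. ((\<lambda>x. (x + 1) powr \<alpha> - x powr \<alpha>) has_real_derivative D) (at t) \<and> D \<ge> 0" by blast
    next
      show "continuous_on {x..y} (\<lambda>x. (x + 1) powr \<alpha> - x powr \<alpha>)"
        using xy assms by (intro continuous_intros continuous_on_powr') auto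
    qed
  qed
  from mono_onD[OF this, of b a] assms show ?thesis by auto
qed

text \<open>Towards the diagonal the denominator shrinks by \<open>powr_convex_exchange\<close>. The
  two numerators share the summand at \<open>(Suc i, Suc j)\<close>, and their other summands are
  compared through that state by induction.\<close>

lemma denom_weight_decreasing:
  assumes "\<alpha> \<ge> 1" "j \<le> i" "j \<ge> 1"
  shows "denom_weight \<alpha> n d (Suc i, j) \<le> denom_weight \<alpha> n d (i, Suc j)"
  using assms(2-)
proof (induction d arbitrary: i j)
  case 0
  then show ?case by (auto simp: indicator_def)
next
  case (Suc d)
  have "denom_weight \<alpha> n d (Suc (Suc i), j) \<le> denom_weight \<alpha> n d (i, Suc (Suc j))"
  proof (cases "i = j")
    case False
    then have "denom_weight \<alpha> n d (Suc (Suc i), j) \<le> denom_weight \<alpha> n d (Suc i, Suc j)"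
      using Suc.prems by (intro Suc.IH) auto
    also have "\<dots> \<le> denom_weight \<alpha> n d (i, Suc (Suc j))"
      using False Suc.prems by (intro Suc.IH) auto
    finally show ?thesis .
  qed (simp add: denom_weight_sym)
  then show ?case using Suc.prems powr_convex_exchange[of \<alpha> "real j" "real i"] assms(1)
    by (auto intro!: frac_le add_nonneg_nonneg add_pos_pos denom_weight_nonneg simp: add.commute)
qed

text \<open>The numerator of \<open>pR\<close> or \<open>pU\<close> cancels exactly against the
  factor by which the factorial grows, so both sides are one common \<open>K\<close> times a
  \<open>denom_weight\<close>. The sides are the unnormalised one-step probabilities of the
  conditioned chain.\<close>

lemma inward_drift:
  fixes d :: nat
  assumes "\<alpha> \<ge> 1" "n \<ge> 1" "i \<ge> 1" "j \<ge> 1"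
  defines "h \<equiv> hop \<alpha> d (indicator {(n, n)})"
  shows "j \<le> i \<Longrightarrow> pR \<alpha> (i, j) * h (Suc i, j) \<le> pU \<alpha> (i, j) * h (i, Suc j)"
    and "i \<le> j \<Longrightarrow> pU \<alpha> (i, j) * h (i, Suc j) \<le> pR \<alpha> (i, j) * h (Suc i, j)"
proof -
  obtain i' j' where ij: "i = Suc i'" "j = Suc j'" using assms by (cases i; cases j) auto
  define K where "K = (fact (n - 1) powr \<alpha>)\<^sup>2 / (fact i' powr \<alpha> * fact j' powr \<alpha>)
      / (real i powr \<alpha> + real j powr \<alpha>)"
  have K: "K \<ge> 0" unfolding K_def by (intro divide_nonneg_nonneg) auto
  have f: "fact (Suc k) powr \<alpha> = real (Suc k) powr \<alpha> * fact k powr \<alpha>" for k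
    by (simp add: powr_mult)
  have p: "real (Suc k) powr \<alpha> \<noteq> 0" for k by auto
  have *: "a / s * (c / (a * u * v) * w) = c / (u * v) / s * w"
     "a / s * (c / (u * (a * v)) * w) = c / (u * v) / s * w" if "a \<noteq> 0" for a s c u v w :: real
    using that by (auto simp: field_simps)
  have R: "pR \<alpha> (i, j) * h (Suc i, j) = K * denom_weight \<alpha> n d (Suc i, j)"
    unfolding h_def ij hop_eq_denom_weight[OF assms(2)] f using p[of i']
    by (simp only: pR_def K_def ij fst_conv snd_conv, intro *)
  have U: "pU \<alpha> (i, j) * h (i, Suc j) = K * denom_weight \<alpha> n d (i, Suc j)"
    unfolding h_def ij hop_eq_denom_weight[OF assms(2)] f using p[of j']
    by (simp only: pU_def K_def ij fst_conv snd_conv, intro *)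
  show "j \<le> i \<Longrightarrow> pR \<alpha> (i, j) * h (Suc i, j) \<le> pU \<alpha> (i, j) * h (i, Suc j)"
    unfolding R U using denom_weight_decreasing[OF assms(1), of j i n d] assms K
    by (intro mult_left_mono) auto
  show "i \<le> j \<Longrightarrow> pU \<alpha> (i, j) * h (i, Suc j) \<le> pR \<alpha> (i, j) * h (Suc i, j)"
    unfolding R U using denom_weight_decreasing[OF assms(1), of i j n d] assms K
    by (intro mult_left_mono) (auto simp: denom_weight_sym)
qed

section \<open>A maximal inequality for drawups\<close>

definition adif :: "nat \<times> nat \<Rightarrow> real" where
  "adif s = \<bar>real (fst s) - real (snd s)\<bar>"

text \<open>Lists carry the newest state at the head, so \<open>d\<close> counts steps back in time:
  the running minimum and the \<open>drawup\<close> are those of the walk read from index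
  \<open>d\<close> to the head.\<close>

fun last_min :: "nat \<Rightarrow> (nat \<times> nat) list \<Rightarrow> real" where
  "last_min 0 p = adif (hd p)"
| "last_min (Suc d) p = min (adif (hd p)) (last_min d (tl p))"

fun drawup :: "nat \<Rightarrow> (nat \<times> nat) list \<Rightarrow> real" where
  "drawup 0 p = 0"
| "drawup (Suc d) p = max (drawup d (tl p)) (adif (hd p) - last_min (Suc d) p)"

lemma last_min_le: "i \<le> d \<Longrightarrow> d < length p \<Longrightarrow> last_min d p \<le> adif (p ! i)"
proof (induction d arbitrary: p i)
  case 0
  then show ?case by (cases p) auto
next
  case (Suc d)
  then show ?case by (cases p; cases i) (auto simp: min_le_iff_disj)
qed

lemma drawup_ge: "i \<le> i' \<Longrightarrow> i' \<le> d \<Longrightarrow> d < length p \<Longrightarrow> adif (p ! i) - adif (p ! i') \<le> drawup d p"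
proof (induction d arbitrary: p i i')
  case 0
  then show ?case by auto
next
  case (Suc d)
  then obtain s q where p: "p = s # q" by (cases p) auto
  show ?case
  proof (cases i)
    case 0
    then show ?thesis using last_min_le[of i' "Suc d" p] Suc.prems p
      by (auto simp: le_max_iff_disj simp del: last_min.simps)
  next
    case (Suc k)
    then obtain k' where "i' = Suc k'" using Suc.prems by (cases i') auto
    then show ?thesis using Suc.IH[of k k' q] Suc.prems \<open>i = Suc k\<close> p by (auto simp: le_max_iff_disj)
  qed
qed

lemma last_min_le_hd: "last_min d p \<le> adif (hd p)"
  by (cases d) auto

lemma last_min_nonneg: "last_min d p \<ge> 0"
  by (induction d arbitrary: p) (auto simp: adif_def)

lemma last_min_Ints: "last_min d p \<in> \<int>"
  by (induction d arbitrary: p) (auto simp: adif_def min_def)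

text \<open>The fourth moment of \<open>x + sqrt r * G\<close> with \<open>G\<close> standard
  normal: the space-time polynomial that is a martingale for Brownian motion with \<open>r\<close>
  units of time left.\<close>

definition quartic :: "real \<Rightarrow> real \<Rightarrow> real" where
  "quartic r x = x ^ 4 + 6 * r * x\<^sup>2 + 3 * r\<^sup>2"

text \<open>A symmetric unit step lowers \<open>quartic\<close> by exactly 2 on average; the
  asymmetry contributes \<open>a - b \<le> 0\<close> times a quantity that is nonnegative for
  \<open>x \<ge> 0\<close>.\<close>

lemma quartic_step:
  assumes "0 \<le> a" "a \<le> b" "0 \<le> x" "1 \<le> r"
  shows "a * quartic (r - 1) (x + 1) + b * quartic (r - 1) (x - 1) \<le> (a + b) * quartic r x"
proof -
  have "a * quartic (r - 1) (x + 1) + b * quartic (r - 1) (x - 1) =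
     (a + b) * (quartic r x - 2) + (a - b) * (4 * x ^ 3 + 4 * x + 12 * (r - 1) * x)"
    by (simp add: quartic_def power2_eq_square power4_eq_xxxx power3_eq_cube algebra_simps)
  moreover have "(a - b) * (4 * x ^ 3 + 4 * x + 12 * (r - 1) * x) \<le> 0"
    using assms by (intro mult_nonpos_nonneg add_nonneg_nonneg) auto
  moreover have "(a + b) * (quartic r x - 2) \<le> (a + b) * quartic r x"
    using assms by (intro mult_left_mono) auto
  ultimately show ?thesis by linarith
qed

text \<open>Covers the walk at its running minimum, where the inward drift gives no sign: the
  distance to the updated minimum becomes 0 or 1, and the quartic with one unit of time less stays
  below its old value in both cases.\<close>

lemma quartic_step_0:
  assumes "0 \<le> a" "0 \<le> b" "1 \<le> r" "x \<in> {0, 1}" "y \<in> {0, 1}"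
  shows "a * quartic (r - 1) x + b * quartic (r - 1) y \<le> (a + b) * quartic r 0"
proof -
  have *: "quartic (r - 1) z \<le> quartic r 0" if "z \<in> {0, 1}" for z
    using that assms by (auto simp: quartic_def power2_eq_square algebra_simps)
  show ?thesis unfolding distrib_right
    by (intro add_mono mult_left_mono *) (use assms in auto)
qed

text \<open>\<open>L - d\<close> is the time left in the window. Once the drawup has reached
  \<open>\<kappa>\<close> the value is frozen at \<open>\<kappa> ^ 4\<close>, which is at most the
  quartic at the moment of crossing.\<close>

definition stopped_quartic :: "real \<Rightarrow> nat \<Rightarrow> nat \<Rightarrow> (nat \<times> nat) list \<Rightarrow> real" where
  "stopped_quartic \<kappa> L d p = (if drawup d p \<ge> \<kappa> then \<kappa> ^ 4
     else quartic (real L - real d) (adif (hd p) - last_min d p))"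

lemma stopped_quartic_step:
  assumes "p \<in> paths l" "d < L" "\<kappa> > 0" "a \<ge> 0" "b \<ge> 0"
    and "snd (hd p) \<le> fst (hd p) \<Longrightarrow> a \<le> b" "fst (hd p) \<le> snd (hd p) \<Longrightarrow> b \<le> a"
  shows "a * stopped_quartic \<kappa> L (Suc d) (right (hd p) # p) + b * stopped_quartic \<kappa> L (Suc d) (up (hd p) # p)
     \<le> (a + b) * stopped_quartic \<kappa> L d p"
proof (cases "drawup d p \<ge> \<kappa>")
  case True
  then show ?thesis by (simp add: stopped_quartic_def le_max_iff_disj algebra_simps)
next
  case False
  define \<mu> where "\<mu> = last_min d p"
  define r where "r = real L - real d"
  define D where "D s = adif s - min (adif s) \<mu>" for s
  have r: "r \<ge> 1" using assms(2) by (auto simp: r_def)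
  have next_le: "stopped_quartic \<kappa> L (Suc d) (s # p) \<le> quartic (r - 1) (D s)" for s
  proof -
    have "\<kappa> ^ 4 \<le> quartic (r - 1) (D s)" if "\<kappa> \<le> D s"
    proof -
      have "\<kappa> ^ 4 \<le> D s ^ 4" using that assms(3) by (intro power_mono) auto
      also have "\<dots> \<le> quartic (r - 1) (D s)" using r by (auto simp: quartic_def intro!: add_nonneg_nonneg)
      finally show ?thesis .
    qed
    moreover have "real L - real (Suc d) = r - 1" by (simp add: r_def)
    ultimately show ?thesis using False
      by (auto simp: stopped_quartic_def D_def \<mu>_def simp del: of_nat_Suc)
  qed
  obtain i j where ij: "hd p = (i, j)" by (cases "hd p")
  \<comment> \<open>Integrality matters: a state strictly above the minimum is at least 1 above it,
    so the next step cannot lower the minimum and changes the distance by exactly 1.\<close>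
  have \<mu>: "0 \<le> \<mu>" "\<mu> \<le> adif (i, j)" "\<mu> \<in> \<int>"
    unfolding \<mu>_def using ij by (metis last_min_nonneg, metis last_min_le_hd, metis last_min_Ints)
  then obtain \<mu>' :: int where \<mu>': "\<mu> = of_int \<mu>'" by (auto elim: Ints_cases)
  have R: "stopped_quartic \<kappa> L d p = quartic r (adif (i, j) - \<mu>)"
    using False ij by (simp add: stopped_quartic_def \<mu>_def r_def)
  have "a * quartic (r - 1) (D (Suc i, j)) + b * quartic (r - 1) (D (i, Suc j))
      \<le> (a + b) * quartic r (adif (i, j) - \<mu>)"
  proof (cases "adif (i, j) = \<mu>")
    case True
    have "D (Suc i, j) \<in> {0, 1}" "D (i, Suc j) \<in> {0, 1}"
      using True by (auto simp: D_def adif_def min_def abs_if split: if_splits)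
    then show ?thesis using True quartic_step_0[of a b r] assms r by simp
  next
    case False
    define x where "x = adif (i, j) - \<mu>"
    have "\<mu>' < \<bar>int i - int j\<bar>" using False \<mu> \<mu>' by (auto simp: adif_def abs_if split: if_splits)
    then have "\<mu>' \<le> \<bar>int i - int j\<bar> - 1" by auto
    then have ge: "\<mu> \<le> \<bar>real i - real j\<bar> - 1" unfolding \<mu>' by linarith
    show ?thesis
    proof (cases "j \<le> i")
      case True
      then have "D (Suc i, j) = x + 1" "D (i, Suc j) = x - 1"
        using ge \<mu>(1) by (auto simp: D_def x_def adif_def min_def abs_if split: if_splits)
      then show ?thesis using quartic_step[of a b x r] True assms r \<mu> ij
        by (auto simp: x_def)
    next
      case False
      then have "D (Suc i, j) = x - 1" "D (i, Suc j) = x + 1"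
        using ge \<mu>(1) by (auto simp: D_def x_def adif_def min_def abs_if split: if_splits)
      then show ?thesis using quartic_step[of b a x r] False assms r \<mu> ij
        by (auto simp: x_def add.commute)
    qed
  qed
  then show ?thesis unfolding R using next_le[of "(Suc i, j)"] next_le[of "(i, Suc j)"] assms(4,5) ij
    by (smt (verit, best) mult_left_mono right_Pair up_Pair)
qed

text \<open>The weighted expectation \<open>E\<close> of \<open>stopped_quartic\<close> decreases by
  \<open>inward_drift\<close>. It starts at \<open>quartic L 0 = 3 * L^2\<close> times the total
  mass and ends above \<open>\<kappa> ^ 4\<close> times the mass of the event. Being quadratic in
  \<open>L\<close>, the bound survives summation over many short blocks.\<close>

lemma drawup_maximal_inequality:
  assumes "\<alpha> \<ge> 1" "n \<ge> 1" "l + L \<le> 2 * n - 2" "\<kappa> > 0"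
  shows "path_expect \<alpha> (l + L) (\<lambda>p. visit \<alpha> (hd p) (n, n) * indicator {p. drawup L p \<ge> \<kappa>} p)
     \<le> 3 * (real L)\<^sup>2 / \<kappa> ^ 4 * path_expect \<alpha> l (\<lambda>p. visit \<alpha> (hd p) (n, n))"
proof -
  define E where "E d = path_expect \<alpha> (l + d) (\<lambda>p. visit \<alpha> (hd p) (n, n) * stopped_quartic \<kappa> L d p)" for d
  have step: "E (Suc d) \<le> E d" if "d < L" for d
  proof -
    have "E (Suc d) = path_expect \<alpha> (l + d) (\<lambda>p.
        pR \<alpha> (hd p) * (visit \<alpha> (right (hd p)) (n, n) * stopped_quartic \<kappa> L (Suc d) (right (hd p) # p)) +
        pU \<alpha> (hd p) * (visit \<alpha> (up (hd p)) (n, n) * stopped_quartic \<kappa> L (Suc d) (up (hd p) # p)))"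
      by (simp add: E_def)
    also have "\<dots> \<le> E d" unfolding E_def
    proof (rule path_expect_mono)
      fix p assume p: "p \<in> paths (l + d)"
      obtain i j where ij: "hd p = (i, j)" by (cases "hd p")
      have ij1: "i \<ge> 1" "j \<ge> 1" "i + j = l + d + 2" using paths_hd[OF p] ij by auto
      define e where "e = n + n - (i + j) - 1"
      have e: "n + n - (i + j) = Suc e" "n + n - (Suc i + j) = e" "n + n - (i + Suc j) = e"
        using assms(2,3) that ij1 by (auto simp: e_def)
      define a where "a = pR \<alpha> (i, j) * hop \<alpha> e (indicator {(n, n)}) (Suc i, j)"
      define b where "b = pU \<alpha> (i, j) * hop \<alpha> e (indicator {(n, n)}) (i, Suc j)"
      have "a * stopped_quartic \<kappa> L (Suc d) (right (hd p) # p) + b * stopped_quartic \<kappa> L (Suc d) (up (hd p) # p)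
        \<le> (a + b) * stopped_quartic \<kappa> L d p"
        by (rule stopped_quartic_step[OF p that])
           (use assms ij ij1 inward_drift[OF assms(1,2) ij1(1,2), of e]
             in \<open>auto simp: a_def b_def intro!: mult_nonneg_nonneg hop_nonneg\<close>)
      then show "pR \<alpha> (hd p) * (visit \<alpha> (right (hd p)) (n, n) * stopped_quartic \<kappa> L (Suc d) (right (hd p) # p)) +
        pU \<alpha> (hd p) * (visit \<alpha> (up (hd p)) (n, n) * stopped_quartic \<kappa> L (Suc d) (up (hd p) # p))
        \<le> visit \<alpha> (hd p) (n, n) * stopped_quartic \<kappa> L d p"
        unfolding ij by (simp only: fst_conv snd_conv right_Pair up_Pair e) (simp add: a_def b_def mult_ac)
    qed
    finally show ?thesis .
  qed
  have "E d \<le> E 0" if "d \<le> L" for d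
    using that by (induction d) (auto intro: order_trans[OF step])
  then have "E L \<le> E 0" by simp
  also have "E 0 = path_expect \<alpha> l (\<lambda>p. 3 * (real L)\<^sup>2 * visit \<alpha> (hd p) (n, n))"
    using assms(4) by (simp add: E_def stopped_quartic_def quartic_def mult.commute)
  finally have EL: "E L \<le> 3 * (real L)\<^sup>2 * path_expect \<alpha> l (\<lambda>p. visit \<alpha> (hd p) (n, n))"
    by (simp only: path_expect_cmult)
  have "\<kappa> ^ 4 * path_expect \<alpha> (l + L) (\<lambda>p. visit \<alpha> (hd p) (n, n) * indicator {p. drawup L p \<ge> \<kappa>} p)
      = path_expect \<alpha> (l + L) (\<lambda>p. \<kappa> ^ 4 * (visit \<alpha> (hd p) (n, n) * indicator {p. drawup L p \<ge> \<kappa>} p))"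
    by (rule path_expect_cmult[symmetric])
  also have "\<dots> \<le> E L" unfolding E_def
    by (intro path_expect_mono) (auto simp: stopped_quartic_def indicator_def quartic_def
        intro!: mult_nonneg_nonneg hop_nonneg)
  also note EL
  finally show ?thesis using assms(4) by (simp add: field_simps)
qed

section \<open>Fourier representation of the visiting probabilities\<close>

text \<open>The characteristic function at \<open>\<theta>\<close> of \<open>c\<close> times a
  standard exponential variable; \<open>c\<close> may be negative.\<close>

definition cfac :: "real \<Rightarrow> real \<Rightarrow> complex" where
  "cfac c \<theta> = inverse (1 - \<i> * of_real (\<theta> * c))"

lemma one_minus_i_nonzero: "1 - \<i> * of_real x \<noteq> 0"
  by (simp add: complex_eq_iff)

lemma norm_one_minus_i: "norm (1 - \<i> * of_real x) = sqrt (1 + x\<^sup>2)"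
  by (simp add: cmod_def)

lemma norm_cfac: "norm (cfac c \<theta>) = inverse (sqrt (1 + (\<theta> * c)\<^sup>2))"
  by (simp add: cfac_def norm_inverse norm_one_minus_i del: of_real_mult)

lemma norm_cfac_le_1: "norm (cfac c \<theta>) \<le> 1"
  by (auto simp: norm_cfac intro!: inverse_le_1_iff[THEN iffD2])

lemma norm_prod_cfac_le_1: "norm (\<Prod>x\<in>I. cfac (c x) \<theta>) \<le> 1"
  by (auto simp: prod_norm[symmetric] norm_cfac_le_1 intro!: prod_le_1)

lemma isCont_cfac: "isCont (cfac c) x"
  unfolding cfac_def by (intro continuous_intros) (auto simp: one_minus_i_nonzero)

lemma borel_measurable_cfac [measurable]: "cfac c \<in> borel_measurable borel"
  by (intro borel_measurable_continuous_onI continuous_at_imp_continuous_on) (auto simp: isCont_cfac)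

lemma integrable_inverse_1_plus_square_scaled:
  assumes "e > 0"
  shows "integrable lborel (\<lambda>x::real. inverse (1 + (x * e)\<^sup>2))"
proof -
  have "integrable lborel (\<lambda>x::real. inverse (1 + x\<^sup>2))"
    using integrable_inverse_1_plus_square by (simp add: set_integrable_def)
  then show ?thesis
    using lborel_integrable_real_affine_iff[of e "\<lambda>x::real. inverse (1 + x\<^sup>2)" 0] assms by (simp add: mult.commute)
qed

text \<open>One factor decays only like \<open>1 / \<bar>\<theta>\<bar>\<close>, which is not
  integrable; two factors give a Cauchy-type bound.\<close>

lemma norm_cfac_pair_le:
  assumes "e > 0" "e \<le> \<bar>b\<bar>" "e \<le> \<bar>d\<bar>"
  shows "norm (cfac b \<theta> * cfac d \<theta>) \<le> inverse (1 + (\<theta> * e)\<^sup>2)"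
proof -
  have *: "inverse (sqrt (1 + (\<theta> * c)\<^sup>2)) \<le> inverse (sqrt (1 + (\<theta> * e)\<^sup>2))" if "e \<le> \<bar>c\<bar>" for c
  proof -
    have "(\<theta> * e)\<^sup>2 \<le> (\<theta> * c)\<^sup>2" using that assms
      by (simp add: power_mult_distrib) (intro mult_left_mono, auto simp: abs_le_square_iff[symmetric])
    then show ?thesis by (intro le_imp_inverse_le real_sqrt_le_mono) (auto intro: add_pos_nonneg)
  qed
  have "norm (cfac b \<theta> * cfac d \<theta>) \<le> inverse (sqrt (1 + (\<theta> * e)\<^sup>2)) * inverse (sqrt (1 + (\<theta> * e)\<^sup>2))"
    unfolding norm_mult norm_cfac by (intro mult_mono *) (use assms in auto)
  also have "\<dots> = inverse (1 + (\<theta> * e)\<^sup>2)"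
    by (metis abs_of_nonneg add_nonneg_nonneg inverse_mult_distrib real_sqrt_mult_self zero_le_one zero_le_power2)
  finally show ?thesis .
qed

lemma integrable_prod_cfac:
  assumes "finite I" "x \<in> I" "y \<in> I" "x \<noteq> y" "c x \<noteq> 0" "c y \<noteq> 0"
  shows "integrable lborel (\<lambda>\<theta>. \<Prod>x\<in>I. cfac (c x) \<theta>)"
proof (rule Bochner_Integration.integrable_bound[OF integrable_inverse_1_plus_square_scaled])
  define e where "e = min \<bar>c x\<bar> \<bar>c y\<bar>"
  show e: "e > 0" using assms by (auto simp: e_def)
  show "AE \<theta> in lborel. norm (\<Prod>x\<in>I. cfac (c x) \<theta>) \<le> norm (inverse (1 + (\<theta> * e)\<^sup>2))"
  proof (rule AE_I2)
    fix \<theta> :: real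
    have "(\<Prod>x\<in>I. cfac (c x) \<theta>) = cfac (c x) \<theta> * (cfac (c y) \<theta> * (\<Prod>x\<in>I - {x} - {y}. cfac (c x) \<theta>))"
      using assms by (simp add: prod.remove[of I x] prod.remove[of "I - {x}" y])
    then have "norm (\<Prod>x\<in>I. cfac (c x) \<theta>) = norm (cfac (c x) \<theta> * cfac (c y) \<theta>) * norm (\<Prod>x\<in>I - {x} - {y}. cfac (c x) \<theta>)"
      by (simp add: norm_mult mult.assoc)
    also have "\<dots> \<le> inverse (1 + (\<theta> * e)\<^sup>2) * 1"
      by (intro mult_mono norm_cfac_pair_le norm_prod_cfac_le_1) (use e in \<open>auto simp: e_def\<close>)
    finally show "norm (\<Prod>x\<in>I. cfac (c x) \<theta>) \<le> norm (inverse (1 + (\<theta> * e)\<^sup>2))" by simp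
  qed
qed simp

text \<open>With \<open>A\<close> and \<open>D\<close> the two linear denominators,
  \<open>b * D - d * A = b - d\<close>. The identity is used twice: to evaluate integrals, and with
  \<open>d < 0\<close> as the source of the transition probabilities of the urn.\<close>

lemma cfac_partial_fraction:
  assumes "b \<noteq> d"
  shows "cfac b \<theta> * cfac d \<theta> = (of_real b * cfac b \<theta> - of_real d * cfac d \<theta>) / of_real (b - d)"
proof -
  define A D where "A = 1 - \<i> * of_real (\<theta> * b)" and "D = 1 - \<i> * of_real (\<theta> * d)"
  have nz: "A \<noteq> 0" "D \<noteq> 0" "complex_of_real (b - d) \<noteq> 0"
    using assms one_minus_i_nonzero by (auto simp: A_def D_def simp del: of_real_mult)
  have "of_real b * D - of_real d * A = complex_of_real (b - d)"
    by (simp add: A_def D_def algebra_simps)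
  then have "(of_real b * inverse A - of_real d * inverse D) / of_real (b - d) =
      (of_real b * inverse A - of_real d * inverse D) / (of_real b * D - of_real d * A)" by simp
  also have "\<dots> = inverse A * inverse D"
  proof -
    have "of_real b * D - of_real d * A \<noteq> 0" using \<open>of_real b * D - of_real d * A = _\<close> nz by simp
    moreover have "of_real b * inverse A - of_real d * inverse D
        = (of_real b * D - of_real d * A) * (inverse A * inverse D)" using nz by (simp add: field_simps)
    ultimately show ?thesis by simp
  qed
  finally show ?thesis by (simp add: cfac_def A_def D_def)
qed

text \<open>This is \<open>\<i> * Ln (1 - \<i> * b * \<theta>)\<close> in real and imaginary
  parts.\<close>

definition cfac_primitive :: "real \<Rightarrow> real \<Rightarrow> complex" where
  "cfac_primitive b \<theta> = Complex (arctan (b * \<theta>)) (ln (1 + b\<^sup>2 * \<theta>\<^sup>2) / 2)"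

lemma cfac_primitive_deriv:
  "(cfac_primitive b has_vector_derivative (of_real b * cfac b \<theta>)) (at \<theta>)"
proof -
  have pos: "1 + b\<^sup>2 * \<theta>\<^sup>2 > 0" by (intro add_pos_nonneg) auto
  have "of_real b * cfac b \<theta> = Complex (b / (1 + b\<^sup>2 * \<theta>\<^sup>2)) (b\<^sup>2 * \<theta> / (1 + b\<^sup>2 * \<theta>\<^sup>2))"
    by (simp add: cfac_def complex_eq_iff power_mult_distrib power2_eq_square mult_ac)
  moreover have "((\<lambda>\<theta>. arctan (b * \<theta>)) has_vector_derivative b / (1 + b\<^sup>2 * \<theta>\<^sup>2)) (at \<theta>)"
    unfolding has_real_derivative_iff_has_vector_derivative[symmetric]
    by (auto intro!: derivative_eq_intros simp: power_mult_distrib field_simps)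
  moreover have "((\<lambda>\<theta>. ln (1 + b\<^sup>2 * \<theta>\<^sup>2) / 2) has_vector_derivative b\<^sup>2 * \<theta> / (1 + b\<^sup>2 * \<theta>\<^sup>2)) (at \<theta>)"
    unfolding has_real_derivative_iff_has_vector_derivative[symmetric]
    using pos by (auto intro!: derivative_eq_intros simp: field_simps)
  ultimately show ?thesis
    unfolding cfac_primitive_def[abs_def] has_vector_derivative_complex_iff
    by (simp add: has_real_derivative_iff_has_vector_derivative)
qed

lemma arctan_mult_at_top: "b \<noteq> 0 \<Longrightarrow> ((\<lambda>x. arctan (b * x)) \<longlongrightarrow> sgn b * (pi / 2)) at_top"
  and arctan_mult_at_bot: "b \<noteq> 0 \<Longrightarrow> ((\<lambda>x. arctan (b * x)) \<longlongrightarrow> - (sgn b * (pi / 2))) at_bot"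
proof -
  assume "b \<noteq> 0"
  then consider "b > 0" | "b < 0" by linarith
  then show "((\<lambda>x. arctan (b * x)) \<longlongrightarrow> sgn b * (pi / 2)) at_top"
  proof cases
    case 1
    then have "filterlim (\<lambda>x. b * x) at_top at_top" 
      by (intro filterlim_tendsto_pos_mult_at_top[OF tendsto_const]) (auto simp: filterlim_ident)
    from filterlim_compose[OF tendsto_arctan_at_top this] show ?thesis using 1 by simp
  next
    case 2
    then have "filterlim (\<lambda>x. b * x) at_bot at_top" 
      by (intro filterlim_tendsto_neg_mult_at_bot[OF tendsto_const]) (auto simp: filterlim_ident)
    from filterlim_compose[OF tendsto_arctan_at_bot this] show ?thesis using 2 by simp
  qed
  then have "((\<lambda>x. - arctan (b * x)) \<longlongrightarrow> - (sgn b * (pi / 2))) at_top" by (rule tendsto_minus)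
  then show "((\<lambda>x. arctan (b * x)) \<longlongrightarrow> - (sgn b * (pi / 2))) at_bot"
    by (subst filterlim_at_bot_mirror) (simp add: arctan_minus)
qed

text \<open>Each logarithm diverges, so the difference is taken first. Its limit is the same at both
  ends of the line and cancels in the integral.\<close>

lemma ln_ratio_limit:
  fixes b d :: real
  assumes "b \<noteq> 0" "d \<noteq> 0"
  shows "((\<lambda>x. ln (1 + b\<^sup>2 * x\<^sup>2) / 2 - ln (1 + d\<^sup>2 * x\<^sup>2) / 2) \<longlongrightarrow> ln (b\<^sup>2 / d\<^sup>2) / 2) at_top" (is ?top)
    and "((\<lambda>x. ln (1 + b\<^sup>2 * x\<^sup>2) / 2 - ln (1 + d\<^sup>2 * x\<^sup>2) / 2) \<longlongrightarrow> ln (b\<^sup>2 / d\<^sup>2) / 2) at_bot" (is ?bot)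
proof -
  have inv: "((\<lambda>x::real. inverse (x\<^sup>2)) \<longlongrightarrow> 0) at_top"
    by (intro tendsto_inverse_0_at_top filterlim_pow_at_top) (auto simp: filterlim_ident)
  have pos: "b\<^sup>2 > 0" "d\<^sup>2 > 0" using assms by auto
  have "((\<lambda>x. ln ((inverse (x\<^sup>2) + b\<^sup>2) / (inverse (x\<^sup>2) + d\<^sup>2)) / 2) \<longlongrightarrow> ln ((0 + b\<^sup>2) / (0 + d\<^sup>2)) / 2) at_top"
    by (intro tendsto_intros inv) (use assms in auto)
  moreover have "\<forall>\<^sub>F x in at_top. ln ((inverse (x\<^sup>2) + b\<^sup>2) / (inverse (x\<^sup>2) + d\<^sup>2)) / 2
      = ln (1 + b\<^sup>2 * x\<^sup>2) / 2 - ln (1 + d\<^sup>2 * x\<^sup>2) / 2"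
    using eventually_gt_at_top[of "0::real"]
  proof eventually_elim
    case (elim x)
    have "(inverse (x\<^sup>2) + b\<^sup>2) / (inverse (x\<^sup>2) + d\<^sup>2) = (1 + b\<^sup>2 * x\<^sup>2) / (1 + d\<^sup>2 * x\<^sup>2)"
    proof -
      have "inverse (x\<^sup>2) + c = (1 + c * x\<^sup>2) / x\<^sup>2" for c using elim by (simp add: field_simps)
      then show ?thesis using elim by simp
    qed
    moreover have "1 + c\<^sup>2 * x\<^sup>2 > 0" for c :: real by (intro add_pos_nonneg) auto
    then have "ln ((1 + b\<^sup>2 * x\<^sup>2) / (1 + d\<^sup>2 * x\<^sup>2)) = ln (1 + b\<^sup>2 * x\<^sup>2) - ln (1 + d\<^sup>2 * x\<^sup>2)"
      by (intro ln_divide_pos) auto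
    ultimately show ?case by (simp only: diff_divide_distrib)
  qed
  ultimately have "((\<lambda>x. ln (1 + b\<^sup>2 * x\<^sup>2) / 2 - ln (1 + d\<^sup>2 * x\<^sup>2) / 2) \<longlongrightarrow> ln ((0 + b\<^sup>2) / (0 + d\<^sup>2)) / 2) at_top"
    by (rule Lim_transform_eventually)
  then show ?top by simp
  then show ?bot by (subst filterlim_at_bot_mirror) simp
qed

text \<open>Only the total increments of the two arctangents survive, \<open>pi * sgn b\<close> and
  \<open>pi * sgn d\<close>. Equal signs give 0; opposite signs give the base case
  \<open>race_density_diagonal\<close>.\<close>

lemma integral_cfac_pair:
  assumes "b \<noteq> d" "b \<noteq> 0" "d \<noteq> 0"
  shows "(\<integral>\<theta>. cfac b \<theta> * cfac d \<theta> \<partial>lborel) = of_real (pi * (sgn b - sgn d) / (b - d))"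
proof -
  define F where "F \<theta> = (cfac_primitive b \<theta> - cfac_primitive d \<theta>) / of_real (b - d)" for \<theta>
  \<comment> \<open>\<open>z s\<close> is the limit of the primitive at the end of the line with
    sign \<open>s\<close>.\<close>
  define z where "z s = Complex (s * (sgn b * (pi / 2)) - s * (sgn d * (pi / 2))) (ln (b\<^sup>2 / d\<^sup>2) / 2) / of_real (b - d)" for s
  have F_alt: "F = (\<lambda>x. Complex (arctan (b * x) - arctan (d * x))
     (ln (1 + b\<^sup>2 * x\<^sup>2) / 2 - ln (1 + d\<^sup>2 * x\<^sup>2) / 2) / of_real (b - d))"
    by (auto simp: F_def cfac_primitive_def fun_eq_iff complex_eq_iff)
  have "(F \<longlongrightarrow> z 1) at_top" unfolding F_alt z_def
    by (intro tendsto_divide tendsto_const tendsto_Complex tendsto_diff)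
       (use assms ln_ratio_limit[OF assms(2,3)] arctan_mult_at_top[of b] arctan_mult_at_top[of d] in \<open>auto\<close>)
  then have top: "((F \<circ> real_of_ereal) \<longlongrightarrow> z 1) (at_left \<infinity>)"
    by (simp add: ereal_tendsto_simps)
  have "(F \<longlongrightarrow> z (-1)) at_bot" unfolding F_alt z_def
    by (intro tendsto_divide tendsto_const tendsto_Complex tendsto_diff)
       (use assms ln_ratio_limit[OF assms(2,3)] arctan_mult_at_bot[of b] arctan_mult_at_bot[of d] in \<open>auto\<close>)
  then have bot: "((F \<circ> real_of_ereal) \<longlongrightarrow> z (-1)) (at_right (-\<infinity>))"
    by (simp add: ereal_tendsto_simps)
  have int: "integrable lborel (\<lambda>\<theta>. cfac b \<theta> * cfac d \<theta>)"
    using integrable_prod_cfac[of "{True, False}" True False "\<lambda>x. if x then b else d"] assms by simp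
  have "(LBINT \<theta>=-\<infinity>..\<infinity>. cfac b \<theta> * cfac d \<theta>) = z 1 - z (-1)"
  proof (rule interval_integral_FTC_integrable[OF _ _ _ _ bot top])
    show "(F has_vector_derivative cfac b x * cfac d x) (at x)" for x
      unfolding F_def cfac_partial_fraction[OF assms(1)]
      by (intro has_vector_derivative_divide has_vector_derivative_diff cfac_primitive_deriv)
    show "isCont (\<lambda>\<theta>. cfac b \<theta> * cfac d \<theta>) x" for x by (intro continuous_intros isCont_cfac)
    show "set_integrable lborel (einterval (- \<infinity>) \<infinity>) (\<lambda>\<theta>. cfac b \<theta> * cfac d \<theta>)"
      using int by (simp add: set_integrable_def)
  qed simp
  also have "z 1 - z (-1) = of_real (pi * (sgn b - sgn d) / (b - d))"
    using assms by (simp add: z_def diff_divide_distrib[symmetric] complex_eq_iff Re_divide_of_real Im_divide_of_real field_simps)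
  finally show ?thesis by (simp add: interval_lebesgue_integral_def set_lebesgue_integral_def)
qed

text \<open>All poles lie in the same half plane; the partial fraction expansion replaces the residue theorem.\<close>

lemma integral_prod_cfac_same_sign:
  assumes "finite I" "card I \<ge> 2" "inj_on c I" "\<And>x. x \<in> I \<Longrightarrow> c x < 0"
  shows "(\<integral>\<theta>. (\<Prod>x\<in>I. cfac (c x) \<theta>) \<partial>lborel) = 0"
  using assms
proof (induction "card I" arbitrary: I rule: less_induct)
  case less
  obtain x y J where I: "I = insert x (insert y J)" "x \<noteq> y" "x \<notin> J" "y \<notin> J"
  proof -
    obtain x where x: "x \<in> I" using less.prems by fastforce
    then have "card (I - {x}) \<ge> 1" using less.prems by simp
    then obtain y where "y \<in> I - {x}" by (metis One_nat_def card.empty equals0I not_one_le_zero)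
    with x that[of x y "I - {x, y}"] show thesis by auto
  qed
  have finJ: "finite J" using less.prems I by auto
  have c: "c x \<noteq> c y" "c x < 0" "c y < 0" using less.prems I by (auto simp: inj_on_def)
  show ?case
  proof (cases "J = {}")
    case True
    then show ?thesis using I c integral_cfac_pair[of "c x" "c y"] by simp
  next
    case False
    \<comment> \<open>Splitting the pair \<open>x\<close>, \<open>y\<close> leaves products that
      lack one of the two. Because of \<open>w\<close> each of them still has at least two factors,
      so it is integrable and covered by the induction hypothesis.\<close>
    then obtain w where w: "w \<in> J" by auto
    have int: "integrable lborel (\<lambda>\<theta>. \<Prod>x\<in>insert u J. cfac (c x) \<theta>)" if "u \<in> {x, y}" for u
      by (rule integrable_prod_cfac[of _ u w]) (use that I c w less.prems finJ in \<open>auto simp: less_imp_neq\<close>)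
    have z: "(\<integral>\<theta>. (\<Prod>x\<in>insert u J. cfac (c x) \<theta>) \<partial>lborel) = 0" if "u \<in> {x, y}" for u
    proof (rule less.hyps)
      show "card (insert u J) < card I" using I that finJ by auto
      show "card (insert u J) \<ge> 2" using I that finJ False by (auto simp: card_gt_0_iff Suc_le_eq)
      show "inj_on c (insert u J)" using less.prems(3) I that by (auto intro: inj_on_subset)
    qed (use less.prems that I finJ in auto)
    have "(\<Prod>x\<in>I. cfac (c x) \<theta>) =
       (of_real (c x) * (\<Prod>x\<in>insert x J. cfac (c x) \<theta>) - of_real (c y) * (\<Prod>x\<in>insert y J. cfac (c x) \<theta>))
         / of_real (c x - c y)" for \<theta>
    proof -
      have "(\<Prod>x\<in>I. cfac (c x) \<theta>) = cfac (c x) \<theta> * cfac (c y) \<theta> * (\<Prod>x\<in>J. cfac (c x) \<theta>)"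
        using I finJ by simp
      then show ?thesis using I finJ unfolding cfac_partial_fraction[OF c(1)] by (simp add: algebra_simps)
    qed
    then show ?thesis using int z by simp
  qed
qed

text \<open>Despite its name the mean holding time in \<open>k\<close>: Rubin's birth process leaves
  \<open>k\<close> at exponential rate \<open>k powr \<alpha>\<close>.\<close>

definition rate :: "real \<Rightarrow> nat \<Rightarrow> real" where
  "rate \<alpha> k = real k powr - \<alpha>"

text \<open>Both ends are included, since the clocks of the final state \<open>s'\<close> enter the
  density as well. The disjoint sum keeps the clocks of the two coordinates apart;
  \<open>race_coeff\<close> counts those of the second negatively.\<close>

definition race_index :: "nat \<times> nat \<Rightarrow> nat \<times> nat \<Rightarrow> (nat + nat) set" where
  "race_index s s' = {fst s..fst s'} <+> {snd s..snd s'}"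

definition race_coeff :: "real \<Rightarrow> nat + nat \<Rightarrow> real" where
  "race_coeff \<alpha> = case_sum (rate \<alpha>) (\<lambda>l. - rate \<alpha> l)"

text \<open>The characteristic function of \<open>\<Sum>\<xi>\<^sub>k k powr -\<alpha> - \<Sum>\<eta>\<^sub>l l powr -\<alpha>\<close> with independent
  standard exponential \<open>\<xi>\<^sub>k\<close>, \<open>\<eta>\<^sub>l\<close>: in Rubin's embedding of the urn into two pure birth processes
  its density at 0 is essentially the expected time spent in \<open>s'\<close>.\<close>

definition race_char :: "real \<Rightarrow> nat \<times> nat \<Rightarrow> nat \<times> nat \<Rightarrow> real \<Rightarrow> complex" where
  "race_char \<alpha> s s' \<theta> = (\<Prod>x\<in>race_index s s'. cfac (race_coeff \<alpha> x) \<theta>)"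

definition race_density :: "real \<Rightarrow> nat \<times> nat \<Rightarrow> nat \<times> nat \<Rightarrow> complex" where
  "race_density \<alpha> s s' = (\<integral>\<theta>. race_char \<alpha> s s' \<theta> \<partial>lborel)"

lemma finite_race_index [simp]: "finite (race_index s s')"
  by (simp add: race_index_def)

lemma race_coeff_simps [simp]: "race_coeff \<alpha> (Inl k) = rate \<alpha> k" "race_coeff \<alpha> (Inr l) = - rate \<alpha> l"
  by (auto simp: race_coeff_def)

lemma rate_pos [simp]: "k \<ge> 1 \<Longrightarrow> rate \<alpha> k > 0"
  by (auto simp: rate_def)

lemma race_char_integrable:
  assumes "1 \<le> i" "1 \<le> j" "i \<le> i'" "j \<le> j'"
  shows "integrable lborel (race_char \<alpha> (i, j) (i', j'))"
  unfolding race_char_def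
  by (rule integrable_prod_cfac[of _ "Inl i" "Inr j"])
     (use assms rate_pos[of i \<alpha>] rate_pos[of j \<alpha>] in \<open>auto simp: race_index_def simp del: rate_pos\<close>)

lemma pR_eq_rate: "1 \<le> i \<Longrightarrow> 1 \<le> j \<Longrightarrow> pR \<alpha> (i, j) = rate \<alpha> j / (rate \<alpha> i + rate \<alpha> j)"
  and pU_eq_rate: "1 \<le> i \<Longrightarrow> 1 \<le> j \<Longrightarrow> pU \<alpha> (i, j) = rate \<alpha> i / (rate \<alpha> i + rate \<alpha> j)"
  unfolding pR_def pU_def rate_def
  by (auto simp: powr_minus field_simps add_pos_pos)

lemma hop_indicator_0: "i > i' \<or> j > j' \<Longrightarrow> hop \<alpha> d (indicator {(i', j')}) (i, j) = 0"
  by (induction d arbitrary: i j) (auto simp: indicator_def)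

lemma rate_inj_on: "\<alpha> > 0 \<Longrightarrow> A \<subseteq> {1..} \<Longrightarrow> inj_on (rate \<alpha>) A"
  unfolding rate_def inj_on_def by (auto simp: powr_minus) (metis (no_types, lifting) One_nat_def less_eq_Suc_le
    nat_neq_iff of_nat_0_le_iff of_nat_less_iff order_less_irrefl powr_less_mono2 subset_eq atLeast_iff)

lemma race_char_Inl:
  "i \<le> i' \<Longrightarrow> race_char \<alpha> (i, j) (i', j') \<theta> = cfac (rate \<alpha> i) \<theta> * race_char \<alpha> (Suc i, j) (i', j') \<theta>"
proof -
  assume "i \<le> i'"
  then have "race_index (i, j) (i', j') = insert (Inl i) (race_index (Suc i, j) (i', j'))"
    by (auto simp: race_index_def Plus_def image_iff)
  moreover have "Inl i \<notin> race_index (Suc i, j) (i', j')" by (auto simp: race_index_def)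
  ultimately show ?thesis by (simp add: race_char_def)
qed

lemma race_char_Inr:
  "j \<le> j' \<Longrightarrow> race_char \<alpha> (i, j) (i', j') \<theta> = cfac (- rate \<alpha> j) \<theta> * race_char \<alpha> (i, Suc j) (i', j') \<theta>"
proof -
  assume "j \<le> j'"
  then have "race_index (i, j) (i', j') = insert (Inr j) (race_index (i, Suc j) (i', j'))"
    by (auto simp: race_index_def Plus_def image_iff)
  moreover have "Inr j \<notin> race_index (i, Suc j) (i', j')" by (auto simp: race_index_def)
  ultimately show ?thesis by (simp add: race_char_def)
qed

text \<open>Partial fractions on the clocks of \<open>i\<close> and \<open>j\<close> produce the
  coefficients \<open>rate \<alpha> j / (rate \<alpha> i + rate \<alpha> j)\<close> and its
  complement, which are \<open>pR\<close> and \<open>pU\<close>: the Markov recursion holds already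
  for the integrands.\<close>

lemma race_density_interior:
  assumes "1 \<le> i" "1 \<le> j" "i < i'" "j < j'"
  shows "race_density \<alpha> (i, j) (i', j') = of_real (pR \<alpha> (i, j)) * race_density \<alpha> (Suc i, j) (i', j')
     + of_real (pU \<alpha> (i, j)) * race_density \<alpha> (i, Suc j) (i', j')"
proof -
  define a b where "a = rate \<alpha> i" and "b = rate \<alpha> j"
  have ab: "a > 0" "b > 0" using assms by (auto simp: a_def b_def)
  have "race_char \<alpha> (i, j) (i', j') \<theta> = of_real (pR \<alpha> (i, j)) * race_char \<alpha> (Suc i, j) (i', j') \<theta>
     + of_real (pU \<alpha> (i, j)) * race_char \<alpha> (i, Suc j) (i', j') \<theta>" for \<theta>
  proof -
    define Q where "Q = race_char \<alpha> (Suc i, Suc j) (i', j') \<theta>"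
    have 1: "race_char \<alpha> (Suc i, j) (i', j') \<theta> = cfac (- b) \<theta> * Q"
      and 2: "race_char \<alpha> (i, Suc j) (i', j') \<theta> = cfac a \<theta> * Q"
      and 3: "race_char \<alpha> (i, j) (i', j') \<theta> = cfac a \<theta> * cfac (- b) \<theta> * Q"
      using assms by (auto simp: race_char_Inl race_char_Inr Q_def a_def b_def)
    have "cfac a \<theta> * cfac (-b) \<theta> = of_real (b / (a + b)) * cfac (-b) \<theta> + of_real (a / (a + b)) * cfac a \<theta>"
      using cfac_partial_fraction[of a "-b" \<theta>] ab by (simp add: add_divide_distrib)
    then show ?thesis unfolding 1 2 3
      using assms by (simp add: pR_eq_rate pU_eq_rate a_def b_def algebra_simps)
  qed
  then have "race_density \<alpha> (i, j) (i', j') = (\<integral>\<theta>. of_real (pR \<alpha> (i, j)) * race_char \<alpha> (Suc i, j) (i', j') \<theta>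
     + of_real (pU \<alpha> (i, j)) * race_char \<alpha> (i, Suc j) (i', j') \<theta> \<partial>lborel)"
    by (simp add: race_density_def)
  then show ?thesis
    using assms by (simp add: race_density_def race_char_integrable)
qed

text \<open>In the last column the term that would describe a step to the right contains clocks of
  the second coordinate only. They are all negative, at least two in number by
  \<open>j < j'\<close>, and the integral vanishes.\<close>

lemma race_density_boundary_right:
  assumes "\<alpha> > 0" "1 \<le> i" "1 \<le> j" "j < j'"
  shows "race_density \<alpha> (i, j) (i, j') = of_real (pU \<alpha> (i, j)) * race_density \<alpha> (i, Suc j) (i, j')"
proof -
  define a b where "a = rate \<alpha> i" and "b = rate \<alpha> j"
  have ab: "a > 0" "b > 0" using assms by (auto simp: a_def b_def)
  define Q where "Q \<theta> = (\<Prod>x\<in>race_index (Suc i, j) (i, j'). cfac (race_coeff \<alpha> x) \<theta>)" for \<theta>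
  have idx: "race_index (Suc i, j) (i, j') = Inr ` {j..j'}" by (auto simp: race_index_def)
  have Q0: "(\<integral>\<theta>. Q \<theta> \<partial>lborel) = 0" unfolding Q_def idx
  proof (rule integral_prod_cfac_same_sign)
    show "inj_on (race_coeff \<alpha>) (Inr ` {j..j'})"
      using rate_inj_on[OF assms(1), of "{j..j'}"] assms by (auto simp: inj_on_def)
  qed (use assms in \<open>auto simp: card_image\<close>)
  have Qint: "integrable lborel Q" unfolding Q_def idx
    by (rule integrable_prod_cfac[of _ "Inr j" "Inr j'"])
      (use assms rate_pos[of j \<alpha>] rate_pos[of j' \<alpha>] in \<open>auto simp del: rate_pos\<close>)
  have "race_char \<alpha> (i, j) (i, j') \<theta> = of_real (b / (a + b)) * Q \<theta>
     + of_real (pU \<alpha> (i, j)) * race_char \<alpha> (i, Suc j) (i, j') \<theta>" for \<theta>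
  proof -
    define Q' where "Q' = race_char \<alpha> (Suc i, Suc j) (i, j') \<theta>"
    have 1: "Q \<theta> = cfac (- b) \<theta> * Q'" unfolding Q_def race_char_def[symmetric]
      using assms by (simp add: race_char_Inr Q'_def b_def)
    have 2: "race_char \<alpha> (i, Suc j) (i, j') \<theta> = cfac a \<theta> * Q'"
      and 3: "race_char \<alpha> (i, j) (i, j') \<theta> = cfac a \<theta> * cfac (- b) \<theta> * Q'"
      using assms by (auto simp: race_char_Inl race_char_Inr Q'_def a_def b_def)
    have "cfac a \<theta> * cfac (-b) \<theta> = of_real (b / (a + b)) * cfac (-b) \<theta> + of_real (a / (a + b)) * cfac a \<theta>"
      using cfac_partial_fraction[of a "-b" \<theta>] ab by (simp add: add_divide_distrib)
    then show ?thesis unfolding 1 2 3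
      using assms by (simp add: pU_eq_rate a_def b_def algebra_simps)
  qed
  then have "race_density \<alpha> (i, j) (i, j') = (\<integral>\<theta>. of_real (b / (a + b)) * Q \<theta>
     + of_real (pU \<alpha> (i, j)) * race_char \<alpha> (i, Suc j) (i, j') \<theta> \<partial>lborel)"
    by (simp add: race_density_def)
  then show ?thesis
    using assms Qint Q0 by (simp add: race_density_def race_char_integrable)
qed

text \<open>Exchanging the coordinates flips the sign of every coefficient, which amounts to
  replacing \<open>\<theta>\<close> by \<open>- \<theta>\<close>.\<close>

lemma race_density_swap:
  "race_density \<alpha> (j, i) (j', i') = race_density \<alpha> (i, j) (i', j')"
proof -
  have "race_char \<alpha> (j, i) (j', i') = (\<lambda>\<theta>. race_char \<alpha> (i, j) (i', j') (- \<theta>))"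
    unfolding race_char_def race_index_def
    by (subst (1 2) prod.Plus) (auto simp: cfac_def mult.commute)
  then show ?thesis unfolding race_density_def
    using lborel_integral_real_affine[of "-1" "race_char \<alpha> (i, j) (i', j')" 0] by simp
qed

lemma race_density_diagonal:
  assumes "1 \<le> i" "1 \<le> j"
  shows "race_density \<alpha> (i, j) (i, j) = of_real (2 * pi / (rate \<alpha> i + rate \<alpha> j))"
proof -
  have "race_char \<alpha> (i, j) (i, j) = (\<lambda>\<theta>. cfac (rate \<alpha> i) \<theta> * cfac (- rate \<alpha> j) \<theta>)"
    unfolding race_char_def race_index_def by (subst prod.Plus) auto
  then show ?thesis unfolding race_density_def
    using integral_cfac_pair[of "rate \<alpha> i" "- rate \<alpha> j"] rate_pos[OF assms(1), of \<alpha>] rate_pos[OF assms(2), of \<alpha>]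
    by (simp add: sgn_if mult.commute)
qed

text \<open>Both sides obey the same first-step recursion and agree when
  \<open>(i, j) = (i', j')\<close>. The factor has a meaning: the density at 0 is the expected time
  spent in the final state divided by \<open>rate \<alpha> i' * rate \<alpha> j'\<close>, and that
  time is the visiting probability times \<open>rate \<alpha> i' * rate \<alpha> j' / (rate \<alpha>
  i' + rate \<alpha> j')\<close>. The \<open>2 * pi\<close> is Fourier inversion.\<close>

theorem visit_eq_race_density:
  assumes "\<alpha> > 0" "1 \<le> i" "1 \<le> j" "i \<le> i'" "j \<le> j'"
  shows "of_real (visit \<alpha> (i, j) (i', j'))
     = of_real ((rate \<alpha> i' + rate \<alpha> j') / (2 * pi)) * race_density \<alpha> (i, j) (i', j')"
  using assms(2-)
proof (induction "i' + j' - (i + j)" arbitrary: i j)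
  case 0
  then have "i = i'" "j = j'" by auto
  moreover have "rate \<alpha> i' + rate \<alpha> j' > 0" using 0 by (intro add_pos_pos) auto
  ultimately show ?case using 0 by (simp add: race_density_diagonal flip: of_real_mult of_real_add)
next
  case (Suc d)
  then have hop: "visit \<alpha> (i, j) (i', j') =
     pR \<alpha> (i, j) * hop \<alpha> d (indicator {(i', j')}) (Suc i, j) + pU \<alpha> (i, j) * hop \<alpha> d (indicator {(i', j')}) (i, Suc j)"
    by (simp flip: Suc.hyps(2))
  have d: "i' + j' - (Suc i + j) = d" "i' + j' - (i + Suc j) = d" using Suc.hyps(2) by auto
  have IHR: "of_real (hop \<alpha> d (indicator {(i', j')}) (Suc i, j)) =
      of_real ((rate \<alpha> i' + rate \<alpha> j') / (2 * pi)) * race_density \<alpha> (Suc i, j) (i', j')" if "i < i'"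
    using Suc.hyps(1)[of "Suc i" j] Suc.prems that d by simp
  have IHU: "of_real (hop \<alpha> d (indicator {(i', j')}) (i, Suc j)) =
      of_real ((rate \<alpha> i' + rate \<alpha> j') / (2 * pi)) * race_density \<alpha> (i, Suc j) (i', j')" if "j < j'"
    using Suc.hyps(1)[of i "Suc j"] Suc.prems that d by simp
  consider "i < i'" "j < j'" | "i = i'" "j < j'" | "i < i'" "j = j'" using Suc by linarith
  then show ?case
  proof cases
    case 1
    then show ?thesis unfolding hop of_real_add of_real_mult IHR[OF 1(1)] IHU[OF 1(2)]
      using Suc.prems by (simp add: race_density_interior algebra_simps)
  next
    case 2
    have "race_density \<alpha> (i, j) (i', j') = of_real (pU \<alpha> (i, j)) * race_density \<alpha> (i, Suc j) (i', j')"
      using race_density_boundary_right[OF assms(1), of i j j'] 2 Suc.prems by simp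
    then show ?thesis unfolding hop of_real_add of_real_mult IHU[OF 2(2)]
      using 2 by (simp add: hop_indicator_0)
  next
    case 3
    \<comment> \<open>The last row is the mirror image of the last column.\<close>
    have "race_density \<alpha> (i, j) (i', j') = of_real (pR \<alpha> (i, j)) * race_density \<alpha> (Suc i, j) (i', j')"
      using race_density_boundary_right[OF assms(1), of j i i'] 3 Suc.prems
      by (simp add: race_density_swap[of \<alpha> j' i j' i'] race_density_swap[of \<alpha> j' "Suc i" j' i'] pR_eq_rate pU_eq_rate add.commute)
    then show ?thesis unfolding hop of_real_add of_real_mult IHR[OF 3(1)]
      using 3 by (simp add: hop_indicator_0)
  qed
qed

section \<open>Asymptotics of the Fourier integrals\<close>

text \<open>\<open>c\<close> times an exponential variable has mean \<open>c\<close> and variance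
  \<open>c^2\<close>; the comparison is with the normal law of these moments, hence an error of
  third order. The constant 7 rounds up \<open>1/2 + 1/8 + 6\<close>, the three error terms.\<close>

lemma cfac_expansion:
  assumes "\<bar>\<theta> * c\<bar> \<le> 1"
  shows "norm (cfac c \<theta> - exp (Complex (- (\<theta> * c)\<^sup>2 / 2) (\<theta> * c))) \<le> 7 * \<bar>\<theta> * c\<bar> ^ 3"
proof -
  define x where "x = \<theta> * c"
  define w where "w = \<i> * complex_of_real x"
  define z where "z = Complex (- x\<^sup>2 / 2) x"
  define r where "r = exp z - (1 + z + z\<^sup>2 / 2)"
  have x1: "\<bar>x\<bar> \<le> 1" using assms by (simp add: x_def)
  have pw: "\<bar>x\<bar> ^ k \<le> \<bar>x\<bar> ^ l" if "l \<le> k" for k l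
    using x1 that by (intro power_decreasing) auto
  have nw: "norm w = \<bar>x\<bar>" by (simp add: w_def norm_mult)
  have w1: "1 - w \<noteq> 0" using one_minus_i_nonzero[of x] by (simp add: w_def)
  have cf: "cfac c \<theta> = inverse (1 - w)" by (simp add: cfac_def w_def x_def)
  have e1: "cfac c \<theta> = 1 + w + w\<^sup>2 + w ^ 3 * inverse (1 - w)"
    unfolding cf using w1 by (simp add: field_simps power2_eq_square power3_eq_cube)
  have z_eq: "z = w + w\<^sup>2 / 2"
    by (simp add: z_def w_def complex_eq_iff power2_eq_square)
  have e2: "1 + z + z\<^sup>2 / 2 = 1 + w + w\<^sup>2 + w ^ 3 / 2 + w ^ 4 / 8"
    unfolding z_eq by (simp add: power2_eq_square power3_eq_cube power4_eq_xxxx field_simps)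
  have nz: "norm z \<le> 3 / 2 * \<bar>x\<bar>"
  proof -
    have "norm z \<le> norm w + norm (w\<^sup>2 / 2)" unfolding z_eq by (rule norm_triangle_ineq)
    also have "\<dots> = \<bar>x\<bar> + \<bar>x\<bar> ^ 2 / 2" by (simp add: nw norm_divide norm_power)
    also have "\<dots> \<le> 3 / 2 * \<bar>x\<bar>" using pw[of 1 2] by simp
    finally show ?thesis .
  qed
  have nr: "norm r \<le> 6 * \<bar>x\<bar> ^ 3"
  proof -
    have "norm r \<le> exp \<bar>Re z\<bar> * norm z ^ 3 / 2"
      using Taylor_exp[of z 2] by (simp add: r_def atMost_nat_numeral atMost_Suc fact_2 numeral_2_eq_2 numeral_3_eq_3 add_ac)
    also have "\<dots> \<le> 3 * (3 / 2 * \<bar>x\<bar>) ^ 3 / 2"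
    proof -
      have "\<bar>Re z\<bar> \<le> 1" using pw[of 0 2] by (simp add: z_def)
      then have "exp \<bar>Re z\<bar> \<le> exp 1" by simp
      also have "\<dots> \<le> (3::real)" by (rule exp_le)
      finally show ?thesis by (intro divide_right_mono mult_mono power_mono nz) auto
    qed
    also have "\<dots> \<le> 6 * \<bar>x\<bar> ^ 3" by (simp add: power_mult_distrib power_divide)
    finally show ?thesis .
  qed
  have "cfac c \<theta> - exp z = w ^ 3 * inverse (1 - w) - w ^ 3 / 2 - w ^ 4 / 8 - r"
    unfolding r_def e1 e2 by simp
  also have "norm \<dots> \<le> norm (w ^ 3 * inverse (1 - w) - w ^ 3 / 2) + norm (w ^ 4 / 8) + norm r"
    by (metis (no_types, lifting) add_right_mono norm_triangle_ineq4 order_trans)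
  also have "norm (w ^ 3 * inverse (1 - w) - w ^ 3 / 2) \<le> \<bar>x\<bar> ^ 3 / 2"
  proof -
    \<comment> \<open>\<open>inverse (1 - w) - 1/2\<close> equals
      \<open>(1 + w) * inverse (1 - w) / 2\<close>, of modulus 1/2 because \<open>w\<close> is
      purely imaginary.\<close>
    have eq: "w ^ 3 * inverse (1 - w) - w ^ 3 / 2 = w ^ 3 * ((1 + w) * inverse (1 - w)) / 2"
      using w1 by (simp add: field_simps)
    have "norm (1 + w) = norm (1 - w)" by (simp add: w_def cmod_def)
    then show ?thesis unfolding eq using w1 by (simp add: norm_mult norm_divide norm_power norm_inverse nw)
  qed
  also have "norm (w ^ 4 / 8) \<le> \<bar>x\<bar> ^ 3 / 8" using pw[of 3 4] by (simp add: norm_divide norm_power nw)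
  also note nr
  finally have "norm (cfac c \<theta> - exp z) \<le> \<bar>x\<bar> ^ 3 / 2 + \<bar>x\<bar> ^ 3 / 8 + 6 * \<bar>x\<bar> ^ 3" by simp
  moreover have "y / 2 + y / 8 + 6 * y \<le> 7 * y" if "y \<ge> 0" for y :: real using that by simp
  from this[of "\<bar>x\<bar> ^ 3"] have "\<bar>x\<bar> ^ 3 / 2 + \<bar>x\<bar> ^ 3 / 8 + 6 * \<bar>x\<bar> ^ 3 \<le> 7 * \<bar>x\<bar> ^ 3" by simp
  ultimately have "norm (cfac c \<theta> - exp z) \<le> 7 * \<bar>x\<bar> ^ 3" by (rule order_trans)
  then show ?thesis by (simp add: z_def x_def)
qed

text \<open>Each factor is replaced by a Gaussian characteristic function. As all factors have
  modulus at most 1 the errors merely add up, to at most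
  \<open>7 * \<bar>u\<bar> ^ 3 * \<delta> n\<close> times the sum of squares.\<close>

lemma prod_cfac_tendsto:
  fixes I :: "nat \<Rightarrow> 'i set" and c :: "nat \<Rightarrow> 'i \<Rightarrow> real"
  assumes mu: "(\<lambda>n. \<Sum>x\<in>I n. c n x) \<longlonglongrightarrow> \<mu>"
    and v: "(\<lambda>n. \<Sum>x\<in>I n. (c n x)\<^sup>2) \<longlonglongrightarrow> v"
    and fin: "\<And>n. finite (I n)"
    and \<delta>: "\<delta> \<longlonglongrightarrow> 0" "\<forall>\<^sub>F n in sequentially. \<forall>x\<in>I n. \<bar>c n x\<bar> \<le> \<delta> n"
  shows "(\<lambda>n. \<Prod>x\<in>I n. cfac (c n x) u) \<longlonglongrightarrow> exp (Complex (- u\<^sup>2 * v / 2) (u * \<mu>))"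
proof -
  define E where "E n x = exp (Complex (- (u * c n x)\<^sup>2 / 2) (u * c n x))" for n x
  have prodE: "(\<Prod>x\<in>I n. E n x) = exp (Complex (- u\<^sup>2 * (\<Sum>x\<in>I n. (c n x)\<^sup>2) / 2) (u * (\<Sum>x\<in>I n. c n x)))" for n
  proof -
    have "(\<Prod>x\<in>I n. E n x) = exp (\<Sum>x\<in>I n. Complex (- (u * c n x)\<^sup>2 / 2) (u * c n x))"
      unfolding E_def by (rule exp_sum[OF fin, symmetric])
    also have "(\<Sum>x\<in>I n. Complex (- (u * c n x)\<^sup>2 / 2) (u * c n x)) =
       Complex (- u\<^sup>2 * (\<Sum>x\<in>I n. (c n x)\<^sup>2) / 2) (u * (\<Sum>x\<in>I n. c n x))"
      by (simp add: complex_eq_iff sum_distrib_left power_mult_distrib sum_negf sum_divide_distrib)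
    finally show ?thesis .
  qed
  have limE: "(\<lambda>n. \<Prod>x\<in>I n. E n x) \<longlonglongrightarrow> exp (Complex (- u\<^sup>2 * v / 2) (u * \<mu>))"
    unfolding prodE by (intro tendsto_intros tendsto_Complex mu v) auto
  have "(\<lambda>n. \<bar>u\<bar> * \<delta> n) \<longlonglongrightarrow> \<bar>u\<bar> * 0" by (intro tendsto_intros \<delta>)
  then have small: "\<forall>\<^sub>F n in sequentially. \<bar>u\<bar> * \<delta> n < 1"
    by (rule order_tendstoD) simp
  have "(\<lambda>n. (\<Prod>x\<in>I n. cfac (c n x) u) - (\<Prod>x\<in>I n. E n x)) \<longlonglongrightarrow> 0"
  proof (rule Lim_null_comparison)
    show "(\<lambda>n. 7 * \<bar>u\<bar> ^ 3 * \<delta> n * (\<Sum>x\<in>I n. (c n x)\<^sup>2)) \<longlonglongrightarrow> 0"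
      using tendsto_mult[OF tendsto_mult[OF tendsto_const \<delta>(1)] v, of "7 * \<bar>u\<bar> ^ 3"] by simp
    show "\<forall>\<^sub>F n in sequentially. norm ((\<Prod>x\<in>I n. cfac (c n x) u) - (\<Prod>x\<in>I n. E n x))
        \<le> 7 * \<bar>u\<bar> ^ 3 * \<delta> n * (\<Sum>x\<in>I n. (c n x)\<^sup>2)"
      using \<delta>(2) small
    proof eventually_elim
      case (elim n)
      have "norm ((\<Prod>x\<in>I n. cfac (c n x) u) - (\<Prod>x\<in>I n. E n x)) \<le> (\<Sum>x\<in>I n. norm (cfac (c n x) u - E n x))"
        by (rule norm_prod_diff) (auto simp: norm_cfac_le_1 E_def)
      also have "\<dots> \<le> (\<Sum>x\<in>I n. 7 * \<bar>u\<bar> ^ 3 * \<delta> n * (c n x)\<^sup>2)"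
      proof (rule sum_mono)
        fix x assume x: "x \<in> I n"
        have "\<bar>u * c n x\<bar> \<le> \<bar>u\<bar> * \<delta> n" using elim x by (auto simp: abs_mult intro!: mult_left_mono)
        then have "\<bar>u * c n x\<bar> \<le> 1" using elim by linarith
        then have "norm (cfac (c n x) u - E n x) \<le> 7 * \<bar>u * c n x\<bar> ^ 3"
          unfolding E_def by (rule cfac_expansion)
        also have "\<dots> = 7 * \<bar>u\<bar> ^ 3 * \<bar>c n x\<bar> * (c n x)\<^sup>2"
        proof -
          have "\<bar>c n x\<bar> ^ 3 = \<bar>c n x\<bar> * (c n x)\<^sup>2" by (simp add: power3_eq_cube power2_eq_square)
          then show ?thesis by (simp add: abs_mult power_mult_distrib)
        qed
        also have "\<dots> \<le> 7 * \<bar>u\<bar> ^ 3 * \<delta> n * (c n x)\<^sup>2"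
          using elim x by (intro mult_right_mono mult_left_mono) auto
        finally show "norm (cfac (c n x) u - E n x) \<le> 7 * \<bar>u\<bar> ^ 3 * \<delta> n * (c n x)\<^sup>2" .
      qed
      finally show ?case by (simp add: sum_distrib_left)
    qed
  qed
  from tendsto_add[OF this limE] show ?thesis by simp
qed

text \<open>Expansion up to the second elementary symmetric sum, which is half of the squared sum
  minus the sum of squares. The first bound is carried along because the induction for the second
  uses it.\<close>

lemma prod_one_plus_ge:
  assumes "finite I" "\<And>x. x \<in> I \<Longrightarrow> (a x :: real) \<ge> 0"
  shows "1 + (\<Sum>x\<in>I. a x) \<le> (\<Prod>x\<in>I. 1 + a x) \<and>
    1 + (\<Sum>x\<in>I. a x) + ((\<Sum>x\<in>I. a x)\<^sup>2 - (\<Sum>x\<in>I. (a x)\<^sup>2)) / 2 \<le> (\<Prod>x\<in>I. 1 + a x)"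
  using assms
proof (induction I rule: finite_induct)
  case (insert y I)
  define S where "S = (\<Sum>x\<in>I. a x)"
  define Q where "Q = (\<Sum>x\<in>I. (a x)\<^sup>2)"
  define P where "P = (\<Prod>x\<in>I. 1 + a x)"
  have IH: "1 + S \<le> P" "1 + S + (S\<^sup>2 - Q) / 2 \<le> P" and S: "S \<ge> 0" and y: "a y \<ge> 0"
    using insert.IH insert.prems by (auto simp: S_def Q_def P_def intro: sum_nonneg)
  have m: "a y * (1 + S) \<le> a y * P" using IH y by (intro mult_left_mono) auto
  have "1 + (a y + S) \<le> (1 + a y) * P" using IH m mult_nonneg_nonneg[OF y S] by (simp add: algebra_simps)
  moreover have "1 + (a y + S) + ((a y + S)\<^sup>2 - ((a y)\<^sup>2 + Q)) / 2 \<le> (1 + a y) * P"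
    using IH m by (simp add: power2_eq_square field_simps)
  ultimately show ?case using insert.hyps by (simp add: S_def P_def Q_def)
qed auto

lemma gaussian_fourier:
  assumes "v > 0"
  shows "(\<integral>u. exp (Complex (- u\<^sup>2 * v / 2) (u * \<mu>)) \<partial>lborel) = of_real (sqrt (2 * pi / v) * exp (- \<mu>\<^sup>2 / (2 * v)))"
proof -
  define t where "t = \<mu> / sqrt v"
  have sv: "sqrt v > 0" using assms by simp
  have "char std_normal_distribution t = of_real (exp (- t\<^sup>2 / 2))"
    by (simp add: char_std_normal_distribution)
  also have "char std_normal_distribution t = (\<integral>x. std_normal_density x *\<^sub>R iexp (t * x) \<partial>lborel)"
    unfolding char_def by (subst integral_density) auto
  also have "\<dots> = sqrt v *\<^sub>R (\<integral>u. std_normal_density (0 + sqrt v * u) *\<^sub>R iexp (t * (0 + sqrt v * u)) \<partial>lborel)"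
    using sv by (subst lborel_integral_real_affine[of "sqrt v" _ 0]) auto
  also have "(\<lambda>u. std_normal_density (0 + sqrt v * u) *\<^sub>R iexp (t * (0 + sqrt v * u))) =
     (\<lambda>u. of_real (1 / sqrt (2 * pi)) * exp (Complex (- u\<^sup>2 * v / 2) (u * \<mu>)))"
  proof
    fix u
    have 1: "std_normal_density (0 + sqrt v * u) = 1 / sqrt (2 * pi) * exp (- u\<^sup>2 * v / 2)"
      using assms by (simp add: std_normal_density_def power_mult_distrib mult.commute)
    have 2: "t * (0 + sqrt v * u) = u * \<mu>" using sv by (simp add: t_def)
    have 3: "exp (Complex (- u\<^sup>2 * v / 2) (u * \<mu>)) = of_real (exp (- u\<^sup>2 * v / 2)) * iexp (u * \<mu>)"
      unfolding exp_of_real[symmetric] exp_add[symmetric] by (rule arg_cong[of _ _ exp]) (simp add: complex_eq_iff)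
    show "std_normal_density (0 + sqrt v * u) *\<^sub>R iexp (t * (0 + sqrt v * u)) =
        of_real (1 / sqrt (2 * pi)) * exp (Complex (- u\<^sup>2 * v / 2) (u * \<mu>))"
      unfolding 1 2 3 by (simp add: scaleR_conv_of_real)
  qed
  also have "(\<integral>u. of_real (1 / sqrt (2 * pi)) * exp (Complex (- u\<^sup>2 * v / 2) (u * \<mu>)) \<partial>lborel)
    = of_real (1 / sqrt (2 * pi)) * (\<integral>u. exp (Complex (- u\<^sup>2 * v / 2) (u * \<mu>)) \<partial>lborel)"
    by (rule integral_mult_right_zero)
  finally have "of_real (sqrt v / sqrt (2 * pi)) * (\<integral>u. exp (Complex (- u\<^sup>2 * v / 2) (u * \<mu>)) \<partial>lborel) = 
     complex_of_real (exp (- t\<^sup>2 / 2))" by (simp add: scaleR_conv_of_real)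
  then have "(\<integral>u. exp (Complex (- u\<^sup>2 * v / 2) (u * \<mu>)) \<partial>lborel) = 
     of_real (sqrt (2 * pi) / sqrt v) * complex_of_real (exp (- t\<^sup>2 / 2))"
    using sv by (simp add: field_simps)
  moreover have "t\<^sup>2 / 2 = \<mu>\<^sup>2 / (2 * v)" using assms by (simp add: t_def power_divide)
  ultimately show ?thesis by (simp add: real_sqrt_divide)
qed

text \<open>On the Fourier side this is a local limit theorem at 0 for weighted sums of independent
  exponential variables.\<close>

lemma integral_prod_cfac_tendsto:
  fixes I :: "nat \<Rightarrow> 'i set" and c :: "nat \<Rightarrow> 'i \<Rightarrow> real"
  assumes mu: "(\<lambda>n. \<Sum>x\<in>I n. c n x) \<longlonglongrightarrow> \<mu>"
    and v: "(\<lambda>n. \<Sum>x\<in>I n. (c n x)\<^sup>2) \<longlonglongrightarrow> v" "v > 0"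
    and fin: "\<And>n. finite (I n)"
    and \<delta>: "\<delta> \<longlonglongrightarrow> 0" "\<forall>\<^sub>F n in sequentially. \<forall>x\<in>I n. \<bar>c n x\<bar> \<le> \<delta> n"
  shows "(\<lambda>n. \<integral>u. (\<Prod>x\<in>I n. cfac (c n x) u) \<partial>lborel) \<longlonglongrightarrow> of_real (sqrt (2 * pi / v) * exp (- \<mu>\<^sup>2 / (2 * v)))"
proof -
  define V where "V n = (\<Sum>x\<in>I n. (c n x)\<^sup>2)" for n
  \<comment> \<open>The second-order term of \<open>prod_one_plus_ge\<close> will eventually be at
    least \<open>u ^ 4 * v^2 / 4 = (u * e) ^ 4\<close>. So the moduli decay quadratically in
    \<open>u\<close>, uniformly in \<open>n\<close>, which supplies the dominating function.\<close>
  define e where "e = sqrt (v / 2)"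
  have e: "e > 0" "e ^ 2 = v / 2" using v by (auto simp: e_def)
  have "(\<lambda>n. (V n)\<^sup>2 - (\<delta> n)\<^sup>2 * V n) \<longlonglongrightarrow> v\<^sup>2 - 0\<^sup>2 * v"
    unfolding V_def by (intro tendsto_intros v \<delta>)
  moreover have "v\<^sup>2 / 2 < v\<^sup>2 - 0\<^sup>2 * v" using v by simp
  ultimately have "\<forall>\<^sub>F n in sequentially. v\<^sup>2 / 2 < (V n)\<^sup>2 - (\<delta> n)\<^sup>2 * V n"
    by (rule order_tendstoD)
  with \<delta>(2) have "\<forall>\<^sub>F n in sequentially. \<forall>u. norm (\<Prod>x\<in>I n. cfac (c n x) u) \<le> sqrt 2 * inverse (1 + (u * e)\<^sup>2)"
  proof eventually_elim
    case (elim n)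
    show ?case
    proof
      fix u :: real
      define S where "S = (\<Sum>x\<in>I n. (u * c n x)\<^sup>2)"
      define Q where "Q = (\<Sum>x\<in>I n. ((u * c n x)\<^sup>2)\<^sup>2)"
      have S: "S = u\<^sup>2 * V n" by (simp add: S_def V_def sum_distrib_left power_mult_distrib)
      have "Q \<le> (\<Sum>x\<in>I n. u ^ 4 * (\<delta> n)\<^sup>2 * (c n x)\<^sup>2)" unfolding Q_def
      proof (rule sum_mono)
        fix x assume "x \<in> I n"
        then have "(c n x)\<^sup>2 \<le> (\<delta> n)\<^sup>2" using elim(1) by (metis abs_le_square_iff abs_of_nonneg abs_ge_zero order_trans)
        then have "(c n x)\<^sup>2 * (c n x)\<^sup>2 \<le> (\<delta> n)\<^sup>2 * (c n x)\<^sup>2" by (intro mult_right_mono) auto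
        then have "u ^ 4 * ((c n x)\<^sup>2 * (c n x)\<^sup>2) \<le> u ^ 4 * ((\<delta> n)\<^sup>2 * (c n x)\<^sup>2)" by (intro mult_left_mono) auto
        then show "((u * c n x)\<^sup>2)\<^sup>2 \<le> u ^ 4 * (\<delta> n)\<^sup>2 * (c n x)\<^sup>2"
          by (simp add: power_mult_distrib power4_eq_xxxx power2_eq_square mult_ac)
      qed
      also have "\<dots> = u ^ 4 * ((\<delta> n)\<^sup>2 * V n)" by (simp add: V_def sum_distrib_left mult.assoc)
      finally have Q: "Q \<le> u ^ 4 * ((\<delta> n)\<^sup>2 * V n)" .
      have S2: "S\<^sup>2 = u ^ 4 * (V n)\<^sup>2" unfolding S by (simp add: power_mult_distrib power4_eq_xxxx power2_eq_square)
      have "u ^ 4 * (v\<^sup>2 / 2) \<le> u ^ 4 * ((V n)\<^sup>2 - (\<delta> n)\<^sup>2 * V n)" using elim(2) by (intro mult_left_mono) auto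
      then have "u ^ 4 * (v\<^sup>2 / 2) \<le> S\<^sup>2 - Q" using Q unfolding S2 right_diff_distrib by (meson diff_left_mono order_trans)
      then have *: "2 * (u ^ 4 * (v\<^sup>2 / 4)) \<le> S\<^sup>2 - Q" by (simp add: mult.commute)
      have S0: "S \<ge> 0" unfolding S_def by (intro sum_nonneg) auto
      have "1 + S + (S\<^sup>2 - Q) / 2 \<le> (\<Prod>x\<in>I n. 1 + (u * c n x)\<^sup>2)"
        unfolding S_def Q_def by (rule prod_one_plus_ge[OF fin, THEN conjunct2]) simp
      moreover have "B \<le> D / 2" if "2 * B \<le> D" for B D :: real using that by simp
      from this[OF *] S0 have "1 + u ^ 4 * (v\<^sup>2 / 4) \<le> 1 + S + (S\<^sup>2 - Q) / 2" by (intro add_mono) auto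
      ultimately have "1 + u ^ 4 * (v\<^sup>2 / 4) \<le> (\<Prod>x\<in>I n. 1 + (u * c n x)\<^sup>2)" by (rule order_trans[rotated])
      also have "u ^ 4 * (v\<^sup>2 / 4) = ((u * e)\<^sup>2)\<^sup>2"
        unfolding power_mult_distrib e(2) by (simp add: power_divide flip: power_mult)
      finally have P: "1 + ((u * e)\<^sup>2)\<^sup>2 \<le> (\<Prod>x\<in>I n. 1 + (u * c n x)\<^sup>2)" .
      define y where "y = (u * e)\<^sup>2"
      have y: "y \<ge> 0" by (simp add: y_def)
      \<comment> \<open>The source of the factor \<open>sqrt 2\<close> in the bound.\<close>
      have "0 \<le> (1 - y)\<^sup>2" by simp
      then have "(1 + y)\<^sup>2 \<le> 2 * (1 + y\<^sup>2)" by (simp add: power2_eq_square algebra_simps)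
      also have "\<dots> \<le> 2 * (\<Prod>x\<in>I n. 1 + (u * c n x)\<^sup>2)" using P by (simp add: y_def)
      finally have "1 + y \<le> sqrt (2 * (\<Prod>x\<in>I n. 1 + (u * c n x)\<^sup>2))"
        using y by (intro real_le_rsqrt) auto
      then have le: "1 + y \<le> sqrt 2 * (\<Prod>x\<in>I n. sqrt (1 + (u * c n x)\<^sup>2))"
      proof -
        have "sqrt (\<Prod>x\<in>A. f x) = (\<Prod>x\<in>A. sqrt (f x))" for A and f :: "'i \<Rightarrow> real"
          by (induction A rule: infinite_finite_induct) (auto simp: real_sqrt_mult)
        then show ?thesis using \<open>1 + y \<le> sqrt _\<close> by (simp add: real_sqrt_mult)
      qed
      have "norm (\<Prod>x\<in>I n. cfac (c n x) u) = inverse (\<Prod>x\<in>I n. sqrt (1 + (u * c n x)\<^sup>2))"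
        by (simp add: prod_norm[symmetric] norm_cfac prod_inversef[symmetric] comp_def)
      also have "\<dots> \<le> sqrt 2 * inverse (1 + y)"
      proof -
        have "(\<Prod>x\<in>I n. sqrt (1 + (u * c n x)\<^sup>2)) > 0" by (intro prod_pos) (auto intro: add_pos_nonneg)
        then show ?thesis using le y by (simp add: field_simps)
      qed
      finally show "norm (\<Prod>x\<in>I n. cfac (c n x) u) \<le> sqrt 2 * inverse (1 + (u * e)\<^sup>2)" by (simp add: y_def)
    qed
  qed
  then obtain n0 where n0: "\<And>n u. n \<ge> n0 \<Longrightarrow> norm (\<Prod>x\<in>I n. cfac (c n x) u) \<le> sqrt 2 * inverse (1 + (u * e)\<^sup>2)"
    by (auto simp: eventually_sequentially)
  have "(\<lambda>n. \<integral>u. (\<Prod>x\<in>I (n + n0). cfac (c (n + n0) x) u) \<partial>lborel) \<longlonglongrightarrow> (\<integral>u. exp (Complex (- u\<^sup>2 * v / 2) (u * \<mu>)) \<partial>lborel)"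
  proof (rule integral_dominated_convergence)
    show "integrable lborel (\<lambda>u. sqrt 2 * inverse (1 + (u * e)\<^sup>2))"
      by (intro integrable_mult_right integrable_inverse_1_plus_square_scaled e)
    show "AE u in lborel. (\<lambda>n. \<Prod>x\<in>I (n + n0). cfac (c (n + n0) x) u) \<longlonglongrightarrow> exp (Complex (- u\<^sup>2 * v / 2) (u * \<mu>))"
      by (intro AE_I2 LIMSEQ_ignore_initial_segment prod_cfac_tendsto[OF mu v(1) fin \<delta>])
    show "(\<lambda>u. exp (Complex (- u\<^sup>2 * v / 2) (u * \<mu>))) \<in> borel_measurable lborel"
      by (simp, intro borel_measurable_continuous_onI continuous_intros continuous_on_Complex) auto
  qed (use n0 in auto)
  then show ?thesis unfolding gaussian_fourier[OF v(2)] by (rule LIMSEQ_offset)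
qed

section \<open>Power sums: scaled means and variances of the clocks\<close>

lemma powr_sum_term_bounds:
  assumes "p > 1" "k \<ge> 2"
  shows "(real k powr (1 - p) - real (Suc k) powr (1 - p)) / (p - 1) \<le> real k powr - p"
    and "real k powr - p \<le> (real (k - 1) powr (1 - p) - real k powr (1 - p)) / (p - 1)"
proof -
  \<comment> \<open>The mean value theorem for the antiderivative
    \<open>- (x powr (1 - p)) / (p - 1)\<close> of \<open>x powr - p\<close>, to be applied to the
    unit intervals on either side of \<open>k\<close>.\<close>
  have *: "\<exists>z. a < z \<and> z < a + 1 \<and> (a powr (1 - p) - (a + 1) powr (1 - p)) / (p - 1) = z powr - p" if "a > 0" for a :: real
  proof -
    have "\<exists>z>a. z < a + 1 \<and> - ((a + 1) powr (1 - p)) / (p - 1) - - (a powr (1 - p)) / (p - 1) = (a + 1 - a) * z powr - p"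
    proof (rule MVT2)
      fix x assume "a \<le> x" "x \<le> a + 1"
      then have "x > 0" using that by simp
      then have "((\<lambda>x. - (x powr (1 - p)) / (p - 1)) has_real_derivative - ((1 - p) * x powr (1 - p - 1)) / (p - 1)) (at x)"
        by (intro DERIV_cdivide DERIV_minus has_real_derivative_powr)
      moreover have "- ((1 - p) * x powr (1 - p - 1)) / (p - 1) = x powr - p"
        using assms by (simp add: minus_mult_left)
      ultimately show "((\<lambda>x. - (x powr (1 - p)) / (p - 1)) has_real_derivative x powr - p) (at x)" by simp
    qed simp
    then show ?thesis by (auto simp: diff_divide_distrib)
  qed
  obtain z where z: "real k < z" "z < real k + 1" "(real k powr (1 - p) - (real k + 1) powr (1 - p)) / (p - 1) = z powr - p"
    using *[of "real k"] assms by auto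
  then show "(real k powr (1 - p) - real (Suc k) powr (1 - p)) / (p - 1) \<le> real k powr - p"
    using assms powr_mono2'[of "-p" "real k" z] by (simp add: add.commute)
  have k1: "real (k - 1) + 1 = real k" using assms by simp
  obtain z where z: "real (k - 1) < z" "z < real (k - 1) + 1" "(real (k - 1) powr (1 - p) - (real (k - 1) + 1) powr (1 - p)) / (p - 1) = z powr - p"
    using *[of "real (k - 1)"] assms by auto
  then show "real k powr - p \<le> (real (k - 1) powr (1 - p) - real k powr (1 - p)) / (p - 1)"
    unfolding k1 using assms powr_mono2'[of "-p" z "real k"] by simp
qed

text \<open>The comparison with the integral of \<open>x powr - p\<close> telescopes;
  \<open>i \<ge> 2\<close> keeps \<open>i - 1\<close> positive in the upper bound.\<close>

lemma powr_sum_bounds: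
  assumes "p > 1" "i \<ge> 2" "i \<le> Suc i'"
  shows "(real i powr (1 - p) - real (Suc i') powr (1 - p)) / (p - 1) \<le> (\<Sum>k=i..i'. real k powr - p)"
    and "(\<Sum>k=i..i'. real k powr - p) \<le> (real (i - 1) powr (1 - p) - real i' powr (1 - p)) / (p - 1)"
proof -
  have "(\<Sum>k=i..<Suc i'. real (Suc k) powr (1 - p) - real k powr (1 - p)) = real (Suc i') powr (1 - p) - real i powr (1 - p)"
    using assms(3) by (rule sum_Suc_diff')
  then have "(real i powr (1 - p) - real (Suc i') powr (1 - p)) = (\<Sum>k=i..<Suc i'. real k powr (1 - p) - real (Suc k) powr (1 - p))"
    by (simp add: sum_subtractf)
  then have "(real i powr (1 - p) - real (Suc i') powr (1 - p)) / (p - 1) =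
      (\<Sum>k=i..i'. (real k powr (1 - p) - real (Suc k) powr (1 - p)) / (p - 1))"
    by (simp add: sum_divide_distrib atLeastLessThanSuc_atLeastAtMost)
  also have "\<dots> \<le> (\<Sum>k=i..i'. real k powr - p)"
    using assms by (intro sum_mono powr_sum_term_bounds) auto
  finally show "(real i powr (1 - p) - real (Suc i') powr (1 - p)) / (p - 1) \<le> (\<Sum>k=i..i'. real k powr - p)" .
  have "(\<Sum>k=i..i'. real k powr - p) \<le> (\<Sum>k=i..i'. (real (k - 1) powr (1 - p) - real k powr (1 - p)) / (p - 1))"
    using assms by (intro sum_mono powr_sum_term_bounds) auto
  also have "\<dots> = (\<Sum>k=i..i'. real (k - 1) powr (1 - p) - real k powr (1 - p)) / (p - 1)"
    by (simp add: sum_divide_distrib)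
  also have "(\<Sum>k=i..i'. real (k - 1) powr (1 - p) - real k powr (1 - p)) = - (\<Sum>k=i..<Suc i'. real (Suc k - 1) powr (1 - p) - real (k - 1) powr (1 - p))"
    by (simp add: sum_negf[symmetric] atLeastLessThanSuc_atLeastAtMost)
  also have "(\<Sum>k=i..<Suc i'. real (Suc k - 1) powr (1 - p) - real (k - 1) powr (1 - p)) = real (Suc i' - 1) powr (1 - p) - real (i - 1) powr (1 - p)"
    using assms(3) by (rule sum_Suc_diff'[where f = "\<lambda>k. real (k - 1) powr (1 - p)"])
  finally show "(\<Sum>k=i..i'. real k powr - p) \<le> (real (i - 1) powr (1 - p) - real i' powr (1 - p)) / (p - 1)"
    by simp
qed

lemma ratio_add_const_tendsto:
  fixes m :: "nat \<Rightarrow> real"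
  assumes "filterlim m at_top sequentially" "(\<lambda>n. f n / m n) \<longlonglongrightarrow> \<tau>"
  shows "(\<lambda>n. (f n + c) / m n) \<longlonglongrightarrow> \<tau>"
proof -
  have "(\<lambda>n. c / m n) \<longlonglongrightarrow> 0" by (rule real_tendsto_divide_at_top[OF tendsto_const assms(1)])
  from tendsto_add[OF assms(2) this] show ?thesis by (simp add: add_divide_distrib)
qed

lemma ratio_at_top:
  fixes m :: "nat \<Rightarrow> real"
  assumes "filterlim m at_top sequentially" "(\<lambda>n. f n / m n) \<longlonglongrightarrow> \<tau>" "\<tau> > 0"
  shows "filterlim f at_top sequentially"
proof -
  have "filterlim (\<lambda>n. f n / m n * m n) at_top sequentially"
    by (rule filterlim_tendsto_pos_mult_at_top[OF assms(2,3,1)])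
  moreover have "\<forall>\<^sub>F n in sequentially. f n / m n * m n = f n"
    using filterlim_at_top_dense[THEN iffD1, OF assms(1), rule_format, of 0] by eventually_elim auto
  ultimately show ?thesis by (simp cong: filterlim_cong)
qed

text \<open>\<open>\<kappa>\<close> is the limit of the rescaled upper tail, so that the case \<open>i' / m \<rightarrow> \<infinity>\<close> is included with \<open>\<kappa> = 0\<close>.\<close>

lemma powr_sum_tendsto:
  fixes m :: "nat \<Rightarrow> real" and i i' :: "nat \<Rightarrow> nat"
  assumes p: "p > 1" and m: "filterlim m at_top sequentially"
    and i: "(\<lambda>n. real (i n) / m n) \<longlonglongrightarrow> \<tau>" "\<tau> > 0"
    and le: "\<forall>\<^sub>F n in sequentially. i n \<le> Suc (i' n)"
    and \<kappa>: "(\<lambda>n. (real (i' n) / m n) powr (1 - p)) \<longlonglongrightarrow> \<kappa>"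
      "(\<lambda>n. ((real (i' n) + 1) / m n) powr (1 - p)) \<longlonglongrightarrow> \<kappa>"
  shows "(\<lambda>n. m n powr (p - 1) * (\<Sum>k=i n..i' n. real k powr - p)) \<longlonglongrightarrow> (\<tau> powr (1 - p) - \<kappa>) / (p - 1)"
proof (rule tendsto_sandwich)
  have mpos: "\<forall>\<^sub>F n in sequentially. m n > 0"
    using filterlim_at_top_dense[THEN iffD1, OF m, rule_format, of 0] .
  have i2: "\<forall>\<^sub>F n in sequentially. real (i n) \<ge> 2"
    using filterlim_at_top[THEN iffD1, OF ratio_at_top[OF m i], rule_format, of 2] .
  have scale: "M powr (p - 1) * x powr (1 - p) = (x / M) powr (1 - p)" if "M > 0" "x \<ge> 0" for M x :: real
  proof -
    have "(x / M) powr (1 - p) = x powr (1 - p) / M powr (1 - p)" using that by (simp add: powr_divide)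
    also have "M powr (1 - p) = inverse (M powr (p - 1))" using powr_minus[of M "p - 1"] by simp
    finally show ?thesis by (simp add: divide_inverse mult.commute)
  qed
  show "\<forall>\<^sub>F n in sequentially. ((real (i n) / m n) powr (1 - p) - ((real (i' n) + 1) / m n) powr (1 - p)) / (p - 1)
      \<le> m n powr (p - 1) * (\<Sum>k=i n..i' n. real k powr - p)"
    using mpos i2 le
  proof eventually_elim
    case (elim n)
    then have "m n powr (p - 1) * ((real (i n) powr (1 - p) - real (Suc (i' n)) powr (1 - p)) / (p - 1))
       \<le> m n powr (p - 1) * (\<Sum>k=i n..i' n. real k powr - p)"
      by (intro mult_left_mono powr_sum_bounds p) auto
    then show ?case using elim scale[of "m n" "real (i n)"] scale[of "m n" "real (Suc (i' n))"]
      by (simp add: right_diff_distrib add.commute)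
  qed
  show "\<forall>\<^sub>F n in sequentially. m n powr (p - 1) * (\<Sum>k=i n..i' n. real k powr - p)
     \<le> (((real (i n) + (- 1)) / m n) powr (1 - p) - (real (i' n) / m n) powr (1 - p)) / (p - 1)"
    using mpos i2 le
  proof eventually_elim
    case (elim n)
    then have "m n powr (p - 1) * (\<Sum>k=i n..i' n. real k powr - p) \<le> 
        m n powr (p - 1) * ((real (i n - 1) powr (1 - p) - real (i' n) powr (1 - p)) / (p - 1))"
      by (intro mult_left_mono powr_sum_bounds p) auto
    moreover have "real (i n - 1) = real (i n) + (- 1)" using elim by (simp add: of_nat_diff)
    ultimately show ?case using elim scale[of "m n" "real (i n) + (-1)"] scale[of "m n" "real (i' n)"]
      by (simp only: right_diff_distrib times_divide_eq_right)
  qed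
  show "(\<lambda>n. ((real (i n) / m n) powr (1 - p) - ((real (i' n) + 1) / m n) powr (1 - p)) / (p - 1))
     \<longlonglongrightarrow> (\<tau> powr (1 - p) - \<kappa>) / (p - 1)"
    using i p by (intro tendsto_intros \<kappa>) auto
  show "(\<lambda>n. (((real (i n) + (- 1)) / m n) powr (1 - p) - (real (i' n) / m n) powr (1 - p)) / (p - 1))
     \<longlonglongrightarrow> (\<tau> powr (1 - p) - \<kappa>) / (p - 1)"
    using i p by (intro tendsto_intros \<kappa> ratio_add_const_tendsto m) auto
qed

text \<open>The expected time at which the birth process started at 1 reaches \<open>k\<close>; the
  term \<open>l = 0\<close> vanishes since \<open>0 powr - \<alpha> = 0\<close>.\<close>

definition rate_sum :: "real \<Rightarrow> nat \<Rightarrow> real" where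
  "rate_sum \<alpha> k = (\<Sum>l<k. rate \<alpha> l)"

lemma rate_antimono: "\<alpha> \<ge> 0 \<Longrightarrow> 1 \<le> k \<Longrightarrow> k \<le> l \<Longrightarrow> rate \<alpha> l \<le> rate \<alpha> k"
  unfolding rate_def by (intro powr_mono2') auto

lemma rate_sum_diff: "i \<le> Suc i' \<Longrightarrow> (\<Sum>k=i..i'. rate \<alpha> k) = rate_sum \<alpha> (Suc i') - rate_sum \<alpha> i"
  unfolding rate_sum_def
  by (subst sum_diff[symmetric]) (auto intro!: sum.cong simp del: sum.lessThan_Suc simp: lessThan_Suc_atMost)

text \<open>The difference consists of \<open>\<bar>i - j\<bar>\<close> rates, each between
  \<open>rate \<alpha> i\<close> and \<open>rate \<alpha> j\<close> by monotonicity.\<close>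

lemma rate_sum_approx:
  assumes "\<alpha> \<ge> 0" "1 \<le> i" "1 \<le> j"
  shows "\<bar>rate_sum \<alpha> i - rate_sum \<alpha> j - (real i - real j) * rate \<alpha> i\<bar> \<le> \<bar>real i - real j\<bar> * \<bar>rate \<alpha> i - rate \<alpha> j\<bar>"
proof -
  have *: "\<bar>rate_sum \<alpha> b - rate_sum \<alpha> a - (real b - real a) * r\<bar> \<le> (real b - real a) * (rate \<alpha> a - rate \<alpha> b)"
    if ab: "1 \<le> a" "a \<le> b" and r: "rate \<alpha> b \<le> r" "r \<le> rate \<alpha> a" for a b r
  proof -
    have "rate_sum \<alpha> b - rate_sum \<alpha> a = (\<Sum>k\<in>{a..<b}. rate \<alpha> k)"
      unfolding rate_sum_def using ab by (subst sum_diff[symmetric]) (auto intro!: sum.cong)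
    then have "rate_sum \<alpha> b - rate_sum \<alpha> a - (real b - real a) * r = (\<Sum>k\<in>{a..<b}. rate \<alpha> k - r)"
      using ab by (simp add: sum_subtractf of_nat_diff)
    also have "\<bar>\<dots>\<bar> \<le> (\<Sum>k\<in>{a..<b}. \<bar>rate \<alpha> k - r\<bar>)" by (rule sum_abs)
    also have "\<dots> \<le> (\<Sum>k\<in>{a..<b}. rate \<alpha> a - rate \<alpha> b)"
    proof (rule sum_mono)
      fix k assume "k \<in> {a..<b}"
      then have "rate \<alpha> k \<le> rate \<alpha> a" "rate \<alpha> b \<le> rate \<alpha> k" using ab assms by (auto intro!: rate_antimono)
      then show "\<bar>rate \<alpha> k - r\<bar> \<le> rate \<alpha> a - rate \<alpha> b" using r by linarith
    qed
    also have "\<dots> = (real b - real a) * (rate \<alpha> a - rate \<alpha> b)" using ab by (simp add: of_nat_diff)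
    finally show ?thesis .
  qed
  show ?thesis
  proof (cases "i \<le> j")
    case True
    have le: "rate \<alpha> j \<le> rate \<alpha> i" using True assms by (intro rate_antimono) auto
    have "rate_sum \<alpha> i - rate_sum \<alpha> j - (real i - real j) * rate \<alpha> i
        = - (rate_sum \<alpha> j - rate_sum \<alpha> i - (real j - real i) * rate \<alpha> i)" by (simp add: algebra_simps)
    then have "\<bar>rate_sum \<alpha> i - rate_sum \<alpha> j - (real i - real j) * rate \<alpha> i\<bar> =
       \<bar>rate_sum \<alpha> j - rate_sum \<alpha> i - (real j - real i) * rate \<alpha> i\<bar>" by (simp only: abs_minus_cancel)
    then show ?thesis using *[of i j "rate \<alpha> i"] True le assms by simp
  next
    case False
    have "rate \<alpha> i \<le> rate \<alpha> j" using False assms by (intro rate_antimono) auto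
    then show ?thesis using *[of j i "rate \<alpha> i"] False assms by simp
  qed
qed

lemma rate_scale: "M > 0 \<Longrightarrow> M powr \<alpha> * rate \<alpha> k = (real k / M) powr - \<alpha>"
  by (simp add: rate_def powr_divide powr_minus) (simp add: divide_inverse)

text \<open>The two indices are about \<open>y * sqrt m\<close> apart at height
  \<open>\<tau> * m\<close>, where each rate is about \<open>(\<tau> * m) powr - \<alpha>\<close>.
  This is how a displacement of the chain becomes an offset of the race.\<close>

lemma rate_sum_tendsto:
  fixes m :: "nat \<Rightarrow> real" and i j :: "nat \<Rightarrow> nat"
  assumes \<alpha>: "\<alpha> \<ge> 0" and m: "filterlim m at_top sequentially"
    and i: "(\<lambda>n. real (i n) / m n) \<longlonglongrightarrow> \<tau>" and j: "(\<lambda>n. real (j n) / m n) \<longlonglongrightarrow> \<tau>" and \<tau>: "\<tau> > 0"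
    and y: "(\<lambda>n. (real (i n) - real (j n)) / sqrt (m n)) \<longlonglongrightarrow> y"
  shows "(\<lambda>n. m n powr (\<alpha> - 1/2) * (rate_sum \<alpha> (i n) - rate_sum \<alpha> (j n))) \<longlonglongrightarrow> y * \<tau> powr - \<alpha>"
proof -
  have mpos: "\<forall>\<^sub>F n in sequentially. m n > 0"
    using filterlim_at_top_dense[THEN iffD1, OF m, rule_format, of 0] .
  have i1: "\<forall>\<^sub>F n in sequentially. real (i n) \<ge> 1" and j1: "\<forall>\<^sub>F n in sequentially. real (j n) \<ge> 1"
    using filterlim_at_top[THEN iffD1, OF ratio_at_top[OF m i \<tau>], rule_format, of 1]
      filterlim_at_top[THEN iffD1, OF ratio_at_top[OF m j \<tau>], rule_format, of 1] by auto
  define A where "A n = (real (i n) - real (j n)) / sqrt (m n) * (real (i n) / m n) powr - \<alpha>" for n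
  define E where "E n = \<bar>(real (i n) - real (j n)) / sqrt (m n)\<bar> * \<bar>(real (i n) / m n) powr - \<alpha> - (real (j n) / m n) powr - \<alpha>\<bar>" for n
  have A: "A \<longlonglongrightarrow> y * \<tau> powr - \<alpha>" unfolding A_def[abs_def]
    by (intro tendsto_intros y i) (use \<tau> in auto)
  have "E \<longlonglongrightarrow> \<bar>y\<bar> * \<bar>\<tau> powr - \<alpha> - \<tau> powr - \<alpha>\<bar>" unfolding E_def[abs_def]
    by (intro tendsto_intros y i j) (use \<tau> in auto)
  then have E: "E \<longlonglongrightarrow> 0" by simp
  have "(\<lambda>n. m n powr (\<alpha> - 1/2) * (rate_sum \<alpha> (i n) - rate_sum \<alpha> (j n)) - A n) \<longlonglongrightarrow> 0"
  proof (rule Lim_null_comparison[OF _ E])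
    show "\<forall>\<^sub>F n in sequentially. norm (m n powr (\<alpha> - 1/2) * (rate_sum \<alpha> (i n) - rate_sum \<alpha> (j n)) - A n) \<le> E n"
      using mpos i1 j1
    proof eventually_elim
      case (elim n)
      define x where "x = real (i n) - real (j n)"
      have M: "m n powr (\<alpha> - 1/2) = m n powr \<alpha> / sqrt (m n)"
        using elim by (simp add: powr_diff powr_half_sqrt)
      have "m n powr (\<alpha> - 1/2) * (rate_sum \<alpha> (i n) - rate_sum \<alpha> (j n)) - A n =
         m n powr (\<alpha> - 1/2) * (rate_sum \<alpha> (i n) - rate_sum \<alpha> (j n) - x * rate \<alpha> (i n))"
        unfolding A_def M x_def rate_scale[OF elim(1), symmetric] by (simp add: algebra_simps diff_divide_distrib)
      then have "norm (m n powr (\<alpha> - 1/2) * (rate_sum \<alpha> (i n) - rate_sum \<alpha> (j n)) - A n) =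
          m n powr (\<alpha> - 1/2) * \<bar>rate_sum \<alpha> (i n) - rate_sum \<alpha> (j n) - x * rate \<alpha> (i n)\<bar>"
        by (simp add: abs_mult)
      also have "\<dots> \<le> m n powr (\<alpha> - 1/2) * (\<bar>x\<bar> * \<bar>rate \<alpha> (i n) - rate \<alpha> (j n)\<bar>)"
        unfolding x_def using elim by (intro mult_left_mono rate_sum_approx \<alpha>) auto
      also have "\<dots> = E n"
        unfolding E_def M x_def[symmetric] rate_scale[OF elim(1), symmetric]
        using elim by (simp add: abs_mult right_diff_distrib[symmetric])
      finally show ?case .
    qed
  qed
  from tendsto_add[OF this A] show ?thesis by simp
qed

lemma race_index_sum:
  assumes "i \<le> Suc i'" "j \<le> Suc j'"
  shows "(\<Sum>x\<in>race_index (i, j) (i', j'). race_coeff \<alpha> x)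
      = (rate_sum \<alpha> (Suc i') - rate_sum \<alpha> (Suc j')) - (rate_sum \<alpha> i - rate_sum \<alpha> j)"
    and "(\<Sum>x\<in>race_index (i, j) (i', j'). (race_coeff \<alpha> x)\<^sup>2)
      = (\<Sum>k=i..i'. real k powr - (2 * \<alpha>)) + (\<Sum>k=j..j'. real k powr - (2 * \<alpha>))"
proof -
  show "(\<Sum>x\<in>race_index (i, j) (i', j'). race_coeff \<alpha> x)
      = (rate_sum \<alpha> (Suc i') - rate_sum \<alpha> (Suc j')) - (rate_sum \<alpha> i - rate_sum \<alpha> j)"
    unfolding race_index_def using rate_sum_diff[OF assms(1), of \<alpha>] rate_sum_diff[OF assms(2), of \<alpha>]
    by (subst sum.Plus) (auto simp: sum_negf)
  have sq: "(rate \<alpha> k)\<^sup>2 = real k powr - (2 * \<alpha>)" for k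
    unfolding rate_def power2_eq_square by (simp add: powr_add[symmetric])
  show "(\<Sum>x\<in>race_index (i, j) (i', j'). (race_coeff \<alpha> x)\<^sup>2)
      = (\<Sum>k=i..i'. real k powr - (2 * \<alpha>)) + (\<Sum>k=j..j'. real k powr - (2 * \<alpha>))"
    unfolding race_index_def by (subst sum.Plus) (auto simp: sq)
qed

lemma race_density_scale:
  assumes "M > 0"
  shows "race_density \<alpha> s s' = M *\<^sub>R (\<integral>u. (\<Prod>x\<in>race_index s s'. cfac (M * race_coeff \<alpha> x) u) \<partial>lborel)"
proof -
  have "(\<lambda>u. race_char \<alpha> s s' (0 + M * u)) = (\<lambda>u. \<Prod>x\<in>race_index s s'. cfac (M * race_coeff \<alpha> x) u)"
    by (auto simp: race_char_def cfac_def fun_eq_iff mult_ac)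
  then show ?thesis unfolding race_density_def
    using lborel_integral_real_affine[of M "race_char \<alpha> s s'" 0] assms by simp
qed

text \<open>\<open>M n\<close> is the inverse order of the standard deviation of the race. In the
  limit the scaled coefficients have total \<open>\<mu> - y * \<tau> powr - \<alpha>\<close> (offset
  of the endpoint minus offset of the start) and total square \<open>v\<close>, where the 2 counts
  the coordinates; each is at most of order \<open>1 / sqrt m\<close>. So the local limit theorem
  applies.\<close>

lemma race_density_tendsto:
  fixes m :: "nat \<Rightarrow> real" and i j i' j' :: "nat \<Rightarrow> nat"
  assumes \<alpha>: "\<alpha> > 1" and m: "filterlim m at_top sequentially"
    and i: "(\<lambda>n. real (i n) / m n) \<longlonglongrightarrow> \<tau>" and j: "(\<lambda>n. real (j n) / m n) \<longlonglongrightarrow> \<tau>" and \<tau>: "\<tau> > 0"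
    and y: "(\<lambda>n. (real (i n) - real (j n)) / sqrt (m n)) \<longlonglongrightarrow> y"
    and le: "\<forall>\<^sub>F n in sequentially. i n \<le> Suc (i' n)" "\<forall>\<^sub>F n in sequentially. j n \<le> Suc (j' n)"
    and \<kappa>i: "(\<lambda>n. (real (i' n) / m n) powr (1 - 2 * \<alpha>)) \<longlonglongrightarrow> \<kappa>"
      "(\<lambda>n. ((real (i' n) + 1) / m n) powr (1 - 2 * \<alpha>)) \<longlonglongrightarrow> \<kappa>"
    and \<kappa>j: "(\<lambda>n. (real (j' n) / m n) powr (1 - 2 * \<alpha>)) \<longlonglongrightarrow> \<kappa>"
      "(\<lambda>n. ((real (j' n) + 1) / m n) powr (1 - 2 * \<alpha>)) \<longlonglongrightarrow> \<kappa>"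
    and \<mu>: "(\<lambda>n. m n powr (\<alpha> - 1/2) * (rate_sum \<alpha> (Suc (i' n)) - rate_sum \<alpha> (Suc (j' n)))) \<longlonglongrightarrow> \<mu>"
    and v: "v = 2 * (\<tau> powr (1 - 2 * \<alpha>) - \<kappa>) / (2 * \<alpha> - 1)" "v > 0"
  shows "(\<lambda>n. m n powr (1/2 - \<alpha>) * Re (race_density \<alpha> (i n, j n) (i' n, j' n)))
     \<longlonglongrightarrow> sqrt (2 * pi / v) * exp (- (\<mu> - y * \<tau> powr - \<alpha>)\<^sup>2 / (2 * v))"
proof -
  define M where "M n = m n powr (\<alpha> - 1/2)" for n
  define I where "I n = race_index (i n, j n) (i' n, j' n)" for n
  have mpos: "\<forall>\<^sub>F n in sequentially. m n > 0"
    using filterlim_at_top_dense[THEN iffD1, OF m, rule_format, of 0] .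
  have i1: "\<forall>\<^sub>F n in sequentially. real (i n) \<ge> 1" and j1: "\<forall>\<^sub>F n in sequentially. real (j n) \<ge> 1"
    using filterlim_at_top[THEN iffD1, OF ratio_at_top[OF m i \<tau>], rule_format, of 1]
      filterlim_at_top[THEN iffD1, OF ratio_at_top[OF m j \<tau>], rule_format, of 1] by auto
  have "(\<lambda>n. M n * (rate_sum \<alpha> (Suc (i' n)) - rate_sum \<alpha> (Suc (j' n))) - M n * (rate_sum \<alpha> (i n) - rate_sum \<alpha> (j n)))
     \<longlonglongrightarrow> \<mu> - y * \<tau> powr - \<alpha>"
    unfolding M_def using \<alpha> by (intro tendsto_diff \<mu> rate_sum_tendsto m i j y \<tau>) auto
  moreover have "\<forall>\<^sub>F n in sequentially. M n * (rate_sum \<alpha> (Suc (i' n)) - rate_sum \<alpha> (Suc (j' n))) - M n * (rate_sum \<alpha> (i n) - rate_sum \<alpha> (j n))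
      = (\<Sum>x\<in>I n. M n * race_coeff \<alpha> x)"
    using le
  proof eventually_elim
    case (elim n)
    then show ?case unfolding I_def sum_distrib_left[symmetric] race_index_sum(1)[OF elim] by (simp add: right_diff_distrib)
  qed
  ultimately have mu: "(\<lambda>n. \<Sum>x\<in>I n. M n * race_coeff \<alpha> x) \<longlonglongrightarrow> \<mu> - y * \<tau> powr - \<alpha>"
    by (rule Lim_transform_eventually)
  have "(\<lambda>n. m n powr (2 * \<alpha> - 1) * (\<Sum>k=i n..i' n. real k powr - (2 * \<alpha>)) + m n powr (2 * \<alpha> - 1) * (\<Sum>k=j n..j' n. real k powr - (2 * \<alpha>)))
     \<longlonglongrightarrow> (\<tau> powr (1 - 2 * \<alpha>) - \<kappa>) / (2 * \<alpha> - 1) + (\<tau> powr (1 - 2 * \<alpha>) - \<kappa>) / (2 * \<alpha> - 1)"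
    using \<alpha> by (intro tendsto_add powr_sum_tendsto m i j \<tau> le \<kappa>i \<kappa>j) auto
  moreover have "(\<tau> powr (1 - 2 * \<alpha>) - \<kappa>) / (2 * \<alpha> - 1) + (\<tau> powr (1 - 2 * \<alpha>) - \<kappa>) / (2 * \<alpha> - 1) = v"
    unfolding v by (simp add: add_divide_distrib[symmetric])
  moreover have "\<forall>\<^sub>F n in sequentially. m n powr (2 * \<alpha> - 1) * (\<Sum>k=i n..i' n. real k powr - (2 * \<alpha>)) + m n powr (2 * \<alpha> - 1) * (\<Sum>k=j n..j' n. real k powr - (2 * \<alpha>))
     = (\<Sum>x\<in>I n. (M n * race_coeff \<alpha> x)\<^sup>2)"
    using le mpos
  proof eventually_elim
    case (elim n)
    have "(M n)\<^sup>2 = m n powr (2 * \<alpha> - 1)" unfolding M_def power2_eq_square by (simp add: powr_add[symmetric])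
    then show ?case unfolding I_def power_mult_distrib sum_distrib_left[symmetric] race_index_sum(2)[OF elim(1,2)]
      by (simp add: distrib_left)
  qed
  ultimately have vv: "(\<lambda>n. \<Sum>x\<in>I n. (M n * race_coeff \<alpha> x)\<^sup>2) \<longlonglongrightarrow> v"
    using Lim_transform_eventually by fastforce
  define \<delta> where "\<delta> n = M n * (rate \<alpha> (i n) + rate \<alpha> (j n))" for n
  have "(\<lambda>n. (real (i n) / m n) powr - \<alpha> + (real (j n) / m n) powr - \<alpha>) \<longlonglongrightarrow> \<tau> powr - \<alpha> + \<tau> powr - \<alpha>"
    using \<tau> by (intro tendsto_intros i j) auto
  then have "(\<lambda>n. ((real (i n) / m n) powr - \<alpha> + (real (j n) / m n) powr - \<alpha>) / sqrt (m n)) \<longlonglongrightarrow> 0"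
    by (rule real_tendsto_divide_at_top) (rule filterlim_compose[OF sqrt_at_top m])
  moreover have "\<forall>\<^sub>F n in sequentially. ((real (i n) / m n) powr - \<alpha> + (real (j n) / m n) powr - \<alpha>) / sqrt (m n) = \<delta> n"
    using mpos
  proof eventually_elim
    case (elim n)
    have "M n = m n powr \<alpha> / sqrt (m n)"
      using elim by (simp add: M_def powr_diff powr_half_sqrt)
    then show ?case unfolding \<delta>_def rate_scale[OF elim, symmetric] by (simp add: algebra_simps add_divide_distrib)
  qed
  ultimately have \<delta>: "\<delta> \<longlonglongrightarrow> 0" by (rule Lim_transform_eventually)
  have \<delta>2: "\<forall>\<^sub>F n in sequentially. \<forall>x\<in>I n. \<bar>M n * race_coeff \<alpha> x\<bar> \<le> \<delta> n"
    using i1 j1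
  proof eventually_elim
    case (elim n)
    have pos: "rate \<alpha> (i n) > 0" "rate \<alpha> (j n) > 0" using elim by auto
    have "\<bar>race_coeff \<alpha> x\<bar> \<le> rate \<alpha> (i n) + rate \<alpha> (j n)" if x: "x \<in> I n" for x
    proof (cases x)
      case (Inl k)
      then have k: "i n \<le> k" using x by (auto simp: I_def race_index_def)
      then have "rate \<alpha> k \<le> rate \<alpha> (i n)" "rate \<alpha> k > 0" using elim \<alpha> by (auto intro!: rate_antimono)
      then show ?thesis using Inl pos by auto
    next
      case (Inr k)
      then have k: "j n \<le> k" using x by (auto simp: I_def race_index_def)
      then have "rate \<alpha> k \<le> rate \<alpha> (j n)" "rate \<alpha> k > 0" using elim \<alpha> by (auto intro!: rate_antimono)
      then show ?thesis using Inr pos by auto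
    qed
    then show ?case unfolding \<delta>_def abs_mult by (auto simp: M_def intro!: mult_left_mono)
  qed
  have "(\<lambda>n. \<integral>u. (\<Prod>x\<in>I n. cfac (M n * race_coeff \<alpha> x) u) \<partial>lborel)
     \<longlonglongrightarrow> of_real (sqrt (2 * pi / v) * exp (- (\<mu> - y * \<tau> powr - \<alpha>)\<^sup>2 / (2 * v)))"
    by (rule integral_prod_cfac_tendsto[OF mu vv v(2) _ \<delta> \<delta>2]) (simp add: I_def)
  from tendsto_Re[OF this] have "(\<lambda>n. Re (\<integral>u. (\<Prod>x\<in>I n. cfac (M n * race_coeff \<alpha> x) u) \<partial>lborel))
     \<longlonglongrightarrow> sqrt (2 * pi / v) * exp (- (\<mu> - y * \<tau> powr - \<alpha>)\<^sup>2 / (2 * v))" by (simp only: Re_complex_of_real)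
  moreover have "\<forall>\<^sub>F n in sequentially. Re (\<integral>u. (\<Prod>x\<in>I n. cfac (M n * race_coeff \<alpha> x) u) \<partial>lborel) =
      m n powr (1/2 - \<alpha>) * Re (race_density \<alpha> (i n, j n) (i' n, j' n))"
    using mpos
  proof eventually_elim
    case (elim n)
    then have "M n > 0" by (simp add: M_def)
    moreover have "m n powr (1/2 - \<alpha>) = inverse (M n)"
      using powr_minus[of "m n" "\<alpha> - 1/2"] by (simp add: M_def)
    ultimately show ?case
      using race_density_scale[of "M n" \<alpha> "(i n, j n)" "(i' n, j' n)"] by (simp add: I_def)
  qed
  ultimately show ?thesis by (rule Lim_transform_eventually)
qed

section \<open>Races started at the fixed state \<open>(1, 1)\<close>\<close>

lemma norm_cfac_minus_one: "norm (cfac c \<theta> - 1) \<le> \<bar>\<theta> * c\<bar>"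
proof -
  have "cfac c \<theta> - 1 = \<i> * of_real (\<theta> * c) * cfac c \<theta>"
    using one_minus_i_nonzero[of "\<theta> * c"] by (simp add: cfac_def field_simps)
  then have "norm (cfac c \<theta> - 1) = \<bar>\<theta> * c\<bar> * norm (cfac c \<theta>)" by (simp add: norm_mult abs_mult)
  also have "\<dots> \<le> \<bar>\<theta> * c\<bar> * 1" by (intro mult_left_mono norm_cfac_le_1) auto
  finally show ?thesis by simp
qed

lemma cfac_mult_conj: "cfac c \<theta> * cfac (- c) \<theta> = of_real (inverse (1 + (\<theta> * c)\<^sup>2))"
proof -
  have "(1 - \<i> * of_real (\<theta> * c)) * (1 - \<i> * of_real (\<theta> * - c)) = of_real (1 + (\<theta> * c)\<^sup>2)"
    by (simp add: complex_eq_iff power2_eq_square)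
  then show ?thesis unfolding cfac_def inverse_mult_distrib[symmetric] of_real_inverse by (simp only:)
qed

text \<open>Clocks with equal index in the two coordinates have conjugate factors, whose product is
  real: this is the characteristic function of the race from \<open>(1, 1)\<close> to
  \<open>(r, r)\<close>.\<close>

definition diag_char :: "real \<Rightarrow> nat \<Rightarrow> real \<Rightarrow> real" where
  "diag_char \<alpha> r \<theta> = (\<Prod>k=1..r. inverse (1 + (\<theta> * rate \<alpha> k)\<^sup>2))"

definition diag_char_limit :: "real \<Rightarrow> real \<Rightarrow> real" where
  "diag_char_limit \<alpha> \<theta> = lim (\<lambda>r. diag_char \<alpha> r \<theta>)"

lemma diag_char_bounds: "0 \<le> diag_char \<alpha> r \<theta>" "diag_char \<alpha> r \<theta> \<le> 1"
  by (auto simp: diag_char_def intro!: prod_nonneg prod_le_1 inverse_le_1_iff[THEN iffD2])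

lemma decseq_diag_char: "decseq (\<lambda>r. diag_char \<alpha> r \<theta>)"
proof (rule decseq_SucI)
  fix r
  have "diag_char \<alpha> (Suc r) \<theta> = diag_char \<alpha> r \<theta> * inverse (1 + (\<theta> * rate \<alpha> (Suc r))\<^sup>2)"
    by (simp add: diag_char_def)
  also have "\<dots> \<le> diag_char \<alpha> r \<theta> * 1"
    by (intro mult_left_mono diag_char_bounds) (auto intro!: inverse_le_1_iff[THEN iffD2])
  finally show "diag_char \<alpha> (Suc r) \<theta> \<le> diag_char \<alpha> r \<theta>" by simp
qed

lemma diag_char_tendsto: "(\<lambda>r. diag_char \<alpha> r \<theta>) \<longlonglongrightarrow> diag_char_limit \<alpha> \<theta>"
proof -
  obtain L where "(\<lambda>r. diag_char \<alpha> r \<theta>) \<longlonglongrightarrow> L"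
    by (rule decseq_convergent[OF decseq_diag_char[of \<alpha> \<theta>], of 0]) (use diag_char_bounds in auto)
  then show ?thesis unfolding diag_char_limit_def by (simp add: limI)
qed

lemma borel_measurable_diag_char [measurable]: "diag_char \<alpha> r \<in> borel_measurable borel"
  unfolding diag_char_def[abs_def] by measurable

lemma borel_measurable_diag_char_limit [measurable]: "diag_char_limit \<alpha> \<in> borel_measurable borel"
  by (rule borel_measurable_LIMSEQ_real[OF diag_char_tendsto]) measurable

lemma diag_char_limit_le: "diag_char_limit \<alpha> \<theta> \<le> inverse (1 + \<theta>\<^sup>2)"
proof -
  have "diag_char_limit \<alpha> \<theta> \<le> diag_char \<alpha> 1 \<theta>"
    by (rule decseq_ge[OF decseq_diag_char diag_char_tendsto])
  then show ?thesis by (simp add: diag_char_def rate_def)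
qed

text \<open>From \<open>1 + x \<le> exp x\<close> in each factor, with a convergent sum of squares
  as \<open>2 * \<alpha> > 1\<close>. Positivity is needed because the integral of the limit ends up
  in a denominator.\<close>

lemma diag_char_limit_pos:
  assumes "\<alpha> > 1"
  shows "diag_char_limit \<alpha> \<theta> \<ge> exp (- (\<theta>\<^sup>2 * (\<Sum>k. (rate \<alpha> k)\<^sup>2)))"
proof (rule LIMSEQ_le_const[OF diag_char_tendsto], intro exI allI impI)
  fix r :: nat
  have sq: "(rate \<alpha> k)\<^sup>2 = real k powr (- (2 * \<alpha>))" for k
    unfolding rate_def power2_eq_square by (simp add: powr_add[symmetric])
  have sum: "summable (\<lambda>k. (rate \<alpha> k)\<^sup>2)" unfolding sq
    using assms by (subst summable_real_powr_iff) auto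
  have "exp (- (\<theta>\<^sup>2 * (\<Sum>k. (rate \<alpha> k)\<^sup>2))) \<le> exp (- (\<theta>\<^sup>2 * (\<Sum>k=1..r. (rate \<alpha> k)\<^sup>2)))"
    using sum_le_suminf[OF sum, of "{1..r}"] by (auto intro: mult_left_mono)
  also have "\<dots> = (\<Prod>k=1..r. inverse (exp ((\<theta> * rate \<alpha> k)\<^sup>2)))"
    by (simp add: sum_distrib_left exp_sum power_mult_distrib exp_minus prod_inversef[symmetric] comp_def)
  also have "\<dots> \<le> diag_char \<alpha> r \<theta>" unfolding diag_char_def
    by (intro prod_mono conjI le_imp_inverse_le exp_ge_add_one_self) (auto intro: add_pos_nonneg)
  finally show "exp (- (\<theta>\<^sup>2 * (\<Sum>k. (rate \<alpha> k)\<^sup>2))) \<le> diag_char \<alpha> r \<theta>" .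
qed

lemma integrable_diag_char_limit:
  assumes "\<alpha> > 1" shows "integrable lborel (diag_char_limit \<alpha>)"
proof (rule Bochner_Integration.integrable_bound)
  show "integrable lborel (\<lambda>x::real. inverse (1 + (x * 1)\<^sup>2))"
    by (rule integrable_inverse_1_plus_square_scaled) simp
  show "AE x in lborel. norm (diag_char_limit \<alpha> x) \<le> norm (inverse (1 + (x * 1)\<^sup>2))"
    using diag_char_limit_le[of \<alpha>] order_trans[OF exp_ge_zero diag_char_limit_pos[OF assms]] by auto
qed simp

lemma integral_diag_char_limit_pos:
  assumes "\<alpha> > 1"
  shows "(\<integral>\<theta>. diag_char_limit \<alpha> \<theta> \<partial>lborel) > 0"
proof -
  define C where "C = (\<Sum>k. (rate \<alpha> k)\<^sup>2)"
  have nonneg: "diag_char_limit \<alpha> \<theta> \<ge> 0" for \<theta> using order_trans[OF exp_ge_zero diag_char_limit_pos[OF assms]] .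
  have "exp (- \<bar>C\<bar>) = (\<integral>\<theta>. exp (- \<bar>C\<bar>) * indicator {0..1} \<theta> \<partial>(lborel :: real measure))" by simp
  also have "\<dots> \<le> (\<integral>\<theta>. diag_char_limit \<alpha> \<theta> \<partial>lborel)"
  proof (rule integral_mono)
    fix \<theta> :: real
    show "exp (- \<bar>C\<bar>) * indicator {0..1} \<theta> \<le> diag_char_limit \<alpha> \<theta>"
    proof (cases "\<theta> \<in> {0..1}")
      case True
      then have "\<theta>\<^sup>2 \<le> 1" by (auto simp: power_le_one)
      then have "\<theta>\<^sup>2 * C \<le> \<bar>C\<bar>" using mult_right_mono[of "\<theta>\<^sup>2" 1 "\<bar>C\<bar>"] mult_left_mono[of C "\<bar>C\<bar>" "\<theta>\<^sup>2"]
        by (simp add: abs_ge_self)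
      then have "exp (- \<bar>C\<bar>) \<le> exp (- (\<theta>\<^sup>2 * C))" by simp
      also have "\<dots> \<le> diag_char_limit \<alpha> \<theta>" unfolding C_def by (rule diag_char_limit_pos[OF assms])
      finally show ?thesis using True by simp
    qed (use nonneg in auto)
  qed (use integrable_diag_char_limit[OF assms] in \<open>auto intro!: integrable_mult_right\<close>)
  finally show ?thesis using exp_gt_zero[of "- \<bar>C\<bar>"] by linarith
qed

text \<open>The clocks up to \<open>r\<close> pair off to \<open>diag_char\<close>. The others
  belong to a single coordinate, number \<open>\<bar>i - j\<bar>\<close>, and have factors within
  \<open>\<bar>\<theta>\<bar> * rate \<alpha> r\<close> of 1.\<close>

lemma race_char_diag:
  assumes "1 \<le> i" "1 \<le> j" "\<alpha> \<ge> 0"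
  defines "r \<equiv> min i j"
  shows "norm (race_char \<alpha> (1, 1) (i, j) \<theta> - of_real (diag_char \<alpha> r \<theta>)) \<le> \<bar>\<theta>\<bar> * (\<bar>real i - real j\<bar> * rate \<alpha> r)"
proof -
  define L where "L = race_index (Suc r, Suc r) (i, j)"
  have split: "race_index (1, 1) (i, j) = race_index (1, 1) (r, r) \<union> L"
    unfolding race_index_def L_def r_def by (auto simp: Plus_def image_iff)
  have disj: "race_index (1, 1) (r, r) \<inter> L = {}"
    unfolding race_index_def L_def by auto
  have "race_char \<alpha> (1, 1) (r, r) \<theta> = of_real (diag_char \<alpha> r \<theta>)"
    unfolding race_char_def race_index_def diag_char_def of_real_prod cfac_mult_conj[symmetric]
    by (subst prod.Plus) (auto simp: prod.distrib)
  then have eq: "race_char \<alpha> (1, 1) (i, j) \<theta> = of_real (diag_char \<alpha> r \<theta>) * (\<Prod>x\<in>L. cfac (race_coeff \<alpha> x) \<theta>)"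
    unfolding race_char_def split using disj by (subst prod.union_disjoint) (auto simp: L_def)
  have "norm ((\<Prod>x\<in>L. cfac (race_coeff \<alpha> x) \<theta>) - (\<Prod>x\<in>L. 1)) \<le> (\<Sum>x\<in>L. norm (cfac (race_coeff \<alpha> x) \<theta> - 1))"
    by (rule norm_prod_diff) (auto simp: norm_cfac_le_1)
  also have "\<dots> \<le> (\<Sum>x\<in>L. \<bar>\<theta>\<bar> * rate \<alpha> r)"
  proof (rule sum_mono)
    fix x assume x: "x \<in> L"
    then obtain k where k: "k \<ge> Suc r" "\<bar>race_coeff \<alpha> x\<bar> = rate \<alpha> k"
      by (cases x) (auto simp: L_def race_index_def rate_def)
    have "norm (cfac (race_coeff \<alpha> x) \<theta> - 1) \<le> \<bar>\<theta>\<bar> * rate \<alpha> k"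
      using norm_cfac_minus_one[of "race_coeff \<alpha> x" \<theta>] by (simp add: abs_mult k)
    also have "\<dots> \<le> \<bar>\<theta>\<bar> * rate \<alpha> r"
      using k assms by (intro mult_left_mono rate_antimono) auto
    finally show "norm (cfac (race_coeff \<alpha> x) \<theta> - 1) \<le> \<bar>\<theta>\<bar> * rate \<alpha> r" .
  qed
  also have "\<dots> = \<bar>\<theta>\<bar> * (\<bar>real i - real j\<bar> * rate \<alpha> r)"
    by (auto simp: L_def race_index_def card_Plus r_def min_def of_nat_diff)
  finally have le: "norm ((\<Prod>x\<in>L. cfac (race_coeff \<alpha> x) \<theta>) - 1) \<le> \<bar>\<theta>\<bar> * (\<bar>real i - real j\<bar> * rate \<alpha> r)" by simp
  have "race_char \<alpha> (1, 1) (i, j) \<theta> - of_real (diag_char \<alpha> r \<theta>) =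
     of_real (diag_char \<alpha> r \<theta>) * ((\<Prod>x\<in>L. cfac (race_coeff \<alpha> x) \<theta>) - 1)"
    unfolding eq by (simp add: algebra_simps)
  then have "norm (race_char \<alpha> (1, 1) (i, j) \<theta> - of_real (diag_char \<alpha> r \<theta>)) \<le> 1 * norm ((\<Prod>x\<in>L. cfac (race_coeff \<alpha> x) \<theta>) - 1)"
    using diag_char_bounds[of \<alpha> r \<theta>] by (simp add: norm_mult mult_left_le_one_le)
  with le show ?thesis by simp
qed

text \<open>The limit is the same however the endpoint runs off, as long as it stays close enough to
  the diagonal for the unpaired clocks to disappear. The pair of first clocks, with
  \<open>rate \<alpha> 1 = 1\<close>, dominates for all \<open>n\<close>.\<close>

lemma race_density_start_tendsto:
  fixes i j :: "nat \<Rightarrow> nat"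
  assumes \<alpha>: "\<alpha> > 1"
    and i: "filterlim i at_top sequentially" and j: "filterlim j at_top sequentially"
    and dif: "(\<lambda>n. \<bar>real (i n) - real (j n)\<bar> * rate \<alpha> (min (i n) (j n))) \<longlonglongrightarrow> 0"
  shows "(\<lambda>n. Re (race_density \<alpha> (1, 1) (i n, j n))) \<longlonglongrightarrow> (\<integral>\<theta>. diag_char_limit \<alpha> \<theta> \<partial>lborel)"
proof -
  have ev: "\<forall>\<^sub>F n in sequentially. 1 \<le> i n \<and> 1 \<le> j n"
    using i j by (auto simp: filterlim_at_top intro: eventually_conj)
  then obtain n0 where n0: "\<And>n. n \<ge> n0 \<Longrightarrow> 1 \<le> i n \<and> 1 \<le> j n" by (auto simp: eventually_sequentially)
  have "(\<lambda>n. \<integral>\<theta>. race_char \<alpha> (1, 1) (i (n + n0), j (n + n0)) \<theta> \<partial>lborel) \<longlonglongrightarrow> (\<integral>\<theta>. complex_of_real (diag_char_limit \<alpha> \<theta>) \<partial>lborel)"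
  proof (rule integral_dominated_convergence)
    show "integrable lborel (\<lambda>x::real. inverse (1 + (x * 1)\<^sup>2))"
      by (rule integrable_inverse_1_plus_square_scaled) simp
    show "AE \<theta> in lborel. norm (race_char \<alpha> (1, 1) (i (n + n0), j (n + n0)) \<theta>) \<le> inverse (1 + (\<theta> * 1)\<^sup>2)" for n
    proof (rule AE_I2)
      fix \<theta> :: real
      let ?i = "i (n + n0)" and ?j = "j (n + n0)"
      have ij: "1 \<le> ?i" "1 \<le> ?j" using n0[of "n + n0"] by auto
      have "race_char \<alpha> (1, 1) (?i, ?j) \<theta> = cfac (rate \<alpha> 1) \<theta> * cfac (- rate \<alpha> 1) \<theta> * race_char \<alpha> (2, 2) (?i, ?j) \<theta>"
        using ij by (simp add: race_char_Inl race_char_Inr numeral_2_eq_2)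
      also have "norm \<dots> \<le> inverse (1 + (\<theta> * 1)\<^sup>2) * 1"
        unfolding norm_mult[of "_ * _"] race_char_def
        by (intro mult_mono norm_prod_cfac_le_1 norm_cfac_pair_le) (auto simp: rate_def)
      finally show "norm (race_char \<alpha> (1, 1) (?i, ?j) \<theta>) \<le> inverse (1 + (\<theta> * 1)\<^sup>2)" by simp
    qed
    show "AE \<theta> in lborel. (\<lambda>n. race_char \<alpha> (1, 1) (i (n + n0), j (n + n0)) \<theta>) \<longlonglongrightarrow> complex_of_real (diag_char_limit \<alpha> \<theta>)"
    proof (rule AE_I2, rule LIMSEQ_ignore_initial_segment)
      fix \<theta> :: real
      have "filterlim (\<lambda>n. min (i n) (j n)) at_top sequentially"
        using i j by (auto simp: filterlim_at_top intro: eventually_conj)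
      from filterlim_compose[OF diag_char_tendsto this]
      have 1: "(\<lambda>n. complex_of_real (diag_char \<alpha> (min (i n) (j n)) \<theta>)) \<longlonglongrightarrow> of_real (diag_char_limit \<alpha> \<theta>)"
        by (rule tendsto_of_real)
      have "(\<lambda>n. race_char \<alpha> (1, 1) (i n, j n) \<theta> - of_real (diag_char \<alpha> (min (i n) (j n)) \<theta>)) \<longlonglongrightarrow> 0"
      proof (rule Lim_null_comparison)
        show "\<forall>\<^sub>F n in sequentially. norm (race_char \<alpha> (1, 1) (i n, j n) \<theta> - of_real (diag_char \<alpha> (min (i n) (j n)) \<theta>))
           \<le> \<bar>\<theta>\<bar> * (\<bar>real (i n) - real (j n)\<bar> * rate \<alpha> (min (i n) (j n)))"
          using ev by eventually_elim (use \<alpha> in \<open>auto intro!: race_char_diag[unfolded One_nat_def]\<close>)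
        show "(\<lambda>n. \<bar>\<theta>\<bar> * (\<bar>real (i n) - real (j n)\<bar> * rate \<alpha> (min (i n) (j n)))) \<longlonglongrightarrow> 0"
          using tendsto_mult[OF tendsto_const dif, of "\<bar>\<theta>\<bar>"] by simp
      qed
      from tendsto_add[OF this 1] show "(\<lambda>n. race_char \<alpha> (1, 1) (i n, j n) \<theta>) \<longlonglongrightarrow> complex_of_real (diag_char_limit \<alpha> \<theta>)" by simp
    qed
  qed (auto simp: race_char_def)
  then have "(\<lambda>n. race_density \<alpha> (1, 1) (i n, j n)) \<longlonglongrightarrow> complex_of_real (\<integral>\<theta>. diag_char_limit \<alpha> \<theta> \<partial>lborel)"
    unfolding race_density_def integral_complex_of_real by (rule LIMSEQ_offset)
  from tendsto_Re[OF this] show ?thesis by simp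
qed

lemma visit_eq_Re_race_density:
  assumes "\<alpha> > 0" "1 \<le> i" "1 \<le> j" "i \<le> i'" "j \<le> j'"
  shows "visit \<alpha> (i, j) (i', j') = (rate \<alpha> i' + rate \<alpha> j') / (2 * pi) * Re (race_density \<alpha> (i, j) (i', j'))"
  using arg_cong[OF visit_eq_race_density[OF assms], of Re] by simp

section \<open>Transition densities of the conditioned chain\<close>

text \<open>Solves \<open>z = (2 * i - k) / sqrt M\<close> for the first coordinate \<open>i\<close>
  at time \<open>k\<close>, rounding down; \<open>rnd\<close> is the value of \<open>z\<close>
  actually attained. Values \<open>z\<close> out of range give states that cannot be visited from
  states with positive coordinates.\<close>

definition lat :: "real \<Rightarrow> nat \<Rightarrow> real \<Rightarrow> nat" where
  "lat M k z = nat \<lfloor>(real k + z * sqrt M) / 2\<rfloor>"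

definition st :: "real \<Rightarrow> nat \<Rightarrow> real \<Rightarrow> nat \<times> nat" where
  "st M k z = (lat M k z, k - lat M k z)"

definition rnd :: "real \<Rightarrow> nat \<Rightarrow> real \<Rightarrow> real" where
  "rnd M k z = (2 * real (lat M k z) - real k) / sqrt M"

text \<open>The transition probabilities of the chain conditioned on \<open>BINGO n n\<close>, spread
  uniformly over lattice cells of width \<open>2 / sqrt M\<close>.\<close>

definition cond_density :: "real \<Rightarrow> nat \<Rightarrow> real \<Rightarrow> nat \<times> nat \<Rightarrow> nat \<Rightarrow> real \<Rightarrow> real" where
  "cond_density \<alpha> n M s k z = sqrt M / 2 * visit \<alpha> s (st M k z) * visit \<alpha> (st M k z) (n, n) / visit \<alpha> s (n, n)"

lemma cond_density_nonneg: "M \<ge> 0 \<Longrightarrow> cond_density \<alpha> n M s k z \<ge> 0"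
  unfolding cond_density_def by (intro divide_nonneg_nonneg mult_nonneg_nonneg hop_nonneg) auto

text \<open>\<open>g 0 = 0\<close> is essential because \<open>nat\<close> sends the whole half-line
  \<open>w < 1\<close> to 0; every other index is taken on an interval of length 1.\<close>

lemma has_integral_nat_floor:
  fixes g :: "nat \<Rightarrow> real"
  assumes "g 0 = 0" "\<And>i. i > K \<Longrightarrow> g i = 0"
  shows "has_bochner_integral lborel (\<lambda>w::real. g (nat \<lfloor>w\<rfloor>)) (\<Sum>i=1..K. g i)"
proof -
  have "(\<lambda>w::real. g (nat \<lfloor>w\<rfloor>)) = (\<lambda>w. \<Sum>i=1..K. g i * indicator {real i..<real i + 1} w)"
  proof
    fix w :: real
    have "(\<Sum>i=1..K. g i * indicator {real i..<real i + 1} w) = (\<Sum>i=1..K. if i = nat \<lfloor>w\<rfloor> then g i else 0)"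
    proof (rule sum.cong)
      fix i assume "i \<in> {1..K}"
      moreover have "w \<in> {real i..<real i + 1} \<longleftrightarrow> \<lfloor>w\<rfloor> = int i" by (auto simp: floor_eq_iff)
      ultimately have "w \<in> {real i..<real i + 1} \<longleftrightarrow> i = nat \<lfloor>w\<rfloor>" by auto
      then show "g i * indicator {real i..<real i + 1} w = (if i = nat \<lfloor>w\<rfloor> then g i else 0)" by (auto simp: indicator_def)
    qed simp
    also have "\<dots> = g (nat \<lfloor>w\<rfloor>)"
    proof (cases "nat \<lfloor>w\<rfloor> \<in> {1..K}")
      case False
      then have "nat \<lfloor>w\<rfloor> = 0 \<or> nat \<lfloor>w\<rfloor> > K" unfolding atLeastAtMost_iff by linarith
      then show ?thesis using False assms by auto
    qed simp
    finally show "g (nat \<lfloor>w\<rfloor>) = (\<Sum>i=1..K. g i * indicator {real i..<real i + 1} w)" by simp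
  qed
  moreover have "has_bochner_integral lborel (\<lambda>w. \<Sum>i=1..K. g i * indicator {real i..<real i + 1} w) (\<Sum>i=1..K. g i * 1)"
  proof (intro has_bochner_integral_sum has_bochner_integral_mult_right)
    fix i
    show "has_bochner_integral lborel (indicat_real {real i..<real i + 1}) 1"
      using has_bochner_integral_real_indicator[of "{real i..<real i + 1}" lborel] by simp
  qed
  ultimately show ?thesis by simp
qed

lemma has_integral_lat:
  fixes g :: "nat \<Rightarrow> real"
  assumes "g 0 = 0" "\<And>i. i > K \<Longrightarrow> g i = 0" "M > 0"
  shows "has_bochner_integral lborel (\<lambda>z. sqrt M / 2 * g (lat M k z)) (\<Sum>i=1..K. g i)"
proof -
  have c: "sqrt M / 2 \<noteq> 0" using assms by simp
  have "has_bochner_integral lborel (\<lambda>z. g (nat \<lfloor>real k / 2 + sqrt M / 2 * z\<rfloor>)) ((\<Sum>i=1..K. g i) /\<^sub>R \<bar>sqrt M / 2\<bar>)"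
    using has_integral_nat_floor[of g K] assms(1,2)
    by (subst lborel_has_bochner_integral_real_affine_iff[OF c, of _ _ "real k / 2", symmetric]) simp
  moreover have "(\<lambda>z. nat \<lfloor>real k / 2 + sqrt M / 2 * z\<rfloor>) = lat M k"
    by (auto simp: lat_def fun_eq_iff add_divide_distrib mult.commute)
  ultimately have "has_bochner_integral lborel (\<lambda>z. g (lat M k z)) ((\<Sum>i=1..K. g i) /\<^sub>R \<bar>sqrt M / 2\<bar>)"
    by (simp add: fun_eq_iff)
  then have "has_bochner_integral lborel (\<lambda>z. sqrt M / 2 * g (lat M k z)) (sqrt M / 2 * ((\<Sum>i=1..K. g i) /\<^sub>R \<bar>sqrt M / 2\<bar>))"
    by (intro has_bochner_integral_mult_right)
  then show ?thesis using assms(3) by simp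
qed

text \<open>The integrand is constant on lattice cells, so a sum over lattice points is exactly an
  integral. Conditional expectations thereby become integrals against densities on one fixed space,
  which can converge pointwise.\<close>

lemma cond_density_integral:
  assumes ij: "1 \<le> i" "1 \<le> j" and M: "M > 0" and k: "k = i + j + d"
  shows "has_bochner_integral lborel (\<lambda>z. \<Phi> (rnd M k z) * cond_density \<alpha> n M (i, j) k z)
    (hop \<alpha> d (\<lambda>s'. visit \<alpha> s' (n, n) * \<Phi> ((real (fst s') - real (snd s')) / sqrt M)) (i, j) / visit \<alpha> (i, j) (n, n))"
proof -
  define g where "g i' = \<Phi> ((2 * real i' - real k) / sqrt M) * visit \<alpha> (i, j) (i', k - i')
     * visit \<alpha> (i', k - i') (n, n) / visit \<alpha> (i, j) (n, n)" for i'
  have z: "g i' = 0" if "i' < i \<or> i' > i + d" for i'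
  proof -
    have "i' < i \<or> k - i' < j" using that k ij by auto
    then show ?thesis unfolding g_def by (simp add: hop_indicator_0)
  qed
  have "has_bochner_integral lborel (\<lambda>z. sqrt M / 2 * g (lat M k z)) (\<Sum>i'=1..i + d. g i')"
    by (rule has_integral_lat) (use z ij M in auto)
  moreover have "sqrt M / 2 * g (lat M k z) = \<Phi> (rnd M k z) * cond_density \<alpha> n M (i, j) k z" for z
    by (simp add: g_def rnd_def cond_density_def st_def)
  moreover have "(\<Sum>i'=1..i + d. g i') = (\<Sum>i'=i..i + d. g i')"
    by (rule sum.mono_neutral_right) (use ij z in auto)
  moreover have "(\<Sum>i'=i..i + d. g i') = (\<Sum>a\<le>d. g (i + a))"
    using sum.shift_bounds_cl_nat_ivl[of g 0 i d] by (simp add: add.commute atLeast0AtMost)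
  moreover have "(\<Sum>a\<le>d. g (i + a)) =
     hop \<alpha> d (\<lambda>s'. visit \<alpha> s' (n, n) * \<Phi> ((real (fst s') - real (snd s')) / sqrt M)) (i, j) / visit \<alpha> (i, j) (n, n)"
    unfolding hop_eq_sum[of \<alpha> d "\<lambda>s'. visit \<alpha> s' (n, n) * \<Phi> ((real (fst s') - real (snd s')) / sqrt M)"] sum_divide_distrib
  proof (rule sum.cong)
    fix a assume "a \<in> {..d}"
    then have "k - (i + a) = j + (d - a)" "2 * real (i + a) - real k = real (i + a) - real (j + (d - a))"
      using k by (auto simp: of_nat_diff)
    then show "g (i + a) = visit \<alpha> (i + a, j + (d - a)) (n, n) *
          \<Phi> ((real (fst (i + a, j + (d - a))) - real (snd (i + a, j + (d - a)))) / sqrt M) *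
          visit \<alpha> (i, j) (i + a, j + (d - a)) / visit \<alpha> (i, j) (n, n)"
      unfolding g_def by (simp only: fst_conv snd_conv) (simp add: mult_ac)
  qed simp
  ultimately show ?thesis by simp
qed

lemma st_exact:
  assumes "i + j = k" "M > 0"
  shows "st M k ((real i - real j) / sqrt M) = (i, j)"
proof -
  have "real k = real i + real j" using assms by auto
  then have "(real k + (real i - real j) / sqrt M * sqrt M) / 2 = real i" using assms by simp
  then show ?thesis using assms by (auto simp: st_def lat_def)
qed

text \<open>As \<open>sqrt m\<close> is of smaller order than \<open>m\<close>, both coordinates are
  \<open>t / 2\<close> to leading order and \<open>z\<close> shows only in their difference.\<close>

lemma lat_asymptotics:
  fixes m :: "nat \<Rightarrow> real" and k :: "nat \<Rightarrow> nat"
  assumes m: "filterlim m at_top sequentially" and k: "(\<lambda>n. real (k n) / m n) \<longlonglongrightarrow> t" and t: "t > 0"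
    and z: "z \<longlonglongrightarrow> \<zeta>"
  defines "i \<equiv> \<lambda>n. lat (m n) (k n) (z n)"
  shows "(\<lambda>n. real (i n) / m n) \<longlonglongrightarrow> t / 2" "(\<lambda>n. real (k n - i n) / m n) \<longlonglongrightarrow> t / 2"
    "(\<lambda>n. (real (i n) - real (k n - i n)) / sqrt (m n)) \<longlonglongrightarrow> \<zeta>"
    "(\<lambda>n. rnd (m n) (k n) (z n)) \<longlonglongrightarrow> \<zeta>"
    "\<forall>\<^sub>F n in sequentially. 1 \<le> i n \<and> i n < k n"
proof -
  have mpos: "\<forall>\<^sub>F n in sequentially. m n > 0"
    using filterlim_at_top_dense[THEN iffD1, OF m, rule_format, of 0] .
  define w where "w n = (real (k n) + z n * sqrt (m n)) / 2" for n
  have sq: "filterlim (\<lambda>n. sqrt (m n)) at_top sequentially" by (rule filterlim_compose[OF sqrt_at_top m])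
  have zs: "(\<lambda>n. z n / sqrt (m n)) \<longlonglongrightarrow> 0" by (rule real_tendsto_divide_at_top[OF z sq])
  have w: "(\<lambda>n. w n / m n) \<longlonglongrightarrow> t / 2"
  proof -
    have "(\<lambda>n. (real (k n) / m n + z n / sqrt (m n)) / 2) \<longlonglongrightarrow> (t + 0) / 2" by (intro tendsto_intros k zs) auto
    moreover have "\<forall>\<^sub>F n in sequentially. (real (k n) / m n + z n / sqrt (m n)) / 2 = w n / m n"
      using mpos
    proof eventually_elim
      case (elim n)
      have "z n / sqrt (m n) = z n * sqrt (m n) / m n" using elim by (simp add: field_simps)
      then show ?case by (simp add: w_def add_divide_distrib)
    qed
    ultimately have "(\<lambda>n. w n / m n) \<longlonglongrightarrow> (t + 0) / 2" by (rule Lim_transform_eventually)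
    then show ?thesis by simp
  qed
  have wtop: "filterlim w at_top sequentially" by (rule ratio_at_top[OF m w]) (use t in simp)
  have "(\<lambda>n. (real (k n) - w n) / m n) \<longlonglongrightarrow> t - t / 2"
    unfolding diff_divide_distrib by (intro tendsto_diff k w)
  then have kwtop: "filterlim (\<lambda>n. real (k n) - w n) at_top sequentially"
    by (rule ratio_at_top[OF m]) (use t in simp)
  have ev: "\<forall>\<^sub>F n in sequentially. m n > 0 \<and> w n \<ge> 1 \<and> real (k n) - w n \<ge> 1"
    using mpos wtop kwtop unfolding filterlim_at_top by (intro eventually_conj) auto
  then have ev2: "\<forall>\<^sub>F n in sequentially. m n > 0 \<and> real (i n) \<le> w n \<and> w n \<le> real (i n) + 1 \<and> 1 \<le> i n \<and> i n < k n"
  proof eventually_elim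
    case (elim n)
    have i: "real (i n) = real_of_int \<lfloor>w n\<rfloor>" using elim unfolding i_def lat_def w_def[symmetric] by (simp add: of_nat_nat)
    have "real (i n) \<le> w n" "w n \<le> real (i n) + 1" unfolding i by linarith+
    moreover have "1 \<le> \<lfloor>w n\<rfloor>" using elim by (simp add: le_floor_iff)
    then have "1 \<le> real (i n)" unfolding i by linarith
    moreover have "real (i n) < real (k n)" using elim \<open>real (i n) \<le> w n\<close> by linarith
    ultimately show ?case using elim by auto
  qed
  show "\<forall>\<^sub>F n in sequentially. 1 \<le> i n \<and> i n < k n" using ev2 by eventually_elim auto
  show i_lim: "(\<lambda>n. real (i n) / m n) \<longlonglongrightarrow> t / 2"
  proof (rule tendsto_sandwich[OF _ _ ratio_add_const_tendsto[OF m w, of "-1"] w])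
    show "\<forall>\<^sub>F n in sequentially. (w n + - 1) / m n \<le> real (i n) / m n"
      using ev2 by eventually_elim (auto intro!: divide_right_mono)
    show "\<forall>\<^sub>F n in sequentially. real (i n) / m n \<le> w n / m n"
      using ev2 by eventually_elim (auto intro!: divide_right_mono)
  qed
  have "(\<lambda>n. real (k n) / m n - real (i n) / m n) \<longlonglongrightarrow> t - t / 2" by (intro tendsto_diff k i_lim)
  moreover have "\<forall>\<^sub>F n in sequentially. real (k n) / m n - real (i n) / m n = real (k n - i n) / m n"
    using ev2 by eventually_elim (auto simp: of_nat_diff diff_divide_distrib)
  ultimately have "(\<lambda>n. real (k n - i n) / m n) \<longlonglongrightarrow> t - t / 2" by (rule Lim_transform_eventually)
  then show "(\<lambda>n. real (k n - i n) / m n) \<longlonglongrightarrow> t / 2" by simp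
  have z2: "(\<lambda>n. z n - 2 / sqrt (m n)) \<longlonglongrightarrow> \<zeta> - 0"
    by (intro tendsto_diff z real_tendsto_divide_at_top[OF tendsto_const sq])
  show r: "(\<lambda>n. rnd (m n) (k n) (z n)) \<longlonglongrightarrow> \<zeta>"
  proof (rule tendsto_sandwich[OF _ _ _ z])
    show "(\<lambda>n. z n - 2 / sqrt (m n)) \<longlonglongrightarrow> \<zeta>" using z2 by simp
    show "\<forall>\<^sub>F n in sequentially. z n - 2 / sqrt (m n) \<le> rnd (m n) (k n) (z n)"
      using ev2
    proof eventually_elim
      case (elim n)
      have "(z n * sqrt (m n) - 2) / sqrt (m n) \<le> (2 * real (i n) - real (k n)) / sqrt (m n)"
        using elim by (intro divide_right_mono) (auto simp: w_def field_simps)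
      then show ?case using elim by (simp add: rnd_def i_def diff_divide_distrib)
    qed
    show "\<forall>\<^sub>F n in sequentially. rnd (m n) (k n) (z n) \<le> z n"
      using ev2
    proof eventually_elim
      case (elim n)
      have "(2 * real (i n) - real (k n)) / sqrt (m n) \<le> (z n * sqrt (m n)) / sqrt (m n)"
        using elim by (intro divide_right_mono) (auto simp: w_def field_simps)
      then show ?case using elim by (simp add: rnd_def i_def)
    qed
  qed
  have "\<forall>\<^sub>F n in sequentially. rnd (m n) (k n) (z n) = (real (i n) - real (k n - i n)) / sqrt (m n)"
    using ev2 by eventually_elim (auto simp: rnd_def i_def of_nat_diff)
  with r show "(\<lambda>n. (real (i n) - real (k n - i n)) / sqrt (m n)) \<longlonglongrightarrow> \<zeta>" by (rule Lim_transform_eventually)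
qed

text \<open>Conditional mean factor and, with \<open>kvar\<close>, conditional variance of the limit
  process at \<open>t'\<close> given its value at \<open>t\<close>. At \<open>t = 0\<close> division
  by zero gives the proper values 0 and \<open>t' / (2 * \<alpha> - 1)\<close>.\<close>

definition kmean :: "real \<Rightarrow> real \<Rightarrow> real \<Rightarrow> real" where
  "kmean \<alpha> t t' = (t' / t) powr (1 - \<alpha>)"

definition kvar :: "real \<Rightarrow> real \<Rightarrow> real \<Rightarrow> real" where
  "kvar \<alpha> t t' = t' * (1 - (t / t') powr (2 * \<alpha> - 1)) / (2 * \<alpha> - 1)"

lemma kvar_pos: "\<alpha> > 1 \<Longrightarrow> 0 \<le> t \<Longrightarrow> t < t' \<Longrightarrow> kvar \<alpha> t t' > 0"
proof -
  assume *: "\<alpha> > 1" "0 \<le> t" "t < t'"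
  then have "(t / t') powr (2 * \<alpha> - 1) < 1 powr (2 * \<alpha> - 1)" by (intro powr_less_mono2) auto
  then show ?thesis unfolding kvar_def using * by (intro divide_pos_pos mult_pos_pos) auto
qed

text \<open>Bayes' formula for a Brownian bridge that starts at \<open>Y\<close> with variance
  \<open>v1\<close> left and ends at 0: with \<open>v2\<close> left, its mean is
  \<open>Y * v2 / v1\<close> and its variance \<open>v2 * (v1 - v2) / v1\<close>. \<open>A\<close>
  converts positions to offsets and is the Jacobian.\<close>

lemma gaussian_bridge:
  assumes "v2 > 0" "v1 > v2" "A > 0" "\<sigma> > 0" "\<sigma>\<^sup>2 = v2 * (v1 - v2) / (v1 * A\<^sup>2)" "c = Y * v2 / (v1 * A)"
  shows "A / (2 * pi) * (sqrt (2 * pi / (v1 - v2)) * exp (- (z * A - Y)\<^sup>2 / (2 * (v1 - v2))))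
     * (sqrt (2 * pi / v2) * exp (- (z * A)\<^sup>2 / (2 * v2))) / (sqrt (2 * pi / v1) * exp (- Y\<^sup>2 / (2 * v1)))
     = normal_density c \<sigma> z"
proof -
  define v where "v = v1 - v2"
  have pos: "v > 0" "v1 > 0" "v2 > 0" using assms by (auto simp: v_def)
  have v1: "v1 = v + v2" by (simp add: v_def)
  have ex: "(- (z * A - Y)\<^sup>2 / (2 * v)) + (- (z * A)\<^sup>2 / (2 * v2)) - (- Y\<^sup>2 / (2 * v1)) = - (z - c)\<^sup>2 / (2 * \<sigma>\<^sup>2)"
  proof -
    have "(z - c)\<^sup>2 / (2 * \<sigma>\<^sup>2) = (z - Y * v2 / (v1 * A))\<^sup>2 * (v1 * A\<^sup>2) / (2 * (v2 * v))"
      using assms(5,6) by (simp add: v_def)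
    also have "z - Y * v2 / (v1 * A) = (z * A * v1 - Y * v2) / (v1 * A)" using pos assms(3) by (simp add: field_simps)
    also have "((z * A * v1 - Y * v2) / (v1 * A))\<^sup>2 * (v1 * A\<^sup>2) / (2 * (v2 * v)) = (z * A * v1 - Y * v2)\<^sup>2 / (2 * v1 * v2 * v)"
      using pos assms(3) by (simp add: power_divide power_mult_distrib power2_eq_square)
    also have "\<dots> = (z * A - Y)\<^sup>2 / (2 * v) + (z * A)\<^sup>2 / (2 * v2) - Y\<^sup>2 / (2 * v1)"
    proof -
      define Z where "Z = z * A"
      have "(Z - Y)\<^sup>2 / (2 * v) + Z\<^sup>2 / (2 * v2) - Y\<^sup>2 / (2 * v1) = ((Z - Y)\<^sup>2 * v1 * v2 + Z\<^sup>2 * v1 * v - Y\<^sup>2 * v2 * v) / (2 * v1 * v2 * v)"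
      proof -
        have "(Z - Y)\<^sup>2 / (2 * v) = (Z - Y)\<^sup>2 * v1 * v2 / (2 * v1 * v2 * v)"
          "Z\<^sup>2 / (2 * v2) = Z\<^sup>2 * v1 * v / (2 * v1 * v2 * v)"
          "Y\<^sup>2 / (2 * v1) = Y\<^sup>2 * v2 * v / (2 * v1 * v2 * v)"
          using pos by auto
        note eqs = this
        show ?thesis unfolding eqs(1) eqs(2) eqs(3) add_divide_distrib diff_divide_distrib ..
      qed
      also have "(Z - Y)\<^sup>2 * v1 * v2 + Z\<^sup>2 * v1 * v - Y\<^sup>2 * v2 * v = (Z * v1 - Y * v2)\<^sup>2"
        unfolding v1 by (simp add: power2_eq_square algebra_simps)
      finally show ?thesis by (simp add: Z_def)
    qed
    finally show ?thesis by simp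
  qed
  have pre: "A / (2 * pi) * sqrt (2 * pi / v) * sqrt (2 * pi / v2) / sqrt (2 * pi / v1) = 1 / sqrt (2 * pi * \<sigma>\<^sup>2)"
  proof -
    have "(A / (2 * pi) * sqrt (2 * pi / v) * sqrt (2 * pi / v2) / sqrt (2 * pi / v1))\<^sup>2
       = (A / (2 * pi))\<^sup>2 * (2 * pi / v) * (2 * pi / v2) / (2 * pi / v1)"
      using pos by (simp add: power_divide power_mult_distrib mult_ac)
    also have "\<dots> = A\<^sup>2 * v1 / (2 * pi * v * v2)"
    proof -
      have "(A / P)\<^sup>2 * (P / v) * (P / v2) / (P / v1) = A\<^sup>2 * v1 / (P * v * v2)" if "P > 0" for P
        using pos that by (simp add: field_simps power2_eq_square)
      from this[of "2 * pi"] show ?thesis by simp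
    qed
    also have "\<dots> = 1 / (2 * pi * \<sigma>\<^sup>2)" using pos assms(3,4,5) by (simp add: v_def[symmetric] field_simps)
    also have "\<dots> = (1 / sqrt (2 * pi * \<sigma>\<^sup>2))\<^sup>2" using assms(4) by (simp add: power_divide)
    finally show ?thesis using pos assms(3,4) by (subst (asm) power2_eq_iff_nonneg) auto
  qed
  have "A / (2 * pi) * (sqrt (2 * pi / v) * exp (- (z * A - Y)\<^sup>2 / (2 * v)))
     * (sqrt (2 * pi / v2) * exp (- (z * A)\<^sup>2 / (2 * v2))) / (sqrt (2 * pi / v1) * exp (- Y\<^sup>2 / (2 * v1)))
     = (A / (2 * pi) * sqrt (2 * pi / v) * sqrt (2 * pi / v2) / sqrt (2 * pi / v1))
      * exp ((- (z * A - Y)\<^sup>2 / (2 * v)) + (- (z * A)\<^sup>2 / (2 * v2)) - (- Y\<^sup>2 / (2 * v1)))"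
  proof -
    have "a * (p * e) * (q * f) / (r * g) = (a * p * q / r) * (e * f / g)" for a p e q f r g :: real by simp
    then show ?thesis unfolding exp_diff exp_add .
  qed
  also have "\<dots> = normal_density c \<sigma> z"
    unfolding pre ex normal_density_def by simp
  finally show ?thesis by (simp add: v_def)
qed

text \<open>\<open>sqrt M = M powr \<alpha> * M powr (1/2 - \<alpha>)\<close> is distributed so that
  every factor has a limit of its own; the contribution of \<open>rate \<alpha> n\<close> cancels in
  the quotient.\<close>

lemma cond_density_prefactor:
  assumes "\<alpha> > 0" "M > 0" "1 \<le> i" "1 \<le> j" "i \<le> i'" "j \<le> j'" "i' \<le> n" "j' \<le> n" "st M k z = (i', j')"
  shows "cond_density \<alpha> n M (i, j) k z = (((real i' / M) powr - \<alpha> + (real j' / M) powr - \<alpha>) / (4 * pi))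
     * (M powr (1/2 - \<alpha>) * Re (race_density \<alpha> (i, j) (i', j')))
     * (M powr (1/2 - \<alpha>) * Re (race_density \<alpha> (i', j') (n, n)))
     / (M powr (1/2 - \<alpha>) * Re (race_density \<alpha> (i, j) (n, n)))"
proof -
  define R1 where "R1 = Re (race_density \<alpha> (i, j) (i', j'))"
  define R2 where "R2 = Re (race_density \<alpha> (i', j') (n, n))"
  define R3 where "R3 = Re (race_density \<alpha> (i, j) (n, n))"
  define c where "c = (rate \<alpha> n + rate \<alpha> n) / (2 * pi)"
  define D where "D = M powr (1/2 - \<alpha>)"
  have D: "D > 0" using assms by (simp add: D_def)
  have "rate \<alpha> n > 0" using assms by (intro rate_pos) auto
  then have c: "c > 0" by (auto simp: c_def)
  have MD: "M powr \<alpha> * D = sqrt M"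
    using assms by (simp add: D_def powr_add[symmetric] powr_half_sqrt)
  have "cond_density \<alpha> n M (i, j) k z = sqrt M / 2 * ((rate \<alpha> i' + rate \<alpha> j') / (2 * pi) * R1) * (c * R2) / (c * R3)"
    unfolding cond_density_def assms(9) R1_def R2_def R3_def c_def
    using assms by (subst (1 2 3) visit_eq_Re_race_density) auto
  also have "\<dots> = (M powr \<alpha> * rate \<alpha> i' + M powr \<alpha> * rate \<alpha> j') / (4 * pi) * (D * R1) * (D * R2) / (D * R3)"
  proof -
    have cancel: "x * (c * y) / (c * w) = x * (y / w)" if "c > 0" for x y w c :: real using that by simp
    show ?thesis unfolding cancel[OF c] cancel[OF D] MD[symmetric] by (simp add: algebra_simps add_divide_distrib)
  qed
  finally show ?thesis unfolding rate_scale[OF assms(2)] by (simp add: R1_def R2_def R3_def D_def)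
qed

lemma eventually_less_of_ratio:
  fixes m :: "nat \<Rightarrow> real"
  assumes m: "filterlim m at_top sequentially"
    and "(\<lambda>n. f n / m n) \<longlonglongrightarrow> c" "(\<lambda>n. g n / m n) \<longlonglongrightarrow> d" "c < d"
  shows "\<forall>\<^sub>F n in sequentially. (f n :: real) < g n"
proof -
  obtain e where e: "c < e" "e < d" using dense[OF assms(4)] by auto
  have mpos: "\<forall>\<^sub>F n in sequentially. m n > 0"
    using filterlim_at_top_dense[THEN iffD1, OF m, rule_format, of 0] .
  show ?thesis using order_tendstoD(2)[OF assms(2) e(1)] order_tendstoD(1)[OF assms(3) e(2)] mpos
  proof eventually_elim
    case (elim n)
    then have "f n / m n < g n / m n" by linarith
    then show ?case using elim by (simp add: divide_less_cancel)
  qed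
qed

lemma eventually_le_of_smallo:
  fixes m :: "nat \<Rightarrow> real"
  assumes m: "filterlim m at_top sequentially" and mn: "m \<in> o(\<lambda>n. real n)"
    and f: "(\<lambda>n. f n / m n) \<longlonglongrightarrow> c"
  shows "\<forall>\<^sub>F n in sequentially. (f n :: real) < real n"
proof -
  have mpos: "\<forall>\<^sub>F n in sequentially. m n > 0"
    using filterlim_at_top_dense[THEN iffD1, OF m, rule_format, of 0] .
  have "(\<lambda>n. f n / m n * (m n / real n)) \<longlonglongrightarrow> c * 0"
    by (intro tendsto_mult f smalloD_tendsto mn)
  then have "\<forall>\<^sub>F n in sequentially. f n / m n * (m n / real n) < 1" by (rule order_tendstoD) simp
  then show ?thesis using mpos eventually_gt_at_top[of 0]
    by eventually_elim (auto simp: field_simps)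
qed

text \<open>Three races enter: start to target, target to \<open>(n, n)\<close>, start to
  \<open>(n, n)\<close>. From a positive scaled time all three are Gaussian in the limit and
  \<open>gaussian_bridge\<close> combines them; from \<open>(1, 1)\<close> the first and the third
  tend to the same constant.\<close>

lemma cond_density_tendsto:
  fixes m :: "nat \<Rightarrow> real" and k k' :: "nat \<Rightarrow> nat"
  assumes \<alpha>: "\<alpha> > 1" and m: "filterlim m at_top sequentially" and mn: "m \<in> o(\<lambda>n. real n)"
    and k: "(\<lambda>n. real (k n) / m n) \<longlonglongrightarrow> t" and k': "(\<lambda>n. real (k' n) / m n) \<longlonglongrightarrow> t'" and t: "0 < t" "t < t'"
    and y: "y \<longlonglongrightarrow> \<eta>"
  shows "(\<lambda>n. cond_density \<alpha> n (m n) (st (m n) (k n) (y n)) (k' n) z)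
     \<longlonglongrightarrow> normal_density (kmean \<alpha> t t' * \<eta>) (sqrt (kvar \<alpha> t t')) z"
    and "(\<lambda>n. cond_density \<alpha> n (m n) (1, 1) (k' n) z) \<longlonglongrightarrow> normal_density 0 (sqrt (kvar \<alpha> 0 t')) z"
proof -
  have mpos: "\<forall>\<^sub>F n in sequentially. m n > 0"
    using filterlim_at_top_dense[THEN iffD1, OF m, rule_format, of 0] .
  have t': "t' > 0" using t by simp
  have tt2: "t / 2 < t' / 2" using t by simp
  define i j where "i n = lat (m n) (k n) (y n)" and "j n = k n - i n" for n
  define i' j' where "i' n = lat (m n) (k' n) z" and "j' n = k' n - i' n" for n
  note ij = lat_asymptotics[OF m k t(1) y, folded i_def, folded j_def]
  note ij' = lat_asymptotics[OF m k' t' tendsto_const[of z], folded i'_def, folded j'_def]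
  have st: "st (m n) (k n) (y n) = (i n, j n)" "st (m n) (k' n) z = (i' n, j' n)" for n
    by (auto simp: st_def i_def j_def i'_def j'_def)
  have top: "filterlim i at_top sequentially" "filterlim j at_top sequentially"
    "filterlim i' at_top sequentially" "filterlim j' at_top sequentially"
    using ratio_at_top[OF m ij(1)] ratio_at_top[OF m ij(2)] ratio_at_top[OF m ij'(1)] ratio_at_top[OF m ij'(2)] t t'
    by (auto simp: filterlim_sequentially_iff_filterlim_real)
  have mn0: "(\<lambda>n. m n / real n) \<longlonglongrightarrow> 0" using mn by (rule smalloD_tendsto)
  have nm: "filterlim (\<lambda>n. real n / m n) at_top sequentially"
  proof -
    have "\<forall>\<^sub>F n in sequentially. m n / real n > 0"
      using mpos eventually_gt_at_top[of 0] by eventually_elim auto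
    from filterlim_inverse_at_top[OF mn0 this] show ?thesis by simp
  qed
  have nm1: "filterlim (\<lambda>n. (real n + 1) / m n) at_top sequentially"
  proof (rule filterlim_at_top_mono[OF nm])
    show "\<forall>\<^sub>F n in sequentially. real n / m n \<le> (real n + 1) / m n"
      using mpos by eventually_elim (auto intro!: divide_right_mono)
  qed
  \<comment> \<open>\<open>(n, n)\<close> is infinitely far away on the scale \<open>m\<close>, so
    the variance beyond it vanishes.\<close>
  have \<kappa>0: "(\<lambda>n. (real n / m n) powr (1 - 2 * \<alpha>)) \<longlonglongrightarrow> 0" "(\<lambda>n. ((real n + 1) / m n) powr (1 - 2 * \<alpha>)) \<longlonglongrightarrow> 0"
    using \<alpha> nm nm1 by (auto intro!: tendsto_neg_powr)
  have small: "\<forall>\<^sub>F n in sequentially. f n \<le> n" if "(\<lambda>n. real (f n) / m n) \<longlonglongrightarrow> c" for f :: "nat \<Rightarrow> nat" and c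
    using eventually_le_of_smallo[OF m mn that] by eventually_elim simp
  have less: "\<forall>\<^sub>F n in sequentially. f n \<le> g n" if "(\<lambda>n. real (f n) / m n) \<longlonglongrightarrow> c" "(\<lambda>n. real (g n) / m n) \<longlonglongrightarrow> d" "c < d"
    for f g :: "nat \<Rightarrow> nat" and c d
    using eventually_less_of_ratio[OF m that] by eventually_elim simp
  have le_Suc: "\<forall>\<^sub>F n in sequentially. f n \<le> Suc (g n)" if "\<forall>\<^sub>F n in sequentially. f n \<le> g n" for f g :: "nat \<Rightarrow> nat"
    using that by eventually_elim simp
  \<comment> \<open>\<open>A\<close> turns a displacement at \<open>t'\<close> into an offset of the
    race, \<open>Y\<close> is the offset of the start, and \<open>v1\<close>, \<open>v2\<close> are
    the limiting variances of the races from the two times to \<open>(n, n)\<close>. Times are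
    halved because each coordinate is about half of the time.\<close>
  define A where "A = (t' / 2) powr - \<alpha>"
  define Y where "Y = \<eta> * (t / 2) powr - \<alpha>"
  define T T' where "T = (t / 2) powr (1 - 2 * \<alpha>)" and "T' = (t' / 2) powr (1 - 2 * \<alpha>)"
  define v1 v2 where "v1 = 2 * T / (2 * \<alpha> - 1)" and "v2 = 2 * T' / (2 * \<alpha> - 1)"
  have A: "A > 0" using t' by (simp add: A_def)
  have TT: "T' < T" unfolding T_def T'_def using t \<alpha> by (intro powr_less_mono2_neg) auto
  have T'0: "T' > 0" "T > 0" using t by (auto simp: T'_def T_def)
  have v: "v2 > 0" "v1 > v2" using TT T'0 \<alpha> unfolding v1_def v2_def by (auto intro!: divide_strict_right_mono)
  have rates: "(\<lambda>n. ((real (i' n) / m n) powr - \<alpha> + (real (j' n) / m n) powr - \<alpha>) / (4 * pi)) \<longlonglongrightarrow> A / (2 * pi)"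
  proof -
    have "(\<lambda>n. ((real (i' n) / m n) powr - \<alpha> + (real (j' n) / m n) powr - \<alpha>) / (4 * pi)) \<longlonglongrightarrow> (A + A) / (4 * pi)"
      unfolding A_def by (intro tendsto_intros ij') (use t' in auto)
    then show ?thesis by simp
  qed
  have R2: "(\<lambda>n. m n powr (1/2 - \<alpha>) * Re (race_density \<alpha> (i' n, j' n) (n, n)))
     \<longlonglongrightarrow> sqrt (2 * pi / v2) * exp (- (z * A)\<^sup>2 / (2 * v2))"
  proof -
    have "(\<lambda>n. m n powr (1/2 - \<alpha>) * Re (race_density \<alpha> (i' n, j' n) (n, n)))
     \<longlonglongrightarrow> sqrt (2 * pi / v2) * exp (- (0 - z * (t' / 2) powr - \<alpha>)\<^sup>2 / (2 * v2))"
      by (rule race_density_tendsto[OF \<alpha> m ij'(1,2) _ ij'(3) le_Suc[OF small[OF ij'(1)]] le_Suc[OF small[OF ij'(2)]] \<kappa>0 \<kappa>0])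
         (use t' v in \<open>auto simp: v2_def T'_def\<close>)
    then show ?thesis by (simp add: A_def)
  qed
  have suc': "(\<lambda>n. real (Suc (i' n)) / m n) \<longlonglongrightarrow> t' / 2" "(\<lambda>n. real (Suc (j' n)) / m n) \<longlonglongrightarrow> t' / 2"
    using ratio_add_const_tendsto[OF m ij'(1), of 1] ratio_add_const_tendsto[OF m ij'(2), of 1] by (simp_all add: add.commute)
  have powr_eq: "(x / 2) powr a * (x / 2) powr b = (x / 2) powr (a + b)" for x a b :: real by (simp add: powr_add)
  have A2: "T' / A\<^sup>2 = t' / 2"
  proof -
    have "A\<^sup>2 = (t' / 2) powr (- 2 * \<alpha>)" unfolding A_def power2_eq_square powr_eq by simp
    then have "T' / A\<^sup>2 = (t' / 2) powr (1 - 2 * \<alpha> - - 2 * \<alpha>)" unfolding T'_def by (simp only: powr_diff)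
    then show ?thesis using t' by simp
  qed
  show "(\<lambda>n. cond_density \<alpha> n (m n) (st (m n) (k n) (y n)) (k' n) z)
     \<longlonglongrightarrow> normal_density (kmean \<alpha> t t' * \<eta>) (sqrt (kvar \<alpha> t t')) z"
  proof -
    have R3: "(\<lambda>n. m n powr (1/2 - \<alpha>) * Re (race_density \<alpha> (i n, j n) (n, n)))
       \<longlonglongrightarrow> sqrt (2 * pi / v1) * exp (- Y\<^sup>2 / (2 * v1))"
    proof -
      have "(\<lambda>n. m n powr (1/2 - \<alpha>) * Re (race_density \<alpha> (i n, j n) (n, n)))
       \<longlonglongrightarrow> sqrt (2 * pi / v1) * exp (- (0 - \<eta> * (t / 2) powr - \<alpha>)\<^sup>2 / (2 * v1))"
        by (rule race_density_tendsto[OF \<alpha> m ij(1,2) _ ij(3) le_Suc[OF small[OF ij(1)]] le_Suc[OF small[OF ij(2)]] \<kappa>0 \<kappa>0])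
           (use t v in \<open>auto simp: v1_def T_def\<close>)
      then show ?thesis by (simp add: Y_def)
    qed
    have R1: "(\<lambda>n. m n powr (1/2 - \<alpha>) * Re (race_density \<alpha> (i n, j n) (i' n, j' n)))
     \<longlonglongrightarrow> sqrt (2 * pi / (v1 - v2)) * exp (- (z * A - Y)\<^sup>2 / (2 * (v1 - v2)))"
      unfolding A_def Y_def
    proof (rule race_density_tendsto[OF \<alpha> m ij(1,2) _ ij(3)])
      show "\<forall>\<^sub>F n in sequentially. i n \<le> Suc (i' n)" "\<forall>\<^sub>F n in sequentially. j n \<le> Suc (j' n)"
        using t by (intro le_Suc less[OF ij(1) ij'(1)] less[OF ij(2) ij'(2)]; simp)+
      show "(\<lambda>n. (real (i' n) / m n) powr (1 - 2 * \<alpha>)) \<longlonglongrightarrow> T'" "(\<lambda>n. (real (j' n) / m n) powr (1 - 2 * \<alpha>)) \<longlonglongrightarrow> T'"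
        "(\<lambda>n. ((real (i' n) + 1) / m n) powr (1 - 2 * \<alpha>)) \<longlonglongrightarrow> T'" "(\<lambda>n. ((real (j' n) + 1) / m n) powr (1 - 2 * \<alpha>)) \<longlonglongrightarrow> T'"
        unfolding T'_def using t' by (intro tendsto_intros ij' ratio_add_const_tendsto m; simp)+
      have "(\<lambda>n. (real (Suc (i' n)) - real (Suc (j' n))) / sqrt (m n)) \<longlonglongrightarrow> z" using ij'(3) by simp
      then show "(\<lambda>n. m n powr (\<alpha> - 1/2) * (rate_sum \<alpha> (Suc (i' n)) - rate_sum \<alpha> (Suc (j' n)))) \<longlonglongrightarrow> z * (t' / 2) powr - \<alpha>"
        using \<alpha> t' by (intro rate_sum_tendsto m suc') auto
      show "v1 - v2 = 2 * ((t / 2) powr (1 - 2 * \<alpha>) - T') / (2 * \<alpha> - 1)"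
        by (simp add: v1_def v2_def T_def right_diff_distrib diff_divide_distrib)
    qed (use t v in auto)
    have nz: "sqrt (2 * pi / v1) * exp (- Y\<^sup>2 / (2 * v1)) \<noteq> 0" using v by simp
    note lim = tendsto_divide[OF tendsto_mult[OF tendsto_mult[OF rates R1] R2] R3 nz]
    have ev: "\<forall>\<^sub>F n in sequentially. ((real (i' n) / m n) powr - \<alpha> + (real (j' n) / m n) powr - \<alpha>) / (4 * pi) *
       (m n powr (1/2 - \<alpha>) * Re (race_density \<alpha> (i n, j n) (i' n, j' n))) *
       (m n powr (1/2 - \<alpha>) * Re (race_density \<alpha> (i' n, j' n) (n, n))) /
       (m n powr (1/2 - \<alpha>) * Re (race_density \<alpha> (i n, j n) (n, n))) =
       cond_density \<alpha> n (m n) (st (m n) (k n) (y n)) (k' n) z"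
      using mpos ij(5) small[OF ij'(1)] small[OF ij'(2)] less[OF ij(1) ij'(1) tt2] less[OF ij(2) ij'(2) tt2]
    proof eventually_elim
      case (elim n)
      have "1 \<le> i n" "1 \<le> j n" using elim by (auto simp: j_def)
      then show ?case unfolding st
        using elim \<alpha> t by (intro cond_density_prefactor[symmetric]) (auto simp: st)
    qed
    have kv: "kvar \<alpha> t t' > 0" using kvar_pos[OF \<alpha>, of t t'] t by simp
    have tt: "(t / t') powr (2 * \<alpha> - 1) = T' / T"
    proof -
      have "(t / t') powr (2 * \<alpha> - 1) = ((t / 2) / (t' / 2)) powr (2 * \<alpha> - 1)" using t by simp
      also have "\<dots> = (t / 2) powr (2 * \<alpha> - 1) / (t' / 2) powr (2 * \<alpha> - 1)" using t by (subst powr_divide) auto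
      also have "\<dots> = T' / T" unfolding T_def T'_def
        using powr_minus[of "t / 2" "2 * \<alpha> - 1"] powr_minus[of "t' / 2" "2 * \<alpha> - 1"] by (simp add: field_simps)
      finally show ?thesis .
    qed
    have var: "(sqrt (kvar \<alpha> t t'))\<^sup>2 = v2 * (v1 - v2) / (v1 * A\<^sup>2)"
    proof -
      have "v2 * (v1 - v2) / (v1 * A\<^sup>2) = (T' / A\<^sup>2) * 2 * (1 - T' / T) / (2 * \<alpha> - 1)"
      proof -
        define c where "c = 2 * \<alpha> - 1"
        have "c > 0" using \<alpha> by (simp add: c_def)
        then have "2 * T' / c * (2 * T / c - 2 * T' / c) / (2 * T / c * A\<^sup>2) = (T' / A\<^sup>2) * 2 * (1 - T' / T) / c"
          using A T'0 by (simp add: field_simps)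
        then show ?thesis by (simp add: v1_def v2_def c_def)
      qed
      also have "\<dots> = kvar \<alpha> t t'" unfolding A2 kvar_def tt by simp
      finally show ?thesis using kv by simp
    qed
    have mean: "kmean \<alpha> t t' * \<eta> = Y * v2 / (v1 * A)"
    proof -
      have "Y * v2 / (v1 * A) = \<eta> * ((t / 2) powr - \<alpha> / T * (T' / A))"
        using \<alpha> T'0 by (simp add: Y_def v1_def v2_def)
      also have "(t / 2) powr - \<alpha> / T = (t / 2) powr (- \<alpha> - (1 - 2 * \<alpha>))" unfolding T_def by (simp only: powr_diff)
      also have "T' / A = (t' / 2) powr (1 - 2 * \<alpha> - - \<alpha>)" unfolding T'_def A_def by (simp only: powr_diff)
      also have "(t / 2) powr (- \<alpha> - (1 - 2 * \<alpha>)) = inverse ((t / 2) powr (1 - \<alpha>))"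
        using powr_minus[of "t / 2" "1 - \<alpha>"] by (simp add: algebra_simps)
      also have "inverse ((t / 2) powr (1 - \<alpha>)) * (t' / 2) powr (1 - 2 * \<alpha> - - \<alpha>) = ((t' / 2) / (t / 2)) powr (1 - \<alpha>)"
        using t by (subst powr_divide) (auto simp: field_simps)
      finally show ?thesis by (simp add: kmean_def)
    qed
    have sd: "sqrt (kvar \<alpha> t t') > 0" using kv by simp
    from Lim_transform_eventually[OF lim ev] show ?thesis
      unfolding gaussian_bridge[OF v A sd var mean] .
  qed
  show "(\<lambda>n. cond_density \<alpha> n (m n) (1, 1) (k' n) z) \<longlonglongrightarrow> normal_density 0 (sqrt (kvar \<alpha> 0 t')) z"
  proof -
    define \<phi> where "\<phi> = (\<integral>\<theta>. diag_char_limit \<alpha> \<theta> \<partial>lborel)"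
    have \<phi>: "\<phi> > 0" unfolding \<phi>_def by (rule integral_diag_char_limit_pos[OF \<alpha>])
    have S1: "(\<lambda>n. Re (race_density \<alpha> (1, 1) (i' n, j' n))) \<longlonglongrightarrow> \<phi>" unfolding \<phi>_def
    proof (rule race_density_start_tendsto[OF \<alpha> top(3,4)])
      define r where "r n = min (i' n) (j' n)" for n
      have "(\<lambda>n. min (real (i' n) / m n) (real (j' n) / m n)) \<longlonglongrightarrow> min (t' / 2) (t' / 2)" by (intro tendsto_min ij')
      moreover have "\<forall>\<^sub>F n in sequentially. min (real (i' n) / m n) (real (j' n) / m n) = real (r n) / m n"
        using mpos by eventually_elim (auto simp: r_def min_def divide_le_cancel)
      ultimately have r: "(\<lambda>n. real (r n) / m n) \<longlonglongrightarrow> t' / 2" using Lim_transform_eventually by fastforce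
      have "(\<lambda>n. \<bar>(real (i' n) - real (j' n)) / sqrt (m n)\<bar> * (real (r n) / m n) powr - \<alpha> * m n powr (1/2 - \<alpha>)) \<longlonglongrightarrow> \<bar>z\<bar> * (t' / 2) powr - \<alpha> * 0"
        using t' \<alpha> by (intro tendsto_intros ij' r tendsto_neg_powr m) auto
      moreover have "\<forall>\<^sub>F n in sequentially. \<bar>(real (i' n) - real (j' n)) / sqrt (m n)\<bar> * (real (r n) / m n) powr - \<alpha> * m n powr (1/2 - \<alpha>)
          = \<bar>real (i' n) - real (j' n)\<bar> * rate \<alpha> (r n)"
        using mpos
      proof eventually_elim
        case (elim n)
        have mm: "m n powr \<alpha> * m n powr (1/2 - \<alpha>) = sqrt (m n)"
          using elim by (simp add: powr_add[symmetric] powr_half_sqrt)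
        have "\<bar>(real (i' n) - real (j' n)) / sqrt (m n)\<bar> * (m n powr \<alpha> * rate \<alpha> (r n)) * m n powr (1/2 - \<alpha>)
          = \<bar>real (i' n) - real (j' n)\<bar> / sqrt (m n) * rate \<alpha> (r n) * (m n powr \<alpha> * m n powr (1/2 - \<alpha>))"
          using elim by (simp add: mult_ac)
        also have "\<dots> = \<bar>real (i' n) - real (j' n)\<bar> / sqrt (m n) * rate \<alpha> (r n) * sqrt (m n)" by (simp only: mm)
        finally have "\<bar>(real (i' n) - real (j' n)) / sqrt (m n)\<bar> * (m n powr \<alpha> * rate \<alpha> (r n)) * m n powr (1/2 - \<alpha>)
          = \<bar>real (i' n) - real (j' n)\<bar> / sqrt (m n) * rate \<alpha> (r n) * sqrt (m n)" .
        then show ?case using elim rate_scale[OF elim, of \<alpha> "r n"] by simp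
      qed
      ultimately show "(\<lambda>n. \<bar>real (i' n) - real (j' n)\<bar> * rate \<alpha> (min (i' n) (j' n))) \<longlonglongrightarrow> 0"
        unfolding r_def using Lim_transform_eventually by fastforce
    qed
    \<comment> \<open>The same constant as for the target: the ratio tends to 1 without an explicit
      value of \<open>\<phi>\<close>.\<close>
    have S2: "(\<lambda>n. Re (race_density \<alpha> (1, 1) (n, n))) \<longlonglongrightarrow> \<phi>" unfolding \<phi>_def
      by (rule race_density_start_tendsto[OF \<alpha> filterlim_ident filterlim_ident]) simp
    have \<phi>0: "\<phi> \<noteq> 0" using \<phi> by simp
    note lim = tendsto_mult[OF tendsto_mult[OF rates tendsto_divide[OF S1 S2 \<phi>0]] R2]
    have ev: "\<forall>\<^sub>F n in sequentially. ((real (i' n) / m n) powr - \<alpha> + (real (j' n) / m n) powr - \<alpha>) / (4 * pi) *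
       (Re (race_density \<alpha> (1, 1) (i' n, j' n)) / Re (race_density \<alpha> (1, 1) (n, n))) *
       (m n powr (1/2 - \<alpha>) * Re (race_density \<alpha> (i' n, j' n) (n, n))) =
       cond_density \<alpha> n (m n) (1, 1) (k' n) z"
      using mpos ij'(5) small[OF ij'(1)] small[OF ij'(2)]
    proof eventually_elim
      case (elim n)
      have "1 \<le> i' n" "1 \<le> j' n" using elim by (auto simp: j'_def)
      then have eq: "cond_density \<alpha> n (m n) (1, 1) (k' n) z = (((real (i' n) / m n) powr - \<alpha> + (real (j' n) / m n) powr - \<alpha>) / (4 * pi))
         * (m n powr (1/2 - \<alpha>) * Re (race_density \<alpha> (1, 1) (i' n, j' n)))
         * (m n powr (1/2 - \<alpha>) * Re (race_density \<alpha> (i' n, j' n) (n, n)))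
         / (m n powr (1/2 - \<alpha>) * Re (race_density \<alpha> (1, 1) (n, n)))"
        using elim \<alpha> by (intro cond_density_prefactor) (auto simp: st)
      have "m n powr (1/2 - \<alpha>) > 0" using elim by simp
      then show ?case unfolding eq by simp
    qed
    have kv: "kvar \<alpha> 0 t' = t' / (2 * \<alpha> - 1)" by (simp add: kvar_def)
    have vv: "v2 = kvar \<alpha> 0 t' * A\<^sup>2"
      using A2 A unfolding kv v2_def by (simp add: field_simps)
    have kpos: "kvar \<alpha> 0 t' > 0" using kv t' \<alpha> by simp
    have "A / (2 * pi) * (\<phi> / \<phi>) * (sqrt (2 * pi / v2) * exp (- (z * A)\<^sup>2 / (2 * v2))) = normal_density 0 (sqrt (kvar \<alpha> 0 t')) z"
    proof -
      have e: "- (z * A)\<^sup>2 / (2 * v2) = - z\<^sup>2 / (2 * kvar \<alpha> 0 t')"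
        unfolding vv using A by (simp add: power_mult_distrib)
      have pre: "A / (2 * pi) * sqrt (2 * pi / v2) = 1 / sqrt (2 * pi * kvar \<alpha> 0 t')"
      proof -
        define K where "K = kvar \<alpha> 0 t'"
        have K: "K > 0" using kpos by (simp add: K_def)
        have "sqrt (2 * pi / (K * A\<^sup>2)) = sqrt (2 * pi) / (sqrt K * A)"
          using A by (simp add: real_sqrt_divide real_sqrt_mult)
        also have "A / (2 * pi) * \<dots> = sqrt (2 * pi) / (2 * pi) / sqrt K" using A by simp
        also have "sqrt (2 * pi) / (2 * pi) = 1 / sqrt (2 * pi)"
          by (simp add: real_div_sqrt divide_eq_eq real_sqrt_divide[symmetric] field_simps)
        finally show ?thesis unfolding vv K_def[symmetric] by (simp add: real_sqrt_mult)
      qed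
      have "A / (2 * pi) * (\<phi> / \<phi>) * (sqrt (2 * pi / v2) * exp (- (z * A)\<^sup>2 / (2 * v2)))
         = (A / (2 * pi) * sqrt (2 * pi / v2)) * exp (- (z * A)\<^sup>2 / (2 * v2))" using \<phi>0 by simp
      then show ?thesis using kpos unfolding normal_density_def pre e by simp
    qed
    with Lim_transform_eventually[OF lim ev] show ?thesis by simp
  qed
qed

section \<open>Finite-dimensional distributions of the conditioned chain\<close>

text \<open>Scheffe's lemma with moving test functions: the positive part of \<open>q' - q n\<close>
  is dominated by \<open>q'\<close>. The test functions depend on \<open>n\<close> because of the
  rounding and because they result from kernels applied before.\<close>

lemma scheffe_weak:
  fixes q \<phi> :: "nat \<Rightarrow> real \<Rightarrow> real"
  assumes qn: "\<forall>\<^sub>F n in sequentially. integrable lborel (q n) \<and> (\<integral>z. q n z \<partial>lborel) = 1 \<and> (\<forall>z. q n z \<ge> 0)"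
    and q: "integrable lborel q'" "(\<integral>z. q' z \<partial>lborel) = 1" "\<And>z. q' z \<ge> 0"
    and lim: "\<And>z. (\<lambda>n. q n z) \<longlonglongrightarrow> q' z"
    and \<phi>: "\<And>n. \<phi> n \<in> borel_measurable lborel" "\<phi>' \<in> borel_measurable lborel"
    and bd: "\<forall>\<^sub>F n in sequentially. \<forall>z. \<bar>\<phi> n z\<bar> \<le> C" and bd': "\<And>z. \<bar>\<phi>' z\<bar> \<le> C"
    and \<phi>lim: "\<And>z. (\<lambda>n. \<phi> n z) \<longlonglongrightarrow> \<phi>' z"
  shows "(\<lambda>n. \<integral>z. \<phi> n z * q n z \<partial>lborel) \<longlonglongrightarrow> (\<integral>z. \<phi>' z * q' z \<partial>lborel)"
proof -
  have C: "C \<ge> 0" using bd'[of 0] by linarith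
  from eventually_conj[OF qn bd] obtain n0 where n0: "\<And>n. n \<ge> n0 \<Longrightarrow> integrable lborel (q n) \<and> (\<integral>z. q n z \<partial>lborel) = 1 \<and> (\<forall>z. q n z \<ge> 0) \<and> (\<forall>z. \<bar>\<phi> n z\<bar> \<le> C)"
    by (auto simp: eventually_sequentially)
  define r where "r n = q (n + n0)" for n
  define \<psi> where "\<psi> n = \<phi> (n + n0)" for n
  have r: "integrable lborel (r n)" "(\<integral>z. r n z \<partial>lborel) = 1" "r n z \<ge> 0" for n z
    using n0[of "n + n0"] by (auto simp: r_def)
  have \<psi>: "\<psi> n \<in> borel_measurable lborel" "\<bar>\<psi> n z\<bar> \<le> C" for n z using n0[of "n + n0"] \<phi> by (auto simp: \<psi>_def)
  have rlim: "(\<lambda>n. r n z) \<longlonglongrightarrow> q' z" for z unfolding r_def by (rule LIMSEQ_ignore_initial_segment[OF lim])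
  have \<psi>lim: "(\<lambda>n. \<psi> n z) \<longlonglongrightarrow> \<phi>' z" for z unfolding \<psi>_def by (rule LIMSEQ_ignore_initial_segment[OF \<phi>lim])
  note [measurable] = borel_measurable_integrable[OF r(1)] borel_measurable_integrable[OF q(1)] \<psi>(1) \<phi>(2)
  have pos: "(\<lambda>n. \<integral>z. max 0 (q' z - r n z) \<partial>lborel) \<longlonglongrightarrow> (\<integral>z. 0 \<partial>(lborel :: real measure))"
  proof (rule integral_dominated_convergence[where w = q'])
    show "AE z in lborel. (\<lambda>n. max 0 (q' z - r n z)) \<longlonglongrightarrow> 0"
    proof (rule AE_I2)
      fix z
      have "(\<lambda>n. max 0 (q' z - r n z)) \<longlonglongrightarrow> max 0 (q' z - q' z)" by (intro tendsto_intros rlim)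
      then show "(\<lambda>n. max 0 (q' z - r n z)) \<longlonglongrightarrow> 0" by simp
    qed
    show "AE z in lborel. norm (max 0 (q' z - r n z)) \<le> q' z" for n
      using r(3) q(3) by (auto simp: max_def)
  qed (use q in auto)
  \<comment> \<open>Both densities have mass 1, so the signed part integrates to 0 and the one-sided
    estimate becomes an L1 estimate.\<close>
  have absd: "\<bar>r n z - q' z\<bar> = (r n z - q' z) + 2 * max 0 (q' z - r n z)" for n z by (auto simp: max_def)
  have intmax: "integrable lborel (\<lambda>z. max 0 (q' z - r n z))" for n
    by (intro integrable_max) (use r q in auto)
  have "(\<integral>z. \<bar>r n z - q' z\<bar> \<partial>lborel) = 2 * (\<integral>z. max 0 (q' z - r n z) \<partial>lborel)" for n
    unfolding absd using r q intmax by simp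
  then have L1: "(\<lambda>n. \<integral>z. \<bar>r n z - q' z\<bar> \<partial>lborel) \<longlonglongrightarrow> 0"
    using tendsto_mult[OF tendsto_const pos, of 2] by simp
  have main: "(\<lambda>n. \<integral>z. \<psi> n z * q' z \<partial>lborel) \<longlonglongrightarrow> (\<integral>z. \<phi>' z * q' z \<partial>lborel)"
  proof (rule integral_dominated_convergence[where w = "\<lambda>z. C * q' z"])
    show "AE z in lborel. (\<lambda>n. \<psi> n z * q' z) \<longlonglongrightarrow> \<phi>' z * q' z" by (intro AE_I2 tendsto_intros \<psi>lim)
    show "AE z in lborel. norm (\<psi> n z * q' z) \<le> C * q' z" for n
      using \<psi>(2) q(3) by (auto simp: abs_mult intro!: mult_mono C)
  qed (use q in auto)
  have int1: "integrable lborel (\<lambda>z. \<psi> n z * r n z)" for n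
    by (rule Bochner_Integration.integrable_bound[of _ "\<lambda>z. C * r n z"])
       (use r \<psi> C in \<open>auto simp: abs_mult intro!: mult_mono\<close>)
  have int2: "integrable lborel (\<lambda>z. \<psi> n z * q' z)" for n
    by (rule Bochner_Integration.integrable_bound[of _ "\<lambda>z. C * q' z"])
       (use q \<psi> C in \<open>auto simp: abs_mult intro!: mult_mono\<close>)
  have "(\<lambda>n. (\<integral>z. \<psi> n z * r n z \<partial>lborel) - (\<integral>z. \<psi> n z * q' z \<partial>lborel)) \<longlonglongrightarrow> 0"
  proof (rule Lim_null_comparison)
    show "(\<lambda>n. C * (\<integral>z. \<bar>r n z - q' z\<bar> \<partial>lborel)) \<longlonglongrightarrow> 0" using tendsto_mult[OF tendsto_const L1, of C] by simp
    show "\<forall>\<^sub>F n in sequentially. norm ((\<integral>z. \<psi> n z * r n z \<partial>lborel) - (\<integral>z. \<psi> n z * q' z \<partial>lborel)) \<le> C * (\<integral>z. \<bar>r n z - q' z\<bar> \<partial>lborel)"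
    proof (intro always_eventually allI)
      fix n
      have "(\<integral>z. \<psi> n z * r n z \<partial>lborel) - (\<integral>z. \<psi> n z * q' z \<partial>lborel) = (\<integral>z. \<psi> n z * r n z - \<psi> n z * q' z \<partial>lborel)"
        using int1 int2 by simp
      also have "norm \<dots> \<le> (\<integral>z. C * \<bar>r n z - q' z\<bar> \<partial>lborel)"
      proof (rule Bochner_Integration.integral_norm_bound_integral)
        show "integrable lborel (\<lambda>z. \<psi> n z * r n z - \<psi> n z * q' z)" using int1 int2 by auto
        show "integrable lborel (\<lambda>z. C * \<bar>r n z - q' z\<bar>)" using r q by auto
        show "norm (\<psi> n z * r n z - \<psi> n z * q' z) \<le> C * \<bar>r n z - q' z\<bar>" for z
          unfolding right_diff_distrib[symmetric] using \<psi>(2) by (auto simp: abs_mult intro!: mult_right_mono)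
      qed
      finally show "norm ((\<integral>z. \<psi> n z * r n z \<partial>lborel) - (\<integral>z. \<psi> n z * q' z \<partial>lborel)) \<le> C * (\<integral>z. \<bar>r n z - q' z\<bar> \<partial>lborel)"
        by simp
    qed
  qed
  from tendsto_add[OF this main] have "(\<lambda>n. \<integral>z. \<psi> n z * r n z \<partial>lborel) \<longlonglongrightarrow> (\<integral>z. \<phi>' z * q' z \<partial>lborel)" by simp
  then show ?thesis unfolding \<psi>_def r_def by (rule LIMSEQ_offset)
qed

text \<open>Convergence in the product topology, kept in sequential form because the kernels are
  applied along sequences of positions that vary with \<open>n\<close>.\<close>

definition cwise :: "(nat \<Rightarrow> nat \<Rightarrow> real) \<Rightarrow> (nat \<Rightarrow> real) \<Rightarrow> bool" where
  "cwise ys y \<longleftrightarrow> (\<forall>i. (\<lambda>n. ys n i) \<longlonglongrightarrow> y i)"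

definition cwise_cont :: "((nat \<Rightarrow> real) \<Rightarrow> real) \<Rightarrow> bool" where
  "cwise_cont F \<longleftrightarrow> (\<forall>ys y. cwise ys y \<longrightarrow> (\<lambda>n. F (ys n)) \<longlonglongrightarrow> F y)"

lemma cwise_const: "cwise (\<lambda>_. y) y"
  by (simp add: cwise_def)

lemma cwise_update: "cwise ys y \<Longrightarrow> x \<longlonglongrightarrow> x' \<Longrightarrow> cwise (\<lambda>n. (ys n)(j := x n)) (y(j := x'))"
  by (auto simp: cwise_def)

lemma cwise_cont_measurable_slice:
  assumes "cwise_cont F"
  shows "(\<lambda>z. F (y(j := z))) \<in> borel_measurable borel"
proof (rule borel_measurable_continuous_onI, rule continuous_at_imp_continuous_on, intro ballI)
  fix z :: real
  show "isCont (\<lambda>z. F (y(j := z))) z"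
  proof (rule continuous_at_sequentiallyI)
    fix u :: "nat \<Rightarrow> real" assume "u \<longlonglongrightarrow> z"
    then have "cwise (\<lambda>n. y(j := u n)) (y(j := z))" by (intro cwise_update cwise_const)
    then show "(\<lambda>n. F (y(j := u n))) \<longlonglongrightarrow> F (y(j := z))" using assms by (auto simp: cwise_cont_def)
  qed
qed

definition start_state :: "real \<Rightarrow> (nat \<Rightarrow> nat) \<Rightarrow> nat \<Rightarrow> (nat \<Rightarrow> real) \<Rightarrow> nat \<times> nat" where
  "start_state M ks j y = (if j = 0 then (1, 1) else st M (ks j) (y j))"

text \<open>A kernel acting on functionals of the whole vector of positions: coordinate
  \<open>Suc j\<close> is overwritten by the next position and integrated out. \<open>Kl\<close> is
  its Gaussian limit.\<close>

definition Kn :: "real \<Rightarrow> nat \<Rightarrow> real \<Rightarrow> (nat \<Rightarrow> nat) \<Rightarrow> nat \<Rightarrow> ((nat \<Rightarrow> real) \<Rightarrow> real) \<Rightarrow> (nat \<Rightarrow> real) \<Rightarrow> real" where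
  "Kn \<alpha> n M ks j F y = (\<integral>z. F (y(Suc j := rnd M (ks (Suc j)) z))
      * cond_density \<alpha> n M (start_state M ks j y) (ks (Suc j)) z \<partial>lborel)"

definition Kl :: "real \<Rightarrow> (nat \<Rightarrow> real) \<Rightarrow> nat \<Rightarrow> ((nat \<Rightarrow> real) \<Rightarrow> real) \<Rightarrow> (nat \<Rightarrow> real) \<Rightarrow> real" where
  "Kl \<alpha> ts j F y = (\<integral>z. F (y(Suc j := kmean \<alpha> (ts j) (ts (Suc j)) * y j + sqrt (kvar \<alpha> (ts j) (ts (Suc j))) * z))
      * std_normal_density z \<partial>lborel)"

fun iterK :: "(nat \<Rightarrow> ((nat \<Rightarrow> real) \<Rightarrow> real) \<Rightarrow> (nat \<Rightarrow> real) \<Rightarrow> real) \<Rightarrow> nat \<Rightarrow> ((nat \<Rightarrow> real) \<Rightarrow> real) \<Rightarrow> real" where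
  "iterK K 0 F = F (\<lambda>_. 0)"
| "iterK K (Suc j) F = iterK K j (K j F)"

lemma measurable_lat [measurable]: "lat M k \<in> measurable borel (count_space UNIV)"
  unfolding lat_def[abs_def] by measurable

lemma visit_pos: "\<lbrakk>1 \<le> i; 1 \<le> j; i \<le> n; j \<le> n\<rbrakk> \<Longrightarrow> visit \<alpha> (i, j) (n, n) > 0"
proof (induction "n + n - (i + j)" arbitrary: i j)
  case 0
  then have "i = n" "j = n" by auto
  then show ?case by simp
next
  case (Suc d)
  have R: "pR \<alpha> (i, j) > 0" "pU \<alpha> (i, j) > 0" using Suc.prems
    by (auto simp: pR_def pU_def intro!: divide_pos_pos add_pos_pos)
  have d: "n + n - (Suc i + j) = d" "n + n - (i + Suc j) = d" using Suc.hyps(2) by auto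
  have eq: "visit \<alpha> (i, j) (n, n) = pR \<alpha> (i, j) * hop \<alpha> d (indicator {(n, n)}) (Suc i, j) + pU \<alpha> (i, j) * hop \<alpha> d (indicator {(n, n)}) (i, Suc j)"
    by (simp flip: Suc.hyps(2))
  consider "i < n" | "j < n" using Suc by linarith
  then show ?case
  proof cases
    case 1
    then have "hop \<alpha> d (indicator {(n, n)}) (Suc i, j) > 0" using Suc.hyps(1)[of "Suc i" j] d Suc.prems by simp
    then show ?thesis unfolding eq using R by (intro add_pos_nonneg mult_pos_pos mult_nonneg_nonneg hop_nonneg) auto
  next
    case 2
    then have "hop \<alpha> d (indicator {(n, n)}) (i, Suc j) > 0" using Suc.hyps(1)[of i "Suc j"] d Suc.prems by simp
    then show ?thesis unfolding eq using R by (intro add_nonneg_pos mult_pos_pos mult_nonneg_nonneg hop_nonneg) auto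
  qed
qed

text \<open>\<open>0 powr \<alpha> = 0\<close>, so a vanishing coordinate never grows. Such states
  arise from the rounding in \<open>st\<close>.\<close>

lemma hop_axis_0:
  assumes "n \<ge> 1"
  shows "hop \<alpha> d (indicator {(n, n)}) (0, j) = 0" "hop \<alpha> d (indicator {(n, n)}) (i, 0) = 0"
proof -
  show "hop \<alpha> d (indicator {(n, n)}) (0, j) = 0"
    using assms by (induction d arbitrary: j) (auto simp: pR_def indicator_def)
  show "hop \<alpha> d (indicator {(n, n)}) (i, 0) = 0"
    using assms by (induction d arbitrary: i) (auto simp: pU_def indicator_def)
qed

text \<open>The function \<open>visit \<alpha> s (n, n)\<close> of \<open>s\<close> is harmonic up
  to time \<open>2 * n\<close>; this is why \<open>cond_density\<close> has mass 1.\<close>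

lemma hop_visit:
  assumes "i + j + d \<le> 2 * n"
  shows "hop \<alpha> d (\<lambda>s. visit \<alpha> s (n, n)) (i, j) = visit \<alpha> (i, j) (n, n)"
proof -
  define e where "e = 2 * n - (i + j + d)"
  have "hop \<alpha> d (\<lambda>s. visit \<alpha> s (n, n)) (i, j) = hop \<alpha> d (hop \<alpha> e (indicator {(n, n)})) (i, j)"
    by (rule hop_cong) (use assms in \<open>auto simp: e_def mult_2 add.assoc\<close>)
  also have "\<dots> = hop \<alpha> (d + e) (indicator {(n, n)}) (i, j)" by (rule hop_add[symmetric])
  also have "d + e = 2 * n - (i + j)" using assms by (simp add: e_def)
  finally show ?thesis by (simp add: mult_2)
qed

lemma cond_density_total:
  assumes "1 \<le> i" "1 \<le> j" "M > 0" "i + j \<le> k" "k \<le> 2 * n" "visit \<alpha> (i, j) (n, n) \<noteq> 0"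
  shows "has_bochner_integral lborel (cond_density \<alpha> n M (i, j) k) 1"
proof -
  have "has_bochner_integral lborel (\<lambda>z. 1 * cond_density \<alpha> n M (i, j) k z)
    (hop \<alpha> (k - (i + j)) (\<lambda>s'. visit \<alpha> s' (n, n) * 1) (i, j) / visit \<alpha> (i, j) (n, n))"
    by (rule cond_density_integral) (use assms in auto)
  moreover have "hop \<alpha> (k - (i + j)) (\<lambda>s'. visit \<alpha> s' (n, n)) (i, j) = visit \<alpha> (i, j) (n, n)"
    by (rule hop_visit) (use assms in auto)
  ultimately show ?thesis using assms(6) by simp
qed

text \<open>The bound is claimed for every \<open>y\<close>, including values that rounding sends
  off the chain. If \<open>(n, n)\<close> cannot be reached from there, the density is 0; otherwise
  both coordinates are positive and its mass is 1.\<close>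

lemma Kn_bounded:
  assumes "M > 0" "n \<ge> 1" "ks j \<le> ks (Suc j)" "ks (Suc j) \<le> 2 * n" "ks 0 = 2" "\<And>y. \<bar>F y\<bar> \<le> C"
  shows "\<bar>Kn \<alpha> n M ks j F y\<bar> \<le> C"
proof -
  define s where "s = start_state M ks j y"
  have C: "C \<ge> 0" using assms(6)[of y] by linarith
  show ?thesis
  proof (cases "visit \<alpha> s (n, n) = 0")
    case True
    then have "cond_density \<alpha> n M s k z = 0" for k z by (simp add: cond_density_def)
    then show ?thesis unfolding Kn_def s_def[symmetric] using C by simp
  next
    case False
    obtain i j' where ij: "s = (i, j')" by (cases s)
    have ge1: "1 \<le> i" "1 \<le> j'" using False hop_axis_0[OF assms(2)] ij
      by (auto simp: Suc_le_eq intro: gr0I)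
    have "i + j' = ks j"
    proof (cases "j = 0")
      case True then show ?thesis using ij assms(5) by (auto simp: s_def start_state_def)
    next
      case False then show ?thesis using ij ge1 by (auto simp: s_def start_state_def st_def)
    qed
    then have tot: "has_bochner_integral lborel (cond_density \<alpha> n M s (ks (Suc j))) 1"
      using False assms ge1 unfolding ij by (intro cond_density_total) auto
    have "\<bar>Kn \<alpha> n M ks j F y\<bar> \<le> (\<integral>z. C * cond_density \<alpha> n M s (ks (Suc j)) z \<partial>lborel)"
      unfolding Kn_def s_def[symmetric] real_norm_def[symmetric]
    proof (rule Bochner_Integration.integral_norm_bound_integral)
      show i2: "integrable lborel (\<lambda>z. C * cond_density \<alpha> n M s (ks (Suc j)) z)"
        using tot by (auto simp: has_bochner_integral_iff)
      show le: "norm (F (y(Suc j := rnd M (ks (Suc j)) z)) * cond_density \<alpha> n M s (ks (Suc j)) z)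
          \<le> C * cond_density \<alpha> n M s (ks (Suc j)) z" for z
        using assms(1,6) by (auto simp: abs_mult cond_density_nonneg intro!: mult_right_mono)
      show "integrable lborel (\<lambda>z. F (y(Suc j := rnd M (ks (Suc j)) z)) * cond_density \<alpha> n M s (ks (Suc j)) z)"
      proof (rule Bochner_Integration.integrable_bound[OF i2])
        show "AE z in lborel. norm (F (y(Suc j := rnd M (ks (Suc j)) z)) * cond_density \<alpha> n M s (ks (Suc j)) z)
          \<le> norm (C * cond_density \<alpha> n M s (ks (Suc j)) z)"
          using le C assms(1) by (intro AE_I2) (auto simp: abs_mult cond_density_nonneg)
        show "(\<lambda>z. F (y(Suc j := rnd M (ks (Suc j)) z)) * cond_density \<alpha> n M s (ks (Suc j)) z) \<in> borel_measurable lborel"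
          unfolding rnd_def cond_density_def st_def by measurable
      qed
    qed
    also have "\<dots> = C" using tot by (simp add: has_bochner_integral_iff)
    finally show ?thesis .
  qed
qed

lemma Kl_bounded:
  assumes "\<And>y. \<bar>F y\<bar> \<le> C" "cwise_cont F"
  shows "\<bar>Kl \<alpha> ts j F y\<bar> \<le> C"
proof -
  have C: "C \<ge> 0" using assms(1)[of y] by linarith
  note [measurable] = cwise_cont_measurable_slice[OF assms(2)]
  have "\<bar>Kl \<alpha> ts j F y\<bar> \<le> (\<integral>z. C * std_normal_density z \<partial>lborel)"
    unfolding Kl_def real_norm_def[symmetric]
  proof (rule Bochner_Integration.integral_norm_bound_integral)
    show i: "integrable lborel (\<lambda>z. C * std_normal_density z)" by simp
    show le: "norm (F (y(Suc j := kmean \<alpha> (ts j) (ts (Suc j)) * y j + sqrt (kvar \<alpha> (ts j) (ts (Suc j))) * z)) * std_normal_density z)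
        \<le> C * std_normal_density z" for z
      using assms by (auto simp: abs_mult intro!: mult_right_mono)
    show "integrable lborel (\<lambda>z. F (y(Suc j := kmean \<alpha> (ts j) (ts (Suc j)) * y j + sqrt (kvar \<alpha> (ts j) (ts (Suc j))) * z)) * std_normal_density z)"
      by (rule Bochner_Integration.integrable_bound[OF i]) (use le C in \<open>auto simp: abs_mult\<close>)
  qed
  then show ?thesis by simp
qed

lemma Kl_cont:
  assumes "\<And>y. \<bar>F y\<bar> \<le> C" "cwise_cont F"
  shows "cwise_cont (Kl \<alpha> ts j F)"
  unfolding cwise_cont_def
proof (intro allI impI)
  fix ys y assume ys: "cwise ys y"
  note [measurable] = cwise_cont_measurable_slice[OF assms(2)]
  show "(\<lambda>n. Kl \<alpha> ts j F (ys n)) \<longlonglongrightarrow> Kl \<alpha> ts j F y"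
    unfolding Kl_def
  proof (rule integral_dominated_convergence[where w = "\<lambda>z. C * std_normal_density z"])
    show "AE z in lborel. (\<lambda>n. F ((ys n)(Suc j := kmean \<alpha> (ts j) (ts (Suc j)) * ys n j + sqrt (kvar \<alpha> (ts j) (ts (Suc j))) * z)) * std_normal_density z)
      \<longlonglongrightarrow> F (y(Suc j := kmean \<alpha> (ts j) (ts (Suc j)) * y j + sqrt (kvar \<alpha> (ts j) (ts (Suc j))) * z)) * std_normal_density z"
    proof (intro AE_I2 tendsto_mult tendsto_const)
      fix z
      have "(\<lambda>n. ys n j) \<longlonglongrightarrow> y j" using ys by (auto simp: cwise_def)
      then have "cwise (\<lambda>n. (ys n)(Suc j := kmean \<alpha> (ts j) (ts (Suc j)) * ys n j + sqrt (kvar \<alpha> (ts j) (ts (Suc j))) * z))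
         (y(Suc j := kmean \<alpha> (ts j) (ts (Suc j)) * y j + sqrt (kvar \<alpha> (ts j) (ts (Suc j))) * z))"
        by (intro cwise_update ys tendsto_intros)
      then show "(\<lambda>n. F ((ys n)(Suc j := kmean \<alpha> (ts j) (ts (Suc j)) * ys n j + sqrt (kvar \<alpha> (ts j) (ts (Suc j))) * z)))
         \<longlonglongrightarrow> F (y(Suc j := kmean \<alpha> (ts j) (ts (Suc j)) * y j + sqrt (kvar \<alpha> (ts j) (ts (Suc j))) * z))"
        using assms(2) by (auto simp: cwise_cont_def)
    qed
    show "AE z in lborel. norm (F ((ys n)(Suc j := kmean \<alpha> (ts j) (ts (Suc j)) * ys n j + sqrt (kvar \<alpha> (ts j) (ts (Suc j))) * z)) * std_normal_density z)
       \<le> C * std_normal_density z" for n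
      using assms by (auto simp: abs_mult intro!: mult_right_mono)
  qed auto
qed

lemma integral_normal_affine:
  assumes "\<sigma> > 0"
  shows "(\<integral>z. g z * normal_density \<mu> \<sigma> z \<partial>lborel) = (\<integral>x. g (\<mu> + \<sigma> * x) * std_normal_density x \<partial>lborel)"
proof -
  have d: "\<sigma> * normal_density \<mu> \<sigma> (\<mu> + \<sigma> * x) = std_normal_density x" for x
  proof -
    have "sqrt (2 * pi * \<sigma>\<^sup>2) = \<sigma> * sqrt (2 * pi)" using assms by (simp add: real_sqrt_mult)
    then show ?thesis using assms by (simp add: normal_density_def power_mult_distrib)
  qed
  have "(\<integral>z. g z * normal_density \<mu> \<sigma> z \<partial>lborel)
     = \<bar>\<sigma>\<bar> *\<^sub>R (\<integral>x. g (\<mu> + \<sigma> * x) * normal_density \<mu> \<sigma> (\<mu> + \<sigma> * x) \<partial>lborel)"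
    by (rule lborel_integral_real_affine) (use assms in simp)
  also have "\<dots> = (\<integral>x. \<sigma> * (g (\<mu> + \<sigma> * x) * normal_density \<mu> \<sigma> (\<mu> + \<sigma> * x)) \<partial>lborel)" using assms by simp
  also have "\<dots> = (\<integral>x. g (\<mu> + \<sigma> * x) * std_normal_density x \<partial>lborel)"
    unfolding d[symmetric] by (simp add: mult_ac)
  finally show ?thesis .
qed

text \<open>The chain starts at time 2 with difference 0, so grid index 0 stands for time 2 instead
  of time 0.\<close>

definition grid :: "real \<Rightarrow> (nat \<Rightarrow> real) \<Rightarrow> nat \<Rightarrow> nat" where
  "grid M ts j = (if j = 0 then 2 else nat \<lfloor>M * ts j\<rfloor>)"

lemma grid_0 [simp]: "grid M ts 0 = 2" by (simp add: grid_def)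

lemma grid_tendsto:
  assumes m: "filterlim m at_top sequentially" and ts: "ts 0 = 0" "strict_mono ts"
  shows "(\<lambda>n. real (grid (m n) ts j) / m n) \<longlonglongrightarrow> ts j"
proof (cases "j = 0")
  case True
  then show ?thesis using real_tendsto_divide_at_top[OF tendsto_const m, of 2] ts by simp
next
  case False
  have tj: "ts j > 0" using False ts strict_monoD[OF ts(2), of 0 j] by simp
  have mpos: "\<forall>\<^sub>F n in sequentially. m n > 0"
    using filterlim_at_top_dense[THEN iffD1, OF m, rule_format, of 0] .
  show ?thesis
  proof (rule tendsto_sandwich)
    show "(\<lambda>n. ts j - 1 / m n) \<longlonglongrightarrow> ts j"
      using tendsto_diff[OF tendsto_const real_tendsto_divide_at_top[OF tendsto_const m, of 1], of "ts j"] by simp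
    show "\<forall>\<^sub>F n in sequentially. ts j - 1 / m n \<le> real (grid (m n) ts j) / m n"
      using mpos
    proof eventually_elim
      case (elim n)
      have "m n * ts j - 1 \<le> real (grid (m n) ts j)" using False elim tj by (simp add: grid_def)
      then have "(m n * ts j - 1) / m n \<le> real (grid (m n) ts j) / m n" using elim by (intro divide_right_mono) auto
      then show ?case using elim by (simp add: diff_divide_distrib)
    qed
    show "\<forall>\<^sub>F n in sequentially. real (grid (m n) ts j) / m n \<le> ts j"
      using mpos
    proof eventually_elim
      case (elim n)
      have "0 \<le> m n * ts j" using elim tj by simp
      then have "real (grid (m n) ts j) \<le> m n * ts j" using False by (simp add: grid_def)
      then have "real (grid (m n) ts j) / m n \<le> (m n * ts j) / m n" using elim by (intro divide_right_mono) auto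
      then show ?case using elim by simp
    qed
  qed simp
qed

lemma grid_eventually:
  assumes m: "filterlim m at_top sequentially" and mn: "m \<in> o(\<lambda>n. real n)" and ts: "ts 0 = 0" "strict_mono ts"
  shows "\<forall>\<^sub>F n in sequentially. n \<ge> 1 \<and> m n > 0 \<and> (\<forall>j<J. grid (m n) ts j < grid (m n) ts (Suc j)) \<and> grid (m n) ts J \<le> n"
proof -
  have mpos: "\<forall>\<^sub>F n in sequentially. m n > 0"
    using filterlim_at_top_dense[THEN iffD1, OF m, rule_format, of 0] .
  have "\<forall>\<^sub>F n in sequentially. \<forall>j\<in>{..<J}. grid (m n) ts j < grid (m n) ts (Suc j)"
  proof (rule eventually_ball_finite)
    show "\<forall>j\<in>{..<J}. \<forall>\<^sub>F n in sequentially. grid (m n) ts j < grid (m n) ts (Suc j)"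
    proof
      fix j
      have "ts j < ts (Suc j)" using ts by (simp add: strict_mono_def)
      from eventually_less_of_ratio[OF m grid_tendsto[OF m ts] grid_tendsto[OF m ts] this]
      show "\<forall>\<^sub>F n in sequentially. grid (m n) ts j < grid (m n) ts (Suc j)" by simp
    qed
  qed simp
  moreover have "\<forall>\<^sub>F n in sequentially. real (grid (m n) ts J) < real n"
    by (rule eventually_le_of_smallo[OF m mn grid_tendsto[OF m ts]])
  ultimately show ?thesis using mpos eventually_ge_at_top[of 1] by eventually_elim auto
qed

text \<open>Convergence along arbitrary convergent \<open>ys\<close>, with functionals
  \<open>Fn\<close> that vary with \<open>n\<close>, is the form that reproduces itself when the
  next kernel is applied.\<close>

lemma Kn_tendsto:
  fixes m :: "nat \<Rightarrow> real" and ts :: "nat \<Rightarrow> real"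
  assumes \<alpha>: "\<alpha> > 1" and m: "filterlim m at_top sequentially" and mn: "m \<in> o(\<lambda>n. real n)"
    and ts: "ts 0 = 0" "strict_mono ts"
    and Fn: "\<And>ys y. cwise ys y \<Longrightarrow> (\<lambda>n. Fn n (ys n)) \<longlonglongrightarrow> F y"
    and bdn: "\<forall>\<^sub>F n in sequentially. \<forall>y. \<bar>Fn n y\<bar> \<le> C"
    and F: "cwise_cont F" "\<And>y. \<bar>F y\<bar> \<le> C"
    and ys: "cwise ys y"
  shows "(\<lambda>n. Kn \<alpha> n (m n) (grid (m n) ts) j (Fn n) (ys n)) \<longlonglongrightarrow> Kl \<alpha> ts j F y"
proof -
  define s where "s n = start_state (m n) (grid (m n) ts) j (ys n)" for n
  define k' where "k' n = grid (m n) ts (Suc j)" for n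
  define \<sigma> where "\<sigma> = sqrt (kvar \<alpha> (ts j) (ts (Suc j)))"
  define \<mu> where "\<mu> = kmean \<alpha> (ts j) (ts (Suc j)) * y j"
  have tj: "0 \<le> ts j" "ts j < ts (Suc j)" using ts strict_mono_less_eq[OF ts(2), of 0 j]
    by (auto simp: strict_mono_def)
  have \<sigma>: "\<sigma> > 0" using kvar_pos[OF \<alpha> tj] by (simp add: \<sigma>_def)
  have k': "(\<lambda>n. real (k' n) / m n) \<longlonglongrightarrow> ts (Suc j)" unfolding k'_def by (rule grid_tendsto[OF m ts])
  have lim: "(\<lambda>n. cond_density \<alpha> n (m n) (s n) (k' n) z) \<longlonglongrightarrow> normal_density \<mu> \<sigma> z" for z
  proof (cases "j = 0")
    case True
    \<comment> \<open>\<open>cond_density_tendsto\<close> assumes an intermediate time even for the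
      start at \<open>(1, 1)\<close>; half of the target time serves as witness.\<close>
    have "0 < ts (Suc j) / 2" "ts (Suc j) / 2 < ts (Suc j)" using tj by auto
    from cond_density_tendsto(2)[OF \<alpha> m mn _ k' this tendsto_const, where k = "\<lambda>n. nat \<lfloor>m n * (ts (Suc j) / 2)\<rfloor>"]
      grid_tendsto[OF m, of "\<lambda>i. real i * (ts (Suc j) / 2)" 1] tj
    show ?thesis using True ts by (simp add: s_def start_state_def \<mu>_def \<sigma>_def kmean_def grid_def strict_mono_def)
  next
    case False
    then have "ts j > 0" using ts strict_monoD[OF ts(2), of 0 j] by simp
    moreover have "(\<lambda>n. ys n j) \<longlonglongrightarrow> y j" using ys by (auto simp: cwise_def)
    ultimately show ?thesis using False
      cond_density_tendsto(1)[OF \<alpha> m mn grid_tendsto[OF m ts, of j] k' _ tj(2)]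
      by (simp add: s_def start_state_def \<mu>_def \<sigma>_def)
  qed
  have valid: "\<forall>\<^sub>F n in sequentially. has_bochner_integral lborel (cond_density \<alpha> n (m n) (s n) (k' n)) 1"
  proof -
    have ev: "\<forall>\<^sub>F n in sequentially. 1 \<le> fst (s n) \<and> 1 \<le> snd (s n) \<and> fst (s n) + snd (s n) = grid (m n) ts j"
    proof (cases "j = 0")
      case True
      then show ?thesis by (simp add: s_def start_state_def)
    next
      case False
      then have tpos: "ts j > 0" using ts strict_monoD[OF ts(2), of 0 j] by simp
      have "(\<lambda>n. ys n j) \<longlonglongrightarrow> y j" using ys by (auto simp: cwise_def)
      from lat_asymptotics(5)[OF m grid_tendsto[OF m ts, of j] tpos this] show ?thesis
        by eventually_elim (use False in \<open>auto simp: s_def start_state_def st_def\<close>)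
    qed
    show ?thesis using ev grid_eventually[OF m mn ts, of "Suc j"]
    proof eventually_elim
      case (elim n)
      obtain i l where il: "s n = (i, l)" by (cases "s n")
      have "i + l \<le> n" using elim il by (auto simp: less_imp_le order_trans[OF less_imp_le])
      then have "visit \<alpha> (i, l) (n, n) > 0" using elim il by (intro visit_pos) auto
      then show ?case unfolding il k'_def using elim il by (intro cond_density_total) auto
    qed
  qed
  have "(\<lambda>n. \<integral>z. Fn n ((ys n)(Suc j := rnd (m n) (k' n) z)) * cond_density \<alpha> n (m n) (s n) (k' n) z \<partial>lborel)
     \<longlonglongrightarrow> (\<integral>z. F (y(Suc j := z)) * normal_density \<mu> \<sigma> z \<partial>lborel)"
  proof (rule scheffe_weak[OF _ _ _ _ lim])
    show "\<forall>\<^sub>F n in sequentially. integrable lborel (cond_density \<alpha> n (m n) (s n) (k' n)) \<and> (\<integral>z. cond_density \<alpha> n (m n) (s n) (k' n) z \<partial>lborel) = 1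
        \<and> (\<forall>z. cond_density \<alpha> n (m n) (s n) (k' n) z \<ge> 0)"
      using valid grid_eventually[OF m mn ts, of 0]
      by eventually_elim (auto simp: has_bochner_integral_iff cond_density_nonneg)
    show "(\<lambda>n. Fn n ((ys n)(Suc j := rnd (m n) (k' n) z))) \<longlonglongrightarrow> F (y(Suc j := z))" for z
      using tj by (intro Fn cwise_update ys lat_asymptotics(4)[OF m k'] tendsto_const) auto
    show "(\<lambda>z. F (y(Suc j := z))) \<in> borel_measurable lborel"
      using cwise_cont_measurable_slice[OF F(1)] by simp
    show "(\<lambda>z. Fn n ((ys n)(Suc j := rnd (m n) (k' n) z))) \<in> borel_measurable lborel" for n
      unfolding rnd_def by measurable
    show "\<forall>\<^sub>F n in sequentially. \<forall>z. \<bar>Fn n ((ys n)(Suc j := rnd (m n) (k' n) z))\<bar> \<le> C" using bdn by eventually_elim auto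
  qed (use \<sigma> F in auto)
  also have "(\<integral>z. F (y(Suc j := z)) * normal_density \<mu> \<sigma> z \<partial>lborel) = Kl \<alpha> ts j F y"
    unfolding Kl_def \<mu>_def[symmetric] \<sigma>_def[symmetric] by (rule integral_normal_affine[OF \<sigma>])
  finally show ?thesis unfolding Kn_def s_def k'_def .
qed

lemma iterK_tendsto:
  fixes m :: "nat \<Rightarrow> real" and ts :: "nat \<Rightarrow> real"
  assumes \<alpha>: "\<alpha> > 1" and m: "filterlim m at_top sequentially" and mn: "m \<in> o(\<lambda>n. real n)"
    and ts: "ts 0 = 0" "strict_mono ts"
    and Fn: "\<And>ys y. cwise ys y \<Longrightarrow> (\<lambda>n. Fn n (ys n)) \<longlonglongrightarrow> F y"
    and bdn: "\<forall>\<^sub>F n in sequentially. \<forall>y. \<bar>Fn n y\<bar> \<le> C"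
    and F: "cwise_cont F" "\<And>y. \<bar>F y\<bar> \<le> C"
  shows "(\<lambda>n. iterK (Kn \<alpha> n (m n) (grid (m n) ts)) J (Fn n)) \<longlonglongrightarrow> iterK (Kl \<alpha> ts) J F"
  using Fn bdn F
proof (induction J arbitrary: Fn F)
  case 0
  show ?case using "0.prems"(1)[OF cwise_const] by simp
next
  case (Suc J)
  show ?case unfolding iterK.simps
  proof (rule Suc.IH)
    show "(\<lambda>n. Kn \<alpha> n (m n) (grid (m n) ts) J (Fn n) (ys n)) \<longlonglongrightarrow> Kl \<alpha> ts J F y" if "cwise ys y" for ys y
      by (rule Kn_tendsto[OF \<alpha> m mn ts Suc.prems that])
    show "\<forall>\<^sub>F n in sequentially. \<forall>y. \<bar>Kn \<alpha> n (m n) (grid (m n) ts) J (Fn n) y\<bar> \<le> C"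
      using grid_eventually[OF m mn ts, of "Suc J"] Suc.prems(2)
    proof eventually_elim
      case (elim n)
      then show ?case by (intro allI Kn_bounded) (auto simp: less_imp_le)
    qed
    show "cwise_cont (Kl \<alpha> ts J F)" by (rule Kl_cont[OF Suc.prems(4,3)])
    show "\<bar>Kl \<alpha> ts J F y\<bar> \<le> C" for y by (rule Kl_bounded[OF Suc.prems(4,3)])
  qed
qed

definition path_vec :: "real \<Rightarrow> (nat \<Rightarrow> nat) \<Rightarrow> nat \<Rightarrow> (nat \<times> nat) list \<Rightarrow> nat \<Rightarrow> real" where
  "path_vec M ks j p = (\<lambda>i. if 1 \<le> i \<and> i \<le> j then
     (real (fst (p ! (ks j - ks i))) - real (snd (p ! (ks j - ks i)))) / sqrt M else 0)"

text \<open>The denominator \<open>visit \<alpha> s (n, n)\<close> of \<open>cond_density\<close> at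
  one grid time cancels against the numerator at the preceding one, so that only the weight of
  \<open>(1, 1)\<close> remains.\<close>

lemma path_expect_iterK:
  assumes "M > 0" "ks 0 = 2" "\<And>j. j < J \<Longrightarrow> ks j < ks (Suc j)" "ks J \<le> 2 * n" "n \<ge> 1"
  shows "path_expect \<alpha> (ks J - 2) (\<lambda>p. visit \<alpha> (hd p) (n, n) * F (path_vec M ks J p))
     = visit \<alpha> (1, 1) (n, n) * iterK (Kn \<alpha> n M ks) J F"
  using assms(3,4)
proof (induction J arbitrary: F)
  case 0
  have "path_vec M ks 0 p = (\<lambda>_. 0)" for p by (auto simp: path_vec_def)
  then show ?case using assms by simp
next
  case (Suc J)
  define d where "d = ks (Suc J) - ks J"
  define l where "l = ks J - 2"
  have "ks J < ks (Suc J)" using Suc.prems by simp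
  have ks2: "ks i \<ge> 2" if "i \<le> J" for i
    using that
  proof (induction i)
    case (Suc i)
    then show ?case using \<open>\<And>j. j < Suc J \<Longrightarrow> ks j < ks (Suc j)\<close>[of i] by simp
  qed (simp add: assms(2))
  have mono: "ks i \<le> ks J" if "i \<le> J" for i
  proof -
    have "j \<le> J \<longrightarrow> ks i \<le> ks j" if "i \<le> j" for j
      using that
    proof (induction j rule: dec_induct)
      case (step j)
      then show ?case using Suc.prems(1)[of j] by auto
    qed simp
    then show ?thesis using that by auto
  qed
  have ld: "ks (Suc J) - 2 = l + d" "ks (Suc J) = ks J + d" using ks2[of J] \<open>ks J < ks (Suc J)\<close> by (auto simp: l_def d_def)
  have "path_expect \<alpha> (ks (Suc J) - 2) (\<lambda>p. visit \<alpha> (hd p) (n, n) * F (path_vec M ks (Suc J) p))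
     = path_expect \<alpha> (l + d) (\<lambda>p. (\<lambda>q s. visit \<alpha> s (n, n) * F ((path_vec M ks J q)(Suc J := (real (fst s) - real (snd s)) / sqrt M))) (drop d p) (hd p))"
    unfolding ld(1)
  proof (rule path_expect_cong)
    fix p assume p: "p \<in> paths (l + d)"
    have len: "length p = Suc (l + d)" using paths_hd[OF p] by simp
    have "path_vec M ks (Suc J) p = (path_vec M ks J (drop d p))(Suc J := (real (fst (hd p)) - real (snd (hd p))) / sqrt M)"
    proof
      fix i
      show "path_vec M ks (Suc J) p i = ((path_vec M ks J (drop d p))(Suc J := (real (fst (hd p)) - real (snd (hd p))) / sqrt M)) i"
      proof (cases "i = Suc J")
        case True
        then show ?thesis using len by (simp add: path_vec_def hd_conv_nth[of p] length_greater_0_conv[symmetric] del: length_greater_0_conv)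
      next
        case False
        have "d + (ks J - ks i) = ks (Suc J) - ks i" if "i \<le> J" using mono[OF that] ld by simp
        then show ?thesis using False len by (auto simp: path_vec_def)
      qed
    qed
    then show "visit \<alpha> (hd p) (n, n) * F (path_vec M ks (Suc J) p) =
       (\<lambda>q s. visit \<alpha> s (n, n) * F ((path_vec M ks J q)(Suc J := (real (fst s) - real (snd s)) / sqrt M))) (drop d p) (hd p)"
      by simp
  qed
  also have "\<dots> = path_expect \<alpha> l (\<lambda>p. hop \<alpha> d (\<lambda>s. visit \<alpha> s (n, n) * F ((path_vec M ks J p)(Suc J := (real (fst s) - real (snd s)) / sqrt M))) (hd p))"
    by (rule path_expect_hop)
  also have "\<dots> = path_expect \<alpha> l (\<lambda>p. visit \<alpha> (hd p) (n, n) * Kn \<alpha> n M ks J F (path_vec M ks J p))"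
  proof (rule path_expect_cong)
    fix p assume p: "p \<in> paths l"
    obtain i j where ij: "hd p = (i, j)" by (cases "hd p")
    have ij1: "1 \<le> i" "1 \<le> j" "i + j = ks J" using paths_hd[OF p] ij ks2[of J] by (auto simp: l_def)
    have len: "length p = Suc l" using paths_hd[OF p] by simp
    have s: "start_state M ks J (path_vec M ks J p) = (i, j)"
    proof (cases "J = 0")
      case True
      then have "p = [(1, 1)]" using p assms(2) by (simp add: l_def)
      then show ?thesis using True ij by (simp add: start_state_def)
    next
      case False
      then have "path_vec M ks J p J = (real i - real j) / sqrt M"
        using len ij by (simp add: path_vec_def hd_conv_nth[of p, symmetric] length_greater_0_conv[symmetric] del: length_greater_0_conv)
      then show ?thesis using False st_exact[OF ij1(3) assms(1)] by (simp add: start_state_def)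
    qed
    define \<Phi> where "\<Phi> x = F ((path_vec M ks J p)(Suc J := x))" for x
    define g where "g s = visit \<alpha> s (n, n) * \<Phi> ((real (fst s) - real (snd s)) / sqrt M)" for s
    have K: "Kn \<alpha> n M ks J F (path_vec M ks J p) = hop \<alpha> d g (i, j) / visit \<alpha> (i, j) (n, n)"
      unfolding Kn_def s ld(2) g_def
      using cond_density_integral[OF ij1(1,2) assms(1), of "ks J + d" d \<Phi> \<alpha> n] ij1
      by (simp add: has_bochner_integral_iff \<Phi>_def)
    \<comment> \<open>If \<open>(n, n)\<close> is out of reach, the quotient \<open>K\<close> is 0
      by division by zero; the identity persists because every term of the numerator
      vanishes.\<close>
    have "hop \<alpha> d g (i, j) = 0" if "visit \<alpha> (i, j) (n, n) = 0"
    proof -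
      have "hop \<alpha> d (\<lambda>s. visit \<alpha> s (n, n)) (i, j) = 0"
        using that hop_visit[of i j d n \<alpha>] Suc.prems ij1 ld by simp
      then have "\<forall>a\<in>{..d}. visit \<alpha> (i + a, j + (d - a)) (n, n) * visit \<alpha> (i, j) (i + a, j + (d - a)) = 0"
        unfolding hop_eq_sum[of \<alpha> d "\<lambda>s. visit \<alpha> s (n, n)"]
        by (subst (asm) sum_nonneg_eq_0_iff) (auto intro!: mult_nonneg_nonneg hop_nonneg)
      then show ?thesis unfolding hop_eq_sum[of \<alpha> d g] g_def by (intro sum.neutral) auto
    qed
    then show "hop \<alpha> d (\<lambda>s. visit \<alpha> s (n, n) * F ((path_vec M ks J p)(Suc J := (real (fst s) - real (snd s)) / sqrt M))) (hd p)
       = visit \<alpha> (hd p) (n, n) * Kn \<alpha> n M ks J F (path_vec M ks J p)"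
      unfolding K ij g_def[symmetric, unfolded \<Phi>_def] by (auto simp: g_def[abs_def] \<Phi>_def[abs_def])
  qed
  also have "\<dots> = visit \<alpha> (1, 1) (n, n) * iterK (Kn \<alpha> n M ks) (Suc J) F"
    unfolding l_def iterK.simps using Suc.prems \<open>ks J < ks (Suc J)\<close>
    by (intro Suc.IH order_trans[OF less_imp_le[OF \<open>ks J < ks (Suc J)\<close>]]) auto
  finally show ?case .
qed

section \<open>Finite-dimensional distributions of the limit process\<close>

lemma cwise_cont_measurable:
  assumes "cwise_cont F"
  shows "F \<in> borel_measurable borel"
proof (rule borel_measurable_continuous_onI, rule continuous_at_imp_continuous_on, intro ballI)
  fix y :: "nat \<Rightarrow> real"
  show "isCont F y"
  proof (rule continuous_at_sequentiallyI)
    fix u :: "nat \<Rightarrow> nat \<Rightarrow> real" assume u: "u \<longlonglongrightarrow> y"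
    have "(\<lambda>n. u n i) \<longlonglongrightarrow> y i" for i
    proof -
      have "isCont (\<lambda>y::nat \<Rightarrow> real. y i) y"
        by (rule continuous_on_interior[OF continuous_on_product_coordinates]) simp
      then show ?thesis using u by (rule isCont_tendsto_compose)
    qed
    then have "cwise u y" by (simp add: cwise_def)
    then show "(\<lambda>n. F (u n)) \<longlonglongrightarrow> F y" using assms by (auto simp: cwise_cont_def)
  qed
qed

lemma (in prob_space) indep_var_integral:
  assumes ind: "indep_var S X T Y" and \<Phi>: "\<Phi> \<in> borel_measurable (S \<Otimes>\<^sub>M T)" and bd: "\<And>x. \<bar>\<Phi> x\<bar> \<le> (C::real)"
  shows "(\<integral>\<omega>. \<Phi> (X \<omega>, Y \<omega>) \<partial>M) = (\<integral>\<omega>. (\<integral>\<omega>'. \<Phi> (X \<omega>, Y \<omega>') \<partial>M) \<partial>M)"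
proof -
  note [measurable] = indep_var_rv1[OF ind] indep_var_rv2[OF ind] \<Phi>
  have eq: "distr M S X \<Otimes>\<^sub>M distr M T Y = distr M (S \<Otimes>\<^sub>M T) (\<lambda>x. (X x, Y x))"
    using ind by (simp add: indep_var_distribution_eq)
  interpret X: prob_space "distr M S X" by (rule prob_space_distr) simp
  interpret Y: prob_space "distr M T Y" by (rule prob_space_distr) simp
  interpret XY: pair_prob_space "distr M S X" "distr M T Y" ..
  have int: "integrable (distr M S X \<Otimes>\<^sub>M distr M T Y) \<Phi>"
    by (rule XY.P.integrable_const_bound[of _ C]) (use bd in auto)
  have "(\<integral>\<omega>. \<Phi> (X \<omega>, Y \<omega>) \<partial>M) = (\<integral>x. \<Phi> x \<partial>(distr M S X \<Otimes>\<^sub>M distr M T Y))"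
    unfolding eq by (subst integral_distr) auto
  also have "\<dots> = (\<integral>x. (\<integral>y. \<Phi> (x, y) \<partial>distr M T Y) \<partial>distr M S X)"
    by (rule XY.integral_fst'[symmetric]) (rule int)
  also have "\<dots> = (\<integral>\<omega>. (\<integral>y. \<Phi> (X \<omega>, y) \<partial>distr M T Y) \<partial>M)"
    by (subst integral_distr) auto
  also have "\<dots> = (\<integral>\<omega>. (\<integral>\<omega>'. \<Phi> (X \<omega>, Y \<omega>') \<partial>M) \<partial>M)"
    by (intro Bochner_Integration.integral_cong refl, subst integral_distr) (auto dest: measurable_space[OF indep_var_rv1[OF ind]])
  finally show ?thesis .
qed

definition H_vec :: "real \<Rightarrow> (real \<Rightarrow> 'b \<Rightarrow> real) \<Rightarrow> (nat \<Rightarrow> real) \<Rightarrow> nat \<Rightarrow> 'b \<Rightarrow> nat \<Rightarrow> real" where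
  "H_vec \<alpha> B ts j \<omega> = (\<lambda>i. if i \<le> j then H_alpha \<alpha> B \<omega> (ts i) else 0)"

text \<open>The value of \<open>H\<close> at \<open>ts (Suc j)\<close> is \<open>\<kappa>\<close>
  times its value at \<open>ts j\<close> plus \<open>\<gamma> (Suc j)\<close> times an increment of
  \<open>B\<close> in the clock \<open>t powr (2 * \<alpha> - 1)\<close>, independent of the earlier
  increments. The claim is the resulting Markov property in kernel form.\<close>

lemma H_vec_step:
  assumes \<alpha>: "\<alpha> > 1" and B: "std_brownian_motion M B" and ts: "ts 0 = 0" "strict_mono ts"
    and F: "cwise_cont F" "\<And>y. \<bar>F y\<bar> \<le> C"
  shows "(\<integral>\<omega>. F (H_vec \<alpha> B ts (Suc j) \<omega>) \<partial>M) = (\<integral>\<omega>. Kl \<alpha> ts j F (H_vec \<alpha> B ts j \<omega>) \<partial>M)"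
proof -
  interpret prob_space M using B by (auto simp: std_brownian_motion_def)
  have Bm [measurable]: "B t \<in> borel_measurable M" for t using B by (auto simp: std_brownian_motion_def)
  have B0: "B 0 \<omega> = 0" if "\<omega> \<in> space M" for \<omega> using B that by (auto simp: std_brownian_motion_def)
  define b where "b i = ts i powr (2 * \<alpha> - 1)" for i
  define \<gamma> where "\<gamma> i = (2 * \<alpha> - 1) powr (-1/2) * ts i powr (1 - \<alpha>)" for i
  define I where "I i \<omega> = B (b (Suc i)) \<omega> - B (b i) \<omega>" for i \<omega>
  have ts_pos: "ts i > 0" if "i \<ge> 1" for i using ts strict_monoD[OF ts(2), of 0 i] that by simp
  have ts_nonneg: "ts i \<ge> 0" for i using ts_pos[of i] ts(1) by (cases i) auto
  have ts_less: "ts i < ts (Suc i)" for i using ts by (simp add: strict_mono_def)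
  have b0: "b 0 = 0" by (simp add: b_def ts)
  have b_less: "b i < b (Suc i)" for i unfolding b_def using ts_less ts_nonneg \<alpha> by (intro powr_less_mono2) auto
  have b_nonneg: "b i \<ge> 0" for i by (simp add: b_def)
  have H: "H_alpha \<alpha> B \<omega> (ts i) = (if i = 0 then 0 else \<gamma> i * B (b i) \<omega>)" for i \<omega>
    using ts_pos[of i] ts(1) by (auto simp: H_alpha_def \<gamma>_def b_def)
  have tele: "B (b i) \<omega> = (\<Sum>l<i. I l \<omega>)" if "\<omega> \<in> space M" for i \<omega>
    using B0[OF that] b0 by (induction i) (auto simp: I_def)
  have ind: "indep_vars (\<lambda>_. borel) I {..<Suc j}"
    using B b0 b_less unfolding std_brownian_motion_def I_def[abs_def] by auto
  have iv: "indep_var (PiM {..<j} (\<lambda>_. borel)) (\<lambda>\<omega>. restrict (\<lambda>i. I i \<omega>) {..<j}) (PiM {j} (\<lambda>_. borel)) (\<lambda>\<omega>. restrict (\<lambda>i. I i \<omega>) {j})"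
    by (rule indep_var_restrict[OF ind]) auto
  \<comment> \<open>Rebuilds the earlier positions from the increments, so that independence of the
    increments passes to \<open>H_vec\<close>.\<close>
  define G where "G u = (\<lambda>i. if 1 \<le> i \<and> i \<le> j then \<gamma> i * (\<Sum>l<i. u l) else 0 :: real)" for u :: "nat \<Rightarrow> real"
  have Gm: "G \<in> measurable (PiM {..<j} (\<lambda>_. borel)) borel"
  proof (rule measurable_coordinatewise_then_product)
    fix i
    have "(\<lambda>u::nat \<Rightarrow> real. \<Sum>l<i. u l) \<in> borel_measurable (PiM {..<j} (\<lambda>_. borel))" if "i \<le> j"
      by (rule borel_measurable_sum[of "{..<i}" "\<lambda>l u. u l"], rule measurable_component_singleton)
         (use that in auto)
    then show "(\<lambda>x. G x i) \<in> borel_measurable (PiM {..<j} (\<lambda>_. borel))"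
      unfolding G_def by (cases "1 \<le> i \<and> i \<le> j") (auto intro!: borel_measurable_times)
  qed
  \<comment> \<open>The last increment is stored as a constant sequence, since
    \<open>indep_var\<close> takes both variables in one type.\<close>
  have Jm: "(\<lambda>u _. u j) \<in> measurable (PiM {j} (\<lambda>_. borel)) (borel :: (nat \<Rightarrow> real) measure)"
    by (rule measurable_coordinatewise_then_product, rule measurable_component_singleton) simp
  have "indep_var borel (G \<circ> (\<lambda>\<omega>. restrict (\<lambda>i. I i \<omega>) {..<j})) borel ((\<lambda>u _. u j) \<circ> (\<lambda>\<omega>. restrict (\<lambda>i. I i \<omega>) {j}))"
    by (rule indep_var_compose[OF iv Gm Jm])
  moreover define U where "U = G \<circ> (\<lambda>\<omega>. restrict (\<lambda>i. I i \<omega>) {..<j})"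
  moreover have "(\<lambda>u (_::nat). u j) \<circ> (\<lambda>\<omega>. restrict (\<lambda>i. I i \<omega>) {j}) = (\<lambda>\<omega> (_::nat). I j \<omega>)" by (auto simp: fun_eq_iff)
  ultimately have UI: "indep_var borel U borel (\<lambda>\<omega> _. I j \<omega>)" by (simp only:)
  have U: "U \<omega> = H_vec \<alpha> B ts j \<omega>" if "\<omega> \<in> space M" for \<omega>
  proof
    fix i
    show "U \<omega> i = H_vec \<alpha> B ts j \<omega> i"
    proof (cases "1 \<le> i \<and> i \<le> j")
      case True
      then have "(\<Sum>l<i. restrict (\<lambda>i. I i \<omega>) {..<j} l) = (\<Sum>l<i. I l \<omega>)" by (intro sum.cong) auto
      then show ?thesis using True tele[OF that, of i] by (simp add: U_def G_def H_vec_def H)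
    qed (auto simp: U_def G_def H_vec_def H)
  qed
  define \<kappa> where "\<kappa> = kmean \<alpha> (ts j) (ts (Suc j))"
  define \<Phi> where "\<Phi> x = F ((fst x)(Suc j := \<kappa> * fst x j + \<gamma> (Suc j) * snd x 0))" for x :: "(nat \<Rightarrow> real) \<times> (nat \<Rightarrow> real)"
  have Fm [measurable]: "F \<in> borel_measurable borel" by (rule cwise_cont_measurable[OF F(1)])
  have \<Phi>m: "\<Phi> \<in> borel_measurable (borel \<Otimes>\<^sub>M borel)"
  proof -
    have "(\<lambda>x::(nat \<Rightarrow> real) \<times> (nat \<Rightarrow> real). (fst x)(Suc j := \<kappa> * fst x j + \<gamma> (Suc j) * snd x 0)) \<in> borel_measurable (borel \<Otimes>\<^sub>M borel)"
    proof (rule measurable_coordinatewise_then_product)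
      fix i
      have m: "(\<lambda>x::(nat \<Rightarrow> real) \<times> (nat \<Rightarrow> real). fst x l) \<in> borel_measurable (borel \<Otimes>\<^sub>M borel)" for l
        by (rule measurable_product_then_coordinatewise) simp
      have m2: "(\<lambda>x::(nat \<Rightarrow> real) \<times> (nat \<Rightarrow> real). snd x l) \<in> borel_measurable (borel \<Otimes>\<^sub>M borel)" for l
        by (rule measurable_product_then_coordinatewise) simp
      show "(\<lambda>x::(nat \<Rightarrow> real) \<times> (nat \<Rightarrow> real). ((fst x)(Suc j := \<kappa> * fst x j + \<gamma> (Suc j) * snd x 0)) i) \<in> borel_measurable (borel \<Otimes>\<^sub>M borel)"
        using m m2 by (cases "i = Suc j") (auto intro!: borel_measurable_add borel_measurable_times)
    qed
    from measurable_compose[OF this Fm] show ?thesis by (simp add: \<Phi>_def[abs_def])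
  qed
  have step: "H_vec \<alpha> B ts (Suc j) \<omega> = (U \<omega>)(Suc j := \<kappa> * U \<omega> j + \<gamma> (Suc j) * I j \<omega>)" if w: "\<omega> \<in> space M" for \<omega>
  proof -
    have "H_alpha \<alpha> B \<omega> (ts (Suc j)) = \<kappa> * H_alpha \<alpha> B \<omega> (ts j) + \<gamma> (Suc j) * I j \<omega>"
    proof (cases "j = 0")
      case True
      then show ?thesis using B0[OF w] b0 by (simp add: H I_def)
    next
      case False
      have "\<kappa> * \<gamma> j = \<gamma> (Suc j)"
        unfolding \<kappa>_def kmean_def \<gamma>_def using ts_pos[of j] ts_pos[of "Suc j"] False by (simp add: powr_divide)
      then show ?thesis using False by (auto simp: H I_def algebra_simps)
    qed
    then show ?thesis unfolding U[OF w] by (auto simp: H_vec_def fun_eq_iff le_Suc_eq)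
  qed
  have "(\<integral>\<omega>. F (H_vec \<alpha> B ts (Suc j) \<omega>) \<partial>M) = (\<integral>\<omega>. \<Phi> (U \<omega>, \<lambda>_. I j \<omega>) \<partial>M)"
    by (intro Bochner_Integration.integral_cong refl) (simp add: step \<Phi>_def)
  also have "\<dots> = (\<integral>\<omega>. (\<integral>\<omega>'. \<Phi> (U \<omega>, \<lambda>_. I j \<omega>') \<partial>M) \<partial>M)"
    by (rule indep_var_integral[OF UI \<Phi>m, of C]) (simp add: \<Phi>_def F)
  also have "\<dots> = (\<integral>\<omega>. Kl \<alpha> ts j F (H_vec \<alpha> B ts j \<omega>) \<partial>M)"
  proof (intro Bochner_Integration.integral_cong refl)
    fix \<omega> assume w: "\<omega> \<in> space M"
    define y where "y = U \<omega>"
    define s where "s = sqrt (b (Suc j) - b j)"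
    have s: "s > 0" using b_less[of j] by (simp add: s_def)
    \<comment> \<open>The clock increment \<open>s^2\<close> times the squared prefactor
      \<open>\<gamma> (Suc j)\<close> is exactly \<open>kvar\<close>; the limit of the urn and the
      definition of \<open>H_alpha\<close> meet here.\<close>
    have sc: "\<gamma> (Suc j) * (0 + s * x) = sqrt (kvar \<alpha> (ts j) (ts (Suc j))) * x" for x
    proof -
      define t where "t = ts (Suc j)"
      have t: "t > 0" unfolding t_def by (rule ts_pos) simp
      have g2: "(\<gamma> (Suc j))\<^sup>2 = t powr (2 - 2 * \<alpha>) / (2 * \<alpha> - 1)"
      proof -
        have pw: "(x powr a)\<^sup>2 = x powr (2 * a)" for x a :: real by (simp add: power2_eq_square powr_add[symmetric])
        have "(\<gamma> (Suc j))\<^sup>2 = (2 * \<alpha> - 1) powr (- 1) * t powr (2 * (1 - \<alpha>))"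
          unfolding \<gamma>_def t_def[symmetric] power_mult_distrib pw by simp
        then show ?thesis using \<alpha> by (simp add: powr_neg_one right_diff_distrib)
      qed
      have "(\<gamma> (Suc j) * s)\<^sup>2 = t powr (2 - 2 * \<alpha>) / (2 * \<alpha> - 1) * (t powr (2 * \<alpha> - 1) - ts j powr (2 * \<alpha> - 1))"
        using b_less[of j] by (simp add: power_mult_distrib g2 s_def b_def t_def)
      also have "\<dots> = kvar \<alpha> (ts j) t"
      proof -
        have "t powr (2 - 2 * \<alpha>) * t powr (2 * \<alpha> - 1) = t" using t by (simp add: powr_add[symmetric])
        moreover have "t powr (2 - 2 * \<alpha>) * ts j powr (2 * \<alpha> - 1) = t * (ts j / t) powr (2 * \<alpha> - 1)"
        proof -
          have "(ts j / t) powr (2 * \<alpha> - 1) = ts j powr (2 * \<alpha> - 1) / t powr (2 * \<alpha> - 1)"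
            using t ts_nonneg by (simp add: powr_divide)
          moreover have "t powr (2 - 2 * \<alpha>) = t / t powr (2 * \<alpha> - 1)"
            using t powr_diff[of t 1 "2 * \<alpha> - 1"] by simp
          ultimately show ?thesis by simp
        qed
        ultimately show ?thesis unfolding kvar_def by (simp add: right_diff_distrib diff_divide_distrib)
      qed
      finally have "sqrt ((\<gamma> (Suc j) * s)\<^sup>2) = sqrt (kvar \<alpha> (ts j) t)" by simp
      moreover have "\<gamma> (Suc j) * s \<ge> 0" using s by (simp add: \<gamma>_def)
      ultimately show ?thesis by (simp add: t_def)
    qed
    have dist: "distributed M lborel (I j) (\<lambda>x. ennreal (normal_density 0 s x))"
      using B b_less[of j] b_nonneg[of j] unfolding std_brownian_motion_def I_def[abs_def] s_def by auto
    have slice: "(\<lambda>x. F (y(Suc j := \<kappa> * y j + \<gamma> (Suc j) * x))) \<in> borel_measurable lborel"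
      using measurable_compose[OF _ cwise_cont_measurable_slice[OF F(1), of y "Suc j"], of "\<lambda>x. \<kappa> * y j + \<gamma> (Suc j) * x" borel] by simp
    have "(\<integral>\<omega>'. \<Phi> (y, \<lambda>_. I j \<omega>') \<partial>M) = (\<integral>\<omega>'. (\<lambda>x. F (y(Suc j := \<kappa> * y j + \<gamma> (Suc j) * x))) (I j \<omega>') \<partial>M)"
      by (simp add: \<Phi>_def)
    also have "\<dots> = (\<integral>x. normal_density 0 s x * F (y(Suc j := \<kappa> * y j + \<gamma> (Suc j) * x)) \<partial>lborel)"
      by (rule distributed_integral[OF dist slice, symmetric]) auto
    also have "\<dots> = (\<integral>x. F (y(Suc j := \<kappa> * y j + \<gamma> (Suc j) * x)) * normal_density 0 s x \<partial>lborel)" by (simp add: mult.commute)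
    also have "\<dots> = (\<integral>x. F (y(Suc j := \<kappa> * y j + \<gamma> (Suc j) * (0 + s * x))) * std_normal_density x \<partial>lborel)"
      by (rule integral_normal_affine[OF s])
    also have "\<dots> = (\<integral>x. F (y(Suc j := \<kappa> * y j + sqrt (kvar \<alpha> (ts j) (ts (Suc j))) * x)) * std_normal_density x \<partial>lborel)"
      unfolding sc ..
    finally show "(\<integral>\<omega>'. \<Phi> (U \<omega>, \<lambda>_. I j \<omega>') \<partial>M) = Kl \<alpha> ts j F (H_vec \<alpha> B ts j \<omega>)"
      unfolding U[OF w, symmetric] y_def[symmetric] Kl_def \<kappa>_def .
  qed
  finally show ?thesis .
qed

lemma H_vec_iterK:
  assumes \<alpha>: "\<alpha> > 1" and B: "std_brownian_motion M B" and ts: "ts 0 = 0" "strict_mono ts"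
    and F: "cwise_cont F" "\<And>y. \<bar>F y\<bar> \<le> C"
  shows "(\<integral>\<omega>. F (H_vec \<alpha> B ts J \<omega>) \<partial>M) = iterK (Kl \<alpha> ts) J F"
  using F
proof (induction J arbitrary: F)
  case 0
  interpret prob_space M using B by (auto simp: std_brownian_motion_def)
  have "H_vec \<alpha> B ts 0 \<omega> = (\<lambda>_. 0)" for \<omega> using ts by (auto simp: H_vec_def H_alpha_def)
  then show ?case by (simp add: prob_space)
next
  case (Suc J)
  have "(\<integral>\<omega>. F (H_vec \<alpha> B ts (Suc J) \<omega>) \<partial>M) = (\<integral>\<omega>. Kl \<alpha> ts J F (H_vec \<alpha> B ts J \<omega>) \<partial>M)"
    by (rule H_vec_step[OF \<alpha> B ts Suc.prems])
  also have "\<dots> = iterK (Kl \<alpha> ts) J (Kl \<alpha> ts J F)"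
    by (rule Suc.IH) (use Kl_cont[OF Suc.prems(2,1)] Kl_bounded[OF Suc.prems(2,1)] in auto)
  finally show ?case by simp
qed

section \<open>Functionals continuous for locally uniform convergence\<close>

definition locunif :: "(nat \<Rightarrow> real \<Rightarrow> real) \<Rightarrow> (real \<Rightarrow> real) \<Rightarrow> bool" where
  "locunif xs x \<longleftrightarrow> (\<forall>T \<epsilon>. \<epsilon> > 0 \<longrightarrow> (\<forall>\<^sub>F n in sequentially. \<forall>t\<in>{0..T}. \<bar>xs n t - x t\<bar> \<le> \<epsilon>))"

definition lu_fun :: "((real \<Rightarrow> real) \<Rightarrow> real) \<Rightarrow> bool" where
  "lu_fun f \<longleftrightarrow> (\<exists>C. \<forall>x. \<bar>f x\<bar> \<le> C) \<and> (\<forall>x. \<not> cadlag x \<longrightarrow> f x = 0) \<and>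
     (\<forall>xs x. cadlag x \<longrightarrow> (\<forall>n. cadlag (xs n)) \<longrightarrow> locunif xs x \<longrightarrow> (\<lambda>n. f (xs n)) \<longlonglongrightarrow> f x)"

lemma lu_funD:
  "lu_fun f \<Longrightarrow> cadlag x \<Longrightarrow> (\<And>n. cadlag (xs n)) \<Longrightarrow> locunif xs x \<Longrightarrow> (\<lambda>n. f (xs n)) \<longlonglongrightarrow> f x"
  by (simp add: lu_fun_def)

text \<open>Locally uniform convergence is Skorohod convergence with identity time changes, so
  continuity in the Skorohod sense is the stronger demand.\<close>

lemma skorohod_test_fun_imp_lu_fun:
  assumes "skorohod_test_fun f"
  shows "lu_fun f"
proof -
  have "skorohod_conv xs x" if "locunif xs x" for xs x
    unfolding skorohod_conv_def
  proof (intro exI[of _ "\<lambda>_ t. t"] conjI allI impI)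
    show "(\<lambda>t. t) \<in> time_changes" by (auto simp: time_changes_def strict_mono_on_def continuous_on_id)
    show "\<forall>\<^sub>F n in sequentially. \<forall>t\<ge>0. \<bar>t - t\<bar> \<le> \<epsilon>" if "\<epsilon> > 0" for \<epsilon> :: real using that by simp
    show "\<forall>\<^sub>F n in sequentially. \<forall>t\<in>{0..T}. \<bar>xs n t - x t\<bar> \<le> \<epsilon>" if "\<epsilon> > 0" for T \<epsilon>
      using \<open>locunif xs x\<close> that by (auto simp: locunif_def)
  qed
  then show ?thesis using assms unfolding skorohod_test_fun_def lu_fun_def by blast
qed

lemma lu_fun_uminus: "lu_fun f \<Longrightarrow> lu_fun (\<lambda>x. - f x)"
  unfolding lu_fun_def by (auto intro!: tendsto_minus)

definition step_path :: "real \<Rightarrow> (nat \<Rightarrow> real) \<Rightarrow> real \<Rightarrow> real" where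
  "step_path c a t = a (nat \<lfloor>c * t\<rfloor>)"

lemma cadlag_step_path:
  assumes c: "c > 0"
  shows "cadlag (step_path c a)"
  unfolding cadlag_def
proof (intro conjI allI impI)
  fix t :: real assume "t \<ge> 0"
  have "\<forall>\<^sub>F s in at_right t. step_path c a s = step_path c a t"
  proof (rule eventually_at_rightI[of t "(\<lfloor>c * t\<rfloor> + 1) / c"])
    have "c * t < \<lfloor>c * t\<rfloor> + 1" by linarith
    then show "t < (\<lfloor>c * t\<rfloor> + 1) / c" using c by (simp add: field_simps)
    fix s assume s: "s \<in> {t<..<(\<lfloor>c * t\<rfloor> + 1) / c}"
    then have "c * s < \<lfloor>c * t\<rfloor> + 1" "c * t \<le> c * s" using c by (auto simp: field_simps)
    then have "\<lfloor>c * s\<rfloor> = \<lfloor>c * t\<rfloor>" by linarith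
    then show "step_path c a s = step_path c a t" by (simp add: step_path_def)
  qed
  then show "continuous (at_right t) (step_path c a)"
    unfolding continuous_within by (rule tendsto_eventually)
next
  fix t :: real assume "t > 0"
  have "\<forall>\<^sub>F s in at_left t. step_path c a s = a (nat (\<lceil>c * t\<rceil> - 1))"
  proof (rule eventually_at_leftI[of "(\<lceil>c * t\<rceil> - 1) / c"])
    have "\<lceil>c * t\<rceil> - 1 < c * t" by linarith
    then show "(\<lceil>c * t\<rceil> - 1) / c < t" using c by (simp add: field_simps)
    fix s assume s: "s \<in> {(\<lceil>c * t\<rceil> - 1) / c<..<t}"
    then have "\<lceil>c * t\<rceil> - 1 < c * s" "c * s < c * t" using c by (auto simp: field_simps)
    then have "\<lfloor>c * s\<rfloor> = \<lceil>c * t\<rceil> - 1" by linarith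
    then show "step_path c a s = a (nat (\<lceil>c * t\<rceil> - 1))" by (simp add: step_path_def)
  qed
  then show "\<exists>l. (step_path c a \<longlongrightarrow> l) (at_left t)" using tendsto_eventually by blast
qed

lemma locunif_step_path:
  assumes c: "c > 0" and "cwise as a"
  shows "locunif (\<lambda>n. step_path c (as n)) (step_path c a)"
  unfolding locunif_def
proof (intro allI impI)
  fix T \<epsilon> :: real assume e: "\<epsilon> > 0"
  have "\<forall>\<^sub>F n in sequentially. \<forall>i\<in>{..nat \<lfloor>c * T\<rfloor>}. \<bar>as n i - a i\<bar> \<le> \<epsilon>"
  proof (rule eventually_ball_finite)
    show "\<forall>i\<in>{..nat \<lfloor>c * T\<rfloor>}. \<forall>\<^sub>F n in sequentially. \<bar>as n i - a i\<bar> \<le> \<epsilon>"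
    proof
      fix i
      have "(\<lambda>n. as n i) \<longlonglongrightarrow> a i" using assms by (auto simp: cwise_def)
      from tendstoD[OF this e] show "\<forall>\<^sub>F n in sequentially. \<bar>as n i - a i\<bar> \<le> \<epsilon>"
        by eventually_elim (auto simp: dist_real_def)
    qed
  qed simp
  then show "\<forall>\<^sub>F n in sequentially. \<forall>t\<in>{0..T}. \<bar>step_path c (as n) t - step_path c a t\<bar> \<le> \<epsilon>"
  proof eventually_elim
    case (elim n)
    show ?case
    proof
      fix t assume "t \<in> {0..T}"
      then have "nat \<lfloor>c * t\<rfloor> \<le> nat \<lfloor>c * T\<rfloor>" using c by (intro nat_mono floor_mono mult_left_mono) auto
      then show "\<bar>step_path c (as n) t - step_path c a t\<bar> \<le> \<epsilon>" using elim by (auto simp: step_path_def)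
    qed
  qed
qed

lemma lu_fun_step_path_cont:
  assumes "lu_fun f" "c > 0"
  shows "cwise_cont (\<lambda>a. f (step_path c a))"
  unfolding cwise_cont_def
proof (intro allI impI)
  fix as a assume "cwise as a"
  then have lu: "locunif (\<lambda>n. step_path c (as n)) (step_path c a)" by (rule locunif_step_path[OF assms(2)])
  show "(\<lambda>n. f (step_path c (as n))) \<longlonglongrightarrow> f (step_path c a)"
    by (rule lu_funD[OF assms(1) _ _ lu]) (simp_all add: cadlag_step_path[OF assms(2)])
qed

lemma scaled_path_eq_step_path:
  "scaled_path M X Y \<omega> = step_path M (\<lambda>k. real_of_int (Delta X Y k \<omega>) / sqrt M)"
  by (auto simp: scaled_path_def step_path_def)

text \<open>\<open>pd\<close> is a bounded pseudometric for locally uniform convergence in which the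
  tolerance \<open>e\<close> also sets the horizon \<open>1 / e\<close>. Inserting 1 keeps the set
  nonempty.\<close>

definition pd_set :: "(real \<Rightarrow> real) \<Rightarrow> (real \<Rightarrow> real) \<Rightarrow> real set" where
  "pd_set x y = insert 1 {e. e > 0 \<and> (\<forall>t\<in>{0..1/e}. \<bar>x t - y t\<bar> \<le> e)}"

definition pd :: "(real \<Rightarrow> real) \<Rightarrow> (real \<Rightarrow> real) \<Rightarrow> real" where
  "pd x y = Inf (pd_set x y)"

lemma pd_set_pos: "e \<in> pd_set x y \<Longrightarrow> e > 0"
  by (auto simp: pd_set_def)

lemma bdd_below_pd_set: "bdd_below (pd_set x y)"
  by (rule bdd_belowI[of _ 0]) (auto dest: pd_set_pos)

lemma pd_nonneg: "pd x y \<ge> 0"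
  unfolding pd_def by (rule cInf_greatest) (auto simp: pd_set_def)

lemma pd_le: "e \<in> pd_set x y \<Longrightarrow> pd x y \<le> e"
  unfolding pd_def by (rule cInf_lower[OF _ bdd_below_pd_set])

lemma pd_le_1: "pd x y \<le> 1"
  by (rule pd_le) (simp add: pd_set_def)

lemma pd_leI: "e > 0 \<Longrightarrow> (\<And>t. 0 \<le> t \<Longrightarrow> t \<le> 1 / e \<Longrightarrow> \<bar>x t - y t\<bar> \<le> e) \<Longrightarrow> pd x y \<le> e"
  by (rule pd_le) (auto simp: pd_set_def)

lemma pd_lessD:
  assumes "pd x y < e"
  obtains e' where "e' \<in> pd_set x y" "e' < e"
  using assms cInf_lessD[of "pd_set x y" e] unfolding pd_def by (auto simp: pd_set_def)

lemma pd_sym: "pd x y = pd y x"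
  by (simp add: pd_def pd_set_def abs_minus_commute)

lemma pd_refl: "pd x x = 0"
proof (rule antisym[OF field_le_epsilon pd_nonneg])
  fix e :: real assume "e > 0"
  then show "pd x x \<le> 0 + e" by (intro pd_leI) auto
qed

text \<open>A smaller tolerance comes with a longer interval, so up to \<open>1 / (e1 + e2)\<close>
  both estimates are available. The inserted tolerance 1 may carry no information, but then
  \<open>pd_le_1\<close> suffices.\<close>

lemma pd_triangle: "pd x z \<le> pd x y + pd y z"
proof (rule field_le_epsilon)
  fix e :: real assume e: "e > 0"
  obtain e1 where e1: "e1 \<in> pd_set x y" "e1 < pd x y + e / 2" using pd_lessD[of x y "pd x y + e / 2"] e by auto
  obtain e2 where e2: "e2 \<in> pd_set y z" "e2 < pd y z + e / 2" using pd_lessD[of y z "pd y z + e / 2"] e by auto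
  have pos: "e1 > 0" "e2 > 0" using e1 e2 pd_set_pos by auto
  have "pd x z \<le> e1 + e2"
  proof (cases "e1 = 1 \<or> e2 = 1")
    case True
    then show ?thesis using pd_le_1[of x z] pos by auto
  next
    case False
    show ?thesis
    proof (rule pd_leI)
      fix t assume t: "0 \<le> t" "t \<le> 1 / (e1 + e2)"
      have "1 / (e1 + e2) \<le> 1 / e1" "1 / (e1 + e2) \<le> 1 / e2" using pos by (auto simp: field_simps)
      then have "t \<le> 1 / e1" "t \<le> 1 / e2" using t by linarith+
      then have "\<bar>x t - y t\<bar> \<le> e1" "\<bar>y t - z t\<bar> \<le> e2" using e1 e2 False t by (auto simp: pd_set_def)
      then show "\<bar>x t - z t\<bar> \<le> e1 + e2" by linarith
    qed (use pos in simp)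
  qed
  then show "pd x z \<le> pd x y + pd y z + e" using e1 e2 by linarith
qed

lemma locunif_imp_pd:
  assumes "locunif xs x"
  shows "(\<lambda>n. pd (xs n) x) \<longlonglongrightarrow> 0"
proof (rule LIMSEQ_I)
  fix r :: real assume r: "r > 0"
  then have "\<forall>\<^sub>F n in sequentially. \<forall>t\<in>{0..1 / (r / 2)}. \<bar>xs n t - x t\<bar> \<le> r / 2"
    using assms unfolding locunif_def by (meson half_gt_zero)
  then have "\<forall>\<^sub>F n in sequentially. norm (pd (xs n) x - 0) < r"
  proof eventually_elim
    case (elim n)
    have "pd (xs n) x \<le> r / 2" by (rule pd_leI) (use elim r in auto)
    then show ?case using pd_nonneg[of "xs n" x] r by simp
  qed
  then show "\<exists>no. \<forall>n\<ge>no. norm (pd (xs n) x - 0) < r" by (simp add: eventually_sequentially)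
qed

lemma pd_imp_locunif:
  assumes "(\<lambda>n. pd (xs n) x) \<longlonglongrightarrow> 0"
  shows "locunif xs x"
  unfolding locunif_def
proof (intro allI impI)
  fix T \<epsilon> :: real assume e: "\<epsilon> > 0"
  define d where "d = min 1 (min \<epsilon> (1 / (\<bar>T\<bar> + 1)))"
  have d: "d > 0" using e by (simp add: d_def add_nonneg_pos)
  have d2: "d \<le> 1" "d \<le> \<epsilon>" "d \<le> 1 / (\<bar>T\<bar> + 1)"
    unfolding d_def by (rule min.cobounded1, (rule min.coboundedI2, rule min.cobounded1), (rule min.coboundedI2, rule min.cobounded2))
  note d = d d2
  have "\<bar>T\<bar> + 1 \<le> 1 / d" using d by (simp add: field_simps)
  then have Td: "T \<le> 1 / d" by linarith
  have "\<forall>\<^sub>F n in sequentially. pd (xs n) x < d" using order_tendstoD(2)[OF assms d(1)] .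
  then show "\<forall>\<^sub>F n in sequentially. \<forall>t\<in>{0..T}. \<bar>xs n t - x t\<bar> \<le> \<epsilon>"
  proof eventually_elim
    case (elim n)
    then obtain e' where e': "e' \<in> pd_set (xs n) x" "e' < d" by (rule pd_lessD)
    then have pos: "e' > 0" and ne: "e' \<noteq> 1" using pd_set_pos d by auto
    have "1 / d \<le> 1 / e'" using e' pos d by (intro divide_left_mono) auto
    show ?case
    proof
      fix t assume "t \<in> {0..T}"
      then have "t \<in> {0..1 / e'}" using Td \<open>1 / d \<le> 1 / e'\<close> by auto
      then have "\<bar>xs n t - x t\<bar> \<le> e'" using e' ne by (auto simp: pd_set_def)
      then show "\<bar>xs n t - x t\<bar> \<le> \<epsilon>" using e' d by linarith
    qed
  qed
qed

text \<open>The infimal convolution of \<open>f\<close> with \<open>k * pd\<close>: for bounded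
  \<open>f\<close>, the largest \<open>k\<close>-Lipschitz minorant on cadlag paths.\<close>

definition lip_env :: "((real \<Rightarrow> real) \<Rightarrow> real) \<Rightarrow> real \<Rightarrow> (real \<Rightarrow> real) \<Rightarrow> real" where
  "lip_env f k x = (if cadlag x then Inf ((\<lambda>y. f y + k * pd x y) ` Collect cadlag) else 0)"

lemma lip_env_bounds:
  assumes "\<And>x. \<bar>f x\<bar> \<le> C" "k \<ge> 0" "cadlag x"
  shows "bdd_below ((\<lambda>y. f y + k * pd x y) ` Collect cadlag)" "- C \<le> lip_env f k x" "lip_env f k x \<le> f x"
proof -
  have ge: "- C \<le> f y + k * pd x y" for y
    using assms(1)[of y] mult_nonneg_nonneg[OF assms(2) pd_nonneg[of x y]] by linarith
  then show bdd: "bdd_below ((\<lambda>y. f y + k * pd x y) ` Collect cadlag)" by (intro bdd_belowI[of _ "- C"]) auto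
  show "- C \<le> lip_env f k x" using assms(3) ge unfolding lip_env_def by (auto intro!: cINF_greatest)
  have "lip_env f k x \<le> f x + k * pd x x"
    using assms(3) unfolding lip_env_def by (auto intro!: cINF_lower[OF bdd])
  then show "lip_env f k x \<le> f x" by (simp add: pd_refl)
qed

lemma lip_env_abs_le:
  assumes "\<And>x. \<bar>f x\<bar> \<le> C" "k \<ge> 0"
  shows "\<bar>lip_env f k x\<bar> \<le> C"
proof (cases "cadlag x")
  case True
  have "lip_env f k x \<le> f x" "- C \<le> lip_env f k x" using lip_env_bounds(2,3)[of f C k x] assms True by auto
  then show ?thesis using assms(1)[of x] by linarith
next
  case False
  then show ?thesis using assms(1)[of x] by (simp add: lip_env_def)
qed

lemma lip_env_lipschitz:
  assumes "\<And>x. \<bar>f x\<bar> \<le> C" "k \<ge> 0" "cadlag x" "cadlag z"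
  shows "\<bar>lip_env f k x - lip_env f k z\<bar> \<le> k * pd x z"
proof -
  have *: "lip_env f k x - k * pd x z \<le> lip_env f k z" if "cadlag x" "cadlag z" for x z
  proof -
    have "lip_env f k x - k * pd x z \<le> f y + k * pd z y" if "cadlag y" for y
    proof -
      have "lip_env f k x \<le> f y + k * pd x y"
        using \<open>cadlag x\<close> that unfolding lip_env_def by (auto intro!: cINF_lower lip_env_bounds(1)[of f C k x] assms)
      also have "\<dots> \<le> f y + k * (pd x z + pd z y)" using assms(2) by (intro add_left_mono mult_left_mono pd_triangle)
      finally show ?thesis by (simp add: distrib_left)
    qed
    then show ?thesis using \<open>cadlag z\<close> unfolding lip_env_def[of f k z] by (auto intro!: cINF_greatest)
  qed
  show ?thesis using *[OF assms(3,4)] *[OF assms(4,3)] pd_sym[of x z] by (simp add: abs_le_iff)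
qed

lemma lip_env_lu_fun:
  assumes "lu_fun f" "k \<ge> 0"
  shows "lu_fun (lip_env f k)"
proof -
  obtain C where C: "\<And>x. \<bar>f x\<bar> \<le> C" using assms by (auto simp: lu_fun_def)
  have "(\<lambda>n. lip_env f k (xs n)) \<longlonglongrightarrow> lip_env f k x" if "cadlag x" "\<And>n. cadlag (xs n)" "locunif xs x" for xs x
  proof -
    have "(\<lambda>n. lip_env f k (xs n) - lip_env f k x) \<longlonglongrightarrow> 0"
    proof (rule Lim_null_comparison)
      show "\<forall>\<^sub>F n in sequentially. norm (lip_env f k (xs n) - lip_env f k x) \<le> k * pd (xs n) x"
        using lip_env_lipschitz[of f C k] C assms(2) that by auto
      show "(\<lambda>n. k * pd (xs n) x) \<longlonglongrightarrow> 0"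
        using tendsto_mult[OF tendsto_const locunif_imp_pd[OF that(3)], of k] by simp
    qed
    then show ?thesis by (simp add: LIM_zero_iff)
  qed
  moreover have "\<bar>lip_env f k x\<bar> \<le> C" for x using lip_env_abs_le[of f C k x] C assms(2) by auto
  moreover have "\<not> cadlag x \<Longrightarrow> lip_env f k x = 0" for x by (simp add: lip_env_def)
  ultimately show ?thesis unfolding lu_fun_def by blast
qed

text \<open>Near \<open>x\<close> continuity bounds \<open>f y\<close> from below; at distance
  \<open>d\<close> or more the penalty \<open>k * d \<ge> 2 * C\<close> outweighs the oscillation of
  \<open>f\<close>.\<close>

lemma lip_env_tendsto:
  assumes f: "lu_fun f"
  shows "(\<lambda>k. lip_env f (real k) x) \<longlonglongrightarrow> f x"
proof (cases "cadlag x")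
  case False
  then show ?thesis using f by (simp add: lip_env_def lu_fun_def)
next
  case True
  obtain C where C: "\<And>x. \<bar>f x\<bar> \<le> C" using f by (auto simp: lu_fun_def)
  show ?thesis
  proof (rule LIMSEQ_I)
    fix r :: real assume r: "r > 0"
    have "\<exists>d>0. \<forall>y. cadlag y \<longrightarrow> pd x y < d \<longrightarrow> f y \<ge> f x - r / 2"
    proof (rule ccontr)
      assume "\<not> ?thesis"
      then have "\<forall>n::nat. \<exists>y. cadlag y \<and> pd x y < inverse (real (Suc n)) \<and> f y < f x - r / 2"
        by (metis inverse_positive_iff_positive not_le of_nat_0_less_iff zero_less_Suc)
      then obtain ys where ys: "\<And>n. cadlag (ys n)" "\<And>n. pd x (ys n) < inverse (real (Suc n))" "\<And>n. f (ys n) < f x - r / 2"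
        by metis
      have pd0: "(\<lambda>n. pd (ys n) x) \<longlonglongrightarrow> 0"
        by (rule tendsto_sandwich[OF _ _ tendsto_const LIMSEQ_inverse_real_of_nat])
           (use ys(2) pd_nonneg in \<open>auto simp: pd_sym[of _ x] less_imp_le\<close>)
      have "(\<lambda>n. f (ys n)) \<longlonglongrightarrow> f x" by (rule lu_funD[OF f True ys(1) pd_imp_locunif[OF pd0]])
      then have "f x \<le> f x - r / 2" by (rule LIMSEQ_le_const2) (use ys(3) in \<open>auto intro: less_imp_le\<close>)
      then show False using r by simp
    qed
    then obtain d where d: "d > 0" "\<And>y. cadlag y \<Longrightarrow> pd x y < d \<Longrightarrow> f y \<ge> f x - r / 2" by auto
    obtain k0 :: nat where k0: "real k0 \<ge> 2 * C / d" using real_arch_simple by blast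
    show "\<exists>no. \<forall>k\<ge>no. norm (lip_env f (real k) x - f x) < r"
    proof (intro exI[of _ k0] allI impI)
      fix k assume k: "k \<ge> k0"
      have "2 * C \<le> real k0 * d" using k0 d by (simp add: field_simps)
      also have "\<dots> \<le> real k * d" using k d by (intro mult_right_mono) auto
      finally have kd: "2 * C \<le> real k * d" .
      have "f x - r / 2 \<le> f y + real k * pd x y" if "cadlag y" for y
      proof (cases "pd x y < d")
        case True
        then show ?thesis using d(2)[OF that] mult_nonneg_nonneg[OF of_nat_0_le_iff pd_nonneg[of x y], of k] by linarith
      next
        case False
        then have "real k * d \<le> real k * pd x y" by (intro mult_left_mono) auto
        then show ?thesis using kd C[of x] C[of y] r by (auto simp: abs_le_iff)
      qed
      then have "f x - r / 2 \<le> lip_env f (real k) x" using True unfolding lip_env_def by (auto intro!: cINF_greatest)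
      moreover have "lip_env f (real k) x \<le> f x" using lip_env_bounds(3)[of f C "real k" x] C True by auto
      ultimately show "norm (lip_env f (real k) x - f x) < r" using r by simp
    qed
  qed
qed

lemma cwise_cont_penalty:
  assumes "\<And>i y. i \<in> I \<Longrightarrow> F i y = max 0 (G i y)" "\<And>i. i \<in> I \<Longrightarrow> cwise_cont (G i)"
  shows "cwise_cont (\<lambda>y. min 1 (\<Sum>i\<in>I. F i y))"
  unfolding cwise_cont_def
proof (intro allI impI tendsto_min tendsto_const tendsto_sum)
  fix ys y i assume *: "cwise ys y" "i \<in> I"
  then have "(\<lambda>n. G i (ys n)) \<longlonglongrightarrow> G i y" using assms(2) by (auto simp: cwise_cont_def)
  then show "(\<lambda>n. F i (ys n)) \<longlonglongrightarrow> F i y" using assms(1)[OF *(2)] by (simp add: tendsto_max)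
qed

lemma strict_mono_scaled: "c > 0 \<Longrightarrow> strict_mono (\<lambda>i. real i / c)"
  by (auto simp: strict_mono_def divide_strict_right_mono)

lemma continuous_on_unif:
  fixes h :: "real \<Rightarrow> real"
  assumes "continuous_on {0..} h" "e > 0"
  obtains d where "d > 0" "\<And>s t. 0 \<le> s \<Longrightarrow> s \<le> T \<Longrightarrow> 0 \<le> t \<Longrightarrow> t \<le> T \<Longrightarrow> \<bar>s - t\<bar> < d \<Longrightarrow> \<bar>h s - h t\<bar> < e"
proof -
  have "uniformly_continuous_on {0..T} h"
    by (rule compact_uniformly_continuous) (auto intro: continuous_on_subset[OF assms(1)])
  then obtain d where "d > 0" "\<And>s t. s \<in> {0..T} \<Longrightarrow> t \<in> {0..T} \<Longrightarrow> dist t s < d \<Longrightarrow> dist (h t) (h s) < e"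
    unfolding uniformly_continuous_on_def using assms(2) by metis
  then show thesis using that[of d] by (auto simp: dist_real_def abs_minus_commute)
qed

lemma locunif_step_approx:
  fixes h :: "real \<Rightarrow> real"
  assumes h: "continuous_on {0..} h"
  shows "locunif (\<lambda>K. step_path (real (Suc K)) (\<lambda>i. h (real i / real (Suc K)))) h"
  unfolding locunif_def
proof (intro allI impI)
  fix T \<epsilon> :: real assume e: "\<epsilon> > 0"
  obtain d where d: "d > 0" "\<And>s t. 0 \<le> s \<Longrightarrow> s \<le> T \<Longrightarrow> 0 \<le> t \<Longrightarrow> t \<le> T \<Longrightarrow> \<bar>s - t\<bar> < d \<Longrightarrow> \<bar>h s - h t\<bar> < \<epsilon>"
    using continuous_on_unif[OF h e] by metis
  have "\<forall>\<^sub>F K in sequentially. inverse (real (Suc K)) < d"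
    using order_tendstoD(2)[OF LIMSEQ_inverse_real_of_nat d(1)] .
  then show "\<forall>\<^sub>F K in sequentially. \<forall>t\<in>{0..T}. \<bar>step_path (real (Suc K)) (\<lambda>i. h (real i / real (Suc K))) t - h t\<bar> \<le> \<epsilon>"
  proof eventually_elim
    case (elim K)
    show ?case
    proof
      fix t assume t: "t \<in> {0..T}"
      define c where "c = real (Suc K)"
      have c: "c > 0" by (simp add: c_def)
      define s where "s = real (nat \<lfloor>c * t\<rfloor>) / c"
      have "real (nat \<lfloor>c * t\<rfloor>) \<le> c * t" "c * t < real (nat \<lfloor>c * t\<rfloor>) + 1" using t c by (auto simp: of_nat_nat)
      then have s: "s \<le> t" "t < s + inverse c" using c by (auto simp: s_def field_simps)
      have "\<bar>h s - h t\<bar> < \<epsilon>" by (rule d(2)) (use s t c elim in \<open>auto simp: s_def c_def\<close>)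
      then show "\<bar>step_path (real (Suc K)) (\<lambda>i. h (real i / real (Suc K))) t - h t\<bar> \<le> \<epsilon>"
        by (simp add: step_path_def s_def c_def)
    qed
  qed
qed

section \<open>Convergence of the conditioned chain\<close>

locale urn_limit =
  fixes \<alpha> :: real and m :: "nat \<Rightarrow> real" and N :: "'a measure" and X Y :: "nat \<Rightarrow> 'a \<Rightarrow> nat"
    and M :: "'b measure" and B :: "real \<Rightarrow> 'b \<Rightarrow> real"
  assumes alpha: "\<alpha> > 1" and m_top: "filterlim m at_top sequentially" and m_small: "m \<in> o(\<lambda>n. real n)"
    and chain: "urn_chain \<alpha> N X Y" and bm: "std_brownian_motion M B"
begin

sublocale N: prob_space N using chain by (auto simp: urn_chain_def)
sublocale M: prob_space M using bm by (auto simp: std_brownian_motion_def)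

lemma measurable_XY [measurable]: "X k \<in> measurable N (count_space UNIV)" "Y k \<in> measurable N (count_space UNIV)"
  using chain by (auto simp: urn_chain_def)

lemma measurable_B [measurable]: "B t \<in> borel_measurable M"
  using bm by (auto simp: std_brownian_motion_def)

lemma measurable_Delta [measurable]: "(\<lambda>\<omega>. real_of_int (Delta X Y k \<omega>)) \<in> borel_measurable N"
  unfolding Delta_def by measurable

lemma measurable_H [measurable]: "(\<lambda>\<omega>. H_alpha \<alpha> B \<omega> t) \<in> borel_measurable M"
  unfolding H_alpha_def by measurable

definition CE :: "nat \<Rightarrow> ('a \<Rightarrow> real) \<Rightarrow> real" where
  "CE n g = (\<integral>\<omega>. indicator (BINGO N X Y n n) \<omega> * g \<omega> \<partial>N) / measure N (BINGO N X Y n n)"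

lemma sets_BINGO [measurable]: "BINGO N X Y i j \<in> sets N"
  unfolding BINGO_def by measurable

lemma CE_prefix:
  assumes "n \<ge> 1" "l \<le> 2 * n - 2"
  shows "(\<integral>\<omega>. indicator (BINGO N X Y n n) \<omega> * F (prefix X Y l \<omega>) \<partial>N) = path_expect \<alpha> l (\<lambda>p. visit \<alpha> (hd p) (n, n) * F p)"
  by (rule integral_BINGO_prefix[OF chain assms])

lemma measure_BINGO:
  assumes "n \<ge> 1" "l \<le> 2 * n - 2"
  shows "measure N (BINGO N X Y n n) = path_expect \<alpha> l (\<lambda>p. visit \<alpha> (hd p) (n, n))"
  using CE_prefix[OF assms, of "\<lambda>_. 1"] by simp

lemma measure_BINGO_eq:
  assumes "n \<ge> 1"
  shows "measure N (BINGO N X Y n n) = visit \<alpha> (1, 1) (n, n)"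
  using measure_BINGO[OF assms, of 0] by simp

lemma measure_BINGO_pos:
  assumes "n \<ge> 1"
  shows "measure N (BINGO N X Y n n) > 0"
  using measure_BINGO_eq[OF assms] visit_pos[of 1 1 n \<alpha>] assms by simp

lemma CE_integrable:
  fixes g :: "'a \<Rightarrow> real"
  assumes "g \<in> borel_measurable N" "\<And>\<omega>. \<bar>g \<omega>\<bar> \<le> C"
  shows "integrable N (\<lambda>\<omega>. indicator (BINGO N X Y n n) \<omega> * g \<omega>)"
proof (rule N.integrable_const_bound[of _ C])
  have "C \<ge> 0" using assms(2)[of undefined] by linarith
  then show "AE \<omega> in N. norm (indicator (BINGO N X Y n n) \<omega> * g \<omega>) \<le> C"
    using assms(2) by (intro AE_I2) (auto simp: indicator_def)
qed (use assms in measurable)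

lemma CE_add:
  assumes "f \<in> borel_measurable N" "\<And>\<omega>. \<bar>f \<omega>\<bar> \<le> C" "g \<in> borel_measurable N" "\<And>\<omega>. \<bar>g \<omega>\<bar> \<le> D"
  shows "CE n (\<lambda>\<omega>. f \<omega> + g \<omega>) = CE n f + CE n g"
  unfolding CE_def
  by (simp add: distrib_left Bochner_Integration.integral_add CE_integrable[OF assms(1,2)] CE_integrable[OF assms(3,4)] add_divide_distrib)

lemma CE_cmult: "CE n (\<lambda>\<omega>. c * g \<omega>) = c * CE n g"
proof -
  have "(\<integral>\<omega>. indicator (BINGO N X Y n n) \<omega> * (c * g \<omega>) \<partial>N) = (\<integral>\<omega>. c * (indicator (BINGO N X Y n n) \<omega> * g \<omega>) \<partial>N)"
    by (simp add: mult_ac)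
  then show ?thesis by (simp add: CE_def)
qed

lemma CE_const: "n \<ge> 1 \<Longrightarrow> CE n (\<lambda>_. c) = c"
  using measure_BINGO_pos[of n] by (simp add: CE_def)

lemma CE_mono:
  assumes "AE \<omega> in N. f \<omega> \<le> g \<omega>" "f \<in> borel_measurable N" "\<And>\<omega>. \<bar>f \<omega>\<bar> \<le> C" "g \<in> borel_measurable N" "\<And>\<omega>. \<bar>g \<omega>\<bar> \<le> D"
  shows "CE n f \<le> CE n g"
  unfolding CE_def
proof (intro divide_right_mono integral_mono_AE CE_integrable[OF assms(2,3)] CE_integrable[OF assms(4,5)])
  show "AE \<omega> in N. indicator (BINGO N X Y n n) \<omega> * f \<omega> \<le> indicator (BINGO N X Y n n) \<omega> * g \<omega>"
    using assms(1) by eventually_elim (auto simp: indicator_def)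
qed simp

lemma CE_sum:
  assumes "finite I" "\<And>i. i \<in> I \<Longrightarrow> f i \<in> borel_measurable N" "\<And>i \<omega>. i \<in> I \<Longrightarrow> \<bar>f i \<omega>\<bar> \<le> C"
  shows "CE n (\<lambda>\<omega>. \<Sum>i\<in>I. f i \<omega>) = (\<Sum>i\<in>I. CE n (f i))"
proof -
  have "(\<integral>\<omega>. indicator (BINGO N X Y n n) \<omega> * (\<Sum>i\<in>I. f i \<omega>) \<partial>N) = (\<Sum>i\<in>I. \<integral>\<omega>. indicator (BINGO N X Y n n) \<omega> * f i \<omega> \<partial>N)"
    unfolding sum_distrib_left by (rule Bochner_Integration.integral_sum) (rule CE_integrable[OF assms(2,3)])
  then show ?thesis by (simp add: CE_def sum_divide_distrib)
qed

definition X_vec :: "real \<Rightarrow> (nat \<Rightarrow> real) \<Rightarrow> nat \<Rightarrow> 'a \<Rightarrow> nat \<Rightarrow> real" where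
  "X_vec R ts J \<omega> = (\<lambda>i. if i \<le> J then scaled_path R X Y \<omega> (ts i) else 0)"

lemma measurable_X_vec [measurable]: "X_vec R ts J \<in> borel_measurable N"
  unfolding X_vec_def[abs_def] scaled_path_def
  by (rule measurable_coordinatewise_then_product) simp

text \<open>Grid time \<open>i\<close> sits at position \<open>grid R ts J - grid R ts i\<close> of
  the reversed list. At index 0 both sides are 0, since \<open>Delta\<close> at time 0 is 0 by
  definition.\<close>

lemma X_vec_eq_path_vec:
  assumes "ts 0 = 0" "\<And>j. j < J \<Longrightarrow> grid R ts j < grid R ts (Suc j)"
  shows "X_vec R ts J \<omega> = path_vec R (grid R ts) J (prefix X Y (grid R ts J - 2) \<omega>)"
proof
  fix i
  have mono: "i \<le> j \<longrightarrow> j \<le> J \<longrightarrow> grid R ts i \<le> grid R ts j" for i j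
  proof (induction j)
    case (Suc j)
    then show ?case using assms(2)[of j] by (auto simp: le_Suc_eq)
  qed simp
  show "X_vec R ts J \<omega> i = path_vec R (grid R ts) J (prefix X Y (grid R ts J - 2) \<omega>) i"
  proof (cases "1 \<le> i \<and> i \<le> J")
    case True
    have g2: "grid R ts i \<ge> 2" "grid R ts i \<le> grid R ts J" using mono[of 0 i] mono[of i J] True by auto
    have "prefix X Y (grid R ts J - 2) \<omega> ! (grid R ts J - grid R ts i) = (X (grid R ts i) \<omega>, Y (grid R ts i) \<omega>)"
      using g2 by (subst prefix_nth) (auto simp: Suc_diff_Suc numeral_2_eq_2)
    moreover have "grid R ts i = nat \<lfloor>R * ts i\<rfloor>" using True by (simp add: grid_def)
    ultimately show ?thesis using True g2 by (simp add: X_vec_def path_vec_def scaled_path_def Delta_def)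
  next
    case False
    then show ?thesis using assms(1) by (cases i) (auto simp: X_vec_def path_vec_def scaled_path_def Delta_def)
  qed
qed

text \<open>Both sides are iterated kernels, by \<open>path_expect_iterK\<close> for the chain and
  by \<open>H_vec_iterK\<close> for the limit, and the kernels converge.\<close>

lemma fdd_tendsto:
  assumes ts: "ts 0 = 0" "strict_mono ts" and F: "cwise_cont F" "\<And>y. \<bar>F y\<bar> \<le> C"
  shows "(\<lambda>n. CE n (\<lambda>\<omega>. F (X_vec (m n) ts J \<omega>))) \<longlonglongrightarrow> (\<integral>\<omega>. F (H_vec \<alpha> B ts J \<omega>) \<partial>M)"
proof -
  have "(\<lambda>n. iterK (Kn \<alpha> n (m n) (grid (m n) ts)) J F) \<longlonglongrightarrow> iterK (Kl \<alpha> ts) J F"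
    by (rule iterK_tendsto[OF alpha m_top m_small ts _ _ F]) (use F in \<open>auto simp: cwise_cont_def\<close>)
  moreover have "\<forall>\<^sub>F n in sequentially. iterK (Kn \<alpha> n (m n) (grid (m n) ts)) J F = CE n (\<lambda>\<omega>. F (X_vec (m n) ts J \<omega>))"
    using grid_eventually[OF m_top m_small ts, of J]
  proof eventually_elim
    case (elim n)
    define ks where "ks = grid (m n) ts"
    have "(\<integral>\<omega>. indicator (BINGO N X Y n n) \<omega> * F (X_vec (m n) ts J \<omega>) \<partial>N) =
       (\<integral>\<omega>. indicator (BINGO N X Y n n) \<omega> * (\<lambda>p. F (path_vec (m n) ks J p)) (prefix X Y (ks J - 2) \<omega>) \<partial>N)"
      using elim by (simp add: X_vec_eq_path_vec[of ts J "m n"] ts(1) ks_def)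
    also have "\<dots> = path_expect \<alpha> (ks J - 2) (\<lambda>p. visit \<alpha> (hd p) (n, n) * F (path_vec (m n) ks J p))"
      by (rule CE_prefix) (use elim in \<open>auto simp: ks_def\<close>)
    also have "\<dots> = visit \<alpha> (1, 1) (n, n) * iterK (Kn \<alpha> n (m n) ks) J F"
      by (rule path_expect_iterK) (use elim in \<open>auto simp: ks_def\<close>)
    finally show ?case using measure_BINGO_pos[of n] measure_BINGO_eq[of n] elim by (simp add: CE_def ks_def)
  qed
  ultimately have "(\<lambda>n. CE n (\<lambda>\<omega>. F (X_vec (m n) ts J \<omega>))) \<longlonglongrightarrow> iterK (Kl \<alpha> ts) J F"
    by (rule Lim_transform_eventually)
  then show ?thesis using H_vec_iterK[OF alpha bm ts F, of J] by simp
qed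

definition drew :: "nat \<Rightarrow> nat \<Rightarrow> real \<Rightarrow> 'a \<Rightarrow> real" where
  "drew k k' \<kappa> \<omega> = indicator {p. drawup (k' - k) p \<ge> \<kappa>} (prefix X Y (k' - 2) \<omega>)"

lemma measurable_drew [measurable]: "drew k k' \<kappa> \<in> borel_measurable N"
  unfolding drew_def[abs_def] using measurable_prefix[OF chain] by measurable

lemma drew_bounded: "\<bar>drew k k' \<kappa> \<omega>\<bar> \<le> 1" and drew_nonneg: "0 \<le> drew k k' \<kappa> \<omega>"
  by (auto simp: drew_def indicator_def)

lemma CE_drew:
  assumes "n \<ge> 1" "2 \<le> k" "k \<le> k'" "k' \<le> 2 * n" "\<kappa> > 0"
  shows "CE n (drew k k' \<kappa>) \<le> 3 * (real (k' - k))\<^sup>2 / \<kappa> ^ 4"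
proof -
  define l where "l = k - 2"
  define L where "L = k' - k"
  have lL: "k' - 2 = l + L" "l + L \<le> 2 * n - 2" using assms by (auto simp: l_def L_def)
  have "(\<integral>\<omega>. indicator (BINGO N X Y n n) \<omega> * drew k k' \<kappa> \<omega> \<partial>N) =
     path_expect \<alpha> (l + L) (\<lambda>p. visit \<alpha> (hd p) (n, n) * indicator {p. drawup L p \<ge> \<kappa>} p)"
    unfolding drew_def L_def[symmetric] lL(1) by (rule CE_prefix[OF assms(1) lL(2)])
  also have "\<dots> \<le> 3 * (real L)\<^sup>2 / \<kappa> ^ 4 * path_expect \<alpha> l (\<lambda>p. visit \<alpha> (hd p) (n, n))"
    by (rule drawup_maximal_inequality) (use alpha assms lL in auto)
  also have "path_expect \<alpha> l (\<lambda>p. visit \<alpha> (hd p) (n, n)) = measure N (BINGO N X Y n n)"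
    by (rule measure_BINGO[symmetric]) (use assms lL in auto)
  finally show ?thesis unfolding CE_def using measure_BINGO_pos[OF assms(1)] by (simp add: L_def divide_le_eq)
qed

lemma drew_zeroD:
  assumes "drew k k' \<kappa> \<omega> = 0" "2 \<le> k" "k \<le> v" "v \<le> u" "u \<le> k'"
  shows "\<bar>real_of_int (Delta X Y u \<omega>)\<bar> - \<bar>real_of_int (Delta X Y v \<omega>)\<bar> < \<kappa>"
proof -
  define p where "p = prefix X Y (k' - 2) \<omega>"
  have "drawup (k' - k) p < \<kappa>" using assms(1) by (auto simp: drew_def p_def indicator_def split: if_splits)
  moreover have "adif (p ! (k' - u)) - adif (p ! (k' - v)) \<le> drawup (k' - k) p"
    by (rule drawup_ge) (use assms in \<open>auto simp: p_def\<close>)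
  moreover have "adif (p ! (k' - w)) = \<bar>real_of_int (Delta X Y w \<omega>)\<bar>" if "k \<le> w" "w \<le> k'" for w
  proof -
    have "k' - 2 + 2 - (k' - w) = w" "k' - w \<le> k' - 2" using that assms by auto
    then have "p ! (k' - w) = (X w \<omega>, Y w \<omega>)" unfolding p_def by (metis prefix_nth)
    then show ?thesis using that assms by (simp add: adif_def Delta_def)
  qed
  ultimately show ?thesis using assms by fastforce
qed

lemma AE_nearest_neighbour:
  "AE \<omega> in N. Delta X Y 2 \<omega> = 0 \<and> (\<forall>k\<ge>2. \<bar>Delta X Y (Suc k) \<omega> - Delta X Y k \<omega>\<bar> \<le> 1)"
proof -
  have "AE \<omega> in N. \<forall>l. prefix X Y l \<omega> \<in> paths l"
    unfolding AE_all_countable using AE_prefix_paths[OF chain] by blast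
  then show ?thesis
  proof eventually_elim
    case (elim \<omega>)
    have "prefix X Y 0 \<omega> \<in> paths 0" using elim by blast
    then have "Delta X Y 2 \<omega> = 0" by (simp add: Delta_def)
    moreover have "\<bar>Delta X Y (Suc k) \<omega> - Delta X Y k \<omega>\<bar> \<le> 1" if "k \<ge> 2" for k
    proof -
      define l where "l = k - 2"
      have k: "k = l + 2" using that by (simp add: l_def)
      have "prefix X Y (Suc l) \<omega> \<in> paths (Suc l)" using elim by blast
      then have "(X (l + 3) \<omega>, Y (l + 3) \<omega>) \<in> {right (X (l + 2) \<omega>, Y (l + 2) \<omega>), up (X (l + 2) \<omega>, Y (l + 2) \<omega>)}"
        by (auto simp del: right_Pair up_Pair)
      then show ?thesis unfolding k by (auto simp: Delta_def numeral_3_eq_3)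
    qed
    ultimately show ?case by blast
  qed
qed

text \<open>Small drawup bounds \<open>\<bar>\<Delta>\<bar>\<close> at \<open>l\<close> from above
  by its value at \<open>k\<close> plus \<open>\<kappa>\<close>; together with a small total fall it
  bounds it from below by that value minus \<open>2 * \<kappa>\<close>. If the sign changes, an
  integer path with unit steps passes through 0 in between, so the two absolute values are below
  \<open>2 * \<kappa>\<close> and \<open>\<kappa>\<close>.\<close>

lemma block_oscillation:
  assumes nn: "\<And>k. k \<ge> 2 \<Longrightarrow> \<bar>Delta X Y (Suc k) \<omega> - Delta X Y k \<omega>\<bar> \<le> 1"
    and k: "2 \<le> k" "k \<le> l" "l \<le> k'"
    and dr: "drew k k' \<kappa> \<omega> = 0"
    and down: "\<bar>real_of_int (Delta X Y k \<omega>)\<bar> - \<bar>real_of_int (Delta X Y k' \<omega>)\<bar> < \<kappa>"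
  shows "\<bar>real_of_int (Delta X Y l \<omega>) - real_of_int (Delta X Y k \<omega>)\<bar> \<le> 3 * \<kappa>"
proof -
  define D where "D w = Delta X Y w \<omega>" for w
  have up1: "\<bar>real_of_int (D u)\<bar> - \<bar>real_of_int (D v)\<bar> < \<kappa>" if "k \<le> v" "v \<le> u" "u \<le> k'" for u v
    unfolding D_def using drew_zeroD[OF dr k(1) that] .
  have lo: "\<bar>real_of_int (D k)\<bar> - 2 * \<kappa> < \<bar>real_of_int (D w)\<bar>" if "k \<le> w" "w \<le> k'" for w
    using up1[of w k'] that down by (auto simp: D_def)
  have \<kappa>: "\<kappa> > 0" using up1[of k k] k by simp
  show ?thesis
  proof (cases "D k * D l \<ge> 0")
    case True
    then have "\<bar>real_of_int (D l) - real_of_int (D k)\<bar> = \<bar>\<bar>real_of_int (D l)\<bar> - \<bar>real_of_int (D k)\<bar>\<bar>"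
      by (auto simp: zero_le_mult_iff)
    then show ?thesis using up1[of k l] lo[of l] k \<kappa> unfolding D_def[symmetric] by linarith
  next
    case False
    have "\<exists>c. k \<le> c \<and> c \<le> l \<and> D c = 0"
    proof (cases "D k \<le> 0")
      case True
      then have "D k \<le> 0" "0 \<le> D l" using False by (auto simp: not_le mult_less_0_iff)
      then show ?thesis using nat_intermed_int_val[of k l D 0] nn k by (auto simp: D_def)
    next
      case F: False
      then have "- D k \<le> 0" "0 \<le> - D l" using False by (auto simp: not_le mult_less_0_iff)
      then show ?thesis using nat_intermed_int_val[of k l "\<lambda>w. - D w" 0] nn k
        by (auto simp: D_def abs_minus_commute)
    qed
    then obtain c where c: "k \<le> c" "c \<le> l" "D c = 0" by auto
    have "\<bar>real_of_int (D l)\<bar> < \<kappa>" using up1[of c l] c k by simp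
    moreover have "\<bar>real_of_int (D k)\<bar> < 2 * \<kappa>" using lo[of c] c k by simp
    ultimately show ?thesis unfolding D_def[symmetric] by linarith
  qed
qed

end

section \<open>Paths of the limit process\<close>

context urn_limit
begin

lemma H_isCont:
  assumes "\<omega> \<in> space M" "t > 0"
  shows "isCont (H_alpha \<alpha> B \<omega>) t"
proof -
  have B: "continuous_on {0..} (\<lambda>t. B t \<omega>)" using bm assms by (auto simp: std_brownian_motion_def)
  have "continuous_on {0<..} (\<lambda>t. (2 * \<alpha> - 1) powr (-1/2) * t powr (1 - \<alpha>) * B (t powr (2 * \<alpha> - 1)) \<omega>)"
    by (intro continuous_intros continuous_on_compose2[OF B]) auto
  then have "continuous_on {0<..} (H_alpha \<alpha> B \<omega>)"
    by (rule continuous_on_eq) (auto simp: H_alpha_def)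
  then show ?thesis using assms(2) by (simp add: continuous_on_eq_continuous_at)
qed

lemma H_zero [simp]: "H_alpha \<alpha> B \<omega> 0 = 0"
  by (simp add: H_alpha_def)

text \<open>For \<open>t > 0\<close> the path is continuous because \<open>B\<close> is. At 0 the
  factor \<open>t powr (1 - \<alpha>)\<close> is unbounded, and the right limit is the only
  question.\<close>

lemma cadlag_H_iff:
  assumes "\<omega> \<in> space M"
  shows "cadlag (H_alpha \<alpha> B \<omega>) \<longleftrightarrow> (H_alpha \<alpha> B \<omega> \<longlongrightarrow> 0) (at_right 0)"
proof
  assume "cadlag (H_alpha \<alpha> B \<omega>)"
  then show "(H_alpha \<alpha> B \<omega> \<longlongrightarrow> 0) (at_right 0)" by (auto simp: cadlag_def continuous_within)
next
  assume lim: "(H_alpha \<alpha> B \<omega> \<longlongrightarrow> 0) (at_right 0)"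
  show "cadlag (H_alpha \<alpha> B \<omega>)" unfolding cadlag_def
  proof (intro conjI allI impI)
    fix t :: real assume "t \<ge> 0"
    then show "continuous (at_right t) (H_alpha \<alpha> B \<omega>)"
      using lim H_isCont[OF assms, of t] by (cases "t = 0") (auto simp: continuous_within intro: filterlim_at_split[THEN iffD1, THEN conjunct2] continuous_at_imp_continuous_at_within[unfolded continuous_within])
  next
    fix t :: real assume "t > 0"
    then show "\<exists>l. (H_alpha \<alpha> B \<omega> \<longlongrightarrow> l) (at_left t)"
      using H_isCont[OF assms, of t] filterlim_at_split unfolding isCont_def by blast
  qed
qed

lemma H_continuous_on:
  assumes "\<omega> \<in> space M" "cadlag (H_alpha \<alpha> B \<omega>)"
  shows "continuous_on {0..} (H_alpha \<alpha> B \<omega>)"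
  unfolding continuous_on_eq_continuous_within
proof
  fix t :: real assume "t \<in> {0..}"
  then show "continuous (at t within {0..}) (H_alpha \<alpha> B \<omega>)"
    using assms H_isCont[OF assms(1), of t]
    by (cases "t = 0") (auto simp: at_within_Ici_at_right cadlag_def intro: continuous_at_imp_continuous_at_within)
qed

text \<open>Smallness of the path on \<open>[0, 1 / 2 ^ r]\<close>, expressed through countably many
  times to be measurable; continuity for \<open>t > 0\<close> makes dyadic times suffice.\<close>

definition dyadic_small :: "nat \<Rightarrow> real \<Rightarrow> 'b \<Rightarrow> bool" where
  "dyadic_small r \<eta> \<omega> \<longleftrightarrow> (\<forall>l i. i \<le> 2 ^ l \<longrightarrow> \<bar>H_alpha \<alpha> B \<omega> (real i / 2 ^ (l + r))\<bar> < \<eta>)"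

lemma measurable_dyadic_small [measurable]: "Measurable.pred M (dyadic_small r \<eta>)"
  unfolding dyadic_small_def by measurable

lemma dyadic_small_imp:
  assumes w: "\<omega> \<in> space M" and s: "dyadic_small r \<eta> \<omega>" and t: "0 < t" "t < 1 / 2 ^ r"
  shows "\<bar>H_alpha \<alpha> B \<omega> t\<bar> \<le> \<eta>"
proof -
  define q where "q l = real (nat \<lfloor>t * 2 ^ (l + r)\<rfloor>) / 2 ^ (l + r)" for l
  have fl: "real (nat \<lfloor>t * 2 ^ (l + r)\<rfloor>) = real_of_int \<lfloor>t * 2 ^ (l + r)\<rfloor>" for l
    using t by (intro of_nat_nat) auto
  have q: "\<bar>q l - t\<bar> \<le> (1/2) ^ l" for l
  proof -
    have "\<bar>real_of_int \<lfloor>t * 2 ^ (l + r)\<rfloor> - t * 2 ^ (l + r)\<bar> \<le> 1" by linarith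
    then have "\<bar>(real_of_int \<lfloor>t * 2 ^ (l + r)\<rfloor> - t * 2 ^ (l + r)) / 2 ^ (l + r)\<bar> \<le> 1 / 2 ^ (l + r)"
      by (simp add: abs_divide divide_right_mono)
    moreover have "(real_of_int \<lfloor>t * 2 ^ (l + r)\<rfloor> - t * 2 ^ (l + r)) / 2 ^ (l + r) = q l - t"
      unfolding q_def fl by (simp add: diff_divide_distrib)
    moreover have "(1::real) / 2 ^ (l + r) \<le> 1 / 2 ^ l" by (intro divide_left_mono) (auto simp: power_increasing)
    ultimately show ?thesis by (simp add: power_one_over)
  qed
  have "q \<longlonglongrightarrow> t"
  proof (rule LIM_zero_cancel, rule Lim_null_comparison)
    show "\<forall>\<^sub>F l in sequentially. norm (q l - t) \<le> (1/2) ^ l" using q by auto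
    show "(\<lambda>l. (1/2 :: real) ^ l) \<longlonglongrightarrow> 0" by (rule LIMSEQ_power_zero) auto
  qed
  then have "(\<lambda>l. \<bar>H_alpha \<alpha> B \<omega> (q l)\<bar>) \<longlonglongrightarrow> \<bar>H_alpha \<alpha> B \<omega> t\<bar>"
    by (intro tendsto_rabs isCont_tendsto_compose[OF H_isCont[OF w t(1)]])
  moreover have "\<bar>H_alpha \<alpha> B \<omega> (q l)\<bar> \<le> \<eta>" for l
  proof -
    have "t * 2 ^ (l + r) < 2 ^ l" using t by (simp add: power_add field_simps)
    then have "real (nat \<lfloor>t * 2 ^ (l + r)\<rfloor>) \<le> 2 ^ l" unfolding fl by linarith
    then have "real (nat \<lfloor>t * 2 ^ (l + r)\<rfloor>) \<le> real (2 ^ l)" by simp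
    then have "nat \<lfloor>t * 2 ^ (l + r)\<rfloor> \<le> 2 ^ l" unfolding of_nat_le_iff .
    then show ?thesis using s unfolding q_def dyadic_small_def by (auto intro: less_imp_le)
  qed
  ultimately show ?thesis by (intro LIMSEQ_le_const2) auto
qed

lemma cadlag_H_iff_dyadic:
  assumes w: "\<omega> \<in> space M"
  shows "cadlag (H_alpha \<alpha> B \<omega>) \<longleftrightarrow> (\<forall>p. \<exists>r. dyadic_small r (1 / real (Suc p)) \<omega>)"
proof
  assume "cadlag (H_alpha \<alpha> B \<omega>)"
  then have lim: "(H_alpha \<alpha> B \<omega> \<longlongrightarrow> 0) (at_right 0)" by (simp add: cadlag_H_iff[OF w])
  show "\<forall>p. \<exists>r. dyadic_small r (1 / real (Suc p)) \<omega>"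
  proof
    fix p :: nat
    have "\<forall>\<^sub>F t in at_right 0. \<bar>H_alpha \<alpha> B \<omega> t\<bar> < 1 / real (Suc p)"
      using tendstoD[OF lim, of "1 / real (Suc p)"] by (simp add: dist_real_def)
    then obtain d where d: "d > 0" "\<And>t. 0 < t \<Longrightarrow> t < d \<Longrightarrow> \<bar>H_alpha \<alpha> B \<omega> t\<bar> < 1 / real (Suc p)"
      unfolding eventually_at_right_field by auto
    obtain r where r: "(1/2 :: real) ^ r < d" using real_arch_pow_inv[OF d(1), of "1/2"] by auto
    have "\<bar>H_alpha \<alpha> B \<omega> (real i / 2 ^ (l + r))\<bar> < 1 / real (Suc p)" if "i \<le> 2 ^ l" for l i
    proof (cases "i = 0")
      case False
      have "real i \<le> 2 ^ l" using that by (metis of_nat_le_iff of_nat_numeral of_nat_power)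
      then have "real i / 2 ^ (l + r) \<le> 2 ^ l / 2 ^ (l + r)" by (intro divide_right_mono) auto
      also have "\<dots> = (1/2) ^ r" by (simp add: power_add power_one_over)
      finally have "real i / 2 ^ (l + r) < d" using r by linarith
      then show ?thesis using False by (intro d(2)) auto
    qed simp
    then show "\<exists>r. dyadic_small r (1 / real (Suc p)) \<omega>" unfolding dyadic_small_def by blast
  qed
next
  assume *: "\<forall>p. \<exists>r. dyadic_small r (1 / real (Suc p)) \<omega>"
  show "cadlag (H_alpha \<alpha> B \<omega>)" unfolding cadlag_H_iff[OF w]
  proof (rule tendstoI)
    fix e :: real assume "e > 0"
    then obtain p where p: "inverse (real (Suc p)) < e" using reals_Archimedean by blast
    obtain r where r: "dyadic_small r (1 / real (Suc p)) \<omega>" using * by blast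
    show "\<forall>\<^sub>F t in at_right 0. dist (H_alpha \<alpha> B \<omega> t) 0 < e"
    proof (rule eventually_at_rightI[of 0 "1 / 2 ^ r"])
      fix t :: real assume "t \<in> {0<..<1 / 2 ^ r}"
      then have "\<bar>H_alpha \<alpha> B \<omega> t\<bar> \<le> 1 / real (Suc p)" by (intro dyadic_small_imp[OF w r]) auto
      then show "dist (H_alpha \<alpha> B \<omega> t) 0 < e" using p by (simp add: inverse_eq_divide)
    qed simp
  qed
qed

lemma measurable_H_vec [measurable]: "H_vec \<alpha> B ts J \<in> borel_measurable M"
  unfolding H_vec_def[abs_def] by (rule measurable_coordinatewise_then_product) simp

text \<open>Finite-dimensional convergence transfers the maximal inequality for the chain to the limit; this
  replaces a modulus of continuity of Brownian motion at 0.\<close>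

lemma prob_dyadic_large:
  assumes \<eta>: "\<eta> > 0"
  shows "M.prob {\<omega> \<in> space M. \<exists>i\<le>2 ^ l. \<bar>H_alpha \<alpha> B \<omega> (real i / 2 ^ (l + r))\<bar> \<ge> \<eta>} \<le> 48 * (1 / 2 ^ r)\<^sup>2 / \<eta> ^ 4"
proof -
  define J :: nat where "J = 2 ^ l"
  define ts where "ts i = real i / 2 ^ (l + r)" for i
  \<comment> \<open>A continuous majorant of the event in question: it is at least the indicator of
    some \<open>\<bar>y i\<bar> \<ge> \<eta>\<close> and vanishes when all
    \<open>\<bar>y i\<bar> \<le> \<eta> / 2\<close>.\<close>
  define \<psi> where "\<psi> y = min 1 (\<Sum>i\<in>{..J}. max 0 (2 * \<bar>y i\<bar> / \<eta> - 1))" for y :: "nat \<Rightarrow> real"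
  have ts: "ts 0 = 0" "strict_mono ts" unfolding ts_def by (auto intro: strict_mono_scaled[of "2 ^ (l + r)"])
  have cont: "cwise_cont \<psi>" unfolding \<psi>_def
  proof (rule cwise_cont_penalty[OF refl])
    show "cwise_cont (\<lambda>y. 2 * \<bar>y i\<bar> / \<eta> - 1)" for i unfolding cwise_cont_def
      using \<eta> by (auto simp: cwise_def intro!: tendsto_intros)
  qed
  have nonneg: "0 \<le> \<psi> y" for y unfolding \<psi>_def by (simp add: sum_nonneg)
  have bd: "\<bar>\<psi> y\<bar> \<le> 1" for y using nonneg[of y] unfolding \<psi>_def by auto
  have \<psi>m [measurable]: "\<psi> \<in> borel_measurable borel" by (rule cwise_cont_measurable[OF cont])
  have tsJ: "ts J = 1 / 2 ^ r" by (simp add: ts_def J_def power_add)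
  have "(\<integral>\<omega>. \<psi> (H_vec \<alpha> B ts J \<omega>) \<partial>M) \<le> 48 * (1 / 2 ^ r)\<^sup>2 / \<eta> ^ 4"
  proof (rule tendsto_upperbound[OF fdd_tendsto[OF ts cont bd]])
    show "\<forall>\<^sub>F n in sequentially. CE n (\<lambda>\<omega>. \<psi> (X_vec (m n) ts J \<omega>)) \<le> 48 * (1 / 2 ^ r)\<^sup>2 / \<eta> ^ 4"
      using grid_eventually[OF m_top m_small ts, of J]
    proof eventually_elim
      case (elim n)
      define ks where "ks = grid (m n) ts"
      have mono: "i \<le> j \<longrightarrow> j \<le> J \<longrightarrow> ks i \<le> ks j" for i j
      proof (induction j)
        case (Suc j)
        then show ?case using elim[THEN conjunct2, THEN conjunct2, THEN conjunct1, rule_format, of j]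
          by (auto simp: le_Suc_eq ks_def)
      qed simp
      have ks2: "2 \<le> ks i" if "i \<le> J" for i using mono[of 0 i] that by (simp add: ks_def)
      have ksJ: "real (ks J) \<le> m n * ts J"
      proof -
        have "J \<noteq> 0" by (simp add: J_def)
        moreover have "0 \<le> m n * ts J" using elim by (simp add: tsJ)
        ultimately show ?thesis by (simp add: ks_def grid_def)
      qed
      have mn: "m n > 0" using elim by simp
      \<comment> \<open>The threshold is \<open>\<eta> / 2\<close> because \<open>\<psi>\<close>
        starts to grow there; its fourth power turns the 3 of the maximal inequality into
        48.\<close>
      define \<kappa> where "\<kappa> = \<eta> / 2 * sqrt (m n)"
      have \<kappa>: "\<kappa> > 0" using \<eta> mn by (simp add: \<kappa>_def)
      have "CE n (\<lambda>\<omega>. \<psi> (X_vec (m n) ts J \<omega>)) \<le> CE n (drew 2 (ks J) \<kappa>)"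
      proof (rule CE_mono[of _ _ 1 1])
        show "AE \<omega> in N. \<psi> (X_vec (m n) ts J \<omega>) \<le> drew 2 (ks J) \<kappa> \<omega>"
          using AE_nearest_neighbour
        proof eventually_elim
          case (elim \<omega>)
          show ?case
          proof (cases "drew 2 (ks J) \<kappa> \<omega> = 0")
            case True
            have "\<bar>X_vec (m n) ts J \<omega> i\<bar> < \<eta> / 2" if "i \<le> J" for i
            proof (cases "i = 0")
              case False
              have "\<bar>real_of_int (Delta X Y (ks i) \<omega>)\<bar> < \<kappa>"
                using drew_zeroD[OF True, of 2 "ks i"] ks2[OF that] mono[of i J] that elim by auto
              then have "\<bar>real_of_int (Delta X Y (ks i) \<omega>)\<bar> / sqrt (m n) < \<eta> / 2" using mn by (simp add: \<kappa>_def field_simps)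
              then show ?thesis using False that mn by (simp add: X_vec_def scaled_path_def ks_def grid_def)
            qed (use \<eta> ts in \<open>simp add: X_vec_def scaled_path_def Delta_def\<close>)
            then have "max 0 (2 * \<bar>X_vec (m n) ts J \<omega> i\<bar> / \<eta> - 1) = 0" if "i \<in> {..J}" for i
              using that \<eta> by (auto simp: max_def field_simps) (smt (verit))
            then have "\<psi> (X_vec (m n) ts J \<omega>) = 0" unfolding \<psi>_def by (simp add: sum.neutral)
            then show ?thesis using True by simp
          next
            case False
            then have "drew 2 (ks J) \<kappa> \<omega> = 1" by (auto simp: drew_def indicator_def)
            then show ?thesis using bd[of "X_vec (m n) ts J \<omega>"] by simp
          qed
        qed
      qed (use bd drew_bounded in auto)
      also have "\<dots> \<le> 3 * (real (ks J - 2))\<^sup>2 / \<kappa> ^ 4"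
        by (rule CE_drew) (use elim ks2[of J] \<kappa> in \<open>auto simp: ks_def\<close>)
      also have "\<dots> \<le> 3 * (m n * ts J)\<^sup>2 / \<kappa> ^ 4"
        using ksJ \<kappa> by (intro divide_right_mono mult_left_mono power_mono) auto
      also have "\<kappa> ^ 4 = \<eta> ^ 4 / 16 * (m n)\<^sup>2"
        using mn by (simp add: \<kappa>_def power_mult_distrib power_divide real_sqrt_power[symmetric] power4_eq_xxxx power2_eq_square)
      also have "3 * (m n * ts J)\<^sup>2 / (\<eta> ^ 4 / 16 * (m n)\<^sup>2) = 48 * (1 / 2 ^ r)\<^sup>2 / \<eta> ^ 4"
        unfolding tsJ using mn \<eta> by (simp add: power_mult_distrib field_simps)
      finally show ?case .
    qed
  qed simp
  moreover have "M.prob {\<omega> \<in> space M. \<exists>i\<le>2 ^ l. \<bar>H_alpha \<alpha> B \<omega> (real i / 2 ^ (l + r))\<bar> \<ge> \<eta>} \<le> (\<integral>\<omega>. \<psi> (H_vec \<alpha> B ts J \<omega>) \<partial>M)"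
  proof -
    let ?A = "{\<omega> \<in> space M. \<exists>i\<le>2 ^ l. \<bar>H_alpha \<alpha> B \<omega> (real i / 2 ^ (l + r))\<bar> \<ge> \<eta>}"
    have [measurable]: "?A \<in> sets M" by measurable
    have "M.prob ?A = (\<integral>\<omega>. indicator ?A \<omega> \<partial>M)" by simp
    also have "\<dots> \<le> (\<integral>\<omega>. \<psi> (H_vec \<alpha> B ts J \<omega>) \<partial>M)"
    proof (rule integral_mono)
      show "integrable M (indicator ?A :: _ \<Rightarrow> real)" by (simp add: integrable_real_indicator M.emeasure_eq_measure)
      show "integrable M (\<lambda>\<omega>. \<psi> (H_vec \<alpha> B ts J \<omega>))" by (rule M.integrable_const_bound[of _ 1]) (use bd in auto)
      fix \<omega> assume "\<omega> \<in> space M"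
      show "indicator ?A \<omega> \<le> \<psi> (H_vec \<alpha> B ts J \<omega>)"
      proof (cases "\<omega> \<in> ?A")
        case True
        then obtain i where i: "i \<le> J" "\<bar>H_alpha \<alpha> B \<omega> (ts i)\<bar> \<ge> \<eta>" by (auto simp: J_def ts_def)
        have "1 \<le> max 0 (2 * \<bar>H_vec \<alpha> B ts J \<omega> i\<bar> / \<eta> - 1)"
          using i \<eta> by (simp add: H_vec_def field_simps le_max_iff_disj)
        also have "\<dots> \<le> (\<Sum>i\<in>{..J}. max 0 (2 * \<bar>H_vec \<alpha> B ts J \<omega> i\<bar> / \<eta> - 1))"
          using i by (intro member_le_sum) auto
        finally show ?thesis using True by (simp add: \<psi>_def)
      qed (use nonneg in auto)
    qed
    finally show ?thesis .
  qed
  ultimately show ?thesis by linarith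
qed

text \<open>For fixed \<open>r\<close> the bound of \<open>prob_dyadic_large\<close> is uniform in
  the level \<open>l\<close> and passes to the increasing union over \<open>l\<close>; then it tends
  to 0 as \<open>r\<close> grows.\<close>

lemma AE_cadlag_H: "AE \<omega> in M. cadlag (H_alpha \<alpha> B \<omega>)"
proof -
  have "AE \<omega> in M. \<exists>r. dyadic_small r (1 / real (Suc p)) \<omega>" for p
  proof -
    define \<eta> where "\<eta> = 1 / real (Suc p)"
    have \<eta>: "\<eta> > 0" by (simp add: \<eta>_def)
    define A where "A r l = {\<omega> \<in> space M. \<exists>i\<le>2 ^ l. \<bar>H_alpha \<alpha> B \<omega> (real i / 2 ^ (l + r))\<bar> \<ge> \<eta>}" for r l
    have Am [measurable]: "A r l \<in> sets M" for r l unfolding A_def by measurable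
    \<comment> \<open>A dyadic point of level \<open>l\<close> is one of level \<open>Suc l\<close>
      with doubled numerator.\<close>
    have inc: "incseq (A r)" for r
    proof (rule incseq_SucI, rule subsetI)
      fix l \<omega> assume "\<omega> \<in> A r l"
      then obtain i where i: "\<omega> \<in> space M" "i \<le> 2 ^ l" "\<bar>H_alpha \<alpha> B \<omega> (real i / 2 ^ (l + r))\<bar> \<ge> \<eta>" by (auto simp: A_def)
      then have "2 * i \<le> 2 ^ Suc l" "\<bar>H_alpha \<alpha> B \<omega> (real (2 * i) / 2 ^ (Suc l + r))\<bar> \<ge> \<eta>" by auto
      then show "\<omega> \<in> A r (Suc l)" using i(1) unfolding A_def by blast
    qed
    have bound: "M.prob (\<Union>l. A r l) \<le> 48 * (1 / 2 ^ r)\<^sup>2 / \<eta> ^ 4" for r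
      by (rule LIMSEQ_le_const2[OF M.finite_Lim_measure_incseq[OF _ inc]])
         (use prob_dyadic_large[OF \<eta>] in \<open>auto simp: A_def[symmetric]\<close>)
    have compl: "{\<omega> \<in> space M. \<not> (\<exists>r. dyadic_small r \<eta> \<omega>)} = (\<Inter>r. \<Union>l. A r l)"
      by (auto simp: dyadic_small_def A_def not_less)
    have "M.prob (\<Inter>r. \<Union>l. A r l) \<le> 48 * (1 / 2 ^ r)\<^sup>2 / \<eta> ^ 4" for r
      by (rule order_trans[OF M.finite_measure_mono bound[of r]]) auto
    moreover have "(\<lambda>r. 48 * (1 / 2 ^ r)\<^sup>2 / \<eta> ^ 4) \<longlonglongrightarrow> 0"
    proof -
      have "(\<lambda>r. 48 * ((1/2) ^ r)\<^sup>2 / \<eta> ^ 4) \<longlonglongrightarrow> 48 * 0\<^sup>2 / \<eta> ^ 4"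
        by (intro tendsto_intros LIMSEQ_power_zero) (use \<eta> in auto)
      then show ?thesis by (simp add: power_one_over)
    qed
    ultimately have "M.prob (\<Inter>r. \<Union>l. A r l) \<le> 0" by (intro LIMSEQ_le_const) auto
    then have "M.prob {\<omega> \<in> space M. \<not> (\<exists>r. dyadic_small r \<eta> \<omega>)} = 0"
      unfolding compl using measure_nonneg[of M] by (intro antisym) auto
    then show ?thesis unfolding \<eta>_def[symmetric]
      by (subst (asm) M.prob_eq_0) (auto simp: AE_iff_measurable[OF _ refl] M.emeasure_eq_measure)
  qed
  then have "AE \<omega> in M. \<forall>p. \<exists>r. dyadic_small r (1 / real (Suc p)) \<omega>" by (simp add: AE_all_countable)
  then show ?thesis using AE_space by eventually_elim (simp add: cadlag_H_iff_dyadic)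
qed

text \<open>On the measurable set of cadlag paths, \<open>f\<close> of the path is a pointwise limit
  of functions of countably many values of \<open>H\<close>; elsewhere \<open>f\<close> is 0 by
  \<open>lu_fun\<close>.\<close>

lemma measurable_lu_fun_H:
  assumes f: "lu_fun f"
  shows "(\<lambda>\<omega>. f (H_alpha \<alpha> B \<omega>)) \<in> borel_measurable M"
proof (rule borel_measurable_LIMSEQ_real)
  define G where "G \<omega> \<longleftrightarrow> (\<forall>p. \<exists>r. dyadic_small r (1 / real (Suc p)) \<omega>)" for \<omega>
  have Gm [measurable]: "Measurable.pred M G" unfolding G_def by measurable
  define u where "u K \<omega> = (if G \<omega> then f (step_path (real (Suc K)) (\<lambda>i. H_alpha \<alpha> B \<omega> (real i / real (Suc K)))) else 0)" for K \<omega>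
  show "u K \<in> borel_measurable M" for K
  proof -
    have "(\<lambda>a. f (step_path (real (Suc K)) a)) \<in> borel_measurable borel"
      by (rule cwise_cont_measurable[OF lu_fun_step_path_cont[OF f]]) simp
    moreover have "(\<lambda>\<omega> i. H_alpha \<alpha> B \<omega> (real i / real (Suc K))) \<in> borel_measurable M"
      by (rule measurable_coordinatewise_then_product) simp
    ultimately have [measurable]: "(\<lambda>\<omega>. f (step_path (real (Suc K)) (\<lambda>i. H_alpha \<alpha> B \<omega> (real i / real (Suc K))))) \<in> borel_measurable M"
      by (rule measurable_compose[rotated])
    show ?thesis unfolding u_def[abs_def] by measurable
  qed
  show "(\<lambda>K. u K \<omega>) \<longlonglongrightarrow> f (H_alpha \<alpha> B \<omega>)" if w: "\<omega> \<in> space M" for \<omega>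
  proof (cases "G \<omega>")
    case True
    then have cad: "cadlag (H_alpha \<alpha> B \<omega>)" by (simp add: G_def cadlag_H_iff_dyadic[OF w])
    have "(\<lambda>K. f (step_path (real (Suc K)) (\<lambda>i. H_alpha \<alpha> B \<omega> (real i / real (Suc K))))) \<longlonglongrightarrow> f (H_alpha \<alpha> B \<omega>)"
      by (rule lu_funD[OF f cad _ locunif_step_approx[OF H_continuous_on[OF w cad]]]) (simp add: cadlag_step_path)
    then show ?thesis using True by (simp add: u_def)
  next
    case False
    then have "\<not> cadlag (H_alpha \<alpha> B \<omega>)" by (simp add: G_def cadlag_H_iff_dyadic[OF w])
    then show ?thesis using f False by (simp add: u_def lu_fun_def)
  qed
qed

lemma measurable_lu_fun_scaled_path:
  assumes f: "lu_fun f" and R: "R > 0"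
  shows "(\<lambda>\<omega>. f (scaled_path R X Y \<omega>)) \<in> borel_measurable N"
proof -
  have "(\<lambda>a. f (step_path R a)) \<in> borel_measurable borel"
    by (rule cwise_cont_measurable[OF lu_fun_step_path_cont[OF f R]])
  moreover have "(\<lambda>\<omega> k. real_of_int (Delta X Y k \<omega>) / sqrt R) \<in> borel_measurable N"
    by (rule measurable_coordinatewise_then_product) simp
  ultimately show ?thesis unfolding scaled_path_eq_step_path by (rule measurable_compose[rotated])
qed

end

section \<open>Approximation by step paths\<close>

definition grid_times :: "nat \<Rightarrow> nat \<Rightarrow> real" where
  "grid_times K i = real i / real (Suc K)"

text \<open>Holding the last value after index \<open>J\<close> makes the path a function of
  finitely many coordinates, to which finite-dimensional convergence applies.\<close>

definition frozen_step :: "nat \<Rightarrow> nat \<Rightarrow> (nat \<Rightarrow> real) \<Rightarrow> real \<Rightarrow> real" where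
  "frozen_step K J y = step_path (real (Suc K)) (\<lambda>i. y (min J i))"

text \<open>A continuous stand-in for a fall of \<open>\<bar>y\<bar>\<close> by at least
  \<open>\<epsilon>\<close> over some grid step: 1 on that event, and 0 when all falls are at most
  \<open>\<epsilon> / 2\<close>.\<close>

definition down_penalty :: "nat \<Rightarrow> real \<Rightarrow> (nat \<Rightarrow> real) \<Rightarrow> real" where
  "down_penalty J \<epsilon> y = min 1 (\<Sum>j<J. max 0 ((\<bar>y j\<bar> - \<bar>y (Suc j)\<bar>) * 2 / \<epsilon> - 1))"

lemma grid_times: "grid_times K 0 = 0" "strict_mono (grid_times K)"
  unfolding grid_times_def by (auto intro: strict_mono_scaled[of "real (Suc K)"] simp del: of_nat_Suc)

lemma down_penalty_bounds: "0 \<le> down_penalty J \<epsilon> y" "\<bar>down_penalty J \<epsilon> y\<bar> \<le> 1"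
  unfolding down_penalty_def using sum_nonneg[of "{..<J}" "\<lambda>j. max 0 ((\<bar>y j\<bar> - \<bar>y (Suc j)\<bar>) * 2 / \<epsilon> - 1)"] by auto

lemma down_penalty_cont: "\<epsilon> > 0 \<Longrightarrow> cwise_cont (down_penalty J \<epsilon>)"
  unfolding down_penalty_def
proof (rule cwise_cont_penalty[OF refl])
  fix j assume "\<epsilon> > 0"
  then show "cwise_cont (\<lambda>y. (\<bar>y j\<bar> - \<bar>y (Suc j)\<bar>) * 2 / \<epsilon> - 1)"
    unfolding cwise_cont_def by (auto simp: cwise_def intro!: tendsto_intros)
qed

lemma down_penalty_less_1:
  assumes "down_penalty J \<epsilon> y < 1" "\<epsilon> > 0" "j < J"
  shows "\<bar>y j\<bar> - \<bar>y (Suc j)\<bar> < \<epsilon>"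
proof (rule ccontr)
  assume "\<not> ?thesis"
  then have "1 \<le> max 0 ((\<bar>y j\<bar> - \<bar>y (Suc j)\<bar>) * 2 / \<epsilon> - 1)" using assms(2) by (simp add: field_simps le_max_iff_disj)
  also have "\<dots> \<le> (\<Sum>j<J. max 0 ((\<bar>y j\<bar> - \<bar>y (Suc j)\<bar>) * 2 / \<epsilon> - 1))"
    using assms(3) by (intro member_le_sum) auto
  finally show False using assms(1) by (simp add: down_penalty_def)
qed

lemma frozen_step_cont: "lu_fun g \<Longrightarrow> cwise_cont (\<lambda>y. g (frozen_step K J y))"
proof -
  assume "lu_fun g"
  then have "cwise_cont (\<lambda>a. g (step_path (real (Suc K)) a))" by (rule lu_fun_step_path_cont) simp
  moreover have "cwise (\<lambda>n i. ys n (min J i)) (\<lambda>i. y (min J i))" if "cwise ys y" for ys y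
    using that by (auto simp: cwise_def)
  ultimately show ?thesis unfolding cwise_cont_def frozen_step_def by blast
qed

context urn_limit
begin

text \<open>\<open>block_oscillation\<close> yields three times its threshold, hence
  \<open>\<epsilon> = 1 / (3 * T)\<close> for the tolerance \<open>1 / T\<close>. For this tolerance
  \<open>pd\<close> looks at \<open>[0, T]\<close>, which \<open>J\<close> grid steps of width
  \<open>1 / Suc K\<close> cover.\<close>

lemma path_near_frozen_step:
  fixes T K :: nat
  defines "J \<equiv> T * Suc K" and "\<epsilon> \<equiv> 1 / (3 * real T)"
  assumes T: "T \<ge> 1" and R: "R > 0"
    and inc: "\<And>j. j < J \<Longrightarrow> grid R (grid_times K) j < grid R (grid_times K) (Suc j)"
    and nn: "Delta X Y 2 \<omega> = 0" "\<And>k. k \<ge> 2 \<Longrightarrow> \<bar>Delta X Y (Suc k) \<omega> - Delta X Y k \<omega>\<bar> \<le> 1"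
    and dr: "\<And>j. j < J \<Longrightarrow> drew (grid R (grid_times K) j) (grid R (grid_times K) (Suc j)) (\<epsilon> * sqrt R) \<omega> = 0"
    and down: "\<And>j. j < J \<Longrightarrow> \<bar>X_vec R (grid_times K) J \<omega> j\<bar> - \<bar>X_vec R (grid_times K) J \<omega> (Suc j)\<bar> < \<epsilon>"
  shows "pd (scaled_path R X Y \<omega>) (frozen_step K J (X_vec R (grid_times K) J \<omega>)) \<le> 1 / real T"
proof (rule pd_leI)
  show "0 < 1 / real T" using T by simp
  define c where "c = real (Suc K)"
  define ks where "ks = grid R (grid_times K)"
  define D where "D k = real_of_int (Delta X Y k \<omega>)" for k
  have c: "c > 0" by (simp add: c_def)
  have ks2: "ks j \<ge> 2" if "j \<le> J" for j
    using that
  proof (induction j)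
    case (Suc j)
    then show ?case using inc[of j] by (simp add: ks_def)
  qed (simp add: ks_def)
  have vec: "X_vec R (grid_times K) J \<omega> j = D (ks j) / sqrt R" if "j \<le> J" for j
  proof (cases "j = 0")
    case True
    then show ?thesis using nn(1) by (simp add: X_vec_def grid_times_def scaled_path_def ks_def D_def Delta_def[of _ _ 0])
  next
    case False
    then show ?thesis using that by (simp add: X_vec_def scaled_path_def ks_def grid_def D_def)
  qed
  fix t :: real assume t: "0 \<le> t" "t \<le> 1 / (1 / real T)"
  then have tT: "t \<le> real T" by simp
  define j where "j = nat \<lfloor>c * t\<rfloor>"
  have j: "real j \<le> c * t" "c * t < real j + 1" using t c by (auto simp: j_def of_nat_nat)
  have cT: "c * t \<le> c * real T" using tT c by (intro mult_left_mono) auto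
  have "real j \<le> real J" using j(1) cT by (simp add: J_def c_def algebra_simps)
  then have jJ: "j \<le> J" by simp
  have fs: "frozen_step K J (X_vec R (grid_times K) J \<omega>) t = D (ks j) / sqrt R"
    using vec[OF jJ] jJ by (simp add: frozen_step_def step_path_def j_def[symmetric] c_def[symmetric] min_absorb2 del: of_nat_Suc)
  define l where "l = nat \<lfloor>R * t\<rfloor>"
  have x: "scaled_path R X Y \<omega> t = D l / sqrt R" by (simp add: scaled_path_def l_def D_def)
  have "\<bar>D l - D (ks j)\<bar> \<le> 3 * (\<epsilon> * sqrt R)"
  \<comment> \<open>Before time 2 the difference is 0 by definition, and it is 0 at time 2, where
    the first block starts.\<close>
  proof (cases "l < 2")
    case True
    have "j = 0"
    proof (rule ccontr)
      assume "j \<noteq> 0"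
      then have "ks j = nat \<lfloor>R * (real j / c)\<rfloor>" by (simp add: ks_def grid_def grid_times_def c_def)
      also have "\<dots> \<le> l" unfolding l_def using j c R by (intro nat_mono floor_mono mult_left_mono) (auto simp: field_simps)
      finally show False using ks2[OF jJ] True by simp
    qed
    then have "D (ks j) = 0" using nn(1) by (simp add: ks_def D_def)
    moreover have "D l = 0" using True by (simp add: D_def Delta_def)
    ultimately show ?thesis using R by (simp add: \<epsilon>_def)
  next
    case False
    show ?thesis
    \<comment> \<open>Index \<open>J\<close> is reached only at \<open>t = T\<close>, which is
      itself a grid time; there is no further block to appeal to.\<close>
    proof (cases "j = J")
      case True
      then have "c * real T \<le> c * t" using j(1) by (simp add: J_def c_def algebra_simps)
      then have "t = real T" using tT c by simp
      moreover have "J \<noteq> 0" using T by (simp add: J_def)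
      moreover have "grid_times K J = real T" unfolding grid_times_def J_def of_nat_mult by simp
      ultimately have "ks j = l" using True by (simp add: ks_def grid_def l_def)
      then show ?thesis using R by (simp add: \<epsilon>_def)
    next
      case jne: False
      then have jlt: "j < J" using jJ by simp
      have lo: "ks j \<le> l"
      proof (cases "j = 0")
        case True then show ?thesis using False by (simp add: ks_def)
      next
        case j0: False
        then have "ks j = nat \<lfloor>R * (real j / c)\<rfloor>" by (simp add: ks_def grid_def grid_times_def c_def)
        also have "\<dots> \<le> l" unfolding l_def using j c R by (intro nat_mono floor_mono mult_left_mono) (auto simp: field_simps)
        finally show ?thesis .
      qed
      have hi: "l \<le> ks (Suc j)"
      proof -
        have "l \<le> nat \<lfloor>R * (real (Suc j) / c)\<rfloor>" unfolding l_def using j c R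
          by (intro nat_mono floor_mono mult_left_mono) (auto simp: field_simps)
        then show ?thesis by (simp add: ks_def grid_def grid_times_def c_def)
      qed
      have "\<bar>D (ks j)\<bar> / sqrt R - \<bar>D (ks (Suc j))\<bar> / sqrt R < \<epsilon>"
        using down[OF jlt] vec[of j] vec[of "Suc j"] jlt R by (simp add: abs_divide)
      then have "(\<bar>D (ks j)\<bar> - \<bar>D (ks (Suc j))\<bar>) / sqrt R < \<epsilon>" by (simp add: diff_divide_distrib)
      then have dn: "\<bar>D (ks j)\<bar> - \<bar>D (ks (Suc j))\<bar> < \<epsilon> * sqrt R" using R by (simp add: divide_less_eq)
      show ?thesis unfolding D_def
        by (rule block_oscillation[OF nn(2) ks2[OF jJ] lo hi]) (use dr[OF jlt] dn in \<open>auto simp: ks_def D_def\<close>)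
    qed
  qed
  then have "\<bar>D l - D (ks j)\<bar> / sqrt R \<le> 3 * \<epsilon>" using R by (simp add: divide_le_eq mult_ac)
  moreover have "3 * \<epsilon> = 1 / real T" by (simp add: \<epsilon>_def)
  moreover have "\<bar>D l / sqrt R - D (ks j) / sqrt R\<bar> = \<bar>D l - D (ks j)\<bar> / sqrt R"
    using R by (simp add: diff_divide_distrib[symmetric] abs_divide)
  ultimately show "\<bar>scaled_path R X Y \<omega> t - frozen_step K J (X_vec R (grid_times K) J \<omega>) t\<bar> \<le> 1 / real T"
    unfolding x fs by simp
qed

lemma CE_abs_diff_le:
  assumes "n \<ge> 1" "AE \<omega> in N. \<bar>f \<omega> - g \<omega>\<bar> \<le> h \<omega>" "f \<in> borel_measurable N" "\<And>\<omega>. \<bar>f \<omega>\<bar> \<le> C"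
    "g \<in> borel_measurable N" "\<And>\<omega>. \<bar>g \<omega>\<bar> \<le> C" "h \<in> borel_measurable N" "\<And>\<omega>. \<bar>h \<omega>\<bar> \<le> D"
  shows "\<bar>CE n f - CE n g\<bar> \<le> CE n h"
proof -
  have s: "\<bar>g \<omega> + h \<omega>\<bar> \<le> C + D" "\<bar>f \<omega> + h \<omega>\<bar> \<le> C + D" for \<omega> using assms(4,6,8)[of \<omega>] by linarith+
  have "CE n f \<le> CE n (\<lambda>\<omega>. g \<omega> + h \<omega>)"
    by (rule CE_mono[OF _ assms(3,4) _ s(1)]) (use assms in auto)
  moreover have "CE n g \<le> CE n (\<lambda>\<omega>. f \<omega> + h \<omega>)"
    by (rule CE_mono[OF _ assms(5,6) _ s(2)]) (use assms in auto)
  ultimately show ?thesis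
    using CE_add[OF assms(5-8), of n] CE_add[OF assms(3,4,7,8), of n] by linarith
qed

definition block_drawups :: "real \<Rightarrow> nat \<Rightarrow> nat \<Rightarrow> real \<Rightarrow> 'a \<Rightarrow> real" where
  "block_drawups R K J \<epsilon> \<omega> =
     (\<Sum>j<J. drew (grid R (grid_times K) j) (grid R (grid_times K) (Suc j)) (\<epsilon> * sqrt R) \<omega>)"

text \<open>There are \<open>T * Suc K\<close> blocks of scaled length \<open>1 / Suc K\<close>. By
  the quadratic bound each contributes order \<open>1 / (Suc K)^2\<close>, so the sum disappears as
  the mesh is refined.\<close>

lemma CE_block_drawups:
  assumes T: "T \<ge> 1" and \<epsilon>: "\<epsilon> > 0"
  shows "\<forall>\<^sub>F n in sequentially. CE n (block_drawups (m n) K (T * Suc K) \<epsilon>) \<le> 12 * real T / (real (Suc K) * \<epsilon> ^ 4)"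
proof -
  define J where "J = T * Suc K"
  define c where "c = real (Suc K)"
  have c: "c > 0" by (simp add: c_def)
  have "\<forall>\<^sub>F n in sequentially. m n \<ge> c" using m_top by (auto simp: filterlim_at_top)
  with grid_eventually[OF m_top m_small grid_times, of J K] show ?thesis
  proof eventually_elim
    case (elim n)
    define ks where "ks = grid (m n) (grid_times K)"
    have mn: "m n > 0" using elim by simp
    have ks2: "ks j \<ge> 2" if "j \<le> J" for j
      using that
    proof (induction j)
      case (Suc j)
      then show ?case using elim(1)[THEN conjunct2, THEN conjunct2, THEN conjunct1, rule_format, of j] by (simp add: ks_def)
    qed (simp add: ks_def)
    have ksJ: "ks j \<le> n" if "j \<le> J" for j
    proof -
      have "j \<le> i \<longrightarrow> i \<le> J \<longrightarrow> ks j \<le> ks i" for i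
      proof (induction i)
        case (Suc i)
        then show ?case using elim(1)[THEN conjunct2, THEN conjunct2, THEN conjunct1, rule_format, of i]
          by (auto simp: le_Suc_eq ks_def)
      qed simp
      from this[of J] that elim show ?thesis by (auto simp: ks_def)
    qed
    \<comment> \<open>The exact length is up to \<open>m n / c + 1\<close> because of the floor;
      \<open>m n \<ge> c\<close> absorbs the 1 into the factor 2.\<close>
    have len: "real (ks (Suc j) - ks j) \<le> 2 * m n / c" if "j < J" for j
    proof -
      have "real (ks (Suc j)) \<le> m n * (real (Suc j) / c)"
        using mn c by (simp add: ks_def grid_def grid_times_def c_def del: of_nat_Suc)
      moreover have "real (ks j) \<ge> m n * (real j / c) - 1"
      proof (cases "j = 0")
        case False
        then show ?thesis using mn c by (simp add: ks_def grid_def grid_times_def c_def del: of_nat_Suc)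
      qed (simp add: ks_def)
      moreover have "m n * (real (Suc j) / c) = m n * (real j / c) + m n / c" by (simp add: add_divide_distrib distrib_left add.commute)
      moreover have "1 \<le> m n / c" using elim c by simp
      moreover have "ks j \<le> ks (Suc j)" using elim that by (auto simp: ks_def less_imp_le)
      ultimately show ?thesis by (simp add: of_nat_diff)
    qed
    have each: "CE n (drew (ks j) (ks (Suc j)) (\<epsilon> * sqrt (m n))) \<le> 12 / (c\<^sup>2 * \<epsilon> ^ 4)" if "j < J" for j
    proof -
      have "CE n (drew (ks j) (ks (Suc j)) (\<epsilon> * sqrt (m n))) \<le> 3 * (real (ks (Suc j) - ks j))\<^sup>2 / (\<epsilon> * sqrt (m n)) ^ 4"
      proof (rule CE_drew)
        show "ks (Suc j) \<le> 2 * n" using ksJ[of "Suc j"] that by simp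
      qed (use elim ks2[of j] that \<epsilon> mn in \<open>auto simp: ks_def less_imp_le\<close>)
      also have "\<dots> \<le> 3 * (2 * m n / c)\<^sup>2 / (\<epsilon> * sqrt (m n)) ^ 4"
        using len[OF that] \<epsilon> mn by (intro divide_right_mono mult_left_mono power_mono) auto
      also have "(\<epsilon> * sqrt (m n)) ^ 4 = \<epsilon> ^ 4 * (m n)\<^sup>2"
        using mn by (simp add: power_mult_distrib power4_eq_xxxx power2_eq_square)
      also have "3 * (2 * m n / c)\<^sup>2 / (\<epsilon> ^ 4 * (m n)\<^sup>2) = 12 / (c\<^sup>2 * \<epsilon> ^ 4)"
        using mn c \<epsilon> by (simp add: power_mult_distrib power_divide field_simps)
      finally show ?thesis .
    qed
    have "CE n (block_drawups (m n) K J \<epsilon>) = (\<Sum>j<J. CE n (drew (ks j) (ks (Suc j)) (\<epsilon> * sqrt (m n))))"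
      unfolding block_drawups_def[abs_def] ks_def by (rule CE_sum) (use drew_bounded in auto)
    also have "\<dots> \<le> (\<Sum>j<J. 12 / (c\<^sup>2 * \<epsilon> ^ 4))" by (rule sum_mono) (use each in auto)
    also have "\<dots> = real T * c * (12 / (c\<^sup>2 * \<epsilon> ^ 4))" unfolding J_def c_def by (simp add: algebra_simps)
    also have "\<dots> = 12 * real T / (c * \<epsilon> ^ 4)"
      using c by (simp add: power2_eq_square)
    finally show ?case by (simp add: J_def c_def)
  qed
qed

lemma measurable_block_drawups [measurable]: "block_drawups R K J \<epsilon> \<in> borel_measurable N"
  unfolding block_drawups_def[abs_def] by measurable

lemma block_drawups_bounds: "0 \<le> block_drawups R K J \<epsilon> \<omega>" "\<bar>block_drawups R K J \<epsilon> \<omega>\<bar> \<le> real J"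
proof -
  show "0 \<le> block_drawups R K J \<epsilon> \<omega>" unfolding block_drawups_def by (intro sum_nonneg drew_nonneg)
  have "\<bar>block_drawups R K J \<epsilon> \<omega>\<bar> \<le> (\<Sum>j<J. 1)" unfolding block_drawups_def
    by (rule order_trans[OF sum_abs sum_mono]) (rule drew_bounded)
  then show "\<bar>block_drawups R K J \<epsilon> \<omega>\<bar> \<le> real J" by simp
qed

text \<open>If there is no block drawup and the penalty is below 1,
  \<open>path_near_frozen_step\<close> gives \<open>1 / T\<close>. Otherwise one of the two error
  terms is at least 1, which dominates since \<open>pd \<le> 1\<close>.\<close>

lemma AE_frozen_step_error:
  fixes T K :: nat and g :: "(real \<Rightarrow> real) \<Rightarrow> real"
  defines "J \<equiv> T * Suc K" and "\<epsilon> \<equiv> 1 / (3 * real T)"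
  assumes T: "T \<ge> 1" and R: "R > 0" and k: "k \<ge> 0"
    and inc: "\<And>j. j < J \<Longrightarrow> grid R (grid_times K) j < grid R (grid_times K) (Suc j)"
    and lip: "\<And>x z. cadlag x \<Longrightarrow> cadlag z \<Longrightarrow> \<bar>g x - g z\<bar> \<le> k * pd x z"
  shows "AE \<omega> in N. \<bar>g (scaled_path R X Y \<omega>) - g (frozen_step K J (X_vec R (grid_times K) J \<omega>))\<bar>
     \<le> k * (1 / real T + block_drawups R K J \<epsilon> \<omega> + down_penalty J \<epsilon> (X_vec R (grid_times K) J \<omega>))"
  using AE_nearest_neighbour
proof eventually_elim
  case (elim \<omega>)
  define x where "x = scaled_path R X Y \<omega>"
  define y where "y = X_vec R (grid_times K) J \<omega>"
  have \<epsilon>: "\<epsilon> > 0" using T by (simp add: \<epsilon>_def)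
  have cad: "cadlag x" "cadlag (frozen_step K J y)"
    unfolding x_def scaled_path_eq_step_path frozen_step_def using R by (auto intro!: cadlag_step_path)
  have "pd x (frozen_step K J y) \<le> 1 / real T + block_drawups R K J \<epsilon> \<omega> + down_penalty J \<epsilon> y"
  proof (cases "down_penalty J \<epsilon> y < 1 \<and> (\<forall>j<J. drew (grid R (grid_times K) j) (grid R (grid_times K) (Suc j)) (\<epsilon> * sqrt R) \<omega> = 0)")
    case True
    have "pd x (frozen_step K J y) \<le> 1 / real T"
      unfolding x_def y_def J_def
      by (rule path_near_frozen_step[OF T R])
         (use True elim inc down_penalty_less_1[OF _ \<epsilon>] in \<open>auto simp: J_def \<epsilon>_def y_def\<close>)
    then show ?thesis using block_drawups_bounds(1)[of R K J \<epsilon> \<omega>] down_penalty_bounds(1)[of J \<epsilon> y] by linarith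
  next
    case False
    then consider "down_penalty J \<epsilon> y \<ge> 1" | j where "j < J" "drew (grid R (grid_times K) j) (grid R (grid_times K) (Suc j)) (\<epsilon> * sqrt R) \<omega> \<noteq> 0"
      by (auto simp: not_less)
    then have "1 \<le> block_drawups R K J \<epsilon> \<omega> + down_penalty J \<epsilon> y"
    proof cases
      case 1
      then show ?thesis using block_drawups_bounds(1)[of R K J \<epsilon> \<omega>] by linarith
    next
      case 2
      then have "1 = drew (grid R (grid_times K) j) (grid R (grid_times K) (Suc j)) (\<epsilon> * sqrt R) \<omega>"
        by (auto simp: drew_def indicator_def split: if_splits)
      also have "\<dots> \<le> block_drawups R K J \<epsilon> \<omega>"
        unfolding block_drawups_def using 2 by (intro member_le_sum drew_nonneg) auto
      finally show ?thesis using down_penalty_bounds(1)[of J \<epsilon> y] by linarith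
    qed
    moreover have "0 \<le> 1 / real T" by simp
    ultimately show ?thesis using pd_le_1[of x "frozen_step K J y"] by linarith
  qed
  then have "k * pd x (frozen_step K J y) \<le> k * (1 / real T + block_drawups R K J \<epsilon> \<omega> + down_penalty J \<epsilon> y)"
    using k by (rule mult_left_mono)
  with lip[OF cad] show ?case unfolding x_def y_def by linarith
qed

lemma frozen_step_H:
  "frozen_step K J (H_vec \<alpha> B (grid_times K) J \<omega>) = step_path (real (Suc K)) (\<lambda>i. H_alpha \<alpha> B \<omega> (real (min J i) / real (Suc K)))"
  by (simp add: frozen_step_def H_vec_def grid_times_def)

text \<open>A cadlag path of the limit is continuous, hence uniformly continuous on
  \<open>[0, T]\<close>: fine step paths approximate it and falls over grid steps stay below
  \<open>\<epsilon> / 2\<close>.\<close>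

lemma H_approx:
  fixes T :: nat
  assumes w: "\<omega> \<in> space M" and cad: "cadlag (H_alpha \<alpha> B \<omega>)" and T: "T \<ge> 1" and \<epsilon>: "\<epsilon> > 0"
  shows "\<forall>\<^sub>F K in sequentially. pd (H_alpha \<alpha> B \<omega>) (frozen_step K (T * Suc K) (H_vec \<alpha> B (grid_times K) (T * Suc K) \<omega>)) \<le> 1 / real T"
    and "\<forall>\<^sub>F K in sequentially. down_penalty (T * Suc K) \<epsilon> (H_vec \<alpha> B (grid_times K) (T * Suc K) \<omega>) = 0"
proof -
  define h where "h = H_alpha \<alpha> B \<omega>"
  have cont: "continuous_on {0..} h" unfolding h_def by (rule H_continuous_on[OF w cad])
  have T0: "1 / real T > 0" using T by simp
  show "\<forall>\<^sub>F K in sequentially. pd (H_alpha \<alpha> B \<omega>) (frozen_step K (T * Suc K) (H_vec \<alpha> B (grid_times K) (T * Suc K) \<omega>)) \<le> 1 / real T"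
  proof -
    have "\<forall>\<^sub>F K in sequentially. \<forall>t\<in>{0..real T}. \<bar>step_path (real (Suc K)) (\<lambda>i. h (real i / real (Suc K))) t - h t\<bar> \<le> 1 / real T"
      using locunif_step_approx[OF cont] T0 unfolding locunif_def by blast
    then show ?thesis
    proof eventually_elim
      case (elim K)
      show ?case unfolding frozen_step_H h_def[symmetric]
      proof (rule pd_leI[OF T0])
        fix t :: real assume t: "0 \<le> t" "t \<le> 1 / (1 / real T)"
        then have tT: "t \<in> {0..real T}" by simp
        have "real (Suc K) * t \<le> real (Suc K) * real T" using tT by (intro mult_left_mono) auto
        then have "\<lfloor>real (Suc K) * t\<rfloor> \<le> \<lfloor>real (Suc K) * real T\<rfloor>" by (rule floor_mono)
        also have "real (Suc K) * real T = real (T * Suc K)" by (simp add: algebra_simps)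
        finally have "nat \<lfloor>real (Suc K) * t\<rfloor> \<le> T * Suc K" by (simp only: floor_of_nat nat_le_iff)
        then have "step_path (real (Suc K)) (\<lambda>i. h (real (min (T * Suc K) i) / real (Suc K))) t = step_path (real (Suc K)) (\<lambda>i. h (real i / real (Suc K))) t"
          unfolding step_path_def by (simp only: min_absorb2)
        then show "\<bar>h t - step_path (real (Suc K)) (\<lambda>i. h (real (min (T * Suc K) i) / real (Suc K))) t\<bar> \<le> 1 / real T"
          using elim tT by (simp add: abs_minus_commute)
      qed
    qed
  qed
  have e2: "\<epsilon> / 2 > 0" using \<epsilon> by simp
  obtain d where d: "d > 0" "\<And>s t. 0 \<le> s \<Longrightarrow> s \<le> real T \<Longrightarrow> 0 \<le> t \<Longrightarrow> t \<le> real T \<Longrightarrow> \<bar>s - t\<bar> < d \<Longrightarrow> \<bar>h s - h t\<bar> < \<epsilon> / 2"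
    using continuous_on_unif[OF cont e2] by metis
  have "\<forall>\<^sub>F K in sequentially. inverse (real (Suc K)) < d"
    using order_tendstoD(2)[OF LIMSEQ_inverse_real_of_nat d(1)] .
  then show "\<forall>\<^sub>F K in sequentially. down_penalty (T * Suc K) \<epsilon> (H_vec \<alpha> B (grid_times K) (T * Suc K) \<omega>) = 0"
  proof eventually_elim
    case (elim K)
    define c where "c = real (Suc K)"
    have c: "c > 0" by (simp add: c_def)
    have z: "max 0 ((\<bar>H_vec \<alpha> B (grid_times K) (T * Suc K) \<omega> j\<bar> - \<bar>H_vec \<alpha> B (grid_times K) (T * Suc K) \<omega> (Suc j)\<bar>) * 2 / \<epsilon> - 1) = 0"
      if "j < T * Suc K" for j
    proof -
      have "real (Suc j) \<le> real (T * Suc K)" using that by (intro of_nat_mono) simp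
      also have "\<dots> = real T * c" by (simp add: c_def algebra_simps)
      finally have "real (Suc j) / c \<le> real T" using c by (simp add: divide_le_eq)
      moreover have "real j / c \<le> real (Suc j) / c" using c by (intro divide_right_mono) auto
      moreover have "\<bar>real j / c - real (Suc j) / c\<bar> = inverse c" using c by (simp add: diff_divide_distrib[symmetric] inverse_eq_divide abs_divide)
      ultimately have "\<bar>h (real j / c) - h (real (Suc j) / c)\<bar> < \<epsilon> / 2"
        using c elim by (intro d(2)) (auto simp: c_def)
      then have "\<bar>h (real j / c)\<bar> - \<bar>h (real (Suc j) / c)\<bar> < \<epsilon> / 2" by linarith
      then have "(\<bar>h (real j / c)\<bar> - \<bar>h (real (Suc j) / c)\<bar>) * 2 / \<epsilon> - 1 < 0" using \<epsilon> by (simp add: field_simps)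
      then show ?thesis using that by (simp add: H_vec_def grid_times_def h_def c_def)
    qed
    have "(\<Sum>j<T * Suc K. max 0 ((\<bar>H_vec \<alpha> B (grid_times K) (T * Suc K) \<omega> j\<bar> - \<bar>H_vec \<alpha> B (grid_times K) (T * Suc K) \<omega> (Suc j)\<bar>) * 2 / \<epsilon> - 1)) = 0"
      by (rule sum.neutral) (use z in \<open>auto simp del: mult_Suc_right\<close>)
    then show ?case unfolding down_penalty_def by (simp only:)
  qed
qed

section \<open>The functional limit theorem\<close>

text \<open>Chain and limit are both replaced by frozen step paths, for which
  \<open>fdd_tendsto\<close> applies. The error on the chain side consists of drawups, small by the
  maximal inequality, and of the penalty, whose expectation converges to that of the limit process
  and is small there. Constants are fixed in the order \<open>T\<close>, \<open>K\<close>,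
  \<open>n\<close>.\<close>

lemma lipschitz_convergence:
  assumes g: "lu_fun g" and k: "k \<ge> 0"
    and lip: "\<And>x z. cadlag x \<Longrightarrow> cadlag z \<Longrightarrow> \<bar>g x - g z\<bar> \<le> k * pd x z"
  shows "(\<lambda>n. CE n (\<lambda>\<omega>. g (scaled_path (m n) X Y \<omega>))) \<longlonglongrightarrow> (\<integral>\<omega>. g (H_alpha \<alpha> B \<omega>) \<partial>M)"
proof (rule LIMSEQ_I)
  fix e :: real assume e: "e > 0"
  obtain C where C: "\<And>x. \<bar>g x\<bar> \<le> C" using g by (auto simp: lu_fun_def)
  have C0: "C \<ge> 0" using C[of "\<lambda>_. 0"] by linarith
  \<comment> \<open>\<open>T\<close> is at once the horizon and the inverse precision of
    \<open>pd\<close>; the added 1 forces \<open>T \<ge> 1\<close>.\<close>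
  obtain T :: nat where T: "8 * k / e + 1 < real T" using reals_Archimedean2 by blast
  have "8 * k / e \<ge> 0" using k e by simp
  then have T1: "T \<ge> 1" using T by linarith
  have kT: "k / real T < e / 8"
  proof -
    have "8 * k / e < real T" using T by linarith
    then have "8 * k < real T * e" using e by (simp add: divide_less_eq)
    then show ?thesis using T1 by (simp add: divide_less_eq mult.commute)
  qed
  define \<epsilon> where "\<epsilon> = 1 / (3 * real T)"
  have \<epsilon>: "\<epsilon> > 0" using T1 by (simp add: \<epsilon>_def)
  define J where "J K = T * Suc K" for K
  define u where "u K \<omega> = H_vec \<alpha> B (grid_times K) (J K) \<omega>" for K \<omega>
  define G where "G K y = g (frozen_step K (J K) y)" for K y
  \<comment> \<open>Only the excess over the unavoidable error \<open>k / T\<close> tends to 0 as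
    the mesh is refined.\<close>
  define r where "r K \<omega> = max 0 (\<bar>g (H_alpha \<alpha> B \<omega>) - G K (u K \<omega>)\<bar> - k / real T)" for K \<omega>
  have Gc: "cwise_cont (G K)" for K unfolding G_def by (rule frozen_step_cont[OF g])
  have Gb: "\<bar>G K y\<bar> \<le> C" for K y by (simp add: G_def C)
  note [measurable] = cwise_cont_measurable[OF Gc] cwise_cont_measurable[OF down_penalty_cont[OF \<epsilon>]] measurable_lu_fun_H[OF g]
  have um [measurable]: "u K \<in> borel_measurable M" for K unfolding u_def[abs_def] by measurable
  have E1: "(\<lambda>K. \<integral>\<omega>. r K \<omega> \<partial>M) \<longlonglongrightarrow> (\<integral>\<omega>. 0 \<partial>M)"
  proof (rule integral_dominated_convergence[where w = "\<lambda>_. 2 * C"])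
    show "r K \<in> borel_measurable M" for K unfolding r_def[abs_def] by measurable
    show "AE \<omega> in M. (\<lambda>K. r K \<omega>) \<longlonglongrightarrow> 0"
      using AE_cadlag_H AE_space
    proof eventually_elim
      case (elim \<omega>)
      have "\<forall>\<^sub>F K in sequentially. r K \<omega> = 0"
        using H_approx(1)[OF elim(2,1) T1 \<epsilon>]
      proof eventually_elim
        case A: (elim K)
        have "cadlag (frozen_step K (J K) (u K \<omega>))" unfolding frozen_step_def by (rule cadlag_step_path) simp
        from lip[OF elim(1) this] have "\<bar>g (H_alpha \<alpha> B \<omega>) - G K (u K \<omega>)\<bar> \<le> k * pd (H_alpha \<alpha> B \<omega>) (frozen_step K (J K) (u K \<omega>))"
          by (simp add: G_def)
        also have "\<dots> \<le> k * (1 / real T)" using A k by (intro mult_left_mono) (auto simp: J_def u_def)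
        finally show ?case by (simp add: r_def)
      qed
      then show ?case by (rule tendsto_eventually)
    qed
    show "AE \<omega> in M. norm (r K \<omega>) \<le> 2 * C" for K
    proof (rule AE_I2)
      fix \<omega>
      have "k / real T \<ge> 0" using k by simp
      moreover have "\<bar>g (H_alpha \<alpha> B \<omega>) - G K (u K \<omega>)\<bar> \<le> 2 * C" using C[of "H_alpha \<alpha> B \<omega>"] Gb[of K "u K \<omega>"] by linarith
      ultimately show "norm (r K \<omega>) \<le> 2 * C" using C0 by (auto simp: r_def)
    qed
  qed auto
  have E2: "(\<lambda>K. \<integral>\<omega>. down_penalty (J K) \<epsilon> (u K \<omega>) \<partial>M) \<longlonglongrightarrow> (\<integral>\<omega>. 0 \<partial>M)"
  proof (rule integral_dominated_convergence[where w = "\<lambda>_. 1"])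
    show "AE \<omega> in M. (\<lambda>K. down_penalty (J K) \<epsilon> (u K \<omega>)) \<longlonglongrightarrow> 0"
      using AE_cadlag_H AE_space
    proof eventually_elim
      case (elim \<omega>)
      show ?case using H_approx(2)[OF elim(2,1) T1 \<epsilon>] unfolding u_def J_def by (rule tendsto_eventually)
    qed
  qed (use down_penalty_bounds in auto)
  have E3: "(\<lambda>K. 12 * real T / \<epsilon> ^ 4 * inverse (real (Suc K))) \<longlonglongrightarrow> 12 * real T / \<epsilon> ^ 4 * 0"
    by (intro tendsto_mult tendsto_const LIMSEQ_inverse_real_of_nat)
  have e8: "e / 8 > 0" using e by simp
  have "\<forall>\<^sub>F K in sequentially. (\<integral>\<omega>. r K \<omega> \<partial>M) < e / 8" using order_tendstoD(2)[OF E1, of "e / 8"] e8 by simp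
  moreover have "\<forall>\<^sub>F K in sequentially. k * (\<integral>\<omega>. down_penalty (J K) \<epsilon> (u K \<omega>) \<partial>M) < e / 8"
    using order_tendstoD(2)[OF tendsto_mult[OF tendsto_const E2, of k], of "e / 8"] e8 by simp
  moreover have "\<forall>\<^sub>F K in sequentially. k * (12 * real T / \<epsilon> ^ 4 * inverse (real (Suc K))) < e / 8"
    using order_tendstoD(2)[OF tendsto_mult[OF tendsto_const E3, of k], of "e / 8"] e8 by simp
  ultimately have "\<forall>\<^sub>F K in sequentially. (\<integral>\<omega>. r K \<omega> \<partial>M) < e / 8 \<and>
     k * (\<integral>\<omega>. down_penalty (J K) \<epsilon> (u K \<omega>) \<partial>M) < e / 8 \<and> k * (12 * real T / \<epsilon> ^ 4 * inverse (real (Suc K))) < e / 8"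
    by eventually_elim auto
  then obtain K where K: "(\<integral>\<omega>. r K \<omega> \<partial>M) < e / 8" "k * (\<integral>\<omega>. down_penalty (J K) \<epsilon> (u K \<omega>) \<partial>M) < e / 8"
    "k * (12 * real T / \<epsilon> ^ 4 * inverse (real (Suc K))) < e / 8"
    by (auto simp: eventually_sequentially)
  define P where "P n \<omega> = down_penalty (J K) \<epsilon> (X_vec (m n) (grid_times K) (J K) \<omega>)" for n \<omega>
  define V where "V n \<omega> = G K (X_vec (m n) (grid_times K) (J K) \<omega>)" for n \<omega>
  define D where "D n = block_drawups (m n) K (J K) \<epsilon>" for n
  have Pm [measurable]: "P n \<in> borel_measurable N" and Vm [measurable]: "V n \<in> borel_measurable N"
    and Dm [measurable]: "D n \<in> borel_measurable N" for n
    unfolding P_def[abs_def] V_def[abs_def] D_def by measurable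
  have limV: "(\<lambda>n. CE n (V n)) \<longlonglongrightarrow> (\<integral>\<omega>. G K (u K \<omega>) \<partial>M)"
    unfolding V_def u_def by (rule fdd_tendsto[OF grid_times Gc Gb])
  have limP: "(\<lambda>n. k * CE n (P n)) \<longlonglongrightarrow> k * (\<integral>\<omega>. down_penalty (J K) \<epsilon> (u K \<omega>) \<partial>M)"
    unfolding P_def u_def
    by (intro tendsto_mult tendsto_const fdd_tendsto[OF grid_times down_penalty_cont[OF \<epsilon>] down_penalty_bounds(2)])
  have Hpart: "\<bar>(\<integral>\<omega>. G K (u K \<omega>) \<partial>M) - (\<integral>\<omega>. g (H_alpha \<alpha> B \<omega>) \<partial>M)\<bar> \<le> k / real T + (\<integral>\<omega>. r K \<omega> \<partial>M)"
  proof -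
    have i1: "integrable M (\<lambda>\<omega>. G K (u K \<omega>))" by (rule M.integrable_const_bound[of _ C]) (use Gb in auto)
    have i2: "integrable M (\<lambda>\<omega>. g (H_alpha \<alpha> B \<omega>))" by (rule M.integrable_const_bound[of _ C]) (use C in auto)
    have i3: "integrable M (r K)" unfolding r_def[abs_def] using i1 i2 by (intro integrable_max) auto
    have "(\<integral>\<omega>. G K (u K \<omega>) \<partial>M) - (\<integral>\<omega>. g (H_alpha \<alpha> B \<omega>) \<partial>M) = (\<integral>\<omega>. G K (u K \<omega>) - g (H_alpha \<alpha> B \<omega>) \<partial>M)"
      using i1 i2 by simp
    also have "norm \<dots> \<le> (\<integral>\<omega>. norm (G K (u K \<omega>) - g (H_alpha \<alpha> B \<omega>)) \<partial>M)" by (rule integral_norm_bound)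
    also have "\<dots> \<le> (\<integral>\<omega>. k / real T + r K \<omega> \<partial>M)"
    proof (rule integral_mono)
      show "norm (G K (u K \<omega>) - g (H_alpha \<alpha> B \<omega>)) \<le> k / real T + r K \<omega>" for \<omega> by (auto simp: r_def)
    qed (use i1 i2 i3 in auto)
    also have "\<dots> = k / real T + (\<integral>\<omega>. r K \<omega> \<partial>M)" using i3 by (simp add: M.prob_space)
    finally show ?thesis by simp
  qed
  have "\<forall>\<^sub>F n in sequentially. \<bar>CE n (\<lambda>\<omega>. g (scaled_path (m n) X Y \<omega>)) - (\<integral>\<omega>. g (H_alpha \<alpha> B \<omega>) \<partial>M)\<bar> < e"
    using grid_eventually[OF m_top m_small grid_times, of "J K" K] CE_block_drawups[OF T1 \<epsilon>, of K]
      tendstoD[OF limV e8] order_tendstoD(2)[OF limP K(2)]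
  proof eventually_elim
    case (elim n)
    have n1: "n \<ge> 1" and mn: "m n > 0" using elim by auto
    define h where "h \<omega> = k * ((1 / real T + D n \<omega>) + P n \<omega>)" for \<omega>
    have Db: "\<bar>D n \<omega>\<bar> \<le> real (J K)" and Pb: "\<bar>P n \<omega>\<bar> \<le> 1" for \<omega>
      unfolding D_def P_def by (rule block_drawups_bounds(2), rule down_penalty_bounds(2))
    have s1: "\<bar>1 / real T + D n \<omega>\<bar> \<le> 1 / real T + real (J K)" for \<omega> using Db[of \<omega>] by (auto intro: order_trans[OF abs_triangle_ineq])
    have s2: "\<bar>(1 / real T + D n \<omega>) + P n \<omega>\<bar> \<le> (1 / real T + real (J K)) + 1" for \<omega>
      using s1[of \<omega>] Pb[of \<omega>] by linarith
    have hm: "h \<in> borel_measurable N" unfolding h_def[abs_def] by measurable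
    have hb: "\<bar>h \<omega>\<bar> \<le> k * ((1 / real T + real (J K)) + 1)" for \<omega>
      unfolding h_def abs_mult using k s2 by (intro mult_mono) auto
    have "\<bar>CE n (\<lambda>\<omega>. g (scaled_path (m n) X Y \<omega>)) - CE n (V n)\<bar> \<le> CE n h"
    proof (rule CE_abs_diff_le[OF n1 _ measurable_lu_fun_scaled_path[OF g mn] C Vm _ hm hb])
      show "AE \<omega> in N. \<bar>g (scaled_path (m n) X Y \<omega>) - V n \<omega>\<bar> \<le> h \<omega>"
        unfolding V_def G_def h_def D_def P_def J_def \<epsilon>_def
        by (rule AE_frozen_step_error[OF T1 mn k _ lip]) (use elim in \<open>auto simp: J_def\<close>)
      show "\<bar>V n \<omega>\<bar> \<le> C" for \<omega> by (simp add: V_def Gb)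
    qed
    also have "CE n h = k * (1 / real T + CE n (D n) + CE n (P n))"
      unfolding h_def CE_cmult
      by (subst CE_add[OF _ s1 Pm Pb], measurable, subst CE_add[OF _ _ Dm Db, of _ "1 / real T"]) (auto simp: CE_const[OF n1])
    also have "\<dots> = k / real T + k * CE n (D n) + k * CE n (P n)" by (simp add: algebra_simps)
    also have "k * CE n (D n) \<le> k * (12 * real T / \<epsilon> ^ 4 * inverse (real (Suc K)))"
      using elim(2) k by (intro mult_left_mono) (auto simp: D_def J_def divide_inverse mult_ac)
    finally have "\<bar>CE n (\<lambda>\<omega>. g (scaled_path (m n) X Y \<omega>)) - CE n (V n)\<bar> \<le> 3 * (e / 8)"
      using kT K(3) elim(4) by linarith
    moreover have "\<bar>CE n (V n) - (\<integral>\<omega>. G K (u K \<omega>) \<partial>M)\<bar> < e / 8" using elim(3) by (simp add: dist_real_def)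
    \<comment> \<open>Six eighths of \<open>e\<close> are spent: three on the chain side, one on the
      finite-dimensional limit, two in \<open>Hpart\<close>.\<close>
    ultimately show ?case using Hpart kT K(1) e by linarith
  qed
  then show "\<exists>no. \<forall>n\<ge>no. norm (CE n (\<lambda>\<omega>. g (scaled_path (m n) X Y \<omega>)) - (\<integral>\<omega>. g (H_alpha \<alpha> B \<omega>) \<partial>M)) < e"
    by (simp add: eventually_sequentially)
qed

text \<open>The Lipschitz envelopes lie below \<open>f\<close> on the paths of the chain, and their
  integrals over the limit process tend to that of \<open>f\<close> by dominated
  convergence.\<close>

lemma lower_bound:
  assumes f: "lu_fun f" and e: "e > 0"
  shows "\<forall>\<^sub>F n in sequentially. (\<integral>\<omega>. f (H_alpha \<alpha> B \<omega>) \<partial>M) - e < CE n (\<lambda>\<omega>. f (scaled_path (m n) X Y \<omega>))"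
proof -
  obtain C where C: "\<And>x. \<bar>f x\<bar> \<le> C" using f by (auto simp: lu_fun_def)
  have env: "lu_fun (lip_env f (real k))" for k by (rule lip_env_lu_fun[OF f]) simp
  have envC: "\<bar>lip_env f (real k) x\<bar> \<le> C" for k x using lip_env_abs_le[of f C "real k" x] C by simp
  note [measurable] = measurable_lu_fun_H[OF f] measurable_lu_fun_H[OF env]
  have "(\<lambda>k. \<integral>\<omega>. lip_env f (real k) (H_alpha \<alpha> B \<omega>) \<partial>M) \<longlonglongrightarrow> (\<integral>\<omega>. f (H_alpha \<alpha> B \<omega>) \<partial>M)"
    by (rule integral_dominated_convergence[where w = "\<lambda>_. C"]) (use envC lip_env_tendsto[OF f] in auto)
  from order_tendstoD(1)[OF this, of "(\<integral>\<omega>. f (H_alpha \<alpha> B \<omega>) \<partial>M) - e"] e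
  have "\<forall>\<^sub>F k in sequentially. (\<integral>\<omega>. f (H_alpha \<alpha> B \<omega>) \<partial>M) - e < (\<integral>\<omega>. lip_env f (real k) (H_alpha \<alpha> B \<omega>) \<partial>M)" by simp
  then obtain k where k: "(\<integral>\<omega>. f (H_alpha \<alpha> B \<omega>) \<partial>M) - e < (\<integral>\<omega>. lip_env f (real k) (H_alpha \<alpha> B \<omega>) \<partial>M)"
    by (auto simp: eventually_sequentially)
  have lip: "\<bar>lip_env f (real k) x - lip_env f (real k) z\<bar> \<le> real k * pd x z" if "cadlag x" "cadlag z" for x z
    using lip_env_lipschitz[of f C "real k" x z] C that by simp
  have "(\<lambda>n. CE n (\<lambda>\<omega>. lip_env f (real k) (scaled_path (m n) X Y \<omega>))) \<longlonglongrightarrow> (\<integral>\<omega>. lip_env f (real k) (H_alpha \<alpha> B \<omega>) \<partial>M)"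
    by (rule lipschitz_convergence[OF env _ lip]) auto
  from order_tendstoD(1)[OF this k]
  have "\<forall>\<^sub>F n in sequentially. (\<integral>\<omega>. f (H_alpha \<alpha> B \<omega>) \<partial>M) - e < CE n (\<lambda>\<omega>. lip_env f (real k) (scaled_path (m n) X Y \<omega>))" .
  moreover have "\<forall>\<^sub>F n in sequentially. m n > 0"
    using filterlim_at_top_dense[THEN iffD1, OF m_top, rule_format, of 0] .
  ultimately show ?thesis
  proof eventually_elim
    case (elim n)
    have "lip_env f (real k) (scaled_path (m n) X Y \<omega>) \<le> f (scaled_path (m n) X Y \<omega>)" for \<omega>
      using lip_env_bounds(3)[of f C "real k" "scaled_path (m n) X Y \<omega>"] C cadlag_step_path[OF elim(2)]
      by (simp add: scaled_path_eq_step_path)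
    then have "CE n (\<lambda>\<omega>. lip_env f (real k) (scaled_path (m n) X Y \<omega>)) \<le> CE n (\<lambda>\<omega>. f (scaled_path (m n) X Y \<omega>))"
      by (intro CE_mono[OF _ measurable_lu_fun_scaled_path[OF env elim(2)] envC measurable_lu_fun_scaled_path[OF f elim(2)] C]) simp
    with elim show ?case by linarith
  qed
qed

text \<open>The matching upper bound is the lower bound for \<open>- f\<close>, again an
  \<open>lu_fun\<close>.\<close>

lemma functional_limit:
  assumes f: "lu_fun f"
  shows "(\<lambda>n. CE n (\<lambda>\<omega>. f (scaled_path (m n) X Y \<omega>))) \<longlonglongrightarrow> (\<integral>\<omega>. f (H_alpha \<alpha> B \<omega>) \<partial>M)"
proof (rule LIMSEQ_I)
  fix e :: real assume e: "e > 0"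
  have neg: "CE n (\<lambda>\<omega>. - f (scaled_path (m n) X Y \<omega>)) = - CE n (\<lambda>\<omega>. f (scaled_path (m n) X Y \<omega>))" for n
    using CE_cmult[of n "-1"] by simp
  have "\<forall>\<^sub>F n in sequentially. norm (CE n (\<lambda>\<omega>. f (scaled_path (m n) X Y \<omega>)) - (\<integral>\<omega>. f (H_alpha \<alpha> B \<omega>) \<partial>M)) < e"
    using lower_bound[OF f e] lower_bound[OF lu_fun_uminus[OF f] e]
  proof eventually_elim
    case (elim n)
    then show ?case unfolding neg by simp
  qed
  then show "\<exists>no. \<forall>n\<ge>no. norm (CE n (\<lambda>\<omega>. f (scaled_path (m n) X Y \<omega>)) - (\<integral>\<omega>. f (H_alpha \<alpha> B \<omega>) \<partial>M)) < e"
    by (simp add: eventually_sequentially)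
qed

end

theorem theorem1p3:
  fixes \<alpha> :: real and m :: "nat \<Rightarrow> real"
    and N :: "'a measure" and X Y :: "nat \<Rightarrow> 'a \<Rightarrow> nat"
    and M :: "'b measure" and B :: "real \<Rightarrow> 'b \<Rightarrow> real"
    and f :: "(real \<Rightarrow> real) \<Rightarrow> real"
  assumes "\<alpha> > 1"
    and "filterlim m at_top sequentially"
    and "m \<in> o(\<lambda>n. real n)"
    and "urn_chain \<alpha> N X Y"
    and "std_brownian_motion M B"
    and "skorohod_test_fun f"
  shows "(\<lambda>n. (\<integral>\<omega>. indicator (BINGO N X Y n n) \<omega> * f (scaled_path (m n) X Y \<omega>) \<partial>N)
                / measure N (BINGO N X Y n n))
         \<longlonglongrightarrow> (\<integral>\<omega>. f (H_alpha \<alpha> B \<omega>) \<partial>M)"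
proof -
  interpret urn_limit \<alpha> m N X Y M B by unfold_locales (use assms in auto)
  show ?thesis using functional_limit[OF skorohod_test_fun_imp_lu_fun[OF assms(6)]] by (simp add: CE_def)
qed

end
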